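(* Let $K$ be a field and let $\mathcal{S}$ be a finitely generated semigroup (under composition) of rational functions in $K(X)$. Suppose that one of the following holds: (1) every nonconstant element of $\mathcal{S}$ has degree $1$; or (2) there is a point $\alpha\in\mathbb{P}^1(\overline{K})$ fixed by every element of $\mathcal{S}$ such that $e_f(\alpha)>1$ for some nonconstant $f\in\mathcal{S}$ and $\mathrm{char}\,K\nmid e_g(\alpha)$ for every nonconstant $g\in\mathcal{S}$. Then either $\mathcal{S}$ contains a nonabelian free semigroup or $\mathcal{S}$ has polynomially bounded growth.
   Context: For a nonconstant rational function $\varphi$ with $\varphi(\alpha)=\alpha$, $e_\varphi(\alpha)\ge1$ denotes the degree of the term of lowest positive degree in the formal power series expansion of $\varphi$ centered at $\alpha$ (i.e. $\varphi$ written locally in the local coordinate at $\alpha$). For finite generating set $S$, $d_S(n)$ counts distinct elements expressible as a composition of at most $n$ elements of $S$; polynomially bounded growth means $d_S(n)=O(n^\kappa)$ for some $\kappa>0$. A nonabelian free semigroup is a subsemigroup free on two generators. *)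

theory Defs
  imports
    "HOL-Computational_Algebra.Computational_Algebra"
    "HOL-Algebra.Algebraic_Closure_Type"
    "HOL-Library.Landau_Symbols"
begin

text \<open>The projective line over a field, and rational functions over \<open>'k\<close> regarded as self-maps
  of the projective line. \<open>Aff f\<close> with \<open>f\<close> in the fraction field of \<open>'k poly\<close> is an
  element of $K(X)$; the extra element \<open>Infinity\<close> is the constant map with value \<open>\<infinity>\<close>,
  which is needed for composition to be total (e.g. composing $1/X$ with the constant $0$).\<close>

datatype 'f proj_line = Aff 'f | Infinity

type_synonym 'k ratfun = "'k poly fract proj_line"

definition proj_quot :: "'f::field \<Rightarrow> 'f \<Rightarrow> 'f proj_line" where
  "proj_quot a b = (if b = 0 then Infinity else Aff (a / b))"

definition lowest_terms :: "'k::field poly fract \<Rightarrow> 'k poly \<times> 'k poly" where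
  "lowest_terms f = (THE (p, q). f = Fract p q \<and> coprime p q \<and> lead_coeff q = 1)"

definition numer :: "'k::field poly fract \<Rightarrow> 'k poly" where
  "numer f = fst (lowest_terms f)"

definition denom :: "'k::field poly fract \<Rightarrow> 'k poly" where
  "denom f = snd (lowest_terms f)"

lemma coprime_poly_dvd_mult:
  fixes p q r :: "'k::field poly"
  assumes "coprime p q" "q dvd p * r" "q \<noteq> 0"
  shows "q dvd r"
proof -
  define I where "I = {a * p + b * q | a b. a * p + b * q \<noteq> 0}"
  have "q \<in> I" unfolding I_def using assms(3) by (auto intro: exI[of _ 0] exI[of _ 1])
  then obtain d where d: "d \<in> I" and min: "\<And>e. e \<in> I \<Longrightarrow> degree d \<le> degree e"
    using ex_has_least_nat[of "\<lambda>x. x \<in> I" q degree] by auto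
  obtain a b where ab: "d = a * p + b * q" and "d \<noteq> 0" using d unfolding I_def by auto
  have dvd: "d dvd u * p + v * q" for u v
  proof -
    let ?x = "u * p + v * q"
    define w where "w = ?x div d"
    have "?x mod d = ?x - w * d" by (simp add: w_def minus_div_mult_eq_mod)
    also have "\<dots> = (u - w * a) * p + (v - w * b) * q" by (simp add: ab algebra_simps)
    finally have "?x mod d = (u - w * a) * p + (v - w * b) * q" .
    then have "?x mod d = 0 \<or> ?x mod d \<in> I"
      unfolding I_def mem_Collect_eq by metis
    moreover have "?x mod d = 0 \<or> degree (?x mod d) < degree d"
      using \<open>d \<noteq> 0\<close> degree_mod_less by blast
    ultimately show ?thesis using min[of "?x mod d"] by (auto simp: dvd_eq_mod_eq_0)
  qed
  have "d dvd p" "d dvd q" using dvd[of 1 0] dvd[of 0 1] by simp_all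
  with assms(1) have "is_unit d" by (rule coprime_common_divisor)
  have "q dvd a * (p * r) + b * q * r" using assms(2) by simp
  also have "\<dots> = d * r" by (simp add: ab algebra_simps)
  finally show ?thesis using \<open>is_unit d\<close> by (simp add: dvd_mult_unit_iff')
qed

lemma lowest_terms_ex1:
  fixes f :: "'k::field poly fract"
  shows "\<exists>!pq. case pq of (p, q) \<Rightarrow> f = Fract p q \<and> coprime p q \<and> lead_coeff q = 1"
proof -
  define P where "P = (\<lambda>n. \<exists>p q. f = Fract p q \<and> q \<noteq> 0 \<and> degree q = n)"
  have "\<exists>n. P n"
    unfolding P_def by (cases f) auto
  then have "P (LEAST n. P n)" by (rule LeastI_ex)
  then obtain p q where pq: "f = Fract p q" "q \<noteq> 0" and dq: "degree q = (LEAST n. P n)"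
    unfolding P_def by blast
  have least: "degree q \<le> degree q'" if "f = Fract p' q'" "q' \<noteq> 0" for p' q'
    unfolding dq by (rule Least_le) (use that P_def in blast)
  have "coprime p q"
  proof (rule coprimeI)
    fix c assume "c dvd p" "c dvd q"
    then obtain p' q' where c: "p = c * p'" "q = c * q'" by (auto elim!: dvdE)
    with pq have nz: "c \<noteq> 0" "q' \<noteq> 0" by auto
    have "f = Fract p' q'" using pq c nz by (simp add: eq_fract)
    from least[OF this nz(2)] c nz have "degree c = 0" by (simp add: degree_mult_eq)
    with nz show "is_unit c" by (simp add: is_unit_iff_degree)
  qed
  define l where "l = inverse (lead_coeff q)"
  have l: "l \<noteq> 0" using pq by (simp add: l_def)
  have 1: "f = Fract (smult l p) (smult l q)"
    using pq l by (simp add: eq_fract)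
  have 2: "coprime (smult l p) (smult l q)"
  proof (rule coprimeI)
    fix c assume "c dvd smult l p" "c dvd smult l q"
    then have "c dvd p" "c dvd q" using l by (simp_all add: dvd_smult_iff)
    with \<open>coprime p q\<close> show "is_unit c" by (rule coprime_common_divisor)
  qed
  have 3: "lead_coeff (smult l q) = 1" using pq l by (simp add: l_def)
  have uniq: "p1 = p2 \<and> q1 = q2"
    if "f = Fract p1 q1" "coprime p1 q1" "lead_coeff q1 = 1"
       "f = Fract p2 q2" "coprime p2 q2" "lead_coeff q2 = 1" for p1 q1 p2 q2
  proof -
    have nz: "q1 \<noteq> 0" "q2 \<noteq> 0" using that by auto
    have eq: "p1 * q2 = p2 * q1" using that nz by (simp add: eq_fract)
    have "q1 dvd p1 * q2" "q2 dvd p2 * q1" using eq by (metis dvd_triv_right)+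
    then have d: "q1 dvd q2" "q2 dvd q1"
      using that nz by (auto intro: coprime_poly_dvd_mult)
    then obtain c where c: "q2 = q1 * c" by (elim dvdE)
    have "degree q1 = degree q2"
      using d nz by (intro antisym dvd_imp_degree_le)
    with c nz have "degree c = 0" by (auto simp: degree_mult_eq)
    then obtain c0 where "c = [:c0:]" by (rule degree_eq_zeroE)
    with c that(3,6) have "q1 = q2" by (simp split: if_splits)
    with eq nz show ?thesis by simp
  qed
  show ?thesis
  proof (rule ex1I[of _ "(smult l p, smult l q)"])
    show "case (smult l p, smult l q) of (p, q) \<Rightarrow> f = Fract p q \<and> coprime p q \<and> lead_coeff q = 1"
      using 1 2 3 by blast
    fix x assume "case x of (p, q) \<Rightarrow> f = Fract p q \<and> coprime p q \<and> lead_coeff q = 1"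
    then show "x = (smult l p, smult l q)"
      using uniq[OF _ _ _ 1 2 3] by (cases x) blast
  qed
qed

lemma lowest_terms:
  fixes f :: "'k::field poly fract"
  shows "f = Fract (numer f) (denom f)" "coprime (numer f) (denom f)" "lead_coeff (denom f) = 1"
  using theI'[OF lowest_terms_ex1[of f]]
  unfolding numer_def denom_def lowest_terms_def by (auto split: prod.splits)

lemma numer_denom_eqI:
  assumes "f = Fract p q" "coprime p q" "lead_coeff q = 1"
  shows "numer f = p" "denom f = q"
proof -
  have "lowest_terms f = (p, q)"
    unfolding lowest_terms_def
    by (rule the1_equality[OF lowest_terms_ex1]) (use assms in auto)
  then show "numer f = p" "denom f = q" by (simp_all add: numer_def denom_def)
qed

fun rat_degree :: "'k::field ratfun \<Rightarrow> nat" where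
  "rat_degree (Aff f) = max (degree (numer f)) (degree (denom f))"
| "rat_degree Infinity = 0"

definition rat_const :: "'k::field \<Rightarrow> 'k poly fract" where
  "rat_const c = to_fract [:c:]"

definition is_constant :: "'k::field ratfun \<Rightarrow> bool" where
  "is_constant f \<longleftrightarrow> f = Infinity \<or> (\<exists>c. f = Aff (rat_const c))"

text \<open>Value of a rational function over \<open>'k\<close> at a point of the projective line over an extension
  field \<open>'l\<close> of \<open>'k\<close>, given by a field embedding \<open>\<iota>\<close>. At \<open>\<infinity>\<close>, the value of $p/q$ is read off
  from the homogenisations of $p$ and $q$ in degree $\max(\deg p, \deg q)$.\<close>

fun rat_eval :: "('k::field \<Rightarrow> 'l::field) \<Rightarrow> 'k ratfun \<Rightarrow> 'l proj_line \<Rightarrow> 'l proj_line" where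
  "rat_eval \<iota> Infinity x = Infinity"
| "rat_eval \<iota> (Aff f) (Aff x) =
     proj_quot (poly (map_poly \<iota> (numer f)) x) (poly (map_poly \<iota> (denom f)) x)"
| "rat_eval \<iota> (Aff f) Infinity =
     proj_quot (\<iota> (coeff (numer f) (rat_degree (Aff f)))) (\<iota> (coeff (denom f) (rat_degree (Aff f))))"

text \<open>Composition $f \circ g$ is the value of $f$ at $g$, a point of the projective line over $K(X)$.\<close>

definition rat_comp :: "'k::field ratfun \<Rightarrow> 'k ratfun \<Rightarrow> 'k ratfun" where
  "rat_comp f g = rat_eval rat_const f g"

definition rat_id :: "'k::field ratfun" where
  "rat_id = Aff (to_fract [:0, 1:])"

text \<open>Expansion of a nonconstant $f$ fixing \<open>\<alpha>\<close>, in the local coordinate $t = X - \alpha$ if \<open>\<alpha>\<close> is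
  finite, and $t = 1/X$ (on source and target, i.e. the expansion of $1/f(1/t)$) if \<open>\<alpha> = \<infinity>\<close>.
  It is obtained by evaluating $f$ in the field of formal Laurent series in $t$; as $f$ fixes
  \<open>\<alpha>\<close>, it is a power series. The values $0$ below only arise for the constant \<open>\<infinity>\<close>.\<close>

fun local_expansion :: "'k::field ratfun \<Rightarrow> 'k alg_closure proj_line \<Rightarrow> 'k alg_closure fls" where
  "local_expansion f (Aff a) =
     (case rat_eval (\<lambda>c. fls_const (to_ac c)) f (Aff (fls_const a + fls_X)) of
        Aff s \<Rightarrow> s | Infinity \<Rightarrow> 0)"
| "local_expansion f Infinity =
     (case rat_eval (\<lambda>c. fls_const (to_ac c)) f (Aff fls_X_inv) of
        Aff s \<Rightarrow> inverse s | Infinity \<Rightarrow> 0)"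

definition local_deg :: "'k::field ratfun \<Rightarrow> 'k alg_closure proj_line \<Rightarrow> nat" where
  "local_deg f \<alpha> = (LEAST n. 0 < n \<and> fls_nth (local_expansion f \<alpha>) (int n) \<noteq> 0)"

inductive_set semigroup_gen :: "'k::field ratfun set \<Rightarrow> 'k ratfun set" for G where
  gen: "g \<in> G \<Longrightarrow> g \<in> semigroup_gen G"
| comp: "f \<in> semigroup_gen G \<Longrightarrow> g \<in> semigroup_gen G \<Longrightarrow> rat_comp f g \<in> semigroup_gen G"

definition comp_word :: "'k::field ratfun list \<Rightarrow> 'k ratfun" where
  "comp_word ws = foldr rat_comp ws rat_id"

definition num_elements :: "'k::field ratfun set \<Rightarrow> nat \<Rightarrow> nat" where
  "num_elements G n = card (comp_word ` {ws \<in> lists G. ws \<noteq> [] \<and> length ws \<le> n})"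

definition poly_bounded_growth :: "'k::field ratfun set \<Rightarrow> bool" where
  "poly_bounded_growth G \<longleftrightarrow>
     (\<exists>\<kappa>::real. \<kappa> > 0 \<and> (\<lambda>n. real (num_elements G n)) \<in> O(\<lambda>n. real n powr \<kappa>))"

definition free_semigroup_on :: "'k::field ratfun set \<Rightarrow> 'k ratfun set \<Rightarrow> bool" where
  "free_semigroup_on B H \<longleftrightarrow> bij_betw comp_word {ws \<in> lists B. ws \<noteq> []} H"

definition contains_nonabelian_free_semigroup :: "'k::field ratfun set \<Rightarrow> bool" where
  "contains_nonabelian_free_semigroup S \<longleftrightarrow>
     (\<exists>B H. H \<subseteq> S \<and> card B = 2 \<and> free_semigroup_on B H)"

lemma rat_const_simps:
  "rat_const (0::'k::field) = 0" "rat_const (1::'k) = 1"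
  "rat_const (a + b) = rat_const a + rat_const (b::'k)"
  "rat_const (a * b) = rat_const a * rat_const (b::'k)"
  by (simp_all add: rat_const_def one_pCons[symmetric] flip: to_fract_add to_fract_mult)

lemma poly_rat_const_X:
  "poly (map_poly rat_const p) (to_fract [:0, 1:]) = to_fract (p :: 'k::field poly)"
proof (induction p)
  case (pCons a p)
  have "to_fract (pCons a p) = to_fract ([:a:] + [:0, 1:] * p)" by simp
  also have "\<dots> = rat_const a + to_fract [:0, 1:] * to_fract p"
    unfolding to_fract_add to_fract_mult rat_const_def ..
  finally show ?case
    using pCons by (simp add: map_poly_pCons rat_const_simps)
qed simp

lemma rat_comp_id_right: "rat_comp f rat_id = (f :: 'k::field ratfun)"
proof (cases f)
  case (Aff g)
  have nz: "denom g \<noteq> 0" using lowest_terms(3)[of g] by auto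
  have "to_fract (numer g) / to_fract (denom g) = g"
    using nz lowest_terms(1)[of g] by (simp add: to_fract_def)
  then show ?thesis
    using nz by (simp add: Aff rat_comp_def rat_id_def poly_rat_const_X proj_quot_def)
qed (simp add: rat_comp_def)

lemma numer_denom_X: "numer (to_fract [:0, 1:]) = [:0, 1::'k::field:]" "denom (to_fract [:0, 1::'k:]) = 1"
  by (rule numer_denom_eqI[of _ "[:0, 1::'k:]" 1]; simp add: to_fract_def)+

lemma rat_comp_id_left: "rat_comp rat_id f = (f :: 'k::field ratfun)"
  by (cases f)
    (simp_all add: rat_comp_def rat_id_def numer_denom_X proj_quot_def map_poly_pCons
      rat_const_simps one_pCons)

end

theory Submission
  imports Defs "HOL-Analysis.Continuum_Not_Denumerable"
begin

text \<open>
  At a common fixed point \<open>\<alpha>\<close>, the nonconstant elements become power series \<open>c X\<^sup>e + \<dots>\<close> under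
  composition. Two distinct series with the same leading term and \<open>e \<ge> 2\<close> prime to the characteristic
  generate a free semigroup, because composition with a common factor changes their order of contact
  in a controlled way; two series of the same degree \<open>e \<ge> 2\<close> whose leading coefficients have a ratio of
  infinite order do so as well. If neither occurs, an element is determined up to finitely many choices
  by its degree \<open>e\<close>, which is multiplicative, so the growth is polynomial.

  If all nonconstant elements have degree one, they are matrices of determinant one up to scaling. If
  some eigenvalue is not a root of unity, it is expanding for some valuation or some complex
  embedding (Kronecker's theorem), and ping-pong gives a free semigroup unless all matrices are monomial
  in its eigenbasis, when the growth is polynomial. If all eigenvalues are roots of unity, their orders
  are bounded, so there are finitely many traces; an irreducible semigroup is then finite because traces
  determine its elements, and a triangular one has polynomial growth.
\<close>

section \<open>Composition semigroups of power series\<close>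

text \<open>The valuation rings come from Zorn's lemma, so their rank is not under control: if
  \<open>\<pi>\<close> is only known to be a nonunit, its powers need not dominate a given matrix
  entry. Every ring is therefore paired with a subfield in which nothing is infinitely large
  compared with the powers of \<open>\<pi>\<close>. Such a pair is built on the field generated by
  \<open>\<pi> = 1/\<mu>\<close>, for an eigenvalue \<open>\<mu>\<close> of infinite order that is
  not an algebraic integer, and is then carried over to the finitely many entries that enter
  ping-pong. For algebraic integers a complex embedding takes over. Orders of eigenvalues are
  bounded by reduction modulo a prime, which sees only the part of the order prime to the residue
  characteristic; in characteristic zero a second prime supplies the rest. Constant maps have
  neither a matrix nor a local series. A common fixed point leaves room for only one of them; for
  Moebius maps a word is cut at its first constant letter.\<close>

definition lead :: "'a::zero fps \<Rightarrow> 'a" where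
  "lead f = fps_nth f (subdegree f)"

definition fps_comp_word :: "'a::comm_ring_1 fps list \<Rightarrow> 'a fps" where
  "fps_comp_word ws = foldr fps_compose ws fps_X"

lemma fps_comp_word_simps [simp]:
  "fps_comp_word [] = fps_X" "fps_comp_word (f # ws) = f oo fps_comp_word ws"
  by (simp_all add: fps_comp_word_def)

text \<open>A vanishing constant term makes \<open>oo\<close> associative, and excluding zero allows
  an inner series to be cancelled.\<close>

definition zero_preserving :: "'a::zero fps \<Rightarrow> bool" where
  "zero_preserving f \<longleftrightarrow> f \<noteq> 0 \<and> fps_nth f 0 = 0"

lemma zero_preserving_subdegree: "zero_preserving f \<Longrightarrow> subdegree f > 0"
  by (metis nth_subdegree_nonzero gr0I zero_preserving_def)

lemma lead_mult: "lead (f * g) = lead f * (lead g :: 'a::idom)"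
  by (cases "f = 0 \<or> g = 0") (auto simp: lead_def)

lemma lead_one [simp]: "lead (1 :: 'a::comm_ring_1 fps) = 1"
  by (simp add: lead_def)

lemma lead_eq_0_iff [simp]: "lead f = 0 \<longleftrightarrow> f = 0"
  by (auto simp: lead_def)

lemma lead_power: "lead (f ^ n) = lead f ^ n" for f :: "'a::idom fps"
  by (induction n) (simp_all add: lead_mult)

lemma zero_preserving_compose:
  fixes f g :: "'a::idom fps"
  assumes "zero_preserving f" "zero_preserving g"
  shows "zero_preserving (f oo g)"
  using assms by (auto simp: zero_preserving_def fps_compose_eq_0_iff)

text \<open>Write \<open>f\<close> as a power of \<open>X\<close> times a series \<open>h\<close>
  with nonzero constant term; the factor \<open>h oo g\<close> then contributes only that constant
  term.\<close>

lemma lead_compose: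
  fixes f g :: "'a::idom fps"
  assumes "zero_preserving f" "zero_preserving g"
  shows "lead (f oo g) = lead f * lead g ^ subdegree f"
proof -
  have g0: "fps_nth g 0 = 0" using assms by (simp add: zero_preserving_def)
  define h where "h = fps_shift (subdegree f) f"
  have f: "f = h * fps_X ^ subdegree f"
    unfolding h_def by (rule subdegree_decompose)
  have h0: "fps_nth h 0 = lead f" "h \<noteq> 0"
    using assms(1) by (auto simp: h_def lead_def zero_preserving_def dest: arg_cong[of _ _ "\<lambda>f. fps_nth f 0"])
  have "fps_nth (h oo g) 0 = lead f" using h0 by simp
  moreover have "lead f \<noteq> 0" using assms by (simp add: zero_preserving_def)
  ultimately have "subdegree (h oo g) = 0" and l: "lead (h oo g) = lead f"
    by (auto simp: lead_def subdegree_eq_0_iff)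
  have "f oo g = (h oo g) * g ^ subdegree f"
    by (subst f) (simp add: fps_compose_mult_distrib[OF g0] fps_compose_power[OF g0, symmetric] g0)
  then show ?thesis by (simp add: lead_mult l lead_power)
qed

text \<open>Since \<open>u - v\<close> divides every \<open>u ^ i - v ^ i\<close>, composition with
  an outer series cannot lower the order of contact.\<close>

lemma subdegree_compose_diff_ge:
  fixes u v y :: "'a::comm_ring_1 fps"
  assumes "k < subdegree (u - v)"
  shows "fps_nth (y oo u) k = fps_nth (y oo v) k"
proof -
  have "fps_nth (u ^ i) k = fps_nth (v ^ i) k" for i
  proof -
    have "u ^ i - v ^ i = (u - v) * (\<Sum>j<i. v ^ (i - Suc j) * u ^ j)"
      by (rule power_diff_sumr2)
    moreover have "fps_nth (u - v) j = 0" if "j \<le> k" for j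
      using assms that by (intro nth_less_subdegree_zero) simp
    ultimately have "fps_nth (u ^ i - v ^ i) k = 0"
      by (simp only: fps_mult_nth) (simp del: fps_sub_nth)
    then show ?thesis by simp
  qed
  then show ?thesis by (simp add: fps_compose_nth)
qed

text \<open>All \<open>k\<close> summands share the leading term \<open>b^(k-1) X^(d(k-1))\<close>,
  so it occurs in the sum with the factor \<open>k\<close>. This is where the condition on the
  characteristic enters.\<close>

lemma lead_sum_equal:
  fixes u v :: "'a::idom fps"
  assumes "subdegree u = d" "subdegree v = d" "lead u = b" "lead v = b" "b \<noteq> 0"
    "of_nat k \<noteq> (0::'a)"
  shows "subdegree (\<Sum>j<k. v ^ (k - Suc j) * u ^ j) = d * (k - 1)"
    "(\<Sum>j<k. v ^ (k - Suc j) * u ^ j) \<noteq> 0"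
proof -
  have k: "k > 0" using assms by (auto intro: Nat.gr0I)
  let ?s = "\<Sum>j<k. v ^ (k - Suc j) * u ^ j"
  have nz: "u \<noteq> 0" "v \<noteq> 0" using assms(3-5) lead_eq_0_iff by metis+
  have t: "subdegree (v ^ (k - Suc j) * u ^ j) = d * (k - 1)"
    "lead (v ^ (k - Suc j) * u ^ j) = b ^ (k - 1)" if "j < k" for j
  proof -
    have e: "k - Suc j + j = k - 1" using that by simp
    show "subdegree (v ^ (k - Suc j) * u ^ j) = d * (k - 1)"
      unfolding e[symmetric] using nz assms(1,2) by (simp add: add_mult_distrib2)
    show "lead (v ^ (k - Suc j) * u ^ j) = b ^ (k - 1)"
      using assms(3,4) power_add[of b "k - Suc j" j] by (simp only: lead_mult lead_power e)
  qed
  have "fps_nth ?s (d * (k - 1)) = (\<Sum>j<k. b ^ (k - 1))"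
    unfolding fps_sum_nth using t by (intro sum.cong) (auto simp: lead_def)
  also have "\<dots> = of_nat k * b ^ (k - 1)" by simp
  finally have "fps_nth ?s (d * (k - 1)) \<noteq> 0" using assms by simp
  moreover have "fps_nth ?s i = 0" if "i < d * (k - 1)" for i
    unfolding fps_sum_nth using t(1) that by (intro sum.neutral) (auto intro!: nth_less_subdegree_zero)
  ultimately show "subdegree ?s = d * (k - 1)" "?s \<noteq> 0"
    by (auto intro: subdegreeI)
qed

text \<open>Composition from the left preserves the excess \<open>m\<close> of the contact order
  over the degree: with \<open>w = y X^k\<close>, the difference is governed by
  \<open>u ^ k - v ^ k\<close>, which is \<open>u - v\<close> times the sum in
  \<open>lead_sum_equal\<close>.\<close>

lemma subdegree_compose_diff:
  fixes u v w :: "'a::idom fps"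
  assumes "zero_preserving u" "zero_preserving v" "zero_preserving w"
    and d: "subdegree u = d" "subdegree v = d" and "lead u = lead v"
    and "u \<noteq> v" and m: "subdegree (u - v) = d + m"
    and k: "subdegree w = k" "of_nat k \<noteq> (0::'a)"
  shows "subdegree ((w oo u) - (w oo v)) = d * k + m" "(w oo u) - (w oo v) \<noteq> 0"
proof -
  have u0: "fps_nth u 0 = 0" "fps_nth v 0 = 0" using assms by (auto simp: zero_preserving_def)
  have d0: "d > 0" using zero_preserving_subdegree assms(1) d by blast
  define y where "y = fps_shift k w"
  have w: "w = y * fps_X ^ k"
    unfolding y_def k(1)[symmetric] by (rule subdegree_decompose)
  have y0: "fps_nth y 0 \<noteq> 0"
    using assms(3) k by (auto simp: y_def zero_preserving_def)
  let ?s = "\<Sum>j<k. v ^ (k - Suc j) * u ^ j"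
  have wc: "w oo z = (y oo z) * z ^ k" if "fps_nth z 0 = 0" for z
    by (subst w) (simp add: fps_compose_mult_distrib[OF that] fps_compose_power[OF that, symmetric] that)
  have "(w oo u) - (w oo v) = (u ^ k - v ^ k) * (y oo u) + v ^ k * ((y oo u) - (y oo v))"
    by (simp add: wc u0 algebra_simps)
  also have "u ^ k - v ^ k = (u - v) * ?s" by (rule power_diff_sumr2)
  finally have eq: "(w oo u) - (w oo v) = (u - v) * ?s * (y oo u) + v ^ k * ((y oo u) - (y oo v))" .
  have b0: "lead v \<noteq> 0" using assms(2) by (simp add: zero_preserving_def)
  note s = lead_sum_equal[OF d \<open>lead u = lead v\<close> refl b0 k(2)]
  have yu: "subdegree (y oo u) = 0" "y oo u \<noteq> 0" using y0
    by (auto simp: subdegree_eq_0_iff dest: arg_cong[of _ _ "\<lambda>f. fps_nth f 0"])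
  have k0: "k > 0" using k(2) by (auto intro: Nat.gr0I)
  have dk: "d + d * (k - 1) = d * k" using k0 by (cases k) simp_all
  \<comment> \<open>\<open>?A\<close> has order exactly \<open>d * k + m\<close>. In
    \<open>?B\<close> the contact order of \<open>u\<close> and \<open>v\<close>, at least
    \<open>d + m\<close>, comes on top of the order \<open>d * k\<close> of \<open>v ^ k\<close>, so
    it starts later because \<open>d > 0\<close>.\<close>
  let ?A = "(u - v) * ?s * (y oo u)" and ?B = "v ^ k * ((y oo u) - (y oo v))"
  have A: "subdegree ?A = d * k + m" "?A \<noteq> 0"
    using s yu \<open>u \<noteq> v\<close> m dk by auto
  have B: "fps_nth ?B i = 0" if "i \<le> d * k + m" for i
  proof -
    have yz: "(y oo u) - (y oo v) = 0 \<or> subdegree ((y oo u) - (y oo v)) \<ge> d + m"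
      using subdegree_compose_diff_ge[of _ u v y] m
      by (metis fps_sub_nth le_less_linear nth_subdegree_nonzero right_minus_eq)
    show ?thesis
    proof (cases "(y oo u) - (y oo v) = 0")
      case False
      then have "subdegree ?B = d * k + subdegree ((y oo u) - (y oo v))"
        using assms(2) d by (auto simp: zero_preserving_def)
      then show ?thesis using yz False that d0 by (intro nth_less_subdegree_zero) auto
    qed simp
  qed
  have nz: "fps_nth (?A + ?B) (d * k + m) \<noteq> 0"
    using A B nth_subdegree_nonzero[of ?A] by simp
  moreover have "fps_nth (?A + ?B) i = 0" if "i < d * k + m" for i
    using A(1) B[of i] that by (simp add: nth_less_subdegree_zero)
  ultimately show "subdegree ((w oo u) - (w oo v)) = d * k + m"
    unfolding eq by (intro subdegreeI)
  show "(w oo u) - (w oo v) \<noteq> 0" unfolding eq using nz by (metis fps_zero_nth)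
qed

section \<open>Words in power series and free pairs\<close>

lemma zero_preserving_fps_X [simp]: "zero_preserving (fps_X :: 'a::comm_ring_1 fps)"
  by (simp add: zero_preserving_def)

lemma zero_preserving_word:
  "(\<And>w. w \<in> set ws \<Longrightarrow> zero_preserving w) \<Longrightarrow> zero_preserving (fps_comp_word ws)"
  for ws :: "'a::idom fps list"
  by (induction ws) (auto intro: zero_preserving_compose)

lemma subdegree_compose:
  fixes f g :: "'a::idom fps"
  assumes "zero_preserving f" "zero_preserving g"
  shows "subdegree (f oo g) = subdegree f * subdegree g"
  using assms by (simp add: zero_preserving_def)

lemma fps_comp_word_append:
  fixes ws ws' :: "'a::idom fps list"
  assumes "\<And>w. w \<in> set ws \<Longrightarrow> zero_preserving w" "\<And>w. w \<in> set ws' \<Longrightarrow> zero_preserving w"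
  shows "fps_comp_word (ws @ ws') = fps_comp_word ws oo fps_comp_word ws'"
  using assms
proof (induction ws)
  case Nil
  have "zero_preserving (fps_comp_word ws')" using Nil by (intro zero_preserving_word)
  then show ?case by (simp add: zero_preserving_def)
next
  case (Cons w ws)
  have "zero_preserving (fps_comp_word ws')" "zero_preserving (fps_comp_word ws)"
    using Cons by (auto intro: zero_preserving_word)
  then show ?case using Cons by (simp add: fps_compose_assoc zero_preserving_def)
qed

lemma subdegree_word:
  fixes ws :: "'a::idom fps list"
  assumes "\<And>w. w \<in> set ws \<Longrightarrow> zero_preserving w \<and> subdegree w = d"
  shows "subdegree (fps_comp_word ws) = d ^ length ws"
  using assms
  by (induction ws) (auto simp: subdegree_compose zero_preserving_word)

lemma fps_compose_right_cancel:
  fixes f g h :: "'a::idom fps"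
  assumes "zero_preserving h" "f oo h = g oo h" "fps_nth f 0 = 0" "fps_nth g 0 = 0"
  shows "f = g"
proof -
  have "(f - g) oo h = 0" using assms by (simp add: fps_compose_sub_distrib)
  then show ?thesis using assms(1) by (auto simp: fps_compose_eq_0_iff zero_preserving_def)
qed

definition fps_free_pair :: "'a::comm_ring_1 fps \<Rightarrow> 'a fps \<Rightarrow> bool" where
  "fps_free_pair u v \<longleftrightarrow> u \<noteq> v \<and> (\<forall>ws\<in>lists {u, v}. \<forall>ws'\<in>lists {u, v}.
     fps_comp_word ws = fps_comp_word ws' \<longrightarrow> ws = ws')"

text \<open>The order \<open>d ^ n\<close> of a word recovers its length \<open>n\<close> when
  \<open>d \<ge> 2\<close>, so only words of equal length have to be told apart.\<close>

lemma fps_free_pair_same_length: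
  fixes u v :: "'a::idom fps"
  assumes "zero_preserving u" "zero_preserving v" "subdegree u = d" "subdegree v = d" "d \<ge> 2"
    "u \<noteq> v"
    and "\<And>n ws ws'. ws \<in> lists {u, v} \<Longrightarrow> ws' \<in> lists {u, v} \<Longrightarrow> length ws = n \<Longrightarrow> length ws' = n \<Longrightarrow>
      fps_comp_word ws = fps_comp_word ws' \<Longrightarrow> ws = ws'"
  shows "fps_free_pair u v"
  unfolding fps_free_pair_def
proof (intro conjI ballI impI \<open>u \<noteq> v\<close>)
  fix ws ws' assume w: "ws \<in> lists {u, v}" "ws' \<in> lists {u, v}"
    and eq: "fps_comp_word ws = fps_comp_word ws'"
  have "subdegree (fps_comp_word ws) = d ^ length ws" "subdegree (fps_comp_word ws') = d ^ length ws'"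
    by (rule subdegree_word; use w assms(1-4) in auto)+
  then have "d ^ length ws = d ^ length ws'" using eq by simp
  then have "length ws = length ws'"
    using \<open>d \<ge> 2\<close> by simp
  then show "ws = ws'" using assms(7)[OF w refl] eq by simp
qed

text \<open>The relative contact order of two words of equal length that end in different letters is
  exactly that of the letters: the contribution of the prefixes is multiplied by the degree.\<close>

lemma equal_lead_words_distinct:
  fixes u v :: "'a::idom fps"
  assumes "zero_preserving u" "zero_preserving v" "subdegree u = d" "subdegree v = d"
    and "d \<ge> 2" "of_nat d \<noteq> (0::'a)" "lead u = lead v" "u \<noteq> v"
    and m: "subdegree (u - v) = d + m" "m > 0"
  shows "ws \<in> lists {u, v} \<Longrightarrow> ws' \<in> lists {u, v} \<Longrightarrow> length ws = n \<Longrightarrow> length ws' = n \<Longrightarrow> ws \<noteq> ws' \<Longrightarrow>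
    fps_comp_word ws \<noteq> fps_comp_word ws' \<and>
    subdegree (fps_comp_word ws - fps_comp_word ws') \<ge> d ^ n + m"
proof (induction n arbitrary: ws ws')
  case (Suc n)
  then have ne: "ws \<noteq> []" "ws' \<noteq> []" by auto
  obtain xs x where xs: "ws = xs @ [x]" using ne(1) by (cases ws rule: rev_cases) auto
  obtain ys y where ys: "ws' = ys @ [y]" using ne(2) by (cases ws' rule: rev_cases) auto
  have mem: "xs \<in> lists {u, v}" "ys \<in> lists {u, v}" "x \<in> {u, v}" "y \<in> {u, v}" "length xs = n" "length ys = n"
    using Suc.prems by (auto simp: xs ys)
  define W where "W = fps_comp_word xs"
  define W' where "W' = fps_comp_word ys"
  have zp: "\<And>w. w \<in> set xs \<union> set ys \<union> {x, y} \<Longrightarrow> zero_preserving w \<and> subdegree w = d"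
    using mem assms(1-4) by auto
  have zpW: "zero_preserving W" "zero_preserving W'"
    unfolding W_def W'_def using zp by (auto intro: zero_preserving_word)
  have sW: "subdegree W = d ^ n"
    unfolding W_def using subdegree_word[of xs d] zp mem by auto
  have nz: "of_nat (d ^ n) \<noteq> (0::'a)" using assms(6) by simp
  have e1: "fps_comp_word ws = W oo x" "fps_comp_word ws' = W' oo y"
    unfolding xs ys W_def W'_def using zp
    by (subst fps_comp_word_append; simp)+
  have IH: "W \<noteq> W' \<and> subdegree (W - W') \<ge> d ^ n + m" if "xs \<noteq> ys"
    unfolding W_def W'_def using Suc.IH[OF mem(1,2,5,6) that] .
  \<comment> \<open>A right composition multiplies the excess \<open>m\<close> by \<open>d\<close>;
    as \<open>d \<ge> 2\<close> and \<open>m > 0\<close>, the result is larger than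
    \<open>m\<close>.\<close>
  have dn: "d * (d ^ n + m) \<ge> d ^ Suc n + m + 1" 
  proof -
    have "m + 1 \<le> 2 * m" using \<open>m > 0\<close> by simp
    also have "2 * m \<le> d * m" using \<open>d \<ge> 2\<close> by (intro mult_le_mono1)
    finally have "d ^ Suc n + (m + 1) \<le> d ^ Suc n + d * m" by (rule add_left_mono)
    then show ?thesis by (simp only: add_mult_distrib2 power_Suc add.assoc)
  qed
  \<comment> \<open>Different prefixes followed by the same letter: the difference has excess above
    \<open>m\<close>, so it cannot cancel the contribution of two different last letters, whose
    excess is exactly \<open>m\<close>.\<close>
  have second: "(W oo y) - (W' oo y) = 0 \<or> subdegree ((W oo y) - (W' oo y)) \<ge> d ^ Suc n + m + 1"
  proof (cases "xs = ys")
    case True then show ?thesis by (simp add: W_def W'_def)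
  next
    case False
    have y: "subdegree y = d" "fps_nth y 0 = 0" using zp by (auto simp: zero_preserving_def)
    have "subdegree ((W oo y) - (W' oo y)) = subdegree (W - W') * d"
      using y by (simp flip: fps_compose_sub_distrib)
    also have "\<dots> \<ge> (d ^ n + m) * d" using IH[OF False] by (intro mult_le_mono1) simp
    finally show ?thesis using dn by (simp add: mult.commute)
  qed
  show ?case
  proof (cases "x = y")
    case True
    then have "xs \<noteq> ys" using Suc.prems xs ys by auto
    then have "W \<noteq> W'" using IH by simp
    then have "W oo y \<noteq> W' oo y"
      using fps_compose_right_cancel[of y W W'] zp zpW by (auto simp: zero_preserving_def)
    then show ?thesis using second by (simp add: e1 True)
  next
    case False
    have xy: "subdegree (x - y) = d + m" "lead x = lead y"
      using False mem(3,4) m(1) \<open>lead u = lead v\<close> by (metis insertE singletonD subdegree_minus_commute)+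
    have first: "subdegree ((W oo x) - (W oo y)) = d * d ^ n + m" "(W oo x) - (W oo y) \<noteq> 0"
      using subdegree_compose_diff[OF _ _ zpW(1) _ _ xy(2) False xy(1) sW nz] zp by auto
    have eq: "fps_comp_word ws - fps_comp_word ws' = ((W oo x) - (W oo y)) + ((W oo y) - (W' oo y))"
      by (simp add: e1)
    have "subdegree (fps_comp_word ws - fps_comp_word ws') = d * d ^ n + m"
      "fps_comp_word ws - fps_comp_word ws' \<noteq> 0"
    proof -
      have "fps_nth ((W oo y) - (W' oo y)) i = 0" if "i \<le> d * d ^ n + m" for i
      proof (cases "(W oo y) - (W' oo y) = 0")
        case False
        then have "i < subdegree ((W oo y) - (W' oo y))" using second that by simp
        then show ?thesis by (rule nth_less_subdegree_zero)
      qed simp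
      note z = this
      have n1: "fps_nth (fps_comp_word ws - fps_comp_word ws') (d * d ^ n + m) \<noteq> 0"
        unfolding eq fps_add_nth z[OF order.refl] using first nth_subdegree_nonzero[OF first(2)] by simp
      moreover have "fps_nth (fps_comp_word ws - fps_comp_word ws') i = 0" if "i < d * d ^ n + m" for i
        unfolding eq fps_add_nth using that z[of i] first(1) by (simp add: nth_less_subdegree_zero del: fps_sub_nth)
      ultimately show "subdegree (fps_comp_word ws - fps_comp_word ws') = d * d ^ n + m"
        by (intro subdegreeI)
      show "fps_comp_word ws - fps_comp_word ws' \<noteq> 0" using n1 by auto
    qed
    then show ?thesis by simp
  qed
qed auto

text \<open>Equal order and equal leading coefficient push the first disagreement beyond
  \<open>d\<close>, which is the positive excess required by
  \<open>equal_lead_words_distinct\<close>.\<close>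

lemma equal_lead_free_pair:
  fixes u v :: "'a::idom fps"
  assumes "zero_preserving u" "zero_preserving v" "subdegree u = d" "subdegree v = d"
    and "d \<ge> 2" "of_nat d \<noteq> (0::'a)" "lead u = lead v" "u \<noteq> v"
  shows "fps_free_pair u v"
proof -
  have "fps_nth (u - v) i = 0" if "i \<le> d" for i
    using that assms(3,4,7) by (cases "i = d") (auto simp: lead_def nth_less_subdegree_zero)
  then have "subdegree (u - v) > d"
    using \<open>u \<noteq> v\<close> by (metis not_le nth_subdegree_nonzero right_minus_eq)
  then obtain m where "subdegree (u - v) = d + m" "m > 0"
    using less_imp_add_positive by metis
  from equal_lead_words_distinct[OF assms this] show ?thesis
    by (intro fps_free_pair_same_length[OF assms(1-5,8)]) blast
qed

section \<open>Leading coefficients of infinite order, and growth in their absence\<close>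

definition torsion :: "'a::monoid_mult \<Rightarrow> bool" where
  "torsion x \<longleftrightarrow> (\<exists>n>0. x ^ n = 1)"

lemma nontorsion_power_inj:
  fixes x :: "'a::field"
  assumes "\<not> torsion x" "x \<noteq> 0" "x ^ i = x ^ j"
  shows "i = j"
proof (rule ccontr)
  assume "i \<noteq> j"
  then consider "i < j" | "j < i" by linarith
  then show False
  proof cases
    case 1
    then have "x ^ (j - i) = 1" using assms by (simp add: power_diff)
    then show ?thesis using 1 assms(1) by (metis torsion_def zero_less_diff)
  next
    case 2
    then have "x ^ (i - j) = 1" using assms by (simp add: power_diff)
    then show ?thesis using 2 assms(1) by (metis torsion_def zero_less_diff)
  qed
qed

text \<open>With \<open>c\<close> the ratio of the leading coefficients, a word of length
  \<open>n\<close> has leading coefficient \<open>c ^ val ws * lv n\<close>, where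
  \<open>val\<close> reads the word as a number in base \<open>d\<close> with digit 1 for
  \<open>u\<close>, digit 0 for \<open>v\<close>, and the first letter least significant. As
  \<open>c\<close> has infinite order and \<open>d \<ge> 2\<close>, the leading coefficient
  determines the word among those of its length.\<close>

lemma nontorsion_lead_ratio_free_pair:
  fixes u v :: "'a::field fps"
  assumes "zero_preserving u" "zero_preserving v" "subdegree u = d" "subdegree v = d"
    and "d \<ge> 2" "\<not> torsion (lead u / lead v)"
  shows "fps_free_pair u v"
proof (rule fps_free_pair_same_length[OF assms(1-5)])
  define c where "c = lead u / lead v"
  have c: "c \<noteq> 0" "lead u = c * lead v" "lead v \<noteq> 0" and nt: "\<not> torsion c"
    using assms by (auto simp: c_def zero_preserving_def)
  show "u \<noteq> v" using nt c by (auto simp: torsion_def intro: exI[of _ 1])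
  define dig where "dig = (\<lambda>w. if w = u then 1 else (0::nat))"
  define val where "val = (\<lambda>ws. foldr (\<lambda>w a. dig w + d * a) ws 0)"
  \<comment> \<open>\<open>lv n\<close> is the leading coefficient of the \<open>n\<close>-fold
    iterate of \<open>v\<close>.\<close>
  define lv where "lv = (\<lambda>n. ((\<lambda>b. lead v * b ^ d) ^^ n) 1)"
  have lead: "lead (fps_comp_word ws) = c ^ val ws * lv (length ws)" if "ws \<in> lists {u, v}" for ws
    using that
  proof (induction ws)
    case Nil
    then show ?case by (simp add: lv_def val_def lead_def)
  next
    case (Cons w ws)
    have zp: "zero_preserving w" "subdegree w = d" "zero_preserving (fps_comp_word ws)"
      using Cons.hyps assms(1-4) by (auto intro!: zero_preserving_word)
    have "lead w = c ^ dig w * lead v" using Cons.hyps c \<open>u \<noteq> v\<close> by (auto simp: dig_def)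
    then have "lead (fps_comp_word (w # ws)) = c ^ dig w * lead v * (c ^ val ws * lv (length ws)) ^ d"
      using zp Cons by (simp add: lead_compose)
    also have "\<dots> = c ^ val (w # ws) * lv (length (w # ws))"
      by (simp add: val_def lv_def power_mult_distrib power_add power_mult[symmetric] mult_ac)
    finally show ?case .
  qed
  have lv0: "lv n \<noteq> 0" for n by (induction n) (use c in \<open>simp_all add: lv_def\<close>)
  have digits: "ws = ws'" if "val ws = val ws'" "ws \<in> lists {u, v}" "ws' \<in> lists {u, v}"
    "length ws = length ws'" for ws ws'
    using that(4,1-3)
  proof (induction ws ws' rule: list_induct2)
    case (Cons w ws w' ws')
    have e: "dig w + d * val ws = dig w' + d * val ws'" using Cons.prems(1) by (simp add: val_def)
    have "dig w mod d = dig w' mod d" using arg_cong[OF e, of "\<lambda>n. n mod d"] by simp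
    then have "dig w = dig w'" using \<open>d \<ge> 2\<close> by (auto simp: dig_def split: if_splits)
    moreover from this have "val ws = val ws'" using e \<open>d \<ge> 2\<close> by simp
    ultimately show ?case using Cons by (auto simp: dig_def split: if_splits)
  qed simp
  fix n ws ws' assume w: "ws \<in> lists {u, v}" "ws' \<in> lists {u, v}" "length ws = n" "length ws' = n"
    and eq: "fps_comp_word ws = fps_comp_word ws'"
  have "c ^ val ws = c ^ val ws'"
    using lead[OF w(1)] lead[OF w(2)] w(3,4) eq lv0 by simp
  then show "ws = ws'" using nontorsion_power_inj[OF nt c(1)] digits w by metis
qed

text \<open>The source of the polynomial bounds: an element is described by a member of a finite set
  together with exponents, which a word of length \<open>n\<close> can raise to at most
  \<open>n\<close>.\<close>

lemma card_image_exponent_vectors_le: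
  assumes "finite I" "finite Z" "A \<subseteq> F ` (Z \<times> (I \<rightarrow>\<^sub>E {..n::nat}))"
  shows "card A \<le> card Z * (n + 1) ^ card I"
proof -
  have fin: "finite (Z \<times> (I \<rightarrow>\<^sub>E {..n}))" using assms by (intro finite_cartesian_product finite_PiE) auto
  have "card A \<le> card (F ` (Z \<times> (I \<rightarrow>\<^sub>E {..n})))" using assms fin by (intro card_mono) auto
  also have "\<dots> \<le> card (Z \<times> (I \<rightarrow>\<^sub>E {..n}))" using fin by (rule card_image_le)
  also have "\<dots> = card Z * (n + 1) ^ card I"
    using assms by (simp add: card_cartesian_product card_PiE)
  finally show ?thesis .
qed

lemma prod_list_eq_prod_count:
  fixes k :: "'a \<Rightarrow> 'b::comm_monoid_mult"
  assumes "finite I" "ws \<in> lists I"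
  shows "prod_list (map k ws) = (\<Prod>i\<in>I. k i ^ count_list ws i)"
  using assms(2)
proof (induction ws)
  case (Cons w ws)
  have "(\<Prod>i\<in>I. k i ^ count_list (w # ws) i) = (\<Prod>i\<in>I. (if i = w then k i else 1) * k i ^ count_list ws i)"
    by (intro prod.cong) auto
  also have "\<dots> = k w * (\<Prod>i\<in>I. k i ^ count_list ws i)"
    using Cons assms(1) by (simp add: prod.distrib)
  finally show ?case using Cons by simp
qed simp

lemma torsion_of_power: "torsion (x ^ n) \<Longrightarrow> n > 0 \<Longrightarrow> torsion x"
  unfolding torsion_def by (metis nat_0_less_mult_iff power_mult)

lemma torsion_common_exponent:
  fixes x :: "'i \<Rightarrow> 'a::comm_monoid_mult"
  assumes "finite I" "\<And>i. i \<in> I \<Longrightarrow> torsion (x i)"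
  shows "\<exists>n>0. \<forall>i\<in>I. x i ^ n = 1"
  using assms
proof (induction I)
  case (insert i I)
  from insert.IH insert.prems obtain n where n: "n > 0" "\<forall>j\<in>I. x j ^ n = 1" by auto
  from insert.prems[of i] obtain m where m: "m > 0" "x i ^ m = 1" by (auto simp: torsion_def)
  note nm = n m
  have "x j ^ (n * m) = 1" if "j \<in> insert i I" for j
  proof (cases "j = i")
    case True
    then show ?thesis using m by (metis mult.commute power_mult power_one)
  next
    case False
    then show ?thesis using that n by (simp add: power_mult)
  qed
  then show ?case using nm by (intro exI[of _ "n * m"]) auto
qed (auto intro: exI[of _ 1])

lemma finite_roots_of_unity: "n > 0 \<Longrightarrow> finite {x :: 'a::idom. x ^ n = 1}"
proof -
  assume "n > 0"
  then have "coeff (monom 1 n - 1 :: 'a poly) n = 1"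
    by (simp add: one_pCons coeff_pCons split: nat.split)
  then have nz: "monom 1 n - 1 \<noteq> (0 :: 'a poly)" by (metis coeff_0 zero_neq_one)
  have "{x :: 'a. x ^ n = 1} \<subseteq> {x. poly (monom 1 n - 1) x = 0}" by (auto simp: poly_monom)
  then show ?thesis using poly_roots_finite[OF nz] by (rule finite_subset)
qed

text \<open>A scaling makes \<open>f\<close> monic; comparing \<open>f \<circ> g\<close> with \<open>g \<circ> f\<close> then forces the leading
  coefficient of every \<open>g\<close> to be a root of unity.\<close>

theorem fps_semigroup_alternative:
  fixes I T :: "'a::alg_closed_field fps set"
  assumes "finite I" "I \<subseteq> T"
    and comp: "\<And>g h. g \<in> T \<Longrightarrow> h \<in> T \<Longrightarrow> g oo h \<in> T"
    and zp: "\<And>g. g \<in> T \<Longrightarrow> zero_preserving g"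
    and char: "\<And>g. g \<in> T \<Longrightarrow> of_nat (subdegree g) \<noteq> (0::'a)"
    and f: "f \<in> T" "subdegree f \<ge> 2"
    and nofree: "\<And>u v. u \<in> T \<Longrightarrow> v \<in> T \<Longrightarrow> \<not> fps_free_pair u v"
  shows "\<exists>C k. \<forall>n. card (fps_comp_word ` {ws \<in> lists I. length ws \<le> n}) \<le> C * (n + 1) ^ k"
proof -
  let ?e = "subdegree f"
  have eq: "u = v" if "u \<in> T" "v \<in> T" "subdegree u = subdegree v" "subdegree u \<ge> 2" "lead u = lead v" for u v
    using equal_lead_free_pair[OF zp[OF that(1)] zp[OF that(2)] refl that(3)[symmetric] that(4)
        char[OF that(1)] that(5)] nofree[OF that(1,2)] by blast
  have tor: "torsion (lead u / lead v)" if "u \<in> T" "v \<in> T" "subdegree u = subdegree v" "subdegree u \<ge> 2" for u v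
    using nontorsion_lead_ratio_free_pair[OF zp[OF that(1)] zp[OF that(2)] refl that(3)[symmetric] that(4)]
      nofree[OF that(1,2)] by blast
  have f0: "lead f \<noteq> 0" using zp[OF f(1)] by (simp add: zero_preserving_def)
  \<comment> \<open>Conjugation with the scaling by \<open>l\<close> multiplies a leading
    coefficient in degree \<open>e\<close> by \<open>l^(e-1)\<close>. This \<open>l\<close> makes
    \<open>f\<close> monic, and \<open>nu\<close> below is the leading coefficient after the
    conjugation.\<close>
  obtain l where l: "l ^ (?e - 1) = inverse (lead f)"
    using nth_root_exists[of "?e - 1" "inverse (lead f)"] f(2) by auto
  have l0: "l \<noteq> 0" using l f0 f(2) by (auto simp: power_0_left split: if_splits)
  define nu where "nu = (\<lambda>g. lead g * l ^ (subdegree g - 1))"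
  have nu0: "nu g \<noteq> 0" if "zero_preserving g" for g
    using that l0 by (auto simp: nu_def zero_preserving_def)
  have nu_comp: "nu (g oo h) = nu g * nu h ^ subdegree g" if "zero_preserving g" "zero_preserving h" for g h
  proof -
    have p: "subdegree g > 0" "subdegree h > 0" using that zero_preserving_subdegree by auto
    have "subdegree g * subdegree h - 1 = (subdegree g - 1) + (subdegree h - 1) * subdegree g"
      using p by (cases "subdegree g"; cases "subdegree h") (auto simp: algebra_simps)
    then show ?thesis
      using that by (simp add: nu_def lead_compose subdegree_compose power_mult_distrib power_add
          power_mult[symmetric] mult_ac)
  qed
  have nuf: "nu f = 1" using l f0 by (simp add: nu_def)
  \<comment> \<open>As \<open>nu f = 1\<close>, the two composites have normalised leading
    coefficients \<open>nu g ^ ?e\<close> and \<open>nu g\<close>. Their degrees agree and are at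
    least 2, so the ratio is a root of unity.\<close>
  have nut: "torsion (nu g)" if "g \<in> T" for g
  proof -
    have p: "subdegree g > 0" using zp[OF that] zero_preserving_subdegree by auto
    have sd: "subdegree (f oo g) = ?e * subdegree g" "subdegree (g oo f) = ?e * subdegree g"
      using zp that f(1) by (simp_all add: subdegree_compose)
    have "?e * subdegree g \<ge> 2 * 1" using p f(2) by (intro mult_le_mono) auto
    then have "torsion (lead (f oo g) / lead (g oo f))" using comp that f(1) sd by (intro tor) auto
    also have "lead (f oo g) / lead (g oo f) = nu (f oo g) / nu (g oo f)"
      using l0 by (simp add: nu_def sd)
    also have "\<dots> = nu g ^ ?e / nu g"
      using nu_comp[OF zp zp] that f(1) by (simp add: nuf)
    also have "\<dots> = nu g ^ (?e - 1)" using nu0[OF zp[OF that]] f(2) by (cases ?e) auto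
    finally show ?thesis by (rule torsion_of_power) (use f(2) in auto)
  qed
  obtain N where N: "N > 0" "\<forall>g\<in>I. nu g ^ N = 1"
    using torsion_common_exponent[OF assms(1), of nu] nut assms(2) by blast
  define Z where "Z = {x::'a. x ^ N = 1}"
  have finZ: "finite Z" unfolding Z_def using N(1) by (rule finite_roots_of_unity)
  have zpI: "zero_preserving g" if "g \<in> I" for g using that assms(2) zp by auto
  have zpw: "zero_preserving (fps_comp_word ws)" if "ws \<in> lists I" for ws
    using that zpI by (auto intro: zero_preserving_word)
  have deg: "subdegree (fps_comp_word ws) = prod_list (map subdegree ws)" if "ws \<in> lists I" for ws
    using that by (induction ws) (auto simp: subdegree_compose zpI zpw)
  have nuw: "nu (fps_comp_word ws) \<in> Z" if "ws \<in> lists I" for ws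
    using that
  proof (induction ws)
    case (Cons w ws)
    have "nu (fps_comp_word (w # ws)) ^ N = nu w ^ N * (nu (fps_comp_word ws) ^ N) ^ subdegree w"
      using Cons by (simp add: nu_comp zpI zpw power_mult_distrib mult.commute flip: power_mult)
    then show ?case using Cons N by (simp add: Z_def)
  qed (auto simp: Z_def nu_def lead_def)
  \<comment> \<open>Composing with \<open>f\<close> on the right lifts words of degree one, the
    empty word among them, into the range where degree and leading coefficient determine a series;
    \<open>f\<close> is cancelled afterwards.\<close>
  have inT: "fps_comp_word ws oo f \<in> T" if "ws \<in> lists I" for ws
    using that
  proof (induction ws)
    case (Cons w ws)
    have "fps_comp_word (w # ws) oo f = w oo (fps_comp_word ws oo f)"
      using zpw[of ws] zp[OF f(1)] Cons by (simp add: fps_compose_assoc zero_preserving_def)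
    then show ?case using Cons assms(2) comp by auto
  qed (use f zp[OF f(1)] in \<open>auto simp: zero_preserving_def\<close>)
  have inj: "fps_comp_word ws = fps_comp_word ws'"
    if w: "ws \<in> lists I" "ws' \<in> lists I" and d: "subdegree (fps_comp_word ws) = subdegree (fps_comp_word ws')"
      and n: "nu (fps_comp_word ws) = nu (fps_comp_word ws')" for ws ws'
  proof -
    let ?W = "fps_comp_word ws" and ?W' = "fps_comp_word ws'"
    have z: "zero_preserving ?W" "zero_preserving ?W'" "zero_preserving f" using zpw w zp f by auto
    have le: "lead ?W = lead ?W'" using n d l0 by (simp add: nu_def)
    have "?W oo f = ?W' oo f"
    proof (rule eq[OF inT[OF w(1)] inT[OF w(2)]])
      show "subdegree (?W oo f) = subdegree (?W' oo f)" using z d by (simp add: subdegree_compose)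
      have "1 * 2 \<le> subdegree ?W * ?e"
        using zero_preserving_subdegree[OF z(1)] f(2) by (intro mult_le_mono) auto
      then show "subdegree (?W oo f) \<ge> 2" using z by (simp add: subdegree_compose)
      show "lead (?W oo f) = lead (?W' oo f)" using z d le by (simp add: lead_compose)
    qed
    then show ?thesis using z fps_compose_right_cancel by (auto simp: zero_preserving_def)
  qed
  have "card (fps_comp_word ` {ws \<in> lists I. length ws \<le> n}) \<le> card Z * (n + 1) ^ card I" for n
  proof -
    let ?A = "{ws \<in> lists I. length ws \<le> n}"
    define sig where "sig = (\<lambda>W :: 'a fps. (nu W, subdegree W))"
    have "inj_on sig (fps_comp_word ` ?A)"
      by (rule inj_onI) (use inj in \<open>auto simp: sig_def\<close>)
    then have "card (fps_comp_word ` ?A) = card (sig ` fps_comp_word ` ?A)"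
      by (simp add: card_image)
    also have "\<dots> \<le> card Z * (n + 1) ^ card I"
    proof (rule card_image_exponent_vectors_le[OF assms(1) finZ])
      show "sig ` fps_comp_word ` ?A \<subseteq> (\<lambda>(z, c). (z, \<Prod>i\<in>I. subdegree i ^ c i)) ` (Z \<times> (I \<rightarrow>\<^sub>E {..n}))"
      proof (intro subsetI, elim imageE)
        fix x W ws assume x: "x = sig W" "W = fps_comp_word ws" and "ws \<in> ?A"
        then have ws: "ws \<in> lists I" "length ws \<le> n" by auto
        define c where "c = (\<lambda>i\<in>I. count_list ws i)"
        have "count_list ws i \<le> n" for i using count_le_length[of ws i] ws by linarith
        then have "c \<in> I \<rightarrow>\<^sub>E {..n}" by (auto simp: c_def)
        moreover have "subdegree (fps_comp_word ws) = (\<Prod>i\<in>I. subdegree i ^ c i)"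
          using deg[OF ws(1)] prod_list_eq_prod_count[OF assms(1) ws(1), of subdegree] by (simp add: c_def)
        ultimately show "x \<in> (\<lambda>(z, c). (z, \<Prod>i\<in>I. subdegree i ^ c i)) ` (Z \<times> (I \<rightarrow>\<^sub>E {..n}))"
          using nuw[OF ws(1)] by (auto simp: x sig_def intro!: image_eqI[of _ _ "(nu (fps_comp_word ws), c)"])
      qed
    qed
    finally show ?thesis .
  qed
  then show ?thesis by blast
qed

section \<open>Local expansions at a common fixed point\<close>

definition field_hom :: "('a::field \<Rightarrow> 'b::field) \<Rightarrow> bool" where
  "field_hom h \<longleftrightarrow> h 0 = 0 \<and> h 1 = 1 \<and> (\<forall>x y. h (x + y) = h x + h y) \<and> (\<forall>x y. h (x * y) = h x * h y)"

lemma field_hom_simps: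
  assumes "field_hom h"
  shows "h 0 = 0" "h 1 = 1" "h (x + y) = h x + h y" "h (x * y) = h x * h y"
  using assms by (auto simp: field_hom_def)

lemma field_hom_eq_0_iff:
  assumes "field_hom h" shows "h x = 0 \<longleftrightarrow> x = 0"
proof
  assume "h x = 0"
  then have "h (x * inverse x) = 0" by (simp add: field_hom_simps[OF assms])
  then show "x = 0" using field_hom_simps(2)[OF assms] by (cases "x = 0") auto
qed (simp add: field_hom_simps[OF assms])

lemma field_hom_divide: "field_hom h \<Longrightarrow> h (x / y) = h x / h y"
proof (cases "y = 0")
  case False
  assume h: "field_hom h"
  have "h (x / y) * h y = h x" using False by (simp flip: field_hom_simps(4)[OF h])
  then show ?thesis using False field_hom_eq_0_iff[OF h, of y] by (simp add: field_simps)
qed (simp add: field_hom_simps)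

lemma field_hom_inj:
  assumes "field_hom h" shows "h x = h y \<longleftrightarrow> x = y"
proof
  assume "h x = h y"
  moreover have "h (x - y) + h y = h x" by (simp flip: field_hom_simps(3)[OF assms])
  ultimately have "h (x - y) = 0" by simp
  then show "x = y" using field_hom_eq_0_iff[OF assms] by fastforce
qed simp

lemma field_hom_poly:
  "field_hom h \<Longrightarrow> h (poly p x) = poly (map_poly h p) (h x)"
  by (induction p) (simp_all add: field_hom_simps map_poly_pCons)

lemma poly_map_poly_hom_comp:
  assumes "field_hom h" "field_hom i"
  shows "map_poly h (map_poly i p) = map_poly (\<lambda>c. h (i c)) p"
  using assms by (subst map_poly_map_poly) (simp_all add: field_hom_simps comp_def)

lemma map_poly_hom_add:
  "field_hom h \<Longrightarrow> map_poly h (p + q) = map_poly h p + map_poly h q"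
  by (intro poly_eqI) (simp add: coeff_map_poly field_hom_simps)

lemma map_poly_hom_mult:
  assumes h: "field_hom h" shows "map_poly h (p * q) = map_poly h p * map_poly h q"
proof -
  have s: "h (sum f A) = (\<Sum>x\<in>A. h (f x))" for f and A :: "nat set"
    by (induction A rule: infinite_finite_induct) (simp_all add: field_hom_simps[OF h])
  show ?thesis
    by (intro poly_eqI) (simp add: coeff_map_poly coeff_mult field_hom_simps[OF h] s)
qed

lemma field_hom_rat_const: "field_hom (rat_const :: 'k::field \<Rightarrow> _)"
  by (simp add: field_hom_def rat_const_simps)

lemma field_hom_to_ac: "field_hom to_ac"
  by (simp add: field_hom_def)

lemma field_hom_fls_const_to_ac: "field_hom (\<lambda>c. fls_const (to_ac c))"
  by (simp add: field_hom_def fls_const_mult_const fls_plus_const)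

lemma denom_nonzero [simp]: "denom f \<noteq> 0"
  using lowest_terms(3)[of f] by auto

lemma numer_denom_rat_const [simp]: "numer (rat_const c) = [:c:]" "denom (rat_const c) = 1"
  by (rule numer_denom_eqI[of _ "[:c:]" 1]; simp add: rat_const_def to_fract_def)+

lemma rat_eval_const:
  "field_hom i \<Longrightarrow> rat_eval i (Aff (rat_const c)) x = Aff (i c)"
  by (cases x) (simp_all add: proj_quot_def field_hom_simps map_poly_pCons one_pCons)

lemma rat_comp_const_left: "is_constant f \<Longrightarrow> rat_comp f g = f"
  by (auto simp: is_constant_def rat_comp_def rat_eval_const[OF field_hom_rat_const])

lemma is_constant_proj_quot: "is_constant (proj_quot (rat_const a) (rat_const b))"
  by (auto simp: is_constant_def proj_quot_def simp flip: field_hom_divide[OF field_hom_rat_const])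

lemma rat_comp_const_right: "is_constant g \<Longrightarrow> is_constant (rat_comp f g)"
proof -
  assume g: "is_constant g"
  show ?thesis
  proof (cases f)
    case (Aff r)
    show ?thesis
      using g unfolding is_constant_def[of g] Aff
      by (auto simp: rat_comp_def is_constant_proj_quot simp flip: field_hom_poly[OF field_hom_rat_const])
  qed (simp add: rat_comp_def is_constant_def)
qed

definition eval_at :: "('k::field \<Rightarrow> 'l::field) \<Rightarrow> 'l \<Rightarrow> 'k poly fract \<Rightarrow> 'l" where
  "eval_at i \<xi> k = poly (map_poly i (numer k)) \<xi> / poly (map_poly i (denom k)) \<xi>"

text \<open>A point at which no nonzero polynomial vanishes behaves like a variable: a fraction may
  be evaluated in any representation, and evaluation embeds the rational function field.\<close>

lemma transcendental_eval_hom: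
  fixes i :: "'k::field \<Rightarrow> 'l::field"
  assumes i: "field_hom i" and tr: "\<forall>d. d \<noteq> 0 \<longrightarrow> poly (map_poly i d) \<xi> \<noteq> 0"
  shows "field_hom (eval_at i \<xi>)" "eval_at i \<xi> (rat_const c) = i c"
    "rat_eval i (Aff k) (Aff \<xi>) = Aff (eval_at i \<xi> k)"
proof -
  let ?\<eta> = "eval_at i \<xi>"
  let ?e = "\<lambda>p. poly (map_poly i p) \<xi>"
  have F: "?\<eta> (Fract n d) = ?e n / ?e d" if "d \<noteq> 0" for n d
  proof -
    let ?k = "Fract n d"
    have "Fract (numer ?k) (denom ?k) = Fract n d" using lowest_terms(1)[of ?k] by simp
    then have "numer ?k * d = n * denom ?k" using that by (simp add: eq_fract)
    then have "?e (numer ?k) * ?e d = ?e n * ?e (denom ?k)"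
      by (metis map_poly_hom_mult[OF i] poly_mult)
    then show ?thesis using tr that by (simp add: eval_at_def field_simps)
  qed
  have e1: "?e 1 = 1" by (simp add: one_pCons map_poly_pCons field_hom_simps[OF i])
  show "field_hom ?\<eta>" unfolding field_hom_def
  proof (intro conjI allI)
    show "?\<eta> 0 = 0" using F[of 1 0] e1 by (simp add: Zero_fract_def)
    show "?\<eta> 1 = 1" using F[of 1 1] e1 by (simp add: One_fract_def)
    fix x y :: "'k poly fract"
    obtain a b c d where xy: "x = Fract a b" "b \<noteq> 0" "y = Fract c d" "d \<noteq> 0"
      by (metis Fract_cases)
    show "?\<eta> (x + y) = ?\<eta> x + ?\<eta> y" "?\<eta> (x * y) = ?\<eta> x * ?\<eta> y"
      using xy tr
      by (simp_all add: F map_poly_hom_mult[OF i] map_poly_hom_add[OF i] field_simps)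
  qed
  show "?\<eta> (rat_const c) = i c"
    using F[of 1 "[:c:]"] e1 by (simp add: rat_const_def to_fract_def map_poly_pCons field_hom_simps[OF i])
  show "rat_eval i (Aff k) (Aff \<xi>) = Aff (?\<eta> k)"
    using tr by (simp add: proj_quot_def eval_at_def)
qed

text \<open>At such a point evaluation is a field embedding and hence commutes with forming
  \<open>f(h)\<close>, without exceptions for poles or cancellation.\<close>

lemma rat_eval_comp_transcendental:
  fixes i :: "'k::field \<Rightarrow> 'l::field"
  assumes i: "field_hom i" and tr: "\<forall>d. d \<noteq> 0 \<longrightarrow> poly (map_poly i d) \<xi> \<noteq> 0"
  shows "rat_eval i (rat_comp f (Aff h)) (Aff \<xi>) = rat_eval i f (rat_eval i (Aff h) (Aff \<xi>))"
proof -
  define \<eta> where "\<eta> = eval_at i \<xi>"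
  note \<eta> = transcendental_eval_hom[OF i tr, folded \<eta>_def]
  have e: "\<eta> (poly (map_poly rat_const p) h) = poly (map_poly i p) (\<eta> h)" for p
    unfolding field_hom_poly[OF \<eta>(1)] poly_map_poly_hom_comp[OF \<eta>(1) field_hom_rat_const] \<eta>(2) ..
  show ?thesis
  proof (cases f)
    case (Aff r)
    let ?n = "poly (map_poly rat_const (numer r)) h" and ?d = "poly (map_poly rat_const (denom r)) h"
    have "rat_eval i (rat_comp f (Aff h)) (Aff \<xi>) = rat_eval i (proj_quot ?n ?d) (Aff \<xi>)"
      by (simp add: Aff rat_comp_def)
    also have "\<dots> = proj_quot (\<eta> ?n) (\<eta> ?d)"
      by (simp add: proj_quot_def \<eta>(3) field_hom_eq_0_iff[OF \<eta>(1)] field_hom_divide[OF \<eta>(1)] del: rat_eval.simps(2))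
    also have "\<dots> = rat_eval i f (Aff (\<eta> h))" by (simp add: Aff e)
    finally show ?thesis by (simp add: \<eta>(3) del: rat_eval.simps(2))
  qed (simp add: rat_comp_def)
qed

section \<open>Power series in the local coordinate at a fixed point\<close>

abbreviation ac_const :: "'k::field \<Rightarrow> 'k alg_closure fls" where
  "ac_const \<equiv> (\<lambda>c. fls_const (to_ac c))"

text \<open>The point near the given base point whose local coordinate is \<open>s\<close>.\<close>

fun local_point :: "'a::field proj_line \<Rightarrow> 'a fps \<Rightarrow> 'a fls proj_line" where
  "local_point (Aff a) s = Aff (fls_const a + fps_to_fls s)"
| "local_point Infinity s = Aff (inverse (fps_to_fls s))"

definition shifted :: "'a::field \<Rightarrow> 'a poly \<Rightarrow> 'a fps" where
  "shifted a p = fps_of_poly (pcompose p [:a, 1:])"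

text \<open>A version of \<open>local_expansion\<close> inside \<open>fps\<close>, so that
  \<open>oo\<close> applies. At infinity \<open>1/f(1/t)\<close> is written with reversed
  polynomials; the subtraction of degrees is exact because a map fixing infinity has a numerator of
  larger degree. At a finite point \<open>a\<close> is subtracted to make the constant term
  vanish.\<close>

fun local_series :: "'k::field ratfun \<Rightarrow> 'k alg_closure proj_line \<Rightarrow> 'k alg_closure fps" where
  "local_series (Aff r) (Aff a) =
     shifted a (map_poly to_ac (numer r)) / shifted a (map_poly to_ac (denom r)) - fps_const a"
| "local_series (Aff r) Infinity =
     fps_X ^ (degree (numer r) - degree (denom r)) * fps_of_poly (reflect_poly (map_poly to_ac (denom r)))
       / fps_of_poly (reflect_poly (map_poly to_ac (numer r)))"
| "local_series Infinity \<alpha> = 0"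

text \<open>Taylor expansion at \<open>a\<close>, with \<open>s\<close> substituted for the
  increment.\<close>

lemma shifted_compose:
  assumes "fps_nth s 0 = 0"
  shows "poly (map_poly fls_const p) (fls_const a + fps_to_fls s) = fps_to_fls (shifted a p oo s)"
proof (induction p)
  case 0
  then show ?case by (simp add: shifted_def)
next
  case (pCons c p)
  have "shifted a (pCons c p) oo s = fps_const c + (fps_const a + s) * (shifted a p oo s)"
    using assms
    by (simp add: shifted_def pcompose_pCons fps_of_poly_add fps_of_poly_mult fps_compose_add_distrib
        fps_compose_mult_distrib fps_of_poly_pCons fps_of_poly_smult distrib_right mult.commute)
  then show ?case
    using pCons by (simp add: map_poly_pCons fls_times_fps_to_fls)
qed

lemma field_hom_fls_const: "field_hom (fls_const :: 'a::field \<Rightarrow> _)"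
  by (simp add: field_hom_def fls_const_mult_const fls_plus_const)

lemma map_poly_ac_const: "map_poly ac_const p = map_poly fls_const (map_poly to_ac p)"
  by (simp add: poly_map_poly_hom_comp[OF field_hom_fls_const field_hom_to_ac])

lemma shifted_nth_0: "fps_nth (shifted a p) 0 = poly p a"
  by (simp add: shifted_def poly_0_coeff_0[symmetric] poly_pcompose)

lemma shifted_eq_0_iff: "shifted a p = 0 \<longleftrightarrow> p = (0 :: 'a::field poly)"
  by (auto simp: shifted_def pcompose_eq_0_iff)

text \<open>Multiplication by the top power of \<open>s\<close> clears the pole at infinity and
  leaves the reversed polynomial.\<close>

lemma reflect_compose:
  fixes p :: "'a::field poly"
  assumes "fps_nth s 0 = 0" "s \<noteq> 0"
  shows "poly (map_poly fls_const p) (inverse (fps_to_fls s)) * fps_to_fls s ^ degree p =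
    fps_to_fls (fps_of_poly (reflect_poly p) oo s)"
proof -
  have cp: "fps_to_fls (fps_of_poly g oo s) = poly (map_poly fls_const g) (fps_to_fls s)" for g
    using shifted_compose[OF assms(1), of g 0] by (simp add: shifted_def pcompose_idR)
  have "degree (map_poly fls_const p) = degree p" by (rule degree_map_poly) simp
  moreover have "reflect_poly (map_poly fls_const p) = map_poly fls_const (reflect_poly p)"
    by (intro poly_eqI) (simp add: coeff_reflect_poly coeff_map_poly calculation)
  ultimately show ?thesis
    using poly_reflect_poly_nz[of "fps_to_fls s" "map_poly fls_const p"] assms
    by (simp add: cp mult.commute)
qed

lemma map_poly_to_ac_eq_0_iff [simp]: "map_poly to_ac p = 0 \<longleftrightarrow> p = 0"
  by (simp add: map_poly_eq_0_iff)

text \<open>Substituting a nonzero series without constant term into a nonzero polynomial gives a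
  nonzero series, so \<open>transcendental_eval_hom\<close> applies at all these points.\<close>

lemma local_point_transcendental:
  assumes "d \<noteq> 0" "zero_preserving s" "local_point \<alpha> s = Aff \<xi>"
  shows "poly (map_poly ac_const d) \<xi> \<noteq> 0"
proof (cases \<alpha>)
  case (Aff a)
  have s: "fps_nth s 0 = 0" "s \<noteq> 0" using assms by (auto simp: zero_preserving_def)
  show ?thesis using assms(1,3) s
    by (auto simp: Aff map_poly_ac_const shifted_compose[OF s(1)] fps_compose_eq_0_iff shifted_eq_0_iff
        dest!: sym[of "fls_const a + _"])
next
  case Infinity
  have s: "fps_nth s 0 = 0" "s \<noteq> 0" using assms by (auto simp: zero_preserving_def)
  have "fps_to_fls (fps_of_poly (reflect_poly (map_poly to_ac d)) oo s) \<noteq> 0"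
    using assms(1) s by (simp add: fps_compose_eq_0_iff)
  then show ?thesis
    using assms(3) reflect_compose[OF s, of "map_poly to_ac d"] by (auto simp: Infinity map_poly_ac_const)
qed

lemma rat_eval_infinity_fixed:
  assumes "rat_eval i (Aff r) Infinity = Infinity" "field_hom i"
  shows "degree (denom r) < degree (numer r)"
proof -
  let ?D = "max (degree (numer r)) (degree (denom r))"
  have "coeff (denom r) ?D = 0"
    using assms by (auto simp: proj_quot_def field_hom_eq_0_iff split: if_splits)
  then show ?thesis
    by (metis denom_nonzero leading_coeff_0_iff linorder_not_less max.absorb_iff2 max_def)
qed

lemma fixed_finite_point:
  assumes "rat_eval to_ac (Aff r) (Aff a) = Aff a"
  shows "poly (map_poly to_ac (denom r)) a \<noteq> 0"
    "poly (map_poly to_ac (numer r)) a = a * poly (map_poly to_ac (denom r)) a"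
  using assms by (auto simp: proj_quot_def field_simps split: if_splits)

lemma local_series_zero_preserving:
  assumes "rat_eval to_ac f \<alpha> = \<alpha>" "\<not> is_constant f"
  shows "zero_preserving (local_series f \<alpha>)"
proof -
  obtain r where f: "f = Aff r" using assms(2) by (cases f) (auto simp: is_constant_def)
  show ?thesis
  proof (cases \<alpha>)
    case (Aff a)
    let ?P = "shifted a (map_poly to_ac (numer r))" and ?Q = "shifted a (map_poly to_ac (denom r))"
    note fx = fixed_finite_point[OF assms(1)[unfolded f Aff]]
    have Q0: "fps_nth ?Q 0 \<noteq> 0" using fx by (simp add: shifted_nth_0)
    have "fps_nth (?P / ?Q) 0 = a"
      using fx Q0 by (simp add: fps_divide_unit shifted_nth_0 field_simps)
    moreover have "?P / ?Q \<noteq> fps_const a"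
    proof
      assume e: "?P / ?Q = fps_const a"
      have "?P / ?Q * ?Q = ?P" using Q0 by (simp add: fps_divide_unit mult.assoc inverse_mult_eq_1)
      then have "?P = fps_const a * ?Q" using e by simp
      then have "shifted a (map_poly to_ac (numer r) - smult a (map_poly to_ac (denom r))) = 0"
        by (simp add: shifted_def pcompose_diff pcompose_smult fps_of_poly_diff fps_of_poly_smult)
      then have m: "map_poly to_ac (numer r) = smult a (map_poly to_ac (denom r))"
        by (simp add: shifted_eq_0_iff)
      \<comment> \<open>If the local series vanished, the numerator would be \<open>a\<close> times
        the monic denominator. Then \<open>a\<close> is the image of a coefficient of the numerator,
        hence comes from the base field, and \<open>f\<close> is constant.\<close>
      define c where "c = coeff (numer r) (degree (denom r))"
      have "a = to_ac c"
        using arg_cong[OF m, of "\<lambda>p. coeff p (degree (denom r))"] lowest_terms(3)[of r]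
        by (simp add: coeff_map_poly c_def)
      then have "coeff (numer r) n = c * coeff (denom r) n" for n
        using arg_cong[OF m, of "\<lambda>p. coeff p n"]
        by (simp add: coeff_map_poly flip: to_ac_mult)
      then have "numer r = smult c (denom r)" by (intro poly_eqI) simp
      then have "r = Fract (smult c (denom r)) (denom r)" using lowest_terms(1)[of r] by simp
      also have "\<dots> = rat_const c" by (simp add: rat_const_def to_fract_def eq_fract)
      finally show False using assms(2) f by (auto simp: is_constant_def)
    qed
    ultimately show ?thesis by (simp add: f Aff zero_preserving_def)
  next
    case Infinity
    have d: "degree (denom r) < degree (numer r)"
      using rat_eval_infinity_fixed[OF assms(1)[unfolded f Infinity] field_hom_to_ac] .
    then have n0: "numer r \<noteq> 0" by auto
    have "fps_nth (fps_of_poly (reflect_poly (map_poly to_ac (numer r)))) 0 \<noteq> 0"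
      using n0 by (simp add: leading_coeff_0_iff)
    then show ?thesis using d
      by (simp add: f Infinity zero_preserving_def fps_divide_unit fps_mult_nth_0 fps_X_power_nth)
  qed
qed

text \<open>The dictionary between maps and series: in the local coordinate at the fixed point,
  applying \<open>f\<close> is substitution into its local series.\<close>

lemma rat_eval_local_point:
  assumes "rat_eval to_ac f \<alpha> = \<alpha>" "\<not> is_constant f" "zero_preserving s"
  shows "rat_eval ac_const f (local_point \<alpha> s) = local_point \<alpha> (local_series f \<alpha> oo s)"
proof -
  obtain r where f: "f = Aff r" using assms(2) by (cases f) (auto simp: is_constant_def)
  have s: "fps_nth s 0 = 0" "s \<noteq> 0" using assms by (auto simp: zero_preserving_def)
  show ?thesis
  proof (cases \<alpha>)
    case (Aff a)
    let ?P = "shifted a (map_poly to_ac (numer r))" and ?Q = "shifted a (map_poly to_ac (denom r))"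
    note fx = fixed_finite_point[OF assms(1)[unfolded f Aff]]
    have Q0: "fps_nth ?Q 0 \<noteq> 0" using fx by (simp add: shifted_nth_0)
    have Qs: "fps_nth (?Q oo s) 0 \<noteq> 0" using Q0 by simp
    have P: "?P = (local_series f \<alpha> + fps_const a) * ?Q"
      using Q0 by (simp add: f Aff fps_divide_unit mult.assoc inverse_mult_eq_1)
    have "?P oo s = ((local_series f \<alpha> oo s) + fps_const a) * (?Q oo s)"
      by (subst P) (simp add: fps_compose_mult_distrib[OF s(1)] fps_compose_add_distrib)
    moreover have "?Q oo s \<noteq> 0" using Qs by (metis fps_zero_nth)
    ultimately show ?thesis
      by (simp add: f Aff map_poly_ac_const shifted_compose[OF s(1)] proj_quot_def fls_times_fps_to_fls add.commute)
  next
    case Infinity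
    let ?p = "map_poly to_ac (numer r)" and ?q = "map_poly to_ac (denom r)"
    let ?P = "fps_of_poly (reflect_poly ?p)" and ?R = "fps_of_poly (reflect_poly ?q)"
    let ?S = "fps_to_fls s"
    have d: "degree (denom r) < degree (numer r)"
      using rat_eval_infinity_fixed[OF assms(1)[unfolded f Infinity] field_hom_to_ac] .
    then have n0: "numer r \<noteq> 0" by auto
    have P0: "fps_nth ?P 0 \<noteq> 0" using n0 by (simp add: leading_coeff_0_iff)
    have dg: "degree ?p = degree (numer r)" "degree ?q = degree (denom r)"
      by (rule degree_map_poly; simp)+
    define k where "k = degree (numer r) - degree (denom r)"
    have ls: "local_series f \<alpha> * ?P = fps_X ^ k * ?R"
      using P0 by (simp add: f Infinity k_def fps_divide_unit mult.assoc inverse_mult_eq_1)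
    have "(local_series f \<alpha> oo s) * (?P oo s) = s ^ k * (?R oo s)"
      using arg_cong[OF ls, of "\<lambda>x. x oo s"] s
      by (simp add: fps_compose_mult_distrib[OF s(1)] fps_compose_power[OF s(1), symmetric])
    then have e: "fps_to_fls (local_series f \<alpha> oo s) * fps_to_fls (?P oo s) = ?S ^ k * fps_to_fls (?R oo s)"
      by (simp flip: fls_times_fps_to_fls fps_to_fls_power)
    have S0: "?S \<noteq> 0" using s by simp
    note rp = reflect_compose[OF s, of ?p] and rq = reflect_compose[OF s, of ?q]
    have kk: "?S ^ degree (numer r) = ?S ^ k * ?S ^ degree (denom r)"
      unfolding k_def power_add[symmetric] using d by simp
    have P1: "fps_to_fls (?P oo s) \<noteq> 0"
    proof -
      have "fps_nth (?P oo s) 0 \<noteq> 0" using P0 by simp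
      then have "?P oo s \<noteq> 0" by (metis fps_zero_nth)
      then show ?thesis by simp
    qed
    have R1: "fps_to_fls (?R oo s) \<noteq> 0" using s by (simp add: fps_compose_eq_0_iff)
    let ?a = "poly (map_poly fls_const ?p) (inverse ?S)" and ?b = "poly (map_poly fls_const ?q) (inverse ?S)"
    have b0: "?b \<noteq> 0" using rq R1 by auto
    have a0: "?a \<noteq> 0" using rp P1 by auto
    have "fps_to_fls (local_series f \<alpha> oo s) * ?a * (?S ^ k * ?S ^ degree (denom r)) = ?S ^ k * (?b * ?S ^ degree (denom r))"
      using e rp rq by (simp add: dg kk mult_ac)
    then have "fps_to_fls (local_series f \<alpha> oo s) * ?a = ?b" using S0 by simp
    moreover have "a / b = inverse x" if "x * a = b" "a \<noteq> 0" "b \<noteq> 0" for a b x :: "'a alg_closure fls"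
      using that by (auto simp: field_simps)
    ultimately have "?a / ?b = inverse (fps_to_fls (local_series f \<alpha> oo s))"
      using a0 b0 by blast
    then show ?thesis
      using b0 by (simp add: f Infinity map_poly_ac_const proj_quot_def)
  qed
qed

lemma local_point_inj:
  assumes "local_point \<alpha> s = local_point \<alpha> t" shows "s = t"
  using assms by (cases \<alpha>) auto

text \<open>For finite \<open>\<alpha>\<close>, \<open>local_expansion\<close> keeps the constant
  term that \<open>local_series\<close> drops; this does not affect positive degrees.\<close>

lemma local_expansion_nth:
  assumes "rat_eval to_ac f \<alpha> = \<alpha>" "\<not> is_constant f" "n > 0"
  shows "fls_nth (local_expansion f \<alpha>) (int n) = fps_nth (local_series f \<alpha>) n"
proof -
  have "rat_eval ac_const f (local_point \<alpha> fps_X) = local_point \<alpha> (local_series f \<alpha>)"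
    using rat_eval_local_point[OF assms(1,2) zero_preserving_fps_X] by simp
  then show ?thesis using \<open>n > 0\<close>
    by (cases \<alpha>) (simp_all add: fls_inverse_X)
qed

lemma local_deg_eq_subdegree:
  assumes "rat_eval to_ac f \<alpha> = \<alpha>" "\<not> is_constant f"
  shows "local_deg f \<alpha> = subdegree (local_series f \<alpha>)"
proof -
  let ?s = "local_series f \<alpha>"
  have zp: "zero_preserving ?s" using assms by (rule local_series_zero_preserving)
  have p: "subdegree ?s > 0" using zp by (rule zero_preserving_subdegree)
  have iff: "0 < n \<and> fls_nth (local_expansion f \<alpha>) (int n) \<noteq> 0 \<longleftrightarrow> 0 < n \<and> fps_nth ?s n \<noteq> 0" for n
    using local_expansion_nth[OF assms] by auto
  show ?thesis unfolding local_deg_def iff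
  proof (rule Least_equality)
    show "0 < subdegree ?s \<and> fps_nth ?s (subdegree ?s) \<noteq> 0" using p zp by (auto simp: zero_preserving_def)
    show "subdegree ?s \<le> n" if "0 < n \<and> fps_nth ?s n \<noteq> 0" for n using that by (auto intro: subdegree_leI)
  qed
qed

text \<open>The point with coordinate \<open>fps_X\<close> is transcendental, and evaluating there
  turns composition of maps into composition of series. A constant composite would force the nonzero
  series \<open>?f oo ?g\<close>, which has no constant term, to be constant.\<close>

lemma local_series_comp:
  assumes "rat_eval to_ac f \<alpha> = \<alpha>" "\<not> is_constant f" "rat_eval to_ac g \<alpha> = \<alpha>" "\<not> is_constant g"
    "rat_eval to_ac (rat_comp f g) \<alpha> = \<alpha>"
  shows "\<not> is_constant (rat_comp f g)"
    "local_series (rat_comp f g) \<alpha> = local_series f \<alpha> oo local_series g \<alpha>"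
proof -
  let ?f = "local_series f \<alpha>" and ?g = "local_series g \<alpha>"
  have zp: "zero_preserving ?f" "zero_preserving ?g" using assms local_series_zero_preserving by auto
  then have zfg: "zero_preserving (?f oo ?g)" by (rule zero_preserving_compose)
  obtain h where h: "g = Aff h" using assms(4) by (cases g) (auto simp: is_constant_def)
  obtain \<xi> where xi: "local_point \<alpha> fps_X = Aff \<xi>" by (cases \<alpha>) auto
  have tr: "\<forall>d. d \<noteq> 0 \<longrightarrow> poly (map_poly ac_const d) \<xi> \<noteq> 0"
    using local_point_transcendental[OF _ zero_preserving_fps_X xi] by blast
  have eg: "rat_eval ac_const g (Aff \<xi>) = local_point \<alpha> ?g"
    using rat_eval_local_point[OF assms(3,4) zero_preserving_fps_X] xi by simp
  have e: "rat_eval ac_const (rat_comp f g) (Aff \<xi>) = local_point \<alpha> (?f oo ?g)"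
    using rat_eval_comp_transcendental[OF field_hom_fls_const_to_ac tr, where f = f and h = h] eg
      rat_eval_local_point[OF assms(1,2) zp(2)] by (simp add: h)
  show nc: "\<not> is_constant (rat_comp f g)"
  proof
    assume c: "is_constant (rat_comp f g)"
    have ne: "fps_to_fls (?f oo ?g) \<noteq> fls_const c" for c
    proof
      assume "fps_to_fls (?f oo ?g) = fls_const c"
      then have e: "?f oo ?g = fps_const c" by (simp flip: fps_const_to_fls)
      moreover have "c = 0" using arg_cong[OF e, of "\<lambda>F. fps_nth F 0"] zfg by (simp add: zero_preserving_def)
      ultimately show False using zfg by (simp add: zero_preserving_def)
    qed
    from c e show False unfolding is_constant_def
    proof (elim disjE exE)
      fix c assume "rat_comp f g = Aff (rat_const c)"
      then have lp: "local_point \<alpha> (?f oo ?g) = Aff (ac_const c)"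
        using e rat_eval_const[OF field_hom_fls_const_to_ac] by metis
      show False
      proof (cases \<alpha>)
        case (Aff a)
        have "fls_const a + fls_const (to_ac c - a) = ac_const c" by (simp add: fls_plus_const)
        then show ?thesis using lp ne[of "to_ac c - a"] Aff by (metis add_left_cancel local_point.simps(1) proj_line.inject)
      next
        case Infinity
        then have "fps_to_fls (?f oo ?g) = inverse (fls_const (to_ac c))" using lp by (metis local_point.simps(2) inverse_inverse_eq proj_line.inject)
        then show ?thesis using ne by (simp add: fls_inverse_const)
      qed
    qed (cases \<alpha>; simp)
  qed
  have "local_point \<alpha> (local_series (rat_comp f g) \<alpha>) = local_point \<alpha> (?f oo ?g)"
    using rat_eval_local_point[OF assms(5) nc zero_preserving_fps_X] e xi by simp
  then show "local_series (rat_comp f g) \<alpha> = ?f oo ?g" by (rule local_point_inj)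
qed

text \<open>The value of a map at the transcendental point with coordinate \<open>fps_X\<close>
  determines the map.\<close>

lemma local_series_inj:
  assumes "rat_eval to_ac f \<alpha> = \<alpha>" "\<not> is_constant f" "rat_eval to_ac g \<alpha> = \<alpha>" "\<not> is_constant g"
    "local_series f \<alpha> = local_series g \<alpha>"
  shows "f = g"
proof -
  obtain h k where h: "g = Aff h" "f = Aff k"
    using assms(2,4) by (cases g; cases f) (auto simp: is_constant_def)
  obtain \<xi> where xi: "local_point \<alpha> fps_X = Aff \<xi>" by (cases \<alpha>) auto
  have tr: "\<forall>d. d \<noteq> 0 \<longrightarrow> poly (map_poly ac_const d) \<xi> \<noteq> 0"
    using local_point_transcendental[OF _ zero_preserving_fps_X xi] by blast
  have "rat_eval ac_const f (Aff \<xi>) = rat_eval ac_const g (Aff \<xi>)"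
    using rat_eval_local_point[OF assms(1,2) zero_preserving_fps_X]
      rat_eval_local_point[OF assms(3,4) zero_preserving_fps_X] xi assms(5) by simp
  then show ?thesis
    using transcendental_eval_hom[OF field_hom_fls_const_to_ac tr]
    unfolding h by (metis field_hom_inj proj_line.inject)
qed

section \<open>From series and word counts back to rational functions\<close>

lemma poly_bounded_growthI:
  assumes "\<And>n. num_elements G n \<le> C * (n + 1) ^ k"
  shows "poly_bounded_growth G"
  unfolding poly_bounded_growth_def
proof (intro exI conjI)
  \<comment> \<open>The exponent is \<open>k + 1\<close> because \<open>\<kappa>\<close> has to be
    positive also when \<open>k = 0\<close>.\<close>
  show "real (k + 1) > 0" by simp
  show "(\<lambda>n. real (num_elements G n)) \<in> O(\<lambda>n. real n powr real (k + 1))"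
  proof (rule bigoI[of _ "real C * 2 ^ k"])
    show "\<forall>\<^sub>F n in at_top. norm (real (num_elements G n)) \<le> real C * 2 ^ k * norm (real n powr real (k + 1))"
    proof (rule eventually_mono[OF eventually_ge_at_top[of "1::nat"]])
      fix n :: nat assume n: "n \<ge> 1"
      have "real (num_elements G n) \<le> real (C * (n + 1) ^ k)" using assms[of n] by (simp only: of_nat_le_iff)
      also have "\<dots> = real C * (real n + 1) ^ k" by (simp add: add.commute)
      also have "\<dots> \<le> real C * (2 * real n) ^ k" using n by (intro mult_left_mono power_mono) auto
      also have "\<dots> = real C * 2 ^ k * real n ^ k" by (simp add: power_mult_distrib)
      also have "\<dots> \<le> real C * 2 ^ k * real n ^ (k + 1)"
        using n by (intro mult_left_mono power_increasing) auto
      also have "real n ^ (k + 1) = real n powr real (k + 1)" using n by (subst powr_realpow) auto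
      finally show "norm (real (num_elements G n)) \<le> real C * 2 ^ k * norm (real n powr real (k + 1))" by simp
    qed
  qed
qed

lemma comp_word_simps [simp]:
  "comp_word [] = rat_id" "comp_word (f # ws) = rat_comp f (comp_word ws)"
  by (simp_all add: comp_word_def)

lemma comp_word_in_semigroup_gen:
  assumes "ws \<in> lists (semigroup_gen G)" "ws \<noteq> []"
  shows "comp_word ws \<in> semigroup_gen G"
  using assms
proof (induction ws)
  case (Cons w ws)
  then show ?case by (cases "ws = []") (auto simp: rat_comp_id_right intro: semigroup_gen.comp)
qed simp

lemma contains_nonabelian_free_semigroupI:
  assumes "u \<in> semigroup_gen G" "v \<in> semigroup_gen G"
    and "\<And>ws ws'. ws \<in> lists {u, v} \<Longrightarrow> ws' \<in> lists {u, v} \<Longrightarrow> ws \<noteq> [] \<Longrightarrow> ws' \<noteq> [] \<Longrightarrow>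
      comp_word ws = comp_word ws' \<Longrightarrow> ws = ws'"
    and "u \<noteq> v"
  shows "contains_nonabelian_free_semigroup (semigroup_gen G)"
  unfolding contains_nonabelian_free_semigroup_def
proof (intro exI conjI)
  show "card {u, v} = 2" using \<open>u \<noteq> v\<close> by simp
  show "free_semigroup_on {u, v} (comp_word ` {ws \<in> lists {u, v}. ws \<noteq> []})"
    unfolding free_semigroup_on_def using assms(3) by (intro inj_on_imp_bij_betw inj_onI) blast
  show "comp_word ` {ws \<in> lists {u, v}. ws \<noteq> []} \<subseteq> semigroup_gen G"
    using assms(1,2) by (auto intro!: comp_word_in_semigroup_gen)
qed

lemma comp_word_constant:
  assumes "w \<in> set ws" "is_constant w"
  shows "is_constant (comp_word ws)"
  using assms(1)
proof (induction ws)
  case (Cons x ws)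
  then show ?case using assms(2) by (cases "x = w") (auto simp: rat_comp_const_left rat_comp_const_right)
qed simp

text \<open>The nonconstant elements embed through \<open>\<sigma>\<close> into a semigroup of power
  series, where \<open>fps_semigroup_alternative\<close> decides. It remains to count the constant
  elements and to pull a free pair back along the injection.\<close>

theorem fixed_point_alternative:
  fixes G :: "'k::field ratfun set" and \<alpha> :: "'k alg_closure proj_line"
  assumes "finite G" and S: "S = semigroup_gen G"
    and fx: "\<And>f. f \<in> S \<Longrightarrow> rat_eval to_ac f \<alpha> = \<alpha>"
    and f: "f \<in> S" "\<not> is_constant f" "local_deg f \<alpha> > 1"
    and char: "\<And>g. g \<in> S \<Longrightarrow> \<not> is_constant g \<Longrightarrow> \<not> CHAR('k) dvd local_deg g \<alpha>"
  shows "contains_nonabelian_free_semigroup S \<or> poly_bounded_growth G"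
proof (rule disjCI)
  assume notpoly: "\<not> poly_bounded_growth G"
  define N where "N = {g \<in> S. \<not> is_constant g}"
  define G' where "G' = {g \<in> G. \<not> is_constant g}"
  define \<sigma> where "\<sigma> = (\<lambda>g. local_series g \<alpha>)"
  have GS: "G \<subseteq> S" unfolding S by (auto intro: semigroup_gen.gen)
  have N: "rat_eval to_ac g \<alpha> = \<alpha>" "\<not> is_constant g" "g \<in> S" if "g \<in> N" for g
    using that fx by (auto simp: N_def)
  have compN: "rat_comp g h \<in> N" "\<sigma> (rat_comp g h) = \<sigma> g oo \<sigma> h" if "g \<in> N" "h \<in> N" for g h
  proof -
    have "rat_comp g h \<in> S" using N that unfolding S by (auto intro: semigroup_gen.comp)
    then show "rat_comp g h \<in> N" "\<sigma> (rat_comp g h) = \<sigma> g oo \<sigma> h"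
      using local_series_comp[of g \<alpha> h] N[OF that(1)] N[OF that(2)] fx by (auto simp: N_def \<sigma>_def)
  qed
  have injN: "inj_on \<sigma> N"
    by (rule inj_onI) (use local_series_inj N in \<open>unfold \<sigma>_def, blast\<close>)
  have zpN: "zero_preserving (\<sigma> g)" if "g \<in> N" for g
    using local_series_zero_preserving N[OF that] by (auto simp: \<sigma>_def)
  have word: "comp_word ws \<in> N \<and> \<sigma> (comp_word ws) = fps_comp_word (map \<sigma> ws)"
    if "ws \<in> lists N" "ws \<noteq> []" for ws
    using that
  proof (induction ws)
    case (Cons w ws)
    then show ?case using compN by (cases "ws = []") (auto simp: rat_comp_id_right)
  qed simp
  have fN: "f \<in> N" using f by (simp add: N_def)
  have finG': "finite G'" using assms(1) by (simp add: G'_def)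
  have G'N: "G' \<subseteq> N" using GS by (auto simp: G'_def N_def)
  have "\<exists>u\<in>\<sigma> ` N. \<exists>v\<in>\<sigma> ` N. fps_free_pair u v"
  proof (rule ccontr)
    assume nf: "\<not> ?thesis"
    have "\<exists>C k. \<forall>n. card (fps_comp_word ` {ws \<in> lists (\<sigma> ` G'). length ws \<le> n}) \<le> C * (n + 1) ^ k"
    proof (rule fps_semigroup_alternative[of _ "\<sigma> ` N" "\<sigma> f"])
      show "of_nat (subdegree g) \<noteq> (0 :: 'k alg_closure)" if g: "g \<in> \<sigma> ` N" for g
      proof -
        obtain h where h: "h \<in> N" "g = local_series h \<alpha>" using g by (auto simp: \<sigma>_def)
        show ?thesis
          using char[OF N(3)[OF h(1)] N(2)[OF h(1)]] local_deg_eq_subdegree[OF N(1)[OF h(1)] N(2)[OF h(1)]]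
          by (simp add: h(2) of_nat_eq_0_iff_char_dvd)
      qed
      show "subdegree (\<sigma> f) \<ge> 2"
        using f local_deg_eq_subdegree[OF fx[OF f(1)] f(2)] by (simp add: \<sigma>_def)
      show "g oo h \<in> \<sigma> ` N" if gh: "g \<in> \<sigma> ` N" "h \<in> \<sigma> ` N" for g h
      proof -
        obtain g' h' where "g = \<sigma> g'" "h = \<sigma> h'" "g' \<in> N" "h' \<in> N" using gh by auto
        then show ?thesis using compN[of g' h'] by (metis imageI)
      qed
    qed (use nf G'N finG' zpN fN in auto)
    then obtain C k where Ck: "\<And>n. card (fps_comp_word ` {ws \<in> lists (\<sigma> ` G'). length ws \<le> n}) \<le> C * (n + 1) ^ k"
      by blast
    have "num_elements G n \<le> (C + 1) * (n + 1) ^ k" for n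
    proof -
      let ?W = "{ws \<in> lists G. ws \<noteq> [] \<and> length ws \<le> n}"
      let ?F = "fps_comp_word ` {ws \<in> lists (\<sigma> ` G'). length ws \<le> n}"
      define Cst where "Cst = {g \<in> S. is_constant g}"
      \<comment> \<open>A constant element that fixes \<open>\<alpha>\<close> has the value
        \<open>\<alpha>\<close>, so there is at most one; it accounts for \<open>C + 1\<close> in
        place of \<open>C\<close>.\<close>
      have val: "(g = Infinity \<and> \<alpha> = Infinity) \<or> (\<exists>c. g = Aff (rat_const c) \<and> \<alpha> = Aff (to_ac c))"
        if "g \<in> Cst" for g
      proof -
        have g: "g \<in> S" "g = Infinity \<or> (\<exists>c. g = Aff (rat_const c))"
          using that by (auto simp: Cst_def is_constant_def)
        have "rat_eval to_ac g \<alpha> = \<alpha>" using fx[OF g(1)] .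
        with g(2) show ?thesis using rat_eval_const[OF field_hom_to_ac, of _ \<alpha>] by (elim disjE exE) auto
      qed
      have cst: "g = h" if "g \<in> Cst" "h \<in> Cst" for g h
        using val[OF that(1)] val[OF that(2)] by auto
      have c1: "finite Cst" "card Cst \<le> 1"
      proof -
        have "\<exists>g. Cst \<subseteq> {g}" using cst by blast
        then obtain g where g: "Cst \<subseteq> {g}" by blast
        then show "finite Cst" by (rule finite_subset) simp
        show "card Cst \<le> 1" using card_mono[OF _ g] by simp
      qed
      have fin: "finite ?F"
        using finG' finite_lists_length_le[of "\<sigma> ` G'" n]
        by (auto intro!: finite_imageI simp: lists_eq_set)
      have sub: "comp_word ` ?W \<subseteq> Cst \<union> {g \<in> N. \<sigma> g \<in> ?F}"
      proof (intro subsetI, elim imageE)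
        fix x ws assume x: "x = comp_word ws" and "ws \<in> ?W"
        then have ws: "ws \<in> lists G" "ws \<noteq> []" "length ws \<le> n" by auto
        have xS: "x \<in> S" unfolding x S using ws by (intro comp_word_in_semigroup_gen) (auto intro: semigroup_gen.gen)
        show "x \<in> Cst \<union> {g \<in> N. \<sigma> g \<in> ?F}"
        proof (cases "is_constant x")
          case False
          then have "ws \<in> lists G'" using comp_word_constant[of _ ws] ws(1) by (auto simp: x G'_def)
          moreover from this have "ws \<in> lists N" using G'N by auto
          ultimately have "x \<in> N" "\<sigma> x = fps_comp_word (map \<sigma> ws)" "map \<sigma> ws \<in> lists (\<sigma> ` G')"
            using word ws(2) by (auto simp: x)
          then show ?thesis using ws(3) by auto
        qed (use xS in \<open>simp add: Cst_def\<close>)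
      qed
      have inj': "inj_on \<sigma> {g \<in> N. \<sigma> g \<in> ?F}" using injN by (rule inj_on_subset) auto
      have fin': "finite {g \<in> N. \<sigma> g \<in> ?F}"
        by (rule finite_imageD[OF finite_subset[OF _ fin] inj']) auto
      have "card {g \<in> N. \<sigma> g \<in> ?F} \<le> card ?F"
        using inj' fin by (intro card_inj_on_le) auto
      then have "card (Cst \<union> {g \<in> N. \<sigma> g \<in> ?F}) \<le> 1 + C * (n + 1) ^ k"
        using card_Un_le[of Cst "{g \<in> N. \<sigma> g \<in> ?F}"] c1(2) Ck[of n] by linarith
      moreover have "num_elements G n \<le> card (Cst \<union> {g \<in> N. \<sigma> g \<in> ?F})"
        unfolding num_elements_def using sub c1 fin' by (intro card_mono) auto
      moreover have "1 + C * (n + 1) ^ k \<le> (C + 1) * (n + 1) ^ k" by simp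
      ultimately show ?thesis by (meson order_trans)
    qed
    then show False using notpoly poly_bounded_growthI by blast
  qed
  then obtain u v where uv: "u \<in> N" "v \<in> N" "fps_free_pair (\<sigma> u) (\<sigma> v)" by auto
  show "contains_nonabelian_free_semigroup S" unfolding S
  proof (rule contains_nonabelian_free_semigroupI)
    show "u \<in> semigroup_gen G" "v \<in> semigroup_gen G" using N uv S by auto
    show "u \<noteq> v" using uv(3) by (auto simp: fps_free_pair_def)
    fix ws ws' assume w: "ws \<in> lists {u, v}" "ws' \<in> lists {u, v}" "ws \<noteq> []" "ws' \<noteq> []"
      and eq: "comp_word ws = comp_word ws'"
    have wN: "ws \<in> lists N" "ws' \<in> lists N" using w uv by auto
    then have "fps_comp_word (map \<sigma> ws) = fps_comp_word (map \<sigma> ws')"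
      using word[OF wN(1) w(3)] word[OF wN(2) w(4)] eq by simp
    moreover have "map \<sigma> ws \<in> lists {\<sigma> u, \<sigma> v}" "map \<sigma> ws' \<in> lists {\<sigma> u, \<sigma> v}" using w by auto
    ultimately have "map \<sigma> ws = map \<sigma> ws'" using uv(3) by (auto simp: fps_free_pair_def)
    moreover have "inj_on \<sigma> (set ws \<union> set ws')" using injN wN by (auto intro: inj_on_subset)
    ultimately show "ws = ws'" by (simp add: inj_on_map_eq_map)
  qed
qed

section \<open>Valuation rings\<close>

definition is_subring :: "'a::comm_ring_1 set \<Rightarrow> bool" where
  "is_subring A \<longleftrightarrow> 1 \<in> A \<and> (\<forall>x\<in>A. \<forall>y\<in>A. x - y \<in> A \<and> x * y \<in> A)"

definition polys_over :: "'a::zero set \<Rightarrow> 'a poly set" where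
  "polys_over A = {p. \<forall>i. coeff p i \<in> A}"

definition adjoin :: "'a::comm_ring_1 set \<Rightarrow> 'a \<Rightarrow> 'a set" where
  "adjoin A y = (\<lambda>p. poly p y) ` polys_over A"

lemma subring_closed:
  assumes "is_subring A"
  shows "1 \<in> A" "0 \<in> A" "x \<in> A \<Longrightarrow> y \<in> A \<Longrightarrow> x - y \<in> A" "x \<in> A \<Longrightarrow> y \<in> A \<Longrightarrow> x * y \<in> A"
    "x \<in> A \<Longrightarrow> - x \<in> A" "x \<in> A \<Longrightarrow> y \<in> A \<Longrightarrow> x + y \<in> A" "x \<in> A \<Longrightarrow> x ^ n \<in> A"
proof -
  have 1: "1 \<in> A" and d: "\<And>x y. x \<in> A \<Longrightarrow> y \<in> A \<Longrightarrow> x - y \<in> A"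
    and m: "\<And>x y. x \<in> A \<Longrightarrow> y \<in> A \<Longrightarrow> x * y \<in> A"
    using assms by (auto simp: is_subring_def)
  have 0: "0 \<in> A" using d[OF 1 1] by simp
  have u: "- x \<in> A" if "x \<in> A" for x using d[OF 0 that] by simp
  show "1 \<in> A" "0 \<in> A" "x \<in> A \<Longrightarrow> y \<in> A \<Longrightarrow> x - y \<in> A" "x \<in> A \<Longrightarrow> y \<in> A \<Longrightarrow> x * y \<in> A"
    "x \<in> A \<Longrightarrow> - x \<in> A" by (fact 1, fact 0, fact d, fact m, fact u)
  show "x \<in> A \<Longrightarrow> y \<in> A \<Longrightarrow> x + y \<in> A" using d[OF _ u, of x y] by simp
  show "x \<in> A \<Longrightarrow> x ^ n \<in> A" by (induction n) (auto intro: 1 m)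
qed

lemma subring_sum: "is_subring A \<Longrightarrow> (\<And>i. i \<in> I \<Longrightarrow> f i \<in> A) \<Longrightarrow> sum f I \<in> A"
  by (induction I rule: infinite_finite_induct) (auto intro: subring_closed)

lemma polys_over_pCons [simp]: "pCons a p \<in> polys_over A \<longleftrightarrow> a \<in> A \<and> p \<in> polys_over A"
proof
  assume p: "pCons a p \<in> polys_over A"
  have "coeff p i \<in> A" for i
    using p[unfolded polys_over_def, simplified, rule_format, of "Suc i"] by simp
  moreover have "a \<in> A" using p[unfolded polys_over_def, simplified, rule_format, of 0] by simp
  ultimately show "a \<in> A \<and> p \<in> polys_over A" by (simp add: polys_over_def)
qed (auto simp: polys_over_def coeff_pCons split: nat.split)

context
  fixes A :: "'a::comm_ring_1 set"
  assumes A: "is_subring A"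
begin

lemma polys_over_closed:
  "0 \<in> polys_over A" "1 \<in> polys_over A" "p \<in> polys_over A \<Longrightarrow> q \<in> polys_over A \<Longrightarrow> p - q \<in> polys_over A"
  "p \<in> polys_over A \<Longrightarrow> q \<in> polys_over A \<Longrightarrow> p + q \<in> polys_over A"
  "p \<in> polys_over A \<Longrightarrow> q \<in> polys_over A \<Longrightarrow> p * q \<in> polys_over A"
  "a \<in> A \<Longrightarrow> p \<in> polys_over A \<Longrightarrow> smult a p \<in> polys_over A"
  "a \<in> A \<Longrightarrow> monom a n \<in> polys_over A"
  "p \<in> polys_over A \<Longrightarrow> reflect_poly p \<in> polys_over A"
proof -
  note c = subring_closed[OF A]
  show "0 \<in> polys_over A" by (simp add: polys_over_def c)
  show "1 \<in> polys_over A" by (auto simp: polys_over_def one_pCons coeff_pCons c split: nat.split)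
  show "p \<in> polys_over A \<Longrightarrow> q \<in> polys_over A \<Longrightarrow> p - q \<in> polys_over A"
    "p \<in> polys_over A \<Longrightarrow> q \<in> polys_over A \<Longrightarrow> p + q \<in> polys_over A"
    "a \<in> A \<Longrightarrow> p \<in> polys_over A \<Longrightarrow> smult a p \<in> polys_over A"
    "a \<in> A \<Longrightarrow> monom a n \<in> polys_over A"
    "p \<in> polys_over A \<Longrightarrow> reflect_poly p \<in> polys_over A"
    by (auto simp: polys_over_def coeff_reflect_poly c)
  show "p \<in> polys_over A \<Longrightarrow> q \<in> polys_over A \<Longrightarrow> p * q \<in> polys_over A"
    by (auto simp: polys_over_def coeff_mult intro!: subring_sum[OF A] c(4))
qed

lemma poly_in_subring: "p \<in> polys_over A \<Longrightarrow> x \<in> A \<Longrightarrow> poly p x \<in> A"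
  by (induction p) (auto intro: subring_closed[OF A])

lemma subring_adjoin: "is_subring (adjoin A y)"
  unfolding is_subring_def
proof (intro conjI ballI)
  show "1 \<in> adjoin A y"
    unfolding adjoin_def using polys_over_closed(2) by (intro image_eqI[of _ _ 1]) auto
  fix u v assume "u \<in> adjoin A y" "v \<in> adjoin A y"
  then obtain p q where pq: "p \<in> polys_over A" "q \<in> polys_over A" "u = poly p y" "v = poly q y"
    by (auto simp: adjoin_def)
  show "u - v \<in> adjoin A y" unfolding adjoin_def
    by (rule image_eqI[of _ _ "p - q"]) (simp_all add: pq polys_over_closed)
  show "u * v \<in> adjoin A y" unfolding adjoin_def
    by (rule image_eqI[of _ _ "p * q"]) (simp_all add: pq polys_over_closed)
qed

lemma adjoin_superset: "A \<subseteq> adjoin A y" "y \<in> adjoin A y"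
proof -
  have 0: "(0 :: 'a poly) \<in> polys_over A" by (rule polys_over_closed)
  show "A \<subseteq> adjoin A y"
  proof
    fix a assume "a \<in> A"
    then show "a \<in> adjoin A y" unfolding adjoin_def using 0 by (intro image_eqI[of _ _ "[:a:]"]) auto
  qed
  show "y \<in> adjoin A y"
    unfolding adjoin_def using 0 subring_closed(1,2)[OF A] by (intro image_eqI[of _ _ "[:0, 1:]"]) auto
qed

end

lemma adjoin_least:
  assumes "is_subring B" "A \<subseteq> B" "y \<in> B" shows "adjoin A y \<subseteq> B"
proof -
  have "polys_over A \<subseteq> polys_over B" using assms(2) by (auto simp: polys_over_def)
  then show ?thesis using poly_in_subring[OF assms(1) _ assms(3)] by (auto simp: adjoin_def)
qed

text \<open>In a ring maximal among those avoiding \<open>1/\<pi>\<close>, the element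
  \<open>\<pi>\<close> lies in the Jacobson radical. If \<open>1/\<pi>\<close> were a polynomial in
  the inverse of \<open>?x\<close>, clearing denominators would put \<open>?x ^ n / \<pi>\<close>
  into \<open>B\<close>; as \<open>?x ^ n\<close> is 1 up to a multiple of \<open>\<pi>\<close>,
  also \<open>1/\<pi>\<close> would lie in \<open>B\<close>.\<close>

lemma maximal_avoiding_unit:
  fixes B :: "'a::field set"
  assumes B: "is_subring B" "\<pi> \<in> B" "inverse \<pi> \<notin> B" "\<pi> \<noteq> 0"
    and max: "\<And>x. inverse \<pi> \<notin> adjoin B x \<Longrightarrow> x \<in> B"
    and b: "b \<in> B"
  shows "1 - \<pi> * b \<noteq> 0" "inverse (1 - \<pi> * b) \<in> B"
proof -
  note c = subring_closed[OF B(1)]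
  let ?x = "1 - \<pi> * b"
  show nz: "?x \<noteq> 0"
  proof
    assume "?x = 0"
    then have "inverse \<pi> = b" using B(4) by (simp add: field_simps)
    then show False using b B(3) by simp
  qed
  show "inverse ?x \<in> B"
  proof (rule max, rule notI)
    assume "inverse \<pi> \<in> adjoin B (inverse ?x)"
    then obtain p where p: "p \<in> polys_over B" "inverse \<pi> = poly p (inverse ?x)"
      by (auto simp: adjoin_def)
    have "?x ^ degree p * inverse \<pi> = poly (reflect_poly p) ?x"
      using poly_reflect_poly_nz[OF nz, of p] p(2) by simp
    also have "\<dots> \<in> B"
      using p(1) b B by (intro poly_in_subring polys_over_closed c) auto
    finally have 1: "?x ^ degree p * inverse \<pi> \<in> B" .
    have "\<exists>d\<in>B. ?x ^ n = 1 - \<pi> * d" for n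
    proof (induction n)
      case 0
      show ?case using c(2) by (intro bexI[of _ 0]) auto
    next
      case (Suc n)
      then obtain d where d: "d \<in> B" "?x ^ n = 1 - \<pi> * d" by auto
      have "?x ^ Suc n = 1 - \<pi> * (b + d - \<pi> * b * d)" by (simp add: d algebra_simps)
      moreover have "b + d - \<pi> * b * d \<in> B" using b d B by (intro c) auto
      ultimately show ?case by blast
    qed
    then obtain d where d: "d \<in> B" "?x ^ degree p = 1 - \<pi> * d" by blast
    have "inverse \<pi> = ?x ^ degree p * inverse \<pi> + d" using B(4) by (simp add: d field_simps)
    then show False using 1 d(1) B(3) c(6) by metis
  qed
qed

text \<open>\<open>1/\<pi>\<close> cannot be a polynomial both in \<open>x\<close> and in
  \<open>1/x\<close>: the relation of smaller degree rewrites the leading power in the other one by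
  lower powers, which gives an induction on the sum of the degree bounds. Hence a maximal ring
  cannot miss both \<open>x\<close> and \<open>1/x\<close>.\<close>

lemma maximal_avoiding_descent:
  fixes B :: "'a::field set"
  assumes B: "is_subring B" "\<pi> \<in> B" "inverse \<pi> \<notin> B" "\<pi> \<noteq> 0"
    and max: "\<And>x. inverse \<pi> \<notin> adjoin B x \<Longrightarrow> x \<in> B"
  shows "x \<noteq> 0 \<Longrightarrow> p \<in> polys_over B \<Longrightarrow> q \<in> polys_over B \<Longrightarrow> degree p \<le> n \<Longrightarrow> degree q \<le> m \<Longrightarrow>
    \<pi> * poly p x = 1 \<Longrightarrow> \<pi> * poly q (inverse x) = 1 \<Longrightarrow> False"
proof (induction "n + m" arbitrary: n m p q x rule: less_induct)
  case less
  note c = subring_closed[OF B(1)] and pc = polys_over_closed[OF B(1)]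
  have const: False if r: "r \<in> polys_over B" "degree r = 0" "\<pi> * poly r y = 1" for r y
  proof -
    obtain a where a: "r = [:a:]" using r(2) degree_eq_zeroE by blast
    then have "a = inverse \<pi>" using r(3) B(4) by (simp add: field_simps)
    then show False using r(1) a B(3) by simp
  qed
  \<comment> \<open>This is the case \<open>m \<le> n\<close>; the other one is the same with
    \<open>x\<close> and \<open>1/x\<close> exchanged.\<close>
  have main: False
    if IH: "\<And>p'. p' \<in> polys_over B \<Longrightarrow> degree p' \<le> n - 1 \<Longrightarrow> \<pi> * poly p' x = 1 \<Longrightarrow> False"
      and n: "n > 0" "m \<le> n" "x \<noteq> 0" and p: "p \<in> polys_over B" "degree p \<le> n" "\<pi> * poly p x = 1"
      and q: "q \<in> polys_over B" "degree q \<le> m" "\<pi> * poly q (inverse x) = 1" for n m p q x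
  proof -
    obtain b q' where q': "q = pCons b q'" by (cases q)
    have b: "b \<in> B" "q' \<in> polys_over B" using q q' by auto
    have dq: "degree q' \<le> n - 1"
      using q(2) n by (cases "q' = 0") (auto simp: q')
    \<comment> \<open>\<open>s\<close> takes the value \<open>x^(n-1) q'(1/x)\<close> at
      \<open>x\<close>; the monomial makes up for a smaller degree of \<open>q'\<close>.\<close>
    define s where "s = monom 1 (n - 1 - degree q') * reflect_poly q'"
    have s: "s \<in> polys_over B" unfolding s_def using b c by (intro pc) auto
    have ds: "degree s \<le> n - 1"
    proof -
      have "degree s \<le> degree (monom (1::'a) (n - 1 - degree q')) + degree (reflect_poly q')"
        unfolding s_def by (rule degree_mult_le)
      also have "\<dots> \<le> (n - 1 - degree q') + degree q'"
        by (intro add_mono degree_monom_le degree_reflect_poly_le)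
      finally show ?thesis using dq by simp
    qed
    have ps: "poly s x = x ^ (n - 1) * poly q' (inverse x)"
    proof -
      have "x ^ (n - 1) = x ^ (n - 1 - degree q') * x ^ degree q'"
        unfolding power_add[symmetric] using dq by (simp only: le_add_diff_inverse2)
      then show ?thesis
        using poly_reflect_poly_nz[OF n(3), of q'] by (simp add: s_def poly_monom mult.assoc)
    qed
    define v where "v = inverse (1 - \<pi> * b)"
    have v: "v \<in> B" "v * (1 - \<pi> * b) = 1"
      using maximal_avoiding_unit[OF B max b(1)] by (auto simp: v_def)
    \<comment> \<open>With the constant term of \<open>q\<close> moved to the left, the factor
      \<open>1 - \<pi> * b\<close> is a unit, so \<open>x ^ n\<close> becomes a polynomial in
      \<open>x\<close> of degree below \<open>n\<close>.\<close>
    have "1 - \<pi> * b = \<pi> * (inverse x * poly q' (inverse x))"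
      using q(3) by (simp add: q' algebra_simps)
    then have "x ^ n * (1 - \<pi> * b) = \<pi> * (x ^ n * inverse x * poly q' (inverse x))" by simp
    also have "x ^ n * inverse x = x ^ (n - 1)" using n by (cases n) auto
    finally have "x ^ n * (v * (1 - \<pi> * b)) = v * \<pi> * poly s x" by (simp add: ps mult_ac)
    then have xn: "x ^ n = v * \<pi> * poly s x" using v by simp
    define a where "a = coeff p n"
    have a: "a \<in> B" using p(1) by (simp add: a_def polys_over_def)
    define p' where "p' = p - monom a n + smult (a * v * \<pi>) s"
    have "p' \<in> polys_over B" unfolding p'_def using a v B s p by (intro pc c) auto
    moreover have "degree p' \<le> n - 1"
    proof (rule degree_le, intro allI impI)
      fix i assume i: "n - 1 < i"
      have "coeff s i = 0" using ds i by (intro coeff_eq_0) simp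
      moreover have "coeff (p - monom a n) i = 0"
        using i p(2) n by (cases "i = n") (auto simp: a_def coeff_eq_0)
      ultimately show "coeff p' i = 0" by (simp add: p'_def)
    qed
    moreover have "poly p' x = poly p x"
      by (simp add: p'_def poly_monom xn mult_ac)
    ultimately show False using IH p(3) by metis
  qed
  show False
  proof (cases "n = 0 \<or> m = 0")
    case True
    then show False using less.prems const[of p x] const[of q "inverse x"] by auto
  next
    case False
    show False
    proof (cases "m \<le> n")
      case True
      show False
      proof (rule main[of n x m p q])
        fix p' assume "p' \<in> polys_over B" "degree p' \<le> n - 1" "\<pi> * poly p' x = 1"
        then show False using less.hyps[of "n - 1" m x p' q] less.prems False by auto
      qed (use less.prems False True in auto)
    next
      case nm: False
      show False
      proof (rule main[of m "inverse x" n q p])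
        fix q' assume "q' \<in> polys_over B" "degree q' \<le> m - 1" "\<pi> * poly q' (inverse x) = 1"
        then show False using less.hyps[of n "m - 1" x p q'] less.prems False by auto
      qed (use less.prems False nm in auto)
    qed
  qed
qed

locale valuation_ring =
  fixes Ov :: "'a::field set"
  assumes subring: "is_subring Ov" and total: "x \<in> Ov \<or> inverse x \<in> Ov"

text \<open>Chevalley's theorem with the condition \<open>inverse \<pi> \<notin> Ov\<close> in the
  role of the prime ideal: Zorn's lemma gives a subring maximal among those containing
  \<open>A\<close> and avoiding \<open>1/\<pi>\<close>, and the descent shows that it contains
  \<open>x\<close> or \<open>1/x\<close> for each \<open>x\<close>.\<close>

theorem Chevalley_extension:
  fixes A :: "'a::field set"
  assumes A: "is_subring A" "\<pi> \<in> A" "inverse \<pi> \<notin> A" "\<pi> \<noteq> 0"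
  shows "\<exists>Ov. valuation_ring Ov \<and> A \<subseteq> Ov \<and> inverse \<pi> \<notin> Ov"
proof -
  define F where "F = {B. is_subring B \<and> A \<subseteq> B \<and> inverse \<pi> \<notin> B}"
  have "\<exists>M\<in>F. \<forall>U\<in>F. M \<subseteq> U \<longrightarrow> U = M"
  proof (rule subset_Zorn_nonempty)
    show "F \<noteq> {}" using A by (auto simp: F_def)
    fix C assume C: "C \<noteq> {}" "subset.chain F C"
    have CF: "B \<in> F" if "B \<in> C" for B using C(2) that by (auto simp: subset.chain_def)
    have dir: "\<exists>B\<in>C. x \<in> B \<and> y \<in> B" if xy: "x \<in> \<Union>C" "y \<in> \<Union>C" for x y
    proof -
      obtain U Y where XY: "U \<in> C" "Y \<in> C" "x \<in> U" "y \<in> Y" using xy by blast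
      then have "U \<subseteq> Y \<or> Y \<subseteq> U" using C(2) by (auto simp: subset_chain_def)
      then show ?thesis using XY by blast
    qed
    have "is_subring (\<Union>C)" unfolding is_subring_def
    proof (intro conjI ballI)
      show "1 \<in> \<Union>C" using C(1) CF by (auto simp: F_def is_subring_def)
      fix x y assume "x \<in> \<Union>C" "y \<in> \<Union>C"
      then obtain B where B: "B \<in> C" "x \<in> B" "y \<in> B" using dir by blast
      then have "is_subring B" using CF by (auto simp: F_def)
      then show "x - y \<in> \<Union>C" "x * y \<in> \<Union>C" using B subring_closed by blast+
    qed
    then show "\<Union>C \<in> F" using C(1) CF by (auto simp: F_def)
  qed
  then obtain M where M: "M \<in> F" "\<And>U. U \<in> F \<Longrightarrow> M \<subseteq> U \<Longrightarrow> U = M" by blast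
  then have sM: "is_subring M" "\<pi> \<in> M" "inverse \<pi> \<notin> M" using A by (auto simp: F_def)
  have max: "x \<in> M" if "inverse \<pi> \<notin> adjoin M x" for x
  proof -
    have "adjoin M x \<in> F" using that M(1) subring_adjoin[OF sM(1)] adjoin_superset(1)[OF sM(1)]
      by (auto simp: F_def)
    then show ?thesis using M(2) adjoin_superset[OF sM(1)] by blast
  qed
  have "x \<in> M \<or> inverse x \<in> M" for x
  proof (rule ccontr)
    assume n: "\<not> ?thesis"
    then have "x \<noteq> 0" using subring_closed(2)[OF sM(1)] by auto
    have "inverse \<pi> \<in> adjoin M x" "inverse \<pi> \<in> adjoin M (inverse x)" using n max by blast+
    then obtain p q where "p \<in> polys_over M" "inverse \<pi> = poly p x" "q \<in> polys_over M"
      "inverse \<pi> = poly q (inverse x)" by (auto simp: adjoin_def)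
    then show False
      using maximal_avoiding_descent[OF sM A(4) max \<open>x \<noteq> 0\<close>, of p q "degree p" "degree q"] A(4)
      by (metis order.refl right_inverse)
  qed
  then have "valuation_ring M" using sM by unfold_locales auto
  then show ?thesis using M(1) by (auto simp: F_def)
qed

section \<open>Maximal ideal, integral closure and Gauss's lemma\<close>

context valuation_ring
begin

lemmas closed = subring_closed[OF subring]

definition vmax :: "'a set" where
  "vmax = {x \<in> Ov. x = 0 \<or> inverse x \<notin> Ov}"

lemma vmax_subset: "x \<in> vmax \<Longrightarrow> x \<in> Ov"
  by (simp add: vmax_def)

lemma zero_in_vmax: "0 \<in> vmax"
  by (simp add: vmax_def closed)

lemma unit_notin_vmax: "x \<in> Ov \<Longrightarrow> x \<notin> vmax \<Longrightarrow> x \<noteq> 0 \<and> inverse x \<in> Ov"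
  by (auto simp: vmax_def)

lemma one_notin_vmax: "1 \<notin> vmax"
  by (simp add: vmax_def closed)

lemma vmax_mult: assumes "x \<in> vmax" "y \<in> Ov" shows "x * y \<in> vmax"
proof -
  have xy: "x * y \<in> Ov" using assms by (intro closed) (auto dest: vmax_subset)
  have "inverse (x * y) \<notin> Ov" if nz: "x * y \<noteq> 0"
  proof
    assume "inverse (x * y) \<in> Ov"
    then have "y * inverse (x * y) \<in> Ov" using assms by (intro closed)
    also have "y * inverse (x * y) = inverse x" using nz by (simp add: field_simps)
    finally show False using assms nz by (auto simp: vmax_def)
  qed
  then show ?thesis using xy by (auto simp: vmax_def)
qed

lemma total_quotient: "x * inverse y \<in> Ov \<or> y * inverse x \<in> Ov"
  using total[of "x * inverse y"] by (simp add: mult.commute)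

lemma vmax_add: assumes "x \<in> vmax" "y \<in> vmax" shows "x + y \<in> vmax"
proof (cases "x = 0 \<or> y = 0")
  case True
  then show ?thesis using assms by auto
next
  case False
  have "x + y = y * (x * inverse y + 1)" "x + y = x * (1 + y * inverse x)"
    using False by (simp_all add: field_simps)
  moreover have "x * inverse y \<in> Ov \<or> y * inverse x \<in> Ov" by (rule total_quotient)
  ultimately show ?thesis using vmax_mult assms closed by metis
qed

lemma vmax_uminus: "x \<in> vmax \<Longrightarrow> - x \<in> vmax"
  using vmax_mult[of x "- 1"] closed by simp

lemma vmax_diff: "x \<in> vmax \<Longrightarrow> y \<in> vmax \<Longrightarrow> x - y \<in> vmax"
  using vmax_add[of x "- y"] vmax_uminus by simp

lemma vmax_sum: "(\<And>i. i \<in> I \<Longrightarrow> f i \<in> vmax) \<Longrightarrow> sum f I \<in> vmax"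
  by (induction I rule: infinite_finite_induct) (auto intro: vmax_add zero_in_vmax)

lemma vmax_prime: assumes "x \<in> Ov" "y \<in> Ov" "x * y \<in> vmax" "x \<notin> vmax" shows "y \<in> vmax"
proof -
  have "x \<noteq> 0" "inverse x \<in> Ov" using unit_notin_vmax assms by auto
  then have "x * y * inverse x \<in> vmax" "x * y * inverse x = y" using vmax_mult[OF assms(3)] by auto
  then show ?thesis by (simp only:)
qed

lemma one_plus_unit: assumes "x \<in> vmax" shows "1 + x \<noteq> 0" "inverse (1 + x) \<in> Ov"
proof -
  have "1 + x \<notin> vmax" using vmax_diff[of "1 + x" x] assms one_notin_vmax by auto
  moreover have "1 + x \<in> Ov" using assms by (intro closed) (auto dest: vmax_subset)
  ultimately show "1 + x \<noteq> 0" "inverse (1 + x) \<in> Ov" using unit_notin_vmax by auto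
qed

text \<open>If \<open>x\<close> is missing, then \<open>1/x\<close> is present, and dividing the
  monic equation by a power of \<open>x\<close> expresses \<open>x\<close> as a polynomial in
  \<open>1/x\<close>.\<close>

lemma integrally_closed:
  assumes "p \<in> polys_over Ov" "lead_coeff p = 1" "poly p x = 0"
  shows "x \<in> Ov"
proof (rule ccontr)
  assume n: "x \<notin> Ov"
  then have ix: "inverse x \<in> Ov" "x \<noteq> 0" using total[of x] closed by auto
  obtain b r where r: "reflect_poly p = pCons b r" by (cases "reflect_poly p")
  have "coeff (reflect_poly p) 0 = 1" using assms by simp
  then have b: "b = 1" by (simp add: r)
  have rp: "r \<in> polys_over Ov" using polys_over_closed(8)[OF subring assms(1)] by (simp add: r)
  have "poly (reflect_poly p) (inverse x) = 0"
    using poly_reflect_poly_nz[of "inverse x" p] ix assms(3) by simp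
  then have "inverse x * poly r (inverse x) = - 1" by (simp add: r b add_eq_0_iff)
  then have "x = - poly r (inverse x)" using ix by (simp add: field_simps)
  moreover have "- poly r (inverse x) \<in> Ov" using rp ix by (intro closed poly_in_subring[OF subring])
  ultimately show False using n by simp
qed

text \<open>An element of largest absolute value. Dividing a polynomial by such a coefficient makes
  it primitive.\<close>

lemma exists_dominating:
  assumes "finite U" "U \<noteq> {}" "0 \<notin> U"
  shows "\<exists>x\<in>U. \<forall>y\<in>U. y * inverse x \<in> Ov"
  using assms
proof (induction U rule: finite_ne_induct)
  case (singleton x)
  then show ?case using closed by auto
next
  case (insert x U)
  then obtain z where z: "z \<in> U" "\<forall>y\<in>U. y * inverse z \<in> Ov" by auto
  have nz: "x \<noteq> 0" "z \<noteq> 0" using insert z by auto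
  consider "x * inverse z \<in> Ov" | "z * inverse x \<in> Ov" using total_quotient by blast
  then show ?case
  proof cases
    case 1
    then show ?thesis using z by auto
  next
    case 2
    have "y * inverse x \<in> Ov" if "y \<in> U" for y
    proof -
      have "y * inverse x = (y * inverse z) * (z * inverse x)" using nz by simp
      then show ?thesis using closed(4) z that 2 by metis
    qed
    then show ?thesis using nz closed(1) by auto
  qed
qed

definition primitive :: "'a poly \<Rightarrow> bool" where
  "primitive g \<longleftrightarrow> g \<in> polys_over Ov \<and> (\<exists>i. coeff g i \<notin> vmax)"

text \<open>Gauss's lemma: if \<open>i\<close> and \<open>j\<close> are the first indices of
  coefficients outside the maximal ideal, then all terms but one of coefficient \<open>i + j\<close>
  of the product lie in that ideal.\<close>

lemma primitive_mult:
  assumes "primitive g" "primitive h" shows "primitive (g * h)"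
proof -
  define i where "i = (LEAST i. coeff g i \<notin> vmax)"
  define j where "j = (LEAST j. coeff h j \<notin> vmax)"
  have gO: "coeff g k \<in> Ov" "coeff h k \<in> Ov" for k using assms by (auto simp: primitive_def polys_over_def)
  have i: "coeff g i \<notin> vmax" using assms(1) unfolding i_def primitive_def by (metis LeastI_ex)
  have j: "coeff h j \<notin> vmax" using assms(2) unfolding j_def primitive_def by (metis LeastI_ex)
  have i': "coeff g k \<in> vmax" if "k < i" for k using that not_less_Least[of k] unfolding i_def by blast
  have j': "coeff h k \<in> vmax" if "k < j" for k using that not_less_Least[of k] unfolding j_def by blast
  have "coeff (g * h) (i + j) \<notin> vmax"
  proof
    assume v: "coeff (g * h) (i + j) \<in> vmax"
    have "coeff (g * h) (i + j) = coeff g i * coeff h j + (\<Sum>k\<in>{..i + j} - {i}. coeff g k * coeff h (i + j - k))"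
      unfolding coeff_mult by (subst sum.remove[of _ i]) auto
    moreover have "(\<Sum>k\<in>{..i + j} - {i}. coeff g k * coeff h (i + j - k)) \<in> vmax"
    proof (rule vmax_sum)
      fix k assume k: "k \<in> {..i + j} - {i}"
      show "coeff g k * coeff h (i + j - k) \<in> vmax"
      proof (cases "k < i")
        case True
        then show ?thesis using i' gO by (intro vmax_mult)
      next
        case False
        then have "i + j - k < j" using k by auto
        then show ?thesis using vmax_mult[OF j' gO(1), of "i + j - k" k] by (simp add: mult.commute)
      qed
    qed
    ultimately have "coeff g i * coeff h j \<in> vmax" using v vmax_diff by fastforce
    then show False using vmax_prime[OF gO(1) gO(2)] i j by blast
  qed
  then show ?thesis using assms polys_over_closed(5)[OF subring] by (auto simp: primitive_def)
qed

text \<open>For nonzero \<open>\<pi>\<close> this is the ring \<open>Ov[1/\<pi>]\<close>. Membership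
  says that powers of \<open>\<pi>\<close> eventually dominate the element, which replaces a rank
  one assumption on \<open>Ov\<close>.\<close>

definition loc :: "'a \<Rightarrow> 'a set" where
  "loc \<pi> = {x. \<exists>n. \<pi> ^ n * x \<in> Ov}"

lemma loc_common:
  assumes "\<pi> \<in> Ov" "finite U" "U \<subseteq> loc \<pi>"
  shows "\<exists>n. \<forall>x\<in>U. \<pi> ^ n * x \<in> Ov"
  using assms(2,3)
proof (induction U)
  case (insert x U)
  then obtain n m where nm: "\<forall>y\<in>U. \<pi> ^ n * y \<in> Ov" "\<pi> ^ m * x \<in> Ov" by (auto simp: loc_def)
  have "\<pi> ^ (n + m) * y \<in> Ov" if "y \<in> insert x U" for y
  proof (cases "y = x")
    case True
    have "\<pi> ^ (n + m) * x = \<pi> ^ n * (\<pi> ^ m * x)" by (simp add: power_add)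
    then show ?thesis using True nm(2) assms(1) closed(4,7) by metis
  next
    case False
    have "\<pi> ^ (n + m) * y = \<pi> ^ m * (\<pi> ^ n * y)" by (simp add: power_add)
    then show ?thesis using False that nm(1) assms(1) closed(4,7) by (metis insertE)
  qed
  then show ?case by blast
qed auto

end

section \<open>Extending a place to finitely many further elements\<close>

definition is_subfield :: "'a::field set \<Rightarrow> bool" where
  "is_subfield E \<longleftrightarrow> is_subring E \<and> (\<forall>x\<in>E. inverse x \<in> E)"

definition algebraic_over :: "'a::field set \<Rightarrow> 'a \<Rightarrow> bool" where
  "algebraic_over E y \<longleftrightarrow> (\<exists>p\<in>polys_over E. p \<noteq> 0 \<and> poly p y = 0)"

definition frac_adjoin :: "'a::field set \<Rightarrow> 'a \<Rightarrow> 'a set" where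
  "frac_adjoin A y = {poly f y * inverse (poly g y) | f g. f \<in> polys_over A \<and> g \<in> polys_over A \<and> poly g y \<noteq> 0}"

lemma frac_adjoinI:
  "f \<in> polys_over A \<Longrightarrow> g \<in> polys_over A \<Longrightarrow> poly g y \<noteq> 0 \<Longrightarrow> x = poly f y * inverse (poly g y) \<Longrightarrow> x \<in> frac_adjoin A y"
  by (auto simp: frac_adjoin_def)

lemma frac_adjoin_superset:
  assumes "is_subring A" shows "adjoin A y \<subseteq> frac_adjoin A y"
proof
  fix x assume "x \<in> adjoin A y"
  then obtain p where "p \<in> polys_over A" "x = poly p y" by (auto simp: adjoin_def)
  then show "x \<in> frac_adjoin A y"
    using polys_over_closed(2)[OF assms] by (intro frac_adjoinI[of p _ 1]) auto
qed

lemma subfield_frac_adjoin: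
  assumes A: "is_subring A" shows "is_subfield (frac_adjoin A y)"
proof -
  note pc = polys_over_closed[OF A]
  have "1 \<in> frac_adjoin A y" using pc by (intro frac_adjoinI[of 1 _ 1]) auto
  moreover have "u - v \<in> frac_adjoin A y \<and> u * v \<in> frac_adjoin A y"
    if uv: "u \<in> frac_adjoin A y" "v \<in> frac_adjoin A y" for u v
  proof -
    obtain f g h k where e: "f \<in> polys_over A" "g \<in> polys_over A" "poly g y \<noteq> 0" "u = poly f y * inverse (poly g y)"
      "h \<in> polys_over A" "k \<in> polys_over A" "poly k y \<noteq> 0" "v = poly h y * inverse (poly k y)"
      using uv by (auto simp: frac_adjoin_def)
    have "u - v = poly (f * k - h * g) y * inverse (poly (g * k) y)"
      unfolding e(4) e(8) using e(3,7) by (simp add: field_simps)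
    moreover have "u * v = poly (f * h) y * inverse (poly (g * k) y)"
      unfolding e(4) e(8) using e(3,7) by (simp add: field_simps)
    ultimately show ?thesis
      using frac_adjoinI[of "f * k - h * g" A "g * k" y "u - v"] frac_adjoinI[of "f * h" A "g * k" y "u * v"]
        e(1-3,5-7) pc(3,5) by simp
  qed
  moreover have "inverse u \<in> frac_adjoin A y" if u: "u \<in> frac_adjoin A y" for u
  proof -
    obtain f g where e: "f \<in> polys_over A" "g \<in> polys_over A" "poly g y \<noteq> 0" "u = poly f y * inverse (poly g y)"
      using u by (auto simp: frac_adjoin_def)
    show ?thesis
    proof (cases "poly f y = 0")
      case True
      then show ?thesis using e pc by (intro frac_adjoinI[of 0 _ 1]) auto
    next
      case False
      then show ?thesis using e(1-3) by (intro frac_adjoinI[of g _ f]) (simp_all add: e(4))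
    qed
  qed
  ultimately show ?thesis by (auto simp: is_subfield_def is_subring_def)
qed

context valuation_ring
begin

text \<open>If \<open>\<pi> ^ n\<close> clears the coefficients of a monic equation of
  \<open>y\<close>, then \<open>\<pi> ^ n * y\<close> is integral over \<open>Ov\<close>, which is
  integrally closed.\<close>

lemma algebraic_in_loc:
  assumes \<pi>: "\<pi> \<in> Ov" "\<pi> \<noteq> 0" and E: "is_subfield E" "E \<subseteq> loc \<pi>" and y: "algebraic_over E y"
  shows "y \<in> loc \<pi>"
proof -
  have sE: "is_subring E" using E by (simp add: is_subfield_def)
  obtain p0 where p0: "p0 \<in> polys_over E" "p0 \<noteq> 0" "poly p0 y = 0" using y by (auto simp: algebraic_over_def)
  define p where "p = smult (inverse (lead_coeff p0)) p0"
  have "lead_coeff p0 \<in> E" using p0 by (auto simp: polys_over_def)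
  then have pE: "p \<in> polys_over E" unfolding p_def using p0 E by (intro polys_over_closed(6)[OF sE]) (auto simp: is_subfield_def)
  have p: "lead_coeff p = 1" "poly p y = 0" using p0 by (auto simp: p_def)
  define d where "d = degree p"
  have "coeff p ` {..d} \<subseteq> loc \<pi>" using pE E(2) by (auto simp: polys_over_def)
  then obtain n where n: "\<And>i. i \<le> d \<Longrightarrow> \<pi> ^ n * coeff p i \<in> Ov"
    using loc_common[OF \<pi>(1), of "coeff p ` {..d}"] by auto
  define c where "c = inverse (\<pi> ^ n)"
  \<comment> \<open>The monic equation of \<open>\<pi> ^ n * y\<close>: its coefficient
    \<open>i\<close> is that of \<open>p\<close> times the power \<open>d - i\<close> of
    \<open>\<pi> ^ n\<close>, so it lies in \<open>Ov\<close> for \<open>i < d\<close>.\<close>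
  define q where "q = smult (\<pi> ^ (n * d)) (pcompose p [:0, c:])"
  have c0: "c \<noteq> 0" using \<pi> by (simp add: c_def)
  have cq: "coeff q i = \<pi> ^ (n * d) * (c ^ i * coeff p i)" for i
    by (simp add: q_def coeff_pcompose_linear)
  have cqi: "coeff q i = (\<pi> ^ n) ^ (d - i) * coeff p i" if "i \<le> d" for i
  proof -
    have "\<pi> ^ (n * d) = (\<pi> ^ n) ^ (d - i) * (\<pi> ^ n) ^ i"
      using that by (simp add: power_mult flip: power_add)
    moreover have "(\<pi> ^ n) ^ i * c ^ i = 1" using \<pi> by (simp add: c_def flip: power_mult_distrib)
    ultimately show ?thesis by (simp add: cq mult_ac) 
  qed
  have "coeff q i \<in> Ov" for i
  proof (cases "i < d")
    case True
    then obtain e where e: "d - i = Suc e" by (metis Suc_diff_Suc)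
    have "coeff q i = (\<pi> ^ n) ^ e * (\<pi> ^ n * coeff p i)" using cqi[of i] True by (simp add: e mult_ac)
    also have "\<dots> \<in> Ov" using closed(4)[OF closed(7)[OF closed(7)[OF \<pi>(1)]] n[of i]] True by auto
    finally show ?thesis .
  next
    case False
    show ?thesis
    proof (cases "i = d")
      case True
      then show ?thesis using cqi[of d] p(1) closed by (simp add: d_def)
    next
      case False
      with \<open>\<not> i < d\<close> have "coeff p i = 0" by (intro coeff_eq_0) (auto simp: d_def)
      then show ?thesis using closed by (simp add: cq)
    qed
  qed
  then have qO: "q \<in> polys_over Ov" by (simp add: polys_over_def)
  have "degree q = d" using c0 \<pi> by (simp add: q_def degree_pcompose d_def)
  then have lq: "lead_coeff q = 1" using cqi[of d] p(1) by (simp add: d_def)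
  have "poly q (\<pi> ^ n * y) = \<pi> ^ (n * d) * poly p (c * (\<pi> ^ n * y))"
    by (simp add: q_def poly_pcompose mult_ac)
  also have "c * (\<pi> ^ n * y) = y" using \<pi> by (simp add: c_def)
  finally have "poly q (\<pi> ^ n * y) = 0" using p by simp
  from integrally_closed[OF qO lq this] show ?thesis by (auto simp: loc_def)
qed

text \<open>The Gauss valuation for a transcendental \<open>y\<close>: quotients of polynomials over
  \<open>Ov \<inter> E\<close> with primitive denominator form a ring that avoids
  \<open>1/\<pi>\<close>, and \<open>Chevalley_extension\<close> enlarges it to a valuation ring of
  the whole field.\<close>

lemma gauss_extension:
  assumes \<pi>: "\<pi> \<in> Ov" "\<pi> \<noteq> 0" "inverse \<pi> \<notin> Ov" and E: "is_subfield E" "E \<subseteq> loc \<pi>" "\<pi> \<in> E"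
    and y: "\<not> algebraic_over E y"
  shows "\<exists>Ov'. valuation_ring Ov' \<and> \<pi> \<in> Ov' \<and> inverse \<pi> \<notin> Ov' \<and>
    frac_adjoin E y \<subseteq> valuation_ring.loc Ov' \<pi>"
proof -
  have sE: "is_subring E" using E by (simp add: is_subfield_def)
  note cE = subring_closed[OF sE]
  \<comment> \<open>Coefficients are restricted to \<open>E\<close>, over which \<open>y\<close> is
    transcendental. The new ring contains \<open>OE\<close> and need not contain
    \<open>Ov\<close>.\<close>
  define OE where "OE = Ov \<inter> E"
  have sOE: "is_subring OE" using subring sE by (auto simp: OE_def is_subring_def)
  note pc = polys_over_closed[OF sOE]
  have tr: "p = 0" if "p \<in> polys_over OE" "poly p y = 0" for p
    using y that by (auto simp: algebraic_over_def polys_over_def OE_def)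
  have prO: "primitive g" if "g \<in> polys_over OE" "coeff g i \<notin> vmax" for g i
    using that by (auto simp: primitive_def polys_over_def OE_def)
  have prnz: "g \<noteq> 0" if "primitive g" for g using that zero_in_vmax by (auto simp: primitive_def)
  define A where "A = {poly f y * inverse (poly g y) | f g. f \<in> polys_over OE \<and> g \<in> polys_over OE \<and> primitive g}"
  have AI: "x \<in> A" if "f \<in> polys_over OE" "g \<in> polys_over OE" "primitive g" "x = poly f y * inverse (poly g y)" for x f g
    using that by (auto simp: A_def)
  have pr1: "primitive 1" using prO[of 1 0] pc(2) one_notin_vmax by (simp add: one_pCons)
  have const: "a \<in> A" if "a \<in> OE" for a
    using that pr1 pc by (intro AI[of "[:a:]" 1]) auto
  have sA: "is_subring A" unfolding is_subring_def
  proof (intro conjI ballI)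
    show "1 \<in> A" using const subring_closed(1)[OF sOE] by auto
    fix u v assume "u \<in> A" "v \<in> A"
    then obtain f g h k where e: "f \<in> polys_over OE" "g \<in> polys_over OE" "primitive g" "u = poly f y * inverse (poly g y)"
      "h \<in> polys_over OE" "k \<in> polys_over OE" "primitive k" "v = poly h y * inverse (poly k y)"
      by (auto simp: A_def)
    have nz: "poly g y \<noteq> 0" "poly k y \<noteq> 0" using tr prnz e by auto
    have "u - v = poly (f * k - h * g) y * inverse (poly (g * k) y)"
      "u * v = poly (f * h) y * inverse (poly (g * k) y)"
      unfolding e(4) e(8) using nz by (simp_all add: field_simps)
    then show "u - v \<in> A" "u * v \<in> A"
      using e pc primitive_mult by (auto intro: AI[of "f * k - h * g" "g * k"] AI[of "f * h" "g * k"])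
  qed
  have \<pi>A: "\<pi> \<in> A" using const \<pi> E by (auto simp: OE_def)
  have "inverse \<pi> \<notin> A"
  proof
    assume "inverse \<pi> \<in> A"
    then obtain f g where e: "f \<in> polys_over OE" "g \<in> polys_over OE" "primitive g"
      "inverse \<pi> = poly f y * inverse (poly g y)" by (auto simp: A_def)
    have nz: "poly g y \<noteq> 0" using tr prnz e by auto
    \<comment> \<open>From \<open>1/\<pi> = f(y)/g(y)\<close> it follows that \<open>g\<close> is a
      multiple of \<open>\<pi>\<close>, against its primitivity.\<close>
    have "poly (g - smult \<pi> f) y = 0" using e(4) nz \<pi> by (simp add: field_simps)
    moreover have "g - smult \<pi> f \<in> polys_over OE" using e \<pi> E by (intro pc) (auto simp: OE_def)
    ultimately have "g - smult \<pi> f = 0" using tr by blast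
    then have g: "g = smult \<pi> f" by simp
    have "\<pi> \<in> vmax" using \<pi> by (simp add: vmax_def)
    moreover have "coeff f i \<in> Ov" for i using e(1) by (auto simp: polys_over_def OE_def)
    ultimately have "coeff g i \<in> vmax" for i unfolding g by (simp add: vmax_mult)
    then show False using e(3) by (auto simp: primitive_def)
  qed
  then obtain Ov' where O': "valuation_ring Ov'" "A \<subseteq> Ov'" "inverse \<pi> \<notin> Ov'"
    using Chevalley_extension[OF sA \<pi>A _ \<pi>(2)] by blast
  interpret O': valuation_ring Ov' by fact
  have "x \<in> O'.loc \<pi>" if x: "x \<in> frac_adjoin E y" for x
  proof -
    obtain f g where e: "f \<in> polys_over E" "g \<in> polys_over E" "poly g y \<noteq> 0" "x = poly f y * inverse (poly g y)"
      using x by (auto simp: frac_adjoin_def)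
    \<comment> \<open>Dividing by a dominating coefficient makes the denominator primitive. The
      numerator then has finitely many coefficients in \<open>loc \<pi>\<close>, and one power of
      \<open>\<pi>\<close> clears them.\<close>
    define U where "U = coeff g ` {..degree g} - {0}"
    have "g \<noteq> 0" using e by auto
    then have "lead_coeff g \<in> U" by (auto simp: U_def)
    then have "U \<noteq> {}" by blast
    moreover have "finite U" "0 \<notin> U" by (auto simp: U_def)
    ultimately obtain b where b: "b \<in> U" "\<forall>z\<in>U. z * inverse b \<in> Ov"
      using exists_dominating by blast
    have b0: "b \<noteq> 0" and bE: "b \<in> E" using b(1) e(2) by (auto simp: U_def polys_over_def)
    have ibE: "inverse b \<in> E" using bE E by (auto simp: is_subfield_def)
    define g1 where "g1 = smult (inverse b) g"
    have "coeff g1 i \<in> Ov" for i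
    proof (cases "coeff g i = 0")
      case False
      then have "coeff g i \<in> U" using le_degree[OF False] by (auto simp: U_def)
      then show ?thesis using b(2) by (auto simp: g1_def mult.commute)
    qed (simp add: g1_def closed)
    moreover have "coeff g1 i \<in> E" for i
      using e(2) ibE cE(4) by (auto simp: g1_def polys_over_def)
    ultimately have g1: "g1 \<in> polys_over OE" by (auto simp: polys_over_def OE_def)
    obtain j where "coeff g j = b" using b(1) by (auto simp: U_def)
    then have "coeff g1 j = 1" using b0 by (simp add: g1_def)
    then have prg1: "primitive g1" using prO[OF g1, of j] one_notin_vmax by simp
    define f1 where "f1 = smult (inverse b) f"
    have f1E: "coeff f1 i \<in> E" for i using e(1) ibE cE(4) by (auto simp: f1_def polys_over_def)
    then have "coeff f1 ` {..degree f1} \<subseteq> loc \<pi>" using E(2) by auto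
    then obtain n where n: "\<And>i. i \<le> degree f1 \<Longrightarrow> \<pi> ^ n * coeff f1 i \<in> Ov"
      using loc_common[OF \<pi>(1), of "coeff f1 ` {..degree f1}"] by auto
    have "\<pi> ^ n * coeff f1 i \<in> OE" for i
    proof (cases "i \<le> degree f1")
      case True
      then show ?thesis using n f1E E(3) cE(4,7) by (auto simp: OE_def)
    next
      case False
      then show ?thesis using closed cE by (simp add: coeff_eq_0 OE_def)
    qed
    then have "smult (\<pi> ^ n) f1 \<in> polys_over OE" by (simp add: polys_over_def)
    then have "\<pi> ^ n * x \<in> A"
      by (rule AI[OF _ g1 prg1]) (use e b0 in \<open>simp add: f1_def g1_def field_simps\<close>)
    then show ?thesis using O'(2) by (auto simp: O'.loc_def)
  qed
  then show ?thesis using O' \<pi>A by blast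
qed

end

text \<open>The subfield grows by a Gauss extension for each \<open>y\<close> that is transcendental
  over it and stays unchanged for the algebraic ones. In the end all of \<open>Y\<close> is
  algebraic over a subfield inside \<open>loc\<close>, and \<open>algebraic_in_loc\<close>
  applies.\<close>

lemma valuation_ring_absorbs_finite:
  fixes Y :: "'a::field set"
  assumes "finite Y" "valuation_ring Ov" "\<pi> \<in> Ov" "\<pi> \<noteq> 0" "inverse \<pi> \<notin> Ov"
    and "is_subfield E" "E \<subseteq> valuation_ring.loc Ov \<pi>" "\<pi> \<in> E"
  shows "\<exists>Ov'. valuation_ring Ov' \<and> \<pi> \<in> Ov' \<and> inverse \<pi> \<notin> Ov' \<and> Y \<subseteq> valuation_ring.loc Ov' \<pi>"
proof -
  have "\<exists>Ov' E'. valuation_ring Ov' \<and> \<pi> \<in> Ov' \<and> inverse \<pi> \<notin> Ov' \<and> is_subfield E' \<and>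
    E' \<subseteq> valuation_ring.loc Ov' \<pi> \<and> \<pi> \<in> E' \<and> (\<forall>y\<in>Y. algebraic_over E' y)"
    using assms(1)
  proof (induction Y)
    case empty
    then show ?case using assms by blast
  next
    case (insert y Y)
    then obtain Ov' E' where *: "valuation_ring Ov'" "\<pi> \<in> Ov'" "inverse \<pi> \<notin> Ov'" "is_subfield E'"
      "E' \<subseteq> valuation_ring.loc Ov' \<pi>" "\<pi> \<in> E'" "\<forall>y\<in>Y. algebraic_over E' y" by blast
    show ?case
    proof (cases "algebraic_over E' y")
      case True
      then show ?thesis using * by blast
    next
      case False
      have sE: "is_subring E'" using *(4) by (simp add: is_subfield_def)
      let ?F = "frac_adjoin E' y"
      have sup: "E' \<subseteq> ?F" "y \<in> ?F"
        using adjoin_superset[OF sE] frac_adjoin_superset[OF sE] by blast+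
      have sF: "is_subfield ?F" by (rule subfield_frac_adjoin[OF sE])
      have "algebraic_over ?F z" if "z \<in> Y" for z
        using *(7) that sup(1) unfolding algebraic_over_def polys_over_def by blast
      moreover have "algebraic_over ?F y"
        using sup(2) subring_closed[of ?F] sF unfolding algebraic_over_def
        by (intro bexI[of _ "[:- y, 1:]"]) (auto simp: is_subfield_def polys_over_closed(1))
      moreover obtain Ov'' where "valuation_ring Ov''" "\<pi> \<in> Ov''" "inverse \<pi> \<notin> Ov''"
        "?F \<subseteq> valuation_ring.loc Ov'' \<pi>"
        using valuation_ring.gauss_extension[OF *(1,2) assms(4) *(3-6) False] by blast
      ultimately show ?thesis using sF sup(1) *(6) by blast
    qed
  qed
  then obtain Ov' E' where *: "valuation_ring Ov'" "\<pi> \<in> Ov'" "inverse \<pi> \<notin> Ov'" "is_subfield E'"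
      "E' \<subseteq> valuation_ring.loc Ov' \<pi>" "\<forall>y\<in>Y. algebraic_over E' y" by blast
  then have "Y \<subseteq> valuation_ring.loc Ov' \<pi>"
    using valuation_ring.algebraic_in_loc[OF *(1,2) assms(4) *(4,5)] by blast
  then show ?thesis using * by blast
qed

section \<open>Integer polynomials and the prime field\<close>

definition ipoly :: "int poly \<Rightarrow> 'a::comm_ring_1 \<Rightarrow> 'a" where
  "ipoly h x = poly (map_poly of_int h) x"

lemma map_poly_of_int_add: "map_poly of_int (p + q) = (map_poly of_int p + map_poly of_int q :: 'a::comm_ring_1 poly)"
  by (intro poly_eqI) (simp add: coeff_map_poly)

lemma map_poly_of_int_mult: "map_poly of_int (p * q) = (map_poly of_int p * map_poly of_int q :: 'a::comm_ring_1 poly)"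
  by (intro poly_eqI) (simp add: coeff_map_poly coeff_mult)

lemma ipoly_simps [simp]:
  "ipoly 0 x = 0" "ipoly (pCons a h) x = of_int a + x * ipoly h x" "ipoly (p + q) x = ipoly p x + ipoly q x"
  "ipoly (p * q) x = ipoly p x * ipoly q x" "ipoly (smult c p) x = of_int c * ipoly p x" "ipoly 1 x = 1"
proof -
  show "ipoly (smult c p) x = of_int c * ipoly p x"
  proof -
    have "map_poly of_int (smult c p) = smult (of_int c) (map_poly of_int p :: 'a poly)"
      by (intro poly_eqI) (simp add: coeff_map_poly)
    then show ?thesis by (simp add: ipoly_def)
  qed
qed (simp_all add: ipoly_def map_poly_of_int_add map_poly_of_int_mult map_poly_pCons one_pCons)

lemma ipoly_eq_sum: "ipoly h (x :: 'a::comm_ring_1) = (\<Sum>i\<le>degree h. of_int (coeff h i) * x ^ i)"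
proof -
  have "degree (map_poly of_int h :: 'a poly) \<le> degree h" 
    by (rule degree_le) (simp add: coeff_map_poly coeff_eq_0)
  then have "(\<Sum>i\<le>degree (map_poly of_int h :: 'a poly). coeff (map_poly of_int h) i * x ^ i) =
      (\<Sum>i\<le>degree h. coeff (map_poly of_int h) i * x ^ i)"
    by (intro sum.mono_neutral_left) (auto simp: coeff_eq_0)
  then show ?thesis by (simp add: ipoly_def poly_altdef coeff_map_poly)
qed

lemma subring_range_of_int: "is_subring (range (of_int :: int \<Rightarrow> 'a::comm_ring_1))"
  unfolding is_subring_def
  by (auto simp flip: of_int_diff of_int_mult intro: range_eqI[of _ _ 1])

lemma polys_over_range_of_int:
  "polys_over (range of_int) = range (map_poly of_int :: int poly \<Rightarrow> 'a::comm_ring_1 poly)"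
proof (intro equalityI subsetI)
  fix p :: "'a poly" assume p: "p \<in> polys_over (range of_int)"
  \<comment> \<open>\<open>map_poly\<close> behaves well only for functions sending zero to zero,
    hence the case distinction around the choice.\<close>
  define s where "s = (\<lambda>x::'a. if x = 0 then 0 else (SOME z::int. of_int z = x))"
  have "p = map_poly of_int (map_poly s p)"
  proof (rule poly_eqI)
    fix n
    have "coeff p n \<in> range of_int" using p by (simp add: polys_over_def)
    then have "\<exists>z. of_int z = coeff p n" by auto
    then have "of_int (SOME z. of_int z = coeff p n) = coeff p n" by (rule someI_ex)
    then have "of_int (s (coeff p n)) = coeff p n" by (simp add: s_def)
    then show "coeff p n = coeff (map_poly of_int (map_poly s p)) n"
      by (simp add: coeff_map_poly s_def)
  qed
  then show "p \<in> range (map_poly of_int)" by blast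
qed (auto simp: polys_over_def coeff_map_poly)

lemma adjoin_range_of_int: "adjoin (range of_int) x = range (\<lambda>h. ipoly h x)"
  by (auto simp: adjoin_def polys_over_range_of_int ipoly_def)

text \<open>Algebraic over the prime field, in any characteristic: the polynomial has to survive
  reduction. Integrality is the separate notion \<open>integral_int\<close>.\<close>

definition algebraic_int :: "'a::field \<Rightarrow> bool" where
  "algebraic_int x \<longleftrightarrow> (\<exists>h. map_poly of_int h \<noteq> (0 :: 'a poly) \<and> ipoly h x = 0)"

definition prime_field :: "'a::field set" where
  "prime_field = {of_int a * inverse (of_int b) | a b. of_int b \<noteq> (0::'a)}"

lemma subfield_prime_field: "is_subfield (prime_field :: 'a::field set)"
proof -
  \<comment> \<open>Evaluation at 0 returns the constant term, so the quotients formed with the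
    element 0 are exactly the fractions of integers.\<close>
  have "(prime_field :: 'a set) = frac_adjoin (range of_int) 0"
  proof (intro equalityI subsetI)
    fix x :: 'a assume "x \<in> prime_field"
    then obtain a b :: int where "of_int b \<noteq> (0::'a)" "x = of_int a * inverse (of_int b)"
      by (auto simp: prime_field_def)
    then show "x \<in> frac_adjoin (range of_int) 0"
      by (intro frac_adjoinI[of "[:of_int a:]" _ "[:of_int b:]"]) (auto simp: polys_over_closed(1)[OF subring_range_of_int])
  next
    fix x :: 'a assume "x \<in> frac_adjoin (range of_int) 0"
    then obtain f g where fg: "f \<in> polys_over (range of_int)" "g \<in> polys_over (range of_int)" "poly g 0 \<noteq> (0::'a)"
      "x = poly f 0 * inverse (poly g 0)" by (auto simp: frac_adjoin_def)
    obtain a b :: int where "coeff f 0 = of_int a" "coeff g 0 = of_int b"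
      using fg(1,2) unfolding polys_over_def by blast
    then show "x \<in> prime_field" using fg(3,4) by (auto simp: prime_field_def poly_0_coeff_0)
  qed
  then show ?thesis using subfield_frac_adjoin[OF subring_range_of_int, where y = "0::'a"] by simp
qed

lemma prime_field_common_denom:
  assumes "finite U" "U \<subseteq> prime_field"
  shows "\<exists>d::int. of_int d \<noteq> (0::'a::field) \<and> (\<forall>x\<in>U. of_int d * x \<in> range (of_int :: int \<Rightarrow> 'a))"
  using assms
proof (induction U)
  case empty
  then show ?case by (intro exI[of _ 1]) auto
next
  case (insert x U)
  then obtain d :: int where d: "of_int d \<noteq> (0::'a)" "\<forall>x\<in>U. of_int d * x \<in> range (of_int :: int \<Rightarrow> 'a)" by auto
  obtain a b :: int where ab: "of_int b \<noteq> (0::'a)" "x = of_int a * inverse (of_int b)"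
    using insert by (auto simp: prime_field_def)
  have "of_int (d * b) * y \<in> range (of_int :: int \<Rightarrow> 'a)" if "y \<in> insert x U" for y
  proof (cases "y = x")
    case True
    then have "of_int (d * b) * y = (of_int (d * a) :: 'a)" using ab by simp
    then show ?thesis by blast
  next
    case False
    then have "of_int d * y \<in> range (of_int :: int \<Rightarrow> 'a)" using d that by auto
    then obtain z :: int where "of_int d * y = (of_int z :: 'a)" by auto
    then have "of_int (d * b) * y = (of_int (b * z) :: 'a)" by (simp add: mult_ac)
    then show ?thesis by blast
  qed
  then show ?case using d ab by (intro exI[of _ "d * b"]) auto
qed

lemma algebraic_over_prime_field:
  fixes x :: "'a::field"
  assumes "algebraic_over prime_field x" shows "algebraic_int x"
proof -
  obtain p where p: "p \<in> polys_over prime_field" "p \<noteq> 0" "poly p x = 0" using assms by (auto simp: algebraic_over_def)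
  have "coeff p ` {..degree p} \<subseteq> prime_field" using p by (auto simp: polys_over_def)
  then obtain d :: int where d: "of_int d \<noteq> (0::'a)" "\<And>i. i \<le> degree p \<Longrightarrow> of_int d * coeff p i \<in> range (of_int :: int \<Rightarrow> 'a)"
    using prime_field_common_denom[of "coeff p ` {..degree p}"] by auto
  have "of_int d * coeff p i \<in> range (of_int :: int \<Rightarrow> 'a)" for i
    using d(2)[of i] by (cases "i \<le> degree p") (auto simp: coeff_eq_0 intro: range_eqI[of _ _ 0])
  then have "smult (of_int d) p \<in> polys_over (range of_int)" by (simp add: polys_over_def)
  then obtain h where h: "smult (of_int d) p = map_poly of_int h" by (auto simp: polys_over_range_of_int)
  have "map_poly of_int h \<noteq> (0 :: 'a poly)" using d(1) p(2) by (simp flip: h)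
  moreover have "ipoly h x = 0" using p(3) by (simp add: ipoly_def flip: h)
  ultimately show ?thesis by (auto simp: algebraic_int_def)
qed

text \<open>A place at which \<open>\<pi>\<close> is small, while nothing in some subfield
  containing \<open>\<pi>\<close> is infinitely large. This is the input of
  \<open>valuation_ring_absorbs_finite\<close>.\<close>

definition place_base :: "'a::field \<Rightarrow> bool" where
  "place_base \<pi> \<longleftrightarrow> (\<exists>Ov E. valuation_ring Ov \<and> \<pi> \<in> Ov \<and> inverse \<pi> \<notin> Ov \<and> is_subfield E \<and>
     E \<subseteq> valuation_ring.loc Ov \<pi> \<and> \<pi> \<in> E)"

text \<open>The \<open>\<pi>\<close>-adic place on rational functions in \<open>\<pi>\<close>: every
  nonzero polynomial is a power of \<open>\<pi>\<close> times one with nonzero constant term, and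
  the latter is a unit because \<open>\<pi>\<close> lies in the maximal ideal.\<close>

lemma place_base_transcendental:
  fixes \<pi> :: "'a::field"
  assumes "\<not> algebraic_int \<pi>"
  shows "place_base \<pi>"
proof -
  let ?P = "prime_field :: 'a set"
  have sP: "is_subring ?P" using subfield_prime_field[where 'a = 'a] by (simp add: is_subfield_def)
  have tr: "p = 0" if "p \<in> polys_over ?P" "poly p \<pi> = 0" for p
    using assms that algebraic_over_prime_field by (auto simp: algebraic_over_def)
  have \<pi>0: "\<pi> \<noteq> 0"
    using tr[of "[:0, 1:]"] polys_over_closed(1)[OF sP] subring_closed[OF sP] by auto
  have A: "is_subring (adjoin ?P \<pi>)" "\<pi> \<in> adjoin ?P \<pi>" "?P \<subseteq> adjoin ?P \<pi>"
    using subring_adjoin[OF sP] adjoin_superset[OF sP] by auto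
  have "inverse \<pi> \<notin> adjoin ?P \<pi>"
  proof
    assume "inverse \<pi> \<in> adjoin ?P \<pi>"
    then obtain p where p: "p \<in> polys_over ?P" "inverse \<pi> = poly p \<pi>" by (auto simp: adjoin_def)
    have "poly (pCons (- 1) p) \<pi> = 0" using \<pi>0 by (simp flip: p(2))
    moreover have "pCons (- 1) p \<in> polys_over ?P" using p(1) subring_closed[OF sP] by simp
    ultimately show False using tr by fastforce
  qed
  then obtain Ov where O: "valuation_ring Ov" "adjoin ?P \<pi> \<subseteq> Ov" "inverse \<pi> \<notin> Ov"
    using Chevalley_extension[OF A(1,2) _ \<pi>0] by blast
  interpret valuation_ring Ov by fact
  have \<pi>O: "\<pi> \<in> Ov" using A O by auto
  have \<pi>m: "\<pi> \<in> vmax" using \<pi>O O(3) by (simp add: vmax_def)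
  have polyO: "poly p \<pi> \<in> Ov" if "p \<in> polys_over ?P" for p
    using that O(2) by (auto simp: adjoin_def)
  have linv: "\<exists>n. \<pi> ^ n * inverse (poly g \<pi>) \<in> Ov" if "g \<in> polys_over ?P" "g \<noteq> 0" for g
    using that
  proof (induction g)
    case (pCons c g)
    show ?case
    proof (cases "c = 0")
      case True
      then obtain n where "\<pi> ^ n * inverse (poly g \<pi>) \<in> Ov" using pCons by auto
      then have "\<pi> ^ Suc n * inverse (poly (pCons c g) \<pi>) \<in> Ov" using \<pi>0 True by (simp add: field_simps)
      then show ?thesis by blast
    next
      case False
      have ic: "inverse c \<in> ?P" "c \<in> ?P" using pCons.prems subfield_prime_field by (auto simp: is_subfield_def)
      then have icO: "inverse c \<in> Ov" using A(3) O(2) by auto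
      have "\<pi> * (poly g \<pi> * inverse c) \<in> vmax"
        using pCons.prems icO \<pi>m by (intro vmax_mult closed polyO) auto
      from one_plus_unit(2)[OF this] have "inverse c * inverse (1 + \<pi> * (poly g \<pi> * inverse c)) \<in> Ov"
        using icO by (intro closed)
      also have "inverse c * inverse (1 + \<pi> * (poly g \<pi> * inverse c)) = inverse (c * (1 + \<pi> * (poly g \<pi> * inverse c)))"
        by simp
      also have "c * (1 + \<pi> * (poly g \<pi> * inverse c)) = poly (pCons c g) \<pi>" using False by (simp add: field_simps)
      finally show ?thesis by (intro exI[of _ 0]) simp
    qed
  qed simp
  have "frac_adjoin ?P \<pi> \<subseteq> loc \<pi>"
  proof
    fix x assume "x \<in> frac_adjoin ?P \<pi>"
    then obtain f g where fg: "f \<in> polys_over ?P" "g \<in> polys_over ?P" "poly g \<pi> \<noteq> 0" "x = poly f \<pi> * inverse (poly g \<pi>)"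
      by (auto simp: frac_adjoin_def)
    then have "g \<noteq> 0" by auto
    then obtain n where n: "\<pi> ^ n * inverse (poly g \<pi>) \<in> Ov" using linv[OF fg(2)] by blast
    have "poly f \<pi> * (\<pi> ^ n * inverse (poly g \<pi>)) \<in> Ov" by (rule closed(4)[OF polyO[OF fg(1)] n])
    then show "x \<in> loc \<pi>" by (auto simp: loc_def fg(4) mult_ac)
  qed
  moreover have "\<pi> \<in> frac_adjoin ?P \<pi>" using frac_adjoin_superset[OF sP] A(2) by blast
  ultimately show ?thesis
    unfolding place_base_def using O \<pi>O subfield_frac_adjoin[OF sP] by blast
qed

lemma ipoly_pseudo_mod:
  fixes f g :: "int poly"
  assumes "g \<noteq> 0"
  shows "\<exists>a q r. a \<noteq> 0 \<and> smult a f = g * q + r \<and> (r = 0 \<or> degree r < degree g)"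
  using pseudo_mod[OF assms, of f] by blast

text \<open>The valuation on \<open>\<rat>(\<pi>)\<close> has rank one, i.e. no nonzero element is divisible by all
  powers of \<open>\<pi>\<close>.\<close>

lemma place_base_algebraic:
  fixes \<pi> :: "'a::field"
  assumes char0: "\<And>n::int. of_int n = (0::'a) \<Longrightarrow> n = 0" and alg: "algebraic_int \<pi>"
    and \<pi>0: "\<pi> \<noteq> 0" and ni: "inverse \<pi> \<notin> range (\<lambda>h. ipoly h \<pi>)"
  shows "place_base \<pi>"
proof -
  let ?Z = "range of_int :: 'a set"
  note sZ = subring_range_of_int[where 'a = 'a]
  have A: "is_subring (adjoin ?Z \<pi>)" "\<pi> \<in> adjoin ?Z \<pi>"
    using subring_adjoin[OF sZ] adjoin_superset[OF sZ] by auto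
  obtain Ov where O: "valuation_ring Ov" "adjoin ?Z \<pi> \<subseteq> Ov" "inverse \<pi> \<notin> Ov"
    using Chevalley_extension[OF A _ \<pi>0] ni by (auto simp: adjoin_range_of_int)
  interpret valuation_ring Ov by fact
  have \<pi>O: "\<pi> \<in> Ov" using A O by auto
  have \<pi>m: "\<pi> \<in> vmax" using \<pi>O O(3) by (simp add: vmax_def)
  have polyO: "ipoly h \<pi> \<in> Ov" for h using O(2) by (auto simp: adjoin_range_of_int)
  have intO: "of_int z \<in> Ov" for z using polyO[of "[:z:]"] by simp
  \<comment> \<open>The elements divisible by all powers of \<open>\<pi>\<close>. They behave like a
    prime ideal, and the aim is that zero is the only one among the polynomials in
    \<open>\<pi>\<close>.\<close>
  define D where "D = {x. \<forall>N. x * inverse (\<pi> ^ N) \<in> Ov}"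
  have D0: "0 \<in> D" by (simp add: D_def closed)
  have Dmult: "x * y \<in> D" if "x \<in> D" "y \<in> Ov" for x y
  proof -
    have "(x * inverse (\<pi> ^ N)) * y \<in> Ov" for N
      using that by (intro closed(4)[OF _ that(2)]) (simp add: D_def)
    then show ?thesis by (simp add: D_def mult_ac)
  qed
  have Ddiff: "x - y \<in> D" if "x \<in> D" "y \<in> D" for x y
    using that closed(3) by (auto simp: D_def left_diff_distrib)
  have Dout: "\<exists>n. \<pi> ^ n * inverse x \<in> Ov" if xD: "x \<notin> D" for x
  proof -
    obtain N where "x * inverse (\<pi> ^ N) \<notin> Ov" using xD by (auto simp: D_def)
    then show ?thesis using total_quotient by blast
  qed
  have Dprime: "y \<in> D" if xy: "x * y \<in> D" "x \<notin> D" for x y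
  proof -
    have x0: "x \<noteq> 0" using xy D0 by auto
    obtain n where n: "\<pi> ^ n * inverse x \<in> Ov" using Dout xy by blast
    have "y * inverse (\<pi> ^ N) \<in> Ov" for N
    proof -
      have "y * inverse (\<pi> ^ N) = (x * y * inverse (\<pi> ^ (N + n))) * (\<pi> ^ n * inverse x)"
        using x0 \<pi>0 by (simp add: power_add field_simps)
      moreover have "x * y * inverse (\<pi> ^ (N + n)) \<in> Ov" using xy(1) unfolding D_def by blast
      ultimately show ?thesis using closed(4)[OF _ n] by metis
    qed
    then show ?thesis by (simp add: D_def)
  qed
  have Dm: "x * inverse \<pi> ^ k \<in> vmax" if "x \<in> D" for x k
  proof -
    have "x * inverse (\<pi> ^ Suc k) \<in> Ov" using that unfolding D_def by blast
    then have "\<pi> * (x * inverse (\<pi> ^ Suc k)) \<in> vmax" using \<pi>m by (intro vmax_mult)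
    moreover have "\<pi> * (x * inverse (\<pi> ^ Suc k)) = x * inverse \<pi> ^ k" using \<pi>0 by (simp add: field_simps)
    ultimately show ?thesis by (simp only:)
  qed
  have oneD: "1 \<notin> D" using O(3) unfolding D_def by (auto intro!: exI[of _ 1])
  obtain h0 :: "int poly" where h0: "map_poly of_int h0 \<noteq> (0 :: 'a poly)" "ipoly h0 \<pi> = 0"
    using alg by (auto simp: algebraic_int_def)
  then have h0nz: "h0 \<noteq> 0" by auto
  define h where "h = primitive_part h0"
  have h: "h \<noteq> 0" "content h = 1" using h0nz by (auto simp: h_def content_primitive_part)
  have hr: "ipoly h \<pi> = 0"
  proof -
    have "h0 = smult (content h0) h" by (simp add: h_def content_times_primitive_part)
    then have "of_int (content h0) * ipoly h \<pi> = (0::'a)" using h0(2) by (metis ipoly_simps(5))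
    moreover have "of_int (content h0) \<noteq> (0::'a)" using h0nz char0[of "content h0"] by auto
    ultimately show ?thesis by simp
  qed
  \<comment> \<open>Suppose that \<open>D\<close> contains nonzero integers; let \<open>m\<close> be
    the least positive one. As \<open>h\<close> has content 1, some coefficient lies outside
    \<open>D\<close>; the lowest such \<open>z\<close> is coprime to \<open>m\<close> because
    \<open>D\<close> is prime, so it is a unit of \<open>Ov\<close>. But dividing
    \<open>h(\<pi>) = 0\<close> by \<open>\<pi> ^ i\<close> puts \<open>z\<close> into the maximal
    ideal: lower terms carry elements of \<open>D\<close>, which absorb negative powers of
    \<open>\<pi>\<close>, and higher terms carry a factor \<open>\<pi>\<close>.\<close>
  have intD: "n = 0" if nD: "of_int n \<in> D" for n :: int
  proof (rule ccontr)
    assume "n \<noteq> 0"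
    define Q where "Q = (\<lambda>k::nat. k > 0 \<and> of_nat k \<in> D)"
    have "Q (nat \<bar>n\<bar>)" using nD \<open>n \<noteq> 0\<close> Ddiff[OF D0 nD] by (auto simp: Q_def abs_if)
    then obtain k where k: "Q k" "\<And>j. Q j \<Longrightarrow> k \<le> j" by (metis LeastI Least_le)
    define m where "m = int k"
    have m: "m > 0" "of_int m \<in> D" using k(1) by (auto simp: m_def Q_def)
    have mdvd: "m dvd z" if z: "of_int z \<in> D" for z
    proof -
      have "of_int (z mod m) = of_int z - of_int m * (of_int (z div m) :: 'a)"
        by (simp flip: of_int_mult of_int_diff add: minus_mult_div_eq_mod)
      also have "\<dots> \<in> D" using z m(2) intO by (intro Ddiff Dmult)
      finally have "of_int (z mod m) \<in> D" .
      moreover have "0 \<le> z mod m" "z mod m < m" using m by auto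
      ultimately have "\<not> z mod m > 0"
        using k(2)[of "nat (z mod m)"] by (force simp: Q_def m_def)
      then show ?thesis using \<open>0 \<le> z mod m\<close> by (auto simp: dvd_eq_mod_eq_0)
    qed
    have m1: "\<not> m dvd 1"
    proof
      assume "m dvd 1"
      then have "m = 1" using m by simp
      then show False using m(2) oneD by simp
    qed
    have "\<exists>i. of_int (coeff h i) \<notin> D"
    proof (rule ccontr)
      assume "\<not> ?thesis"
      then have "m dvd coeff h i" for i using mdvd by blast
      then have "[:m:] dvd h" by (simp add: const_poly_dvd_iff)
      then have "m dvd content h" by (simp add: const_poly_dvd_iff_dvd_content)
      then show False using h(2) m1 by simp
    qed
    define i where "i = (LEAST i. of_int (coeff h i) \<notin> D)"
    have i: "of_int (coeff h i) \<notin> D" "\<And>j. j < i \<Longrightarrow> of_int (coeff h j) \<in> D"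
      using LeastI_ex[OF \<open>\<exists>i. of_int (coeff h i) \<notin> D\<close>] not_less_Least unfolding i_def by blast+
    define z where "z = coeff h i"
    have "coprime z m"
    proof -
      define g where "g = gcd z m"
      obtain q where q: "m = g * q" unfolding g_def by (metis dvdE gcd_dvd2)
      have "of_int g \<notin> D"
      proof
        assume "of_int g \<in> D"
        then have "m dvd z" using mdvd[of g] by (auto simp: g_def)
        then obtain c where "z = m * c" by (auto elim: dvdE)
        then show False using i(1) Dmult[OF m(2) intO[of c]] by (simp add: z_def)
      qed
      then have "of_int q \<in> D" using Dprime[of "of_int g" "of_int q"] m(2) by (simp add: q)
      then have "m dvd q" by (rule mdvd)
      then have "g * q dvd 1 * q" using q by simp
      moreover have "q \<noteq> 0" using q m(1) by auto
      ultimately have "g dvd 1" by (metis dvd_mult_cancel_right)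
      then show ?thesis by (simp add: g_def coprime_iff_gcd_eq_1)
    qed
    then obtain a b where ab: "a * z + b * m = 1" using bezout_int[of z m] by (auto simp: coprime_iff_gcd_eq_1)
    have mm: "of_int m \<in> vmax" using Dm[OF m(2), of 0] by simp
    have zm: "of_int z \<notin> vmax"
    proof
      assume "of_int z \<in> vmax"
      then have "of_int z * of_int a + of_int m * (of_int b :: 'a) \<in> vmax"
        using mm intO by (intro vmax_add vmax_mult)
      moreover have "of_int z * of_int a + of_int m * (of_int b :: 'a) = of_int (a * z + b * m)" by (simp add: mult_ac)
      ultimately show False using one_notin_vmax by (simp add: ab)
    qed
    have "(\<Sum>j\<le>degree h. of_int (coeff h j) * \<pi> ^ j) = 0" using hr by (simp add: ipoly_eq_sum)
    moreover have ideg: "i \<le> degree h" using i(1) D0 by (intro le_degree) auto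
    ultimately have "of_int z * \<pi> ^ i = - (\<Sum>j\<in>{..degree h} - {i}. of_int (coeff h j) * \<pi> ^ j)"
      by (subst (asm) sum.remove[of _ i]) (auto simp: z_def add_eq_0_iff2)
    then have "of_int z * \<pi> ^ i * inverse \<pi> ^ i = - (\<Sum>j\<in>{..degree h} - {i}. of_int (coeff h j) * \<pi> ^ j * inverse \<pi> ^ i)"
      by (simp add: sum_distrib_right)
    also have "of_int z * \<pi> ^ i * inverse \<pi> ^ i = of_int z" using \<pi>0 by (simp add: power_inverse)
    also have "- (\<Sum>j\<in>{..degree h} - {i}. of_int (coeff h j) * \<pi> ^ j * inverse \<pi> ^ i) \<in> vmax"
    proof (intro vmax_uminus vmax_sum)
      fix j assume j: "j \<in> {..degree h} - {i}"
      show "of_int (coeff h j) * \<pi> ^ j * inverse \<pi> ^ i \<in> vmax"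
      proof (cases "j < i")
        case True
        then have "\<pi> ^ j * inverse \<pi> ^ i = inverse \<pi> ^ (i - j)"
          using \<pi>0 by (simp add: power_inverse power_diff field_simps)
        then show ?thesis using Dm[OF i(2)[OF True], of "i - j"] by (simp add: mult.assoc)
      next
        case False
        then obtain e where e: "j = i + Suc e" using j by (metis DiffD2 add_Suc_right linorder_neqE_nat less_iff_Suc_add singletonI)
        have "of_int (coeff h j) * \<pi> ^ j * inverse \<pi> ^ i = \<pi> * (of_int (coeff h j) * \<pi> ^ e)"
          using \<pi>0 by (simp add: e power_inverse power_add)
        also have "\<dots> \<in> vmax" using intO \<pi>O \<pi>m by (intro vmax_mult closed)
        finally show ?thesis .
      qed
    qed
    finally show False using zm by simp
  qed
  \<comment> \<open>A polynomial \<open>f\<close> of least degree with value in \<open>D\<close>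
    divides, up to integer factors, every other one with value in \<open>D\<close>, in particular
    the polynomial \<open>k\<close> of least degree vanishing at \<open>\<pi>\<close>. So either
    \<open>f\<close> vanishes at \<open>\<pi>\<close>, and then \<open>g\<close> does, or
    \<open>f\<close> is a nonzero integer in \<open>D\<close>.\<close>
  have polyD: "ipoly g \<pi> = 0" if gD: "ipoly g \<pi> \<in> D" for g
  proof (rule ccontr)
    assume g0: "ipoly g \<pi> \<noteq> 0"
    define Q where "Q = (\<lambda>f. f \<noteq> (0 :: int poly) \<and> ipoly f \<pi> \<in> D)"
    have "Q g" using gD g0 by (auto simp: Q_def)
    then obtain f where f: "Q f" "\<And>f'. Q f' \<Longrightarrow> degree f \<le> degree f'"
      using ex_has_least_nat[of Q g degree] by blast
    define K where "K = (\<lambda>f. f \<noteq> (0 :: int poly) \<and> ipoly f \<pi> = 0)"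
    have "K h" using h hr by (auto simp: K_def)
    then obtain k where k: "K k" "\<And>k'. K k' \<Longrightarrow> degree k \<le> degree k'"
      using ex_has_least_nat[of K h degree] by blast
    have f0: "f \<noteq> 0" using f by (simp add: Q_def)
    have dv: "\<exists>a q. a \<noteq> 0 \<and> smult a p = f * q" if p: "ipoly p \<pi> \<in> D" for p
    proof -
      obtain a q r where r: "a \<noteq> 0" "smult a p = f * q + r" "r = 0 \<or> degree r < degree f"
        using ipoly_pseudo_mod[OF f0] by blast
      have "ipoly r \<pi> = ipoly p \<pi> * of_int a - ipoly f \<pi> * ipoly q \<pi>"
        using arg_cong[OF r(2), of "\<lambda>p. ipoly p \<pi>"] by (simp add: mult.commute)
      also have "\<dots> \<in> D" using p f(1) intO polyO by (intro Ddiff Dmult) (auto simp: Q_def)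
      finally have "ipoly r \<pi> \<in> D" .
      then have "r = 0" using r(3) f(2)[of r] by (force simp: Q_def)
      then show ?thesis using r by auto
    qed
    have of_nz: "of_int a \<noteq> (0::'a)" if "a \<noteq> 0" for a using char0 that by blast
    show False
    proof (cases "ipoly f \<pi> = 0")
      case True
      obtain a q where "a \<noteq> 0" "smult a g = f * q" using dv[OF gD] by blast
      then have "of_int a * ipoly g \<pi> = 0" using True by (metis ipoly_simps(4,5) mult_zero_left)
      then show False using g0 of_nz[OF \<open>a \<noteq> 0\<close>] by simp
    next
      case False
      obtain a q where aq: "a \<noteq> 0" "smult a k = f * q" using dv[of k] k(1) D0 by (auto simp: K_def)
      then have "ipoly f \<pi> * ipoly q \<pi> = 0" using k(1) by (metis K_def ipoly_simps(4,5) mult_zero_right)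
      then have q: "ipoly q \<pi> = 0" using False by simp
      have "q \<noteq> 0" using aq k(1) by (auto simp: K_def)
      then have "degree k \<le> degree q" using q k(2) by (auto simp: K_def)
      moreover have "degree k = degree f + degree q"
        using arg_cong[OF aq(2), of degree] aq(1) f0 \<open>q \<noteq> 0\<close> by (simp add: degree_mult_eq)
      ultimately have "degree f = 0" by simp
      then obtain c where c: "f = [:c:]" by (metis degree_eq_zeroE)
      then have "of_int c \<in> D" using f(1) by (auto simp: Q_def)
      then show False using intD f0 c by auto
    qed
  qed
  have "frac_adjoin ?Z \<pi> \<subseteq> loc \<pi>"
  proof
    fix x assume "x \<in> frac_adjoin ?Z \<pi>"
    then obtain f g where fg: "ipoly g \<pi> \<noteq> 0" "x = ipoly f \<pi> * inverse (ipoly g \<pi>)"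
      by (auto simp: frac_adjoin_def polys_over_range_of_int ipoly_def)
    then obtain n where n: "\<pi> ^ n * inverse (ipoly g \<pi>) \<in> Ov" using Dout polyD by blast
    have "ipoly f \<pi> * (\<pi> ^ n * inverse (ipoly g \<pi>)) \<in> Ov" by (rule closed(4)[OF polyO n])
    then show "x \<in> loc \<pi>" by (auto simp: loc_def fg(2) mult_ac)
  qed
  moreover have "\<pi> \<in> frac_adjoin ?Z \<pi>" using frac_adjoin_superset[OF sZ] A(2) by blast
  ultimately show ?thesis
    unfolding place_base_def using O \<pi>O subfield_frac_adjoin[OF sZ] by blast
qed

section \<open>Ping-pong for two-by-two matrices\<close>

datatype 'a mat2 = Mat2 (m11: 'a) (m12: 'a) (m21: 'a) (m22: 'a)

instantiation mat2 :: (comm_ring_1) monoid_mult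
begin

definition one_mat2 :: "'a mat2" where
  "1 = Mat2 1 0 0 1"

definition times_mat2 :: "'a mat2 \<Rightarrow> 'a mat2 \<Rightarrow> 'a mat2" where
  "A * B = Mat2 (m11 A * m11 B + m12 A * m21 B) (m11 A * m12 B + m12 A * m22 B)
     (m21 A * m11 B + m22 A * m21 B) (m21 A * m12 B + m22 A * m22 B)"

instance
  by standard (auto simp: one_mat2_def times_mat2_def algebra_simps intro: mat2.expand)

end

lemma mat2_one_sel [simp]: "m11 1 = 1" "m12 1 = 0" "m21 1 = 0" "m22 1 = 1"
  by (simp_all add: one_mat2_def)

lemma mat2_times_sel [simp]:
  "m11 (A * B) = m11 A * m11 B + m12 A * m21 B" "m12 (A * B) = m11 A * m12 B + m12 A * m22 B"
  "m21 (A * B) = m21 A * m11 B + m22 A * m21 B" "m22 (A * B) = m21 A * m12 B + m22 A * m22 B"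
  by (simp_all add: times_mat2_def)

lemma mat2_eq_iff: "A = B \<longleftrightarrow> m11 A = m11 B \<and> m12 A = m12 B \<and> m21 A = m21 B \<and> m22 A = m22 B"
  by (auto intro: mat2.expand)

definition mdet :: "'a::comm_ring_1 mat2 \<Rightarrow> 'a" where
  "mdet A = m11 A * m22 A - m12 A * m21 A"

definition mtr :: "'a::comm_ring_1 mat2 \<Rightarrow> 'a" where
  "mtr A = m11 A + m22 A"

definition mscale :: "'a::comm_ring_1 \<Rightarrow> 'a mat2 \<Rightarrow> 'a mat2" where
  "mscale c A = Mat2 (c * m11 A) (c * m12 A) (c * m21 A) (c * m22 A)"

definition madj :: "'a::comm_ring_1 mat2 \<Rightarrow> 'a mat2" where
  "madj A = Mat2 (m22 A) (- m12 A) (- m21 A) (m11 A)"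

lemma mscale_sel [simp]:
  "m11 (mscale c A) = c * m11 A" "m12 (mscale c A) = c * m12 A"
  "m21 (mscale c A) = c * m21 A" "m22 (mscale c A) = c * m22 A"
  by (simp_all add: mscale_def)

lemma mscale_simps:
  "mscale c A * B = mscale c (A * B)" "A * mscale c B = mscale c (A * B)"
  "mscale c (mscale d A) = mscale (c * d) A" "mscale 1 A = A"
  by (simp_all add: mat2_eq_iff algebra_simps)

lemma mdet_mult: "mdet (A * B) = mdet A * mdet B"
  by (simp add: mdet_def algebra_simps)

lemma mdet_one [simp]: "mdet 1 = 1"
  by (simp add: mdet_def)

lemma madj_mult: "madj A * A = mscale (mdet A) 1" "A * madj A = mscale (mdet A) 1"
  by (simp_all add: mat2_eq_iff madj_def mdet_def algebra_simps)

lemma madj_inverse: "mdet A = 1 \<Longrightarrow> madj A * A = 1" "mdet A = 1 \<Longrightarrow> A * madj A = 1"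
  by (simp_all add: madj_mult mscale_simps)

lemma mdet_madj: "mdet (madj A) = mdet A"
  by (simp add: mdet_def madj_def algebra_simps)

lemma mdet_prod_list: "(\<And>w. w \<in> set ws \<Longrightarrow> mdet w = 1) \<Longrightarrow> mdet (prod_list ws) = 1"
  by (induction ws) (simp_all add: mdet_mult)

definition mproj :: "'a::field mat2 \<Rightarrow> 'a mat2 \<Rightarrow> bool" where
  "mproj A B \<longleftrightarrow> (\<exists>c. c \<noteq> 0 \<and> A = mscale c B)"

lemma mproj_refl: "mproj A A"
  unfolding mproj_def by (intro exI[of _ 1]) (simp add: mscale_simps)

lemma mproj_mult_left_cancel:
  assumes "mproj (A * B) (A * C)" "mdet A \<noteq> 0"
  shows "mproj B C"
proof -
  obtain c where c: "c \<noteq> 0" "A * B = mscale c (A * C)" using assms by (auto simp: mproj_def)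
  then have "madj A * (A * B) = mscale c (madj A * (A * C))" by (simp add: mscale_simps)
  then have "mscale (mdet A) B = mscale (mdet A) (mscale c C)"
    by (simp add: mult.assoc[symmetric] madj_mult mscale_simps mult.commute)
  then have "B = mscale c C" using assms(2) by (simp add: mat2_eq_iff)
  then show ?thesis using c by (auto simp: mproj_def)
qed

text \<open>Proportional matrices act alike on the projective line, so words are compared modulo
  scalars.\<close>

definition mfree :: "'a::field mat2 \<Rightarrow> 'a mat2 \<Rightarrow> bool" where
  "mfree A B \<longleftrightarrow> A \<noteq> B \<and> (\<forall>ws\<in>lists {A, B}. \<forall>ws'\<in>lists {A, B}.
     mproj (prod_list ws) (prod_list ws') \<longrightarrow> ws = ws')"

text \<open>The action on slopes \<open>y/x\<close>, chosen so that the attracting direction of a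
  diagonal matrix with dominant upper left entry is the point 0.\<close>

definition mact :: "'a::field mat2 \<Rightarrow> 'a \<Rightarrow> 'a" where
  "mact A z = (m21 A + m22 A * z) / (m11 A + m12 A * z)"

text \<open>Since \<open>ZA\<close> and \<open>ZB\<close> are disjoint, the image of a point of
  \<open>Z\<close> reveals the first letter of a word. Proportional words act alike, so they share
  that letter; it is cancelled and the rest is induction.\<close>

lemma ping_pong:
  fixes A B :: "'a::field mat2"
  assumes det: "mdet A \<noteq> 0" "mdet B \<noteq> 0" and Z: "Z \<noteq> {}"
    and A: "\<And>z. z \<in> Z \<Longrightarrow> m11 A + m12 A * z \<noteq> 0 \<and> mact A z \<in> ZA \<and> mact A z \<in> Z"
    and B: "\<And>z. z \<in> Z \<Longrightarrow> m11 B + m12 B * z \<noteq> 0 \<and> mact B z \<in> ZB \<and> mact B z \<in> Z"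
    and disj: "ZA \<inter> ZB = {}"
  shows "mfree A B"
proof -
  obtain z0 where z0: "z0 \<in> Z" using Z by auto
  have neq: "A \<noteq> B" using A[OF z0] B[OF z0] disj by auto
  define ZZ where "ZZ = (\<lambda>M. if M = A then ZA else ZB)"
  have M: "m11 M + m12 M * z \<noteq> 0 \<and> mact M z \<in> ZZ M \<and> mact M z \<in> Z \<and> mdet M \<noteq> 0"
    if "M \<in> {A, B}" "z \<in> Z" for M z
    using that A B neq det by (auto simp: ZZ_def)
  have sep: False if "x \<in> ZZ M" "x \<in> ZZ M'" "M \<in> {A, B}" "M' \<in> {A, B}" "M \<noteq> M'" for x M M'
    using that disj neq by (auto simp: ZZ_def)
  have comp: "m11 (M * N) + m12 (M * N) * z \<noteq> 0 \<and> mact (M * N) z = mact M (mact N z)"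
    if "m11 N + m12 N * z \<noteq> 0" "m11 M + m12 M * mact N z \<noteq> 0" for M N :: "'a mat2" and z
  proof -
    have "m11 (M * N) + m12 (M * N) * z = (m11 M + m12 M * mact N z) * (m11 N + m12 N * z)"
      "m21 (M * N) + m22 (M * N) * z = (m21 M + m22 M * mact N z) * (m11 N + m12 N * z)"
      using that(1) by (simp_all add: mact_def field_simps)
    then show ?thesis using that by (simp add: mact_def)
  qed
  have word: "m11 (prod_list ws) + m12 (prod_list ws) * z \<noteq> 0 \<and> mact (prod_list ws) z \<in> Z \<and>
      (ws \<noteq> [] \<longrightarrow> mact (prod_list ws) z \<in> ZZ (hd ws))" if "ws \<in> lists {A, B}" "z \<in> Z" for ws z
    using that
  proof (induction ws)
    case Nil
    then show ?case by (simp add: mact_def)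
  next
    case (Cons M ws)
    then have IH: "m11 (prod_list ws) + m12 (prod_list ws) * z \<noteq> 0" "mact (prod_list ws) z \<in> Z" by auto
    have "M \<in> {A, B}" using Cons by auto
    from M[OF this IH(2)] comp[OF IH(1), of M] show ?case by simp
  qed
  have act_proj: "mact N z = mact N' z" if "mproj N N'" for N N' :: "'a mat2" and z
    using that by (auto simp: mproj_def mact_def mult.assoc simp flip: distrib_left)
  \<comment> \<open>A nonempty word is not scalar: it moves a point from the region of the letter
    other than its first one into the region of its first letter.\<close>
  have nonempty: False if w: "M # ws \<in> lists {A, B}" and p: "mproj (prod_list (M # ws)) 1 \<or> mproj 1 (prod_list (M # ws))" for M ws
  proof -
    obtain M' where M': "M' \<in> {A, B}" "M' \<noteq> M" using neq by blast
    have z: "mact M' z0 \<in> Z" "mact M' z0 \<in> ZZ M'" using M[OF M'(1) z0] by auto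
    have "mact (prod_list (M # ws)) (mact M' z0) = mact 1 (mact M' z0)"
      using p act_proj[of "prod_list (M # ws)" 1] act_proj[of 1 "prod_list (M # ws)"] by metis
    then have "mact M' z0 \<in> ZZ M" using word[OF w z(1)] by (simp add: mact_def)
    then show False using sep[OF z(2)] w M' by auto
  qed
  have "mproj (prod_list ws) (prod_list ws') \<Longrightarrow> ws = ws'" if "ws \<in> lists {A, B}" "ws' \<in> lists {A, B}" for ws ws'
    using that
  proof (induction ws arbitrary: ws')
    case Nil
    then show ?case using nonempty by (cases ws') auto
  next
    case (Cons M ws)
    show ?case
    proof (cases ws')
      case Nil
      then show ?thesis using nonempty[of M ws] Cons by simp
    next
      case (Cons M' u)
      note ws' = this
      have w: "M # ws \<in> lists {A, B}" "M' # u \<in> lists {A, B}" using Cons.prems ws' \<open>M \<in> {A, B}\<close> \<open>ws \<in> lists {A, B}\<close> by auto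
      have "mact (prod_list (M # ws)) z0 \<in> ZZ M" "mact (prod_list (M' # u)) z0 \<in> ZZ M'"
        using word[OF w(1) z0] word[OF w(2) z0] by auto
      moreover have "mact (prod_list (M # ws)) z0 = mact (prod_list (M' # u)) z0"
        using act_proj Cons.prems ws' by blast
      ultimately have eq: "M = M'" using sep w by fastforce
      then have "mproj (prod_list ws) (prod_list u)"
        using mproj_mult_left_cancel[of M "prod_list ws" "prod_list u"] Cons.prems(1) ws' w M z0 by auto
      then show ?thesis using Cons.IH[of u] w eq ws' by auto
    qed
  qed
  then show ?thesis using neq by (auto simp: mfree_def)
qed

text \<open>The common core of both ping-pong arguments. \<open>g\<close> sends a slope in
  \<open>Z\<close> to \<open>m21 g / m11 g\<close> times an element of \<open>W\<close>, whose
  members have size about one. The diagonal factors then multiply by \<open>q / p\<close> or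
  \<open>q' / p'\<close>, which has to lead back into \<open>Z\<close> and to keep the two images
  apart.\<close>

lemma diagonal_ping_pong:
  fixes g :: "'a::field mat2"
  assumes nz: "p \<noteq> 0" "q \<noteq> 0" "p' \<noteq> 0" "q' \<noteq> 0" "m11 g \<noteq> 0" "m21 g \<noteq> 0" "mdet g \<noteq> 0"
    and Z: "Z \<noteq> {}"
    and W: "\<And>z. z \<in> Z \<Longrightarrow> 1 + m12 g / m11 g * z \<noteq> 0 \<and> (1 + m22 g / m21 g * z) / (1 + m12 g / m11 g * z) \<in> W"
    and u: "\<And>w. w \<in> W \<Longrightarrow> q / p * (m21 g / m11 g) * w \<in> Z"
    and v: "\<And>w. w \<in> W \<Longrightarrow> q' / p' * (m21 g / m11 g) * w \<in> Z"
    and disj: "\<And>w w'. w \<in> W \<Longrightarrow> w' \<in> W \<Longrightarrow> q / p * w \<noteq> q' / p' * w'"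
  shows "mfree (Mat2 p 0 0 q * g) (Mat2 p' 0 0 q' * g)"
proof -
  define V where "V = (\<lambda>r. (\<lambda>w. r * (m21 g / m11 g) * w) ` W)"
  have act: "m11 (Mat2 p 0 0 q * g) + m12 (Mat2 p 0 0 q * g) * z \<noteq> 0 \<and>
      mact (Mat2 p 0 0 q * g) z \<in> V (q / p) \<and> mact (Mat2 p 0 0 q * g) z \<in> Z"
    if nz': "p \<noteq> 0" "q \<noteq> 0" and z: "z \<in> Z" and u: "\<And>w. w \<in> W \<Longrightarrow> q / p * (m21 g / m11 g) * w \<in> Z" for p q z
  proof -
    let ?w = "(1 + m22 g / m21 g * z) / (1 + m12 g / m11 g * z)"
    have w: "?w \<in> W" "1 + m12 g / m11 g * z \<noteq> 0" using W[OF z] by auto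
    have d: "m11 (Mat2 p 0 0 q * g) + m12 (Mat2 p 0 0 q * g) * z = p * m11 g * (1 + m12 g / m11 g * z)"
      "m21 (Mat2 p 0 0 q * g) + m22 (Mat2 p 0 0 q * g) * z = q * m21 g * (1 + m22 g / m21 g * z)"
      using nz by (simp_all add: field_simps)
    have e: "mact (Mat2 p 0 0 q * g) z = q / p * (m21 g / m11 g) * ?w"
      unfolding mact_def d using nz nz' w by simp
    have "mact (Mat2 p 0 0 q * g) z \<in> V (q / p)" using e w(1) unfolding V_def by (rule image_eqI)
    moreover have "mact (Mat2 p 0 0 q * g) z \<in> Z" unfolding e by (rule u[OF w(1)])
    moreover have "m11 (Mat2 p 0 0 q * g) + m12 (Mat2 p 0 0 q * g) * z \<noteq> 0"
      unfolding d using nz nz' w by simp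
    ultimately show ?thesis by blast
  qed
  show ?thesis
  proof (rule ping_pong[OF _ _ Z])
    show "mdet (Mat2 p 0 0 q * g) \<noteq> 0" "mdet (Mat2 p' 0 0 q' * g) \<noteq> 0"
      using nz unfolding mdet_mult by (auto simp: mdet_def)
    show "V (q / p) \<inter> V (q' / p') = {}"
    proof (rule ccontr)
      assume "\<not> ?thesis"
      then obtain w w' where w: "w \<in> W" "w' \<in> W" "q / p * (m21 g / m11 g) * w = q' / p' * (m21 g / m11 g) * w'"
        by (auto simp: V_def)
      then have "(m21 g / m11 g) * (q / p * w) = (m21 g / m11 g) * (q' / p' * w')" by (simp add: mult_ac)
      then have "q / p * w = q' / p' * w'" using nz by (metis mult_left_cancel divide_eq_0_iff)
      then show False using disj[OF w(1,2)] by simp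
    qed
  qed (use act nz u v in blast)+
qed

lemma diag_power: "Mat2 p 0 0 q ^ n = Mat2 (p ^ n) 0 0 (q ^ n)" for p q :: "'a::comm_ring_1"
  by (induction n) (simp_all add: mat2_eq_iff)

text \<open>\<open>Z\<close> is a small ball around 0 and \<open>W\<close> is the group of units of
  \<open>Ov\<close>. Two consecutive exponents suffice, since their scalings differ by
  \<open>\<pi> ^ 2\<close>, which is not a unit.\<close>

lemma nonarchimedean_free:
  fixes g :: "'a::field mat2"
  assumes O: "valuation_ring Ov" "\<pi> \<in> Ov" "inverse \<pi> \<notin> Ov" "\<pi> \<noteq> 0"
    and g: "m11 g \<noteq> 0" "m21 g \<noteq> 0" "mdet g \<noteq> 0"
    and loc: "{m12 g / m11 g, m22 g / m21 g, m21 g / m11 g} \<subseteq> valuation_ring.loc Ov \<pi>"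
  shows "\<exists>n m. mfree (Mat2 (inverse \<pi>) 0 0 \<pi> ^ n * g) (Mat2 (inverse \<pi>) 0 0 \<pi> ^ m * g)"
proof -
  interpret valuation_ring Ov by fact
  have \<pi>m: "\<pi> \<in> vmax" using O by (simp add: vmax_def)
  obtain k where k: "\<pi> ^ k * (m12 g / m11 g) \<in> Ov" "\<pi> ^ k * (m22 g / m21 g) \<in> Ov" "\<pi> ^ k * (m21 g / m11 g) \<in> Ov"
    using loc_common[OF O(2) _ loc] by auto
  define Z where "Z = (\<lambda>x. \<pi> ^ Suc k * x) ` Ov"
  define W where "W = {w \<in> Ov. w \<noteq> 0 \<and> inverse w \<in> Ov}"
  \<comment> \<open>The scaling contributes \<open>\<pi> ^ (2 * N)\<close>. Of these
    \<open>2 * k + 2\<close> factors, \<open>k\<close> clear the denominator of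
    \<open>m21 g / m11 g\<close>, and the remaining \<open>k + 2\<close> are enough for
    \<open>Z\<close>.\<close>
  define N where "N = k + 1"
  have Wmult: "w * w' \<in> W" "inverse w \<in> W" if "w \<in> W" "w' \<in> W" for w w'
    using that closed(4) by (auto simp: W_def)
  have small: "1 + x * z \<in> W" if "\<pi> ^ k * x \<in> Ov" "z \<in> Z" for x z
  proof -
    obtain y where y: "y \<in> Ov" "z = \<pi> ^ Suc k * y" using \<open>z \<in> Z\<close> by (auto simp: Z_def)
    have "x * z = \<pi> * ((\<pi> ^ k * x) * y)" by (simp add: y mult_ac)
    also have "\<dots> \<in> vmax" using \<open>\<pi> ^ k * x \<in> Ov\<close> y by (intro vmax_mult[OF \<pi>m] closed(4)[OF _ y(1)])
    finally show ?thesis using one_plus_unit vmax_subset closed(1,6) by (auto simp: W_def)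
  qed
  have into: "\<pi> ^ n / inverse \<pi> ^ n * (m21 g / m11 g) * w \<in> Z" if "n \<ge> N" "w \<in> W" for n w
  proof -
    obtain e where e: "n = N + e" using \<open>n \<ge> N\<close> le_Suc_ex by blast
    have "\<pi> ^ n / inverse \<pi> ^ n = \<pi> ^ n * \<pi> ^ n" using O(4) by (simp add: field_simps)
    then have "\<pi> ^ n / inverse \<pi> ^ n * (m21 g / m11 g) * w = \<pi> ^ Suc k * (\<pi> ^ e * \<pi> ^ Suc e * (\<pi> ^ k * (m21 g / m11 g)) * w)"
      by (simp add: e N_def power_add mult_ac)
    moreover have "\<pi> ^ e * \<pi> ^ Suc e * (\<pi> ^ k * (m21 g / m11 g)) * w \<in> Ov"
      using k(3) \<open>w \<in> W\<close> by (intro closed(4)[OF closed(4)[OF closed(4)[OF closed(7) closed(7)]]] O(2)) (auto simp: W_def)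
    ultimately show ?thesis unfolding Z_def by (rule image_eqI)
  qed
  have "mfree (Mat2 (inverse \<pi> ^ N) 0 0 (\<pi> ^ N) * g) (Mat2 (inverse \<pi> ^ Suc N) 0 0 (\<pi> ^ Suc N) * g)"
  proof (rule diagonal_ping_pong[where Z = Z and W = W])
    show "Z \<noteq> {}" using closed by (auto simp: Z_def)
    show "1 + m12 g / m11 g * z \<noteq> 0 \<and> (1 + m22 g / m21 g * z) / (1 + m12 g / m11 g * z) \<in> W" if "z \<in> Z" for z
    proof -
      have 1: "1 + m12 g / m11 g * z \<in> W" "1 + m22 g / m21 g * z \<in> W" using small k that by blast+
      then have "(1 + m22 g / m21 g * z) * inverse (1 + m12 g / m11 g * z) \<in> W" using Wmult by blast
      then show ?thesis using 1 by (simp add: W_def divide_inverse)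
    qed
    show "\<pi> ^ N / inverse \<pi> ^ N * w \<noteq> \<pi> ^ Suc N / inverse \<pi> ^ Suc N * w'" if w: "w \<in> W" "w' \<in> W" for w w'
    proof
      assume "\<pi> ^ N / inverse \<pi> ^ N * w = \<pi> ^ Suc N / inverse \<pi> ^ Suc N * w'"
      then have "w = \<pi> * \<pi> * w'" using O(4) by (simp add: field_simps)
      then have "inverse \<pi> = \<pi> * (w' * inverse w)" using O(4) w by (auto simp: W_def field_simps)
      then have "inverse \<pi> \<in> Ov" using O(2) w closed(4) by (simp add: W_def)
      then show False using O(3) by simp
    qed
    show "\<pi> ^ N / inverse \<pi> ^ N * (m21 g / m11 g) * w \<in> Z" "\<pi> ^ Suc N / inverse \<pi> ^ Suc N * (m21 g / m11 g) * w \<in> Z"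
      if "w \<in> W" for w using into[OF order.refl that] into[OF le_SucI[OF order.refl] that] by (simp_all only:)
  qed (use g O(4) in auto)
  then show ?thesis unfolding diag_power by blast
qed

lemma archimedean_free:
  fixes g :: "complex mat2"
  assumes \<mu>: "norm \<mu> > 1" and g: "m11 g \<noteq> 0" "m21 g \<noteq> 0" "mdet g \<noteq> 0"
  shows "\<exists>n m. mfree (Mat2 \<mu> 0 0 (inverse \<mu>) ^ n * g) (Mat2 \<mu> 0 0 (inverse \<mu>) ^ m * g)"
proof -
  \<comment> \<open>The factor by which the diagonal matrix contracts slopes.\<close>
  define t where "t = norm (inverse \<mu>) ^ 2"
  have i: "0 < norm (inverse \<mu>)" "norm (inverse \<mu>) < 1"
    using \<mu> by (auto simp: norm_inverse inverse_less_1_iff)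
  then have t: "0 < t" "t < 1"
    using mult_strict_mono[of "norm (inverse \<mu>)" 1 "norm (inverse \<mu>)" 1] by (auto simp: t_def power2_eq_square)
  define B where "B = norm (m12 g / m11 g) + norm (m22 g / m21 g) + 1"
  have B: "B \<ge> norm (m12 g / m11 g)" "B \<ge> norm (m22 g / m21 g)" "B > 0" by (auto simp: B_def add_nonneg_pos)
  \<comment> \<open>For slopes up to this radius both linear factors have norm between 1/2 and 3/2,
    so their quotient lies in the annulus \<open>W\<close>.\<close>
  define r where "r = 1 / (2 * B)"
  have r: "r > 0" using B by (simp add: r_def)
  define Z where "Z = {z::complex. norm z \<le> r}"
  define W where "W = {w::complex. 1/3 \<le> norm w \<and> norm w \<le> 3}"
  define c where "c = m21 g / m11 g"
  have c0: "norm c > 0" using g by (simp add: c_def)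
  obtain N where N: "t ^ N < r / (3 * norm c)"
    using real_arch_pow_inv[of "r / (3 * norm c)" t] t r c0 by auto
  \<comment> \<open>The radii of \<open>W\<close> have ratio 9, so a contraction stronger than 1/9
    moves the annulus off itself.\<close>
  obtain j where j: "t ^ j < 1 / 9" using real_arch_pow_inv[of "1 / 9" t] t by auto
  have ratio: "norm (inverse \<mu> ^ n / \<mu> ^ n) = t ^ n" for n
  proof -
    have "inverse \<mu> ^ n / \<mu> ^ n = inverse \<mu> ^ n * inverse \<mu> ^ n"
      by (simp add: divide_inverse power_inverse)
    then have "norm (inverse \<mu> ^ n / \<mu> ^ n) = norm (inverse \<mu>) ^ n * norm (inverse \<mu>) ^ n"
      by (simp only: norm_mult norm_power)
    then show ?thesis by (simp only: t_def power2_eq_square power_mult_distrib)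
  qed
  have half: "norm (x * z) \<le> 1 / 2" if "norm x \<le> B" "z \<in> Z" for x z
  proof -
    have "norm (x * z) \<le> B * r" using that B unfolding norm_mult by (intro mult_mono) (auto simp: Z_def)
    also have "\<dots> = 1 / 2" using B by (simp add: r_def)
    finally show ?thesis .
  qed
  have near: "1/2 \<le> norm (1 + y) \<and> norm (1 + y) \<le> 3/2" if "norm y \<le> 1 / 2" for y :: complex
    using that norm_triangle_ineq[of 1 y] norm_triangle_ineq2[of 1 "- y"] by simp
  have into: "inverse \<mu> ^ n / \<mu> ^ n * c * w \<in> Z" if "n \<ge> N" "w \<in> W" for n w
  proof -
    have "norm (inverse \<mu> ^ n / \<mu> ^ n * c * w) = t ^ n * norm c * norm w" by (simp only: norm_mult ratio)
    also have "\<dots> \<le> t ^ N * norm c * 3"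
      using that t by (intro mult_mono power_decreasing) (auto simp: W_def)
    also have "\<dots> \<le> r" using N c0 by (simp add: field_simps)
    finally show ?thesis by (simp add: Z_def)
  qed
  have "mfree (Mat2 (\<mu> ^ N) 0 0 (inverse \<mu> ^ N) * g) (Mat2 (\<mu> ^ (N + j)) 0 0 (inverse \<mu> ^ (N + j)) * g)"
  proof (rule diagonal_ping_pong[where Z = Z and W = W])
    show "Z \<noteq> {}" using r by (auto simp: Z_def intro!: exI[of _ 0])
    show "1 + m12 g / m11 g * z \<noteq> 0 \<and> (1 + m22 g / m21 g * z) / (1 + m12 g / m11 g * z) \<in> W" if "z \<in> Z" for z
    proof -
      have 1: "1/2 \<le> norm (1 + m12 g / m11 g * z)" "norm (1 + m12 g / m11 g * z) \<le> 3/2"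
        "1/2 \<le> norm (1 + m22 g / m21 g * z)" "norm (1 + m22 g / m21 g * z) \<le> 3/2"
        using near half B that by blast+
      then have p: "norm (1 + m12 g / m11 g * z) > 0" by linarith
      have "1/3 \<le> norm (1 + m22 g / m21 g * z) / norm (1 + m12 g / m11 g * z)"
        "norm (1 + m22 g / m21 g * z) / norm (1 + m12 g / m11 g * z) \<le> 3"
        unfolding pos_le_divide_eq[OF p] pos_divide_le_eq[OF p] using 1 by linarith+
      then show ?thesis using p by (auto simp: W_def norm_divide)
    qed
    show "inverse \<mu> ^ N / \<mu> ^ N * w \<noteq> inverse \<mu> ^ (N + j) / \<mu> ^ (N + j) * w'" if w: "w \<in> W" "w' \<in> W" for w w'
    proof
      assume "inverse \<mu> ^ N / \<mu> ^ N * w = inverse \<mu> ^ (N + j) / \<mu> ^ (N + j) * w'"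
      from arg_cong[OF this, of norm] have "t ^ N * norm w = t ^ N * (t ^ j * norm w')"
        unfolding norm_mult ratio by (simp only: power_add mult.assoc)
      then have "norm w = t ^ j * norm w'" using t by simp
      also have "\<dots> \<le> t ^ j * 3" using w t by (intro mult_left_mono) (auto simp: W_def)
      also have "\<dots> < 1 / 3" using j by simp
      finally show False using w by (simp add: W_def)
    qed
    show "inverse \<mu> ^ N / \<mu> ^ N * (m21 g / m11 g) * w \<in> Z" "inverse \<mu> ^ (N + j) / \<mu> ^ (N + j) * (m21 g / m11 g) * w \<in> Z"
      if "w \<in> W" for w using into[OF _ that] by (auto simp: c_def)
  qed (use g \<mu> in auto)
  then show ?thesis unfolding diag_power by blast
qed

section \<open>Complex embeddings and Kronecker's theorem\<close>

lemma ipoly_more [simp]: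
  "ipoly (p - q) x = ipoly p x - ipoly q x" "ipoly (monom a n) x = of_int a * x ^ n"
proof -
  have "ipoly (p - q) x + ipoly q x = ipoly p x" by (simp flip: ipoly_simps(3))
  then show "ipoly (p - q) x = ipoly p x - ipoly q x" by (simp add: algebra_simps)
  show "ipoly (monom a n) x = of_int a * x ^ n" by (simp add: ipoly_def map_poly_monom poly_monom)
qed

definition integral_int :: "'a::field \<Rightarrow> bool" where
  "integral_int x \<longleftrightarrow> (\<exists>h. lead_coeff h = 1 \<and> ipoly h x = 0)"

lemma ipoly_reflect:
  fixes x :: "'a::field"
  assumes "x \<noteq> 0" shows "ipoly (reflect_poly g) x = x ^ degree g * ipoly g (inverse x)"
proof -
  have "ipoly (reflect_poly g) x = (\<Sum>i\<le>degree g. of_int (coeff (reflect_poly g) i) * x ^ i)"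
  proof -
    have "ipoly (reflect_poly g) x = (\<Sum>i\<le>degree (reflect_poly g). of_int (coeff (reflect_poly g) i) * x ^ i)"
      by (rule ipoly_eq_sum)
    also have "\<dots> = (\<Sum>i\<le>degree g. of_int (coeff (reflect_poly g) i) * x ^ i)"
      using degree_reflect_poly_le[of g] by (intro sum.mono_neutral_left) (auto simp: coeff_eq_0)
    finally show ?thesis .
  qed
  also have "\<dots> = (\<Sum>i\<le>degree g. of_int (coeff g (degree g - i)) * x ^ i)"
    by (intro sum.cong) (auto simp: coeff_reflect_poly)
  also have "\<dots> = (\<Sum>i\<le>degree g. of_int (coeff g i) * x ^ (degree g - i))"
    by (rule sum.reindex_bij_witness[of _ "\<lambda>i. degree g - i" "\<lambda>i. degree g - i"]) auto
  also have "\<dots> = (\<Sum>i\<le>degree g. x ^ degree g * (of_int (coeff g i) * inverse x ^ i))"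
    using assms by (intro sum.cong) (auto simp: power_diff power_inverse field_simps)
  also have "\<dots> = x ^ degree g * ipoly g (inverse x)" by (simp add: ipoly_eq_sum sum_distrib_left)
  finally show ?thesis .
qed

text \<open>If \<open>x\<close> is a polynomial in \<open>1/x\<close> of degree \<open>k\<close>,
  multiplication by \<open>x ^ k\<close> gives a monic equation of degree \<open>k + 1\<close>. By
  contraposition a nonintegral \<open>x\<close> provides what \<open>place_base_algebraic\<close>
  requires of \<open>1/x\<close>.\<close>

lemma integral_intI:
  fixes x :: "'a::field"
  assumes "x \<noteq> 0" "x \<in> range (\<lambda>h. ipoly h (inverse x))"
  shows "integral_int x"
proof -
  obtain g where g: "x = ipoly g (inverse x)" using assms(2) by auto
  define k where "k = degree g"
  define h where "h = monom 1 (Suc k) - reflect_poly g"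
  have c: "coeff (reflect_poly g) (Suc k) = 0"
    using degree_reflect_poly_le[of g] by (intro coeff_eq_0) (simp add: k_def)
  have "degree h \<le> Suc k"
    unfolding h_def using degree_reflect_poly_le[of g]
    by (intro degree_diff_le degree_monom_le) (simp add: k_def)
  moreover have ck: "coeff h (Suc k) = 1" using c by (simp add: h_def)
  ultimately have "degree h = Suc k" using le_degree[of h "Suc k"] by simp
  then have "lead_coeff h = 1" using ck by simp
  moreover have "ipoly h x = 0"
    using ipoly_reflect[OF assms(1), of g] by (simp add: h_def k_def flip: g)
  ultimately show ?thesis by (auto simp: integral_int_def)
qed

lemma of_int_in_subring:
  assumes "is_subring A" shows "of_int z \<in> A"
proof -
  have "of_nat n \<in> A" for n by (induction n) (auto intro: subring_closed[OF assms])
  then show ?thesis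
    by (cases z) (auto intro: subring_closed[OF assms] simp del: of_nat_Suc)
qed

lemma integral_int_in_valuation_ring:
  assumes "valuation_ring Ov" "integral_int x" shows "x \<in> Ov"
proof -
  interpret valuation_ring Ov by fact
  obtain h where h: "lead_coeff h = 1" "ipoly h x = 0" using assms by (auto simp: integral_int_def)
  have i: "of_int z \<in> Ov" for z :: int by (rule of_int_in_subring[OF subring])
  show ?thesis
  proof (rule integrally_closed)
    show "map_poly of_int h \<in> polys_over Ov" using i by (simp add: polys_over_def coeff_map_poly)
    have "degree (map_poly of_int h :: 'a poly) = degree h"
      by (rule map_poly_degree_eq) (simp add: h(1))
    then show "lead_coeff (map_poly of_int h :: 'a poly) = 1" using h(1) by (simp add: coeff_map_poly)
    show "poly (map_poly of_int h) x = 0" using h by (simp add: ipoly_def)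
  qed
qed

text \<open>Integral elements lie in all valuation rings, while \<open>Chevalley_extension\<close>
  separates a nonintegral element from some valuation ring. No equation for the power has to be
  computed.\<close>

lemma integral_int_power:
  fixes x :: "'a::field"
  assumes "integral_int x" "x \<noteq> 0" shows "integral_int (x ^ n)"
proof (rule integral_intI)
  let ?y = "x ^ n"
  show "?y \<noteq> 0" using assms by simp
  show "?y \<in> range (\<lambda>h. ipoly h (inverse ?y))"
  proof (rule ccontr)
    assume n: "\<not> ?thesis"
    let ?A = "adjoin (range of_int) (inverse ?y)"
    have "is_subring ?A" "inverse ?y \<in> ?A"
      using subring_adjoin[OF subring_range_of_int] adjoin_superset[OF subring_range_of_int] by auto
    then obtain Ov where O: "valuation_ring Ov" "?y \<notin> Ov"
      using Chevalley_extension[of ?A "inverse ?y"] n assms(2) by (auto simp: adjoin_range_of_int)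
    then have "x \<in> Ov" using integral_int_in_valuation_ring assms(1) by blast
    then have "?y \<in> Ov" using subring_closed(7) O(1) unfolding valuation_ring_def by blast
    then show False using O by simp
  qed
qed

text \<open>Gaussian elimination with cross multiplication in place of division, so that the
  solution stays in \<open>R\<close>, which may be the integers or a subfield.\<close>

lemma homogeneous_system_solution:
  fixes c :: "'i \<Rightarrow> 'j \<Rightarrow> 'a::idom"
  assumes R: "is_subring R" and "finite J" "finite I" "card J < card I"
    and "\<And>i j. i \<in> I \<Longrightarrow> j \<in> J \<Longrightarrow> c i j \<in> R"
  shows "\<exists>u. (\<forall>i\<in>I. u i \<in> R) \<and> (\<exists>i\<in>I. u i \<noteq> 0) \<and> (\<forall>j\<in>J. (\<Sum>i\<in>I. u i * c i j) = 0)"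
  using assms(2-5)
proof (induction J arbitrary: I c)
  case empty
  then have "I \<noteq> {}" by auto
  then show ?case using subring_closed[OF R] by (intro exI[of _ "\<lambda>_. 1"]) auto
next
  case (insert j J)
  note rc = subring_closed[OF R]
  show ?case
  proof (cases "\<forall>i\<in>I. c i j = 0")
    case True
    have "card J < card I" using insert.prems insert.hyps by simp
    then obtain u where "\<forall>i\<in>I. u i \<in> R" "\<exists>i\<in>I. u i \<noteq> 0" "\<forall>j\<in>J. (\<Sum>i\<in>I. u i * c i j) = 0"
      using insert.IH[OF insert.prems(1), of c] insert.prems(3) by blast
    then show ?thesis using True by (intro exI[of _ u]) auto
  next
    case False
    then obtain p where p: "p \<in> I" "c p j \<noteq> 0" by auto
    define I' where "I' = I - {p}"
    have I': "finite I'" "card J < card I'" "p \<notin> I'" "I = insert p I'"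
      using insert.prems insert.hyps p by (auto simp: I'_def card_Diff_singleton)
    \<comment> \<open>Equation \<open>j\<close> is used to eliminate the unknown \<open>p\<close>;
      these are the coefficients of the remaining system, scaled by the pivot
      \<open>c p j\<close>.\<close>
    define c' where "c' = (\<lambda>i l. c p j * c i l - c i j * c p l)"
    have c'R: "c' i l \<in> R" if "i \<in> I'" "l \<in> J" for i l
      using insert.prems(3) that p I'(4) rc by (auto simp: c'_def)
    obtain u' where u': "\<forall>i\<in>I'. u' i \<in> R" "\<exists>i\<in>I'. u' i \<noteq> 0" "\<forall>l\<in>J. (\<Sum>i\<in>I'. u' i * c' i l) = 0"
      using insert.IH[OF I'(1,2), of c'] c'R by blast
    define s where "s = (\<Sum>i\<in>I'. u' i * c i j)"
    \<comment> \<open>The unknown \<open>p\<close> is recovered from equation \<open>j\<close>, the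
      others being scaled by the pivot.\<close>
    define u where "u = (\<lambda>i. if i = p then - s else c p j * u' i)"
    have cI: "c i l \<in> R" if "i \<in> I" "l \<in> insert j J" for i l using insert.prems(3) that by blast
    have sR: "s \<in> R" unfolding s_def using u'(1) cI I'(4) rc by (intro subring_sum[OF R]) auto
    have uR: "\<forall>i\<in>I. u i \<in> R" using sR u'(1) cI p I'(4) rc by (auto simp: u_def)
    have sum: "(\<Sum>i\<in>I. u i * c i l) = - s * c p l + (\<Sum>i\<in>I'. c p j * u' i * c i l)" for l
    proof -
      have "(\<Sum>i\<in>I. u i * c i l) = u p * c p l + (\<Sum>i\<in>I'. u i * c i l)" using I' by simp
      also have "(\<Sum>i\<in>I'. u i * c i l) = (\<Sum>i\<in>I'. c p j * u' i * c i l)"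
        using I'(3) by (intro sum.cong) (auto simp: u_def)
      finally show ?thesis by (simp add: u_def)
    qed
    have "(\<Sum>i\<in>I. u i * c i l) = 0" if "l \<in> insert j J" for l
    proof (cases "l = j")
      case True
      have "(\<Sum>i\<in>I'. c p j * u' i * c i j) = c p j * s" by (simp add: s_def sum_distrib_left mult.assoc)
      then show ?thesis by (simp add: sum True mult.commute)
    next
      case False
      then have "0 = (\<Sum>i\<in>I'. u' i * c' i l)" using u' that by auto
      also have "\<dots> = (\<Sum>i\<in>I'. c p j * u' i * c i l) - (\<Sum>i\<in>I'. u' i * c i j * c p l)"
        by (simp add: c'_def algebra_simps sum_subtractf)
      also have "(\<Sum>i\<in>I'. u' i * c i j * c p l) = s * c p l" by (simp add: s_def sum_distrib_right)
      finally show ?thesis by (simp add: sum)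
    qed
    moreover have "\<exists>i\<in>I. u i \<noteq> 0" using u'(2) I'(3,4) p by (auto simp: u_def)
    ultimately show ?thesis using uR by blast
  qed
qed

text \<open>Multiplication by \<open>x\<close> shifts the coordinates, and the monic equation
  rewrites the top power.\<close>

lemma power_integral_combination:
  fixes x :: "'a::field"
  assumes h: "lead_coeff h = 1" "ipoly h x = 0" and d: "d = degree h" "d > 0"
  shows "\<exists>c. x ^ k = (\<Sum>j<d. of_int (c j) * x ^ j)"
proof (induction k)
  case 0
  have "(\<Sum>j<d. of_int (if j = 0 then 1 else 0) * x ^ j) = (\<Sum>j<d. if j = 0 then 1 else (0::'a))"
    by (intro sum.cong) auto
  also have "\<dots> = 1" using d(2) by simp
  finally show ?case by (intro exI[of _ "\<lambda>j. if j = 0 then 1 else 0"]) simp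
next
  case (Suc k)
  then obtain c where c: "x ^ k = (\<Sum>j<d. of_int (c j) * x ^ j)" by blast
  obtain e where e: "d = Suc e" using d(2) by (cases d) auto
  have "0 = (\<Sum>j\<le>d. of_int (coeff h j) * x ^ j)" using h(2) by (simp add: ipoly_eq_sum d)
  also have "\<dots> = (\<Sum>j<d. of_int (coeff h j) * x ^ j) + x ^ d"
    using h(1) by (simp add: lessThan_Suc_atMost[symmetric] d)
  finally have xd: "x ^ d = - (\<Sum>j<d. of_int (coeff h j) * x ^ j)" by (simp add: eq_neg_iff_add_eq_0 add.commute)
  define c' where "c' = (\<lambda>j. (if j = 0 then 0 else c (j - 1)) - c e * coeff h j)"
  have "x ^ Suc k = (\<Sum>j<d. of_int (c j) * x ^ Suc j)" by (simp add: c sum_distrib_left mult_ac)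
  also have "\<dots> = (\<Sum>j<e. of_int (c j) * x ^ Suc j) + of_int (c e) * x ^ d" by (simp add: e)
  also have "(\<Sum>j<e. of_int (c j) * x ^ Suc j) = (\<Sum>j<d. of_int (if j = 0 then 0 else c (j - 1)) * x ^ j)"
    unfolding e sum.lessThan_Suc_shift by simp
  also have "\<dots> + of_int (c e) * x ^ d = (\<Sum>j<d. of_int (c' j) * x ^ j)"
    by (simp add: xd c'_def sum_distrib_left sum_subtractf left_diff_distrib right_diff_distrib mult_ac)
  finally show ?case by blast
qed

text \<open>The powers of \<open>x ^ n\<close> with exponents up to \<open>degree h\<close>
  outnumber the \<open>degree h\<close> powers of \<open>x\<close> that span them, so they satisfy
  an integer relation. The degree bound does not depend on \<open>n\<close>.\<close>

lemma power_annihilator: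
  fixes x :: "'a::field"
  assumes h: "lead_coeff h = 1" "ipoly h x = 0" "degree h > 0"
  shows "\<exists>g. g \<noteq> 0 \<and> degree g \<le> degree h \<and> ipoly g (x ^ n) = 0"
proof -
  let ?d = "degree h"
  have "\<forall>i. \<exists>c. x ^ (n * i) = (\<Sum>j<?d. of_int (c j) * x ^ j)"
    using power_integral_combination[OF h(1,2) refl h(3)] by blast
  then obtain c :: "nat \<Rightarrow> nat \<Rightarrow> int" where c: "\<And>i. x ^ (n * i) = (\<Sum>j<?d. of_int (c i j) * x ^ j)" by metis
  obtain u where u: "\<exists>i\<in>{..?d}. u i \<noteq> 0" "\<forall>j\<in>{..<?d}. (\<Sum>i\<in>{..?d}. u i * c i j) = 0"
    using homogeneous_system_solution[of UNIV "{..<?d}" "{..?d}" c] by (auto simp: is_subring_def)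
  define g where "g = (\<Sum>i\<le>?d. monom (u i) i)"
  have cg: "coeff g i = (if i \<le> ?d then u i else 0)" for i by (simp add: g_def coeff_sum)
  have "g \<noteq> 0" using u(1) cg by (metis atMost_iff coeff_0)
  moreover have "degree g \<le> ?d" by (rule degree_le) (simp add: cg)
  moreover have "ipoly g (x ^ n) = 0"
  proof -
    have s: "ipoly (\<Sum>i\<in>A. f i) y = (\<Sum>i\<in>A. ipoly (f i) y)" for f y and A :: "nat set"
      by (induction A rule: infinite_finite_induct) auto
    have "ipoly g (x ^ n) = (\<Sum>i\<le>?d. of_int (u i) * x ^ (n * i))" by (simp add: g_def s power_mult)
    also have "\<dots> = (\<Sum>i\<le>?d. \<Sum>j<?d. of_int (u i * c i j) * x ^ j)"
      by (simp only: c sum_distrib_left of_int_mult mult.assoc)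
    also have "\<dots> = (\<Sum>j<?d. \<Sum>i\<le>?d. of_int (u i * c i j) * x ^ j)" by (rule sum.swap)
    also have "\<dots> = (\<Sum>j<?d. of_int (\<Sum>i\<le>?d. u i * c i j) * x ^ j)" by (simp add: sum_distrib_right)
    also have "\<dots> = 0" using u(2) by simp
    finally show ?thesis .
  qed
  ultimately show ?thesis by blast
qed

section \<open>Embeddings of countable rings into the complex numbers\<close>

definition ring_emb :: "'a::comm_ring_1 set \<Rightarrow> ('a \<Rightarrow> complex) \<Rightarrow> bool" where
  "ring_emb R \<phi> \<longleftrightarrow> is_subring R \<and> \<phi> 1 = 1 \<and>
     (\<forall>x\<in>R. \<forall>y\<in>R. \<phi> (x - y) = \<phi> x - \<phi> y \<and> \<phi> (x * y) = \<phi> x * \<phi> y) \<and> (\<forall>x\<in>R. \<phi> x = 0 \<longrightarrow> x = 0)"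

lemma ring_emb_simps:
  assumes "ring_emb R \<phi>"
  shows "is_subring R" "\<phi> 1 = 1" "\<phi> 0 = 0" "x \<in> R \<Longrightarrow> y \<in> R \<Longrightarrow> \<phi> (x - y) = \<phi> x - \<phi> y"
    "x \<in> R \<Longrightarrow> y \<in> R \<Longrightarrow> \<phi> (x * y) = \<phi> x * \<phi> y" "x \<in> R \<Longrightarrow> y \<in> R \<Longrightarrow> \<phi> (x + y) = \<phi> x + \<phi> y"
    "x \<in> R \<Longrightarrow> \<phi> (x ^ n) = \<phi> x ^ n" "x \<in> R \<Longrightarrow> \<phi> x = 0 \<longleftrightarrow> x = 0"
proof -
  show R: "is_subring R" and 1: "\<phi> 1 = 1" using assms by (auto simp: ring_emb_def)
  note c = subring_closed[OF R]
  have d: "\<phi> (x - y) = \<phi> x - \<phi> y" and m: "\<phi> (x * y) = \<phi> x * \<phi> y" if "x \<in> R" "y \<in> R" for x y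
    using assms that by (auto simp: ring_emb_def)
  show "x \<in> R \<Longrightarrow> y \<in> R \<Longrightarrow> \<phi> (x - y) = \<phi> x - \<phi> y" "x \<in> R \<Longrightarrow> y \<in> R \<Longrightarrow> \<phi> (x * y) = \<phi> x * \<phi> y"
    using d m by auto
  show 0: "\<phi> 0 = 0" using d[OF c(1) c(1)] by simp
  show "x \<in> R \<Longrightarrow> y \<in> R \<Longrightarrow> \<phi> (x + y) = \<phi> x + \<phi> y"
    using d[of "x + y" y] c(6) by simp
  show "x \<in> R \<Longrightarrow> \<phi> (x ^ n) = \<phi> x ^ n"
    by (induction n) (auto simp: 1 m c)
  show "x \<in> R \<Longrightarrow> \<phi> x = 0 \<longleftrightarrow> x = 0" using assms 0 by (auto simp: ring_emb_def)
qed

context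
  fixes R :: "'a::idom set" and \<phi> :: "'a \<Rightarrow> complex"
  assumes emb: "ring_emb R \<phi>"
begin

lemmas es = ring_emb_simps[OF emb]
lemmas rc = subring_closed[OF es(1)]

lemma emb_poly_hom:
  assumes "p \<in> polys_over R" "q \<in> polys_over R"
  shows "map_poly \<phi> (p - q) = map_poly \<phi> p - map_poly \<phi> q" "map_poly \<phi> (p * q) = map_poly \<phi> p * map_poly \<phi> q"
    "map_poly \<phi> (p + q) = map_poly \<phi> p + map_poly \<phi> q" "c \<in> R \<Longrightarrow> map_poly \<phi> (smult c p) = smult (\<phi> c) (map_poly \<phi> p)"
proof -
  have pq: "coeff p i \<in> R" "coeff q i \<in> R" for i using assms by (auto simp: polys_over_def)
  show "map_poly \<phi> (p - q) = map_poly \<phi> p - map_poly \<phi> q" "map_poly \<phi> (p + q) = map_poly \<phi> p + map_poly \<phi> q"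
    "c \<in> R \<Longrightarrow> map_poly \<phi> (smult c p) = smult (\<phi> c) (map_poly \<phi> p)"
    by (intro poly_eqI; simp add: coeff_map_poly es pq)+
  have s: "\<phi> (sum f A) = (\<Sum>x\<in>A. \<phi> (f x))" if "\<And>x. x \<in> A \<Longrightarrow> f x \<in> R" for f and A :: "nat set"
    using that
  proof (induction A rule: infinite_finite_induct)
    case (insert x F)
    then have "sum f F \<in> R" by (intro subring_sum[OF es(1)]) auto
    then show ?case using insert by (simp add: es)
  qed (simp_all add: es)
  show "map_poly \<phi> (p * q) = map_poly \<phi> p * map_poly \<phi> q"
    by (intro poly_eqI) (simp add: coeff_map_poly coeff_mult s es pq rc)
qed

lemma emb_degree: "p \<in> polys_over R \<Longrightarrow> degree (map_poly \<phi> p) = degree p"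
  by (cases "p = 0") (auto intro!: map_poly_degree_eq simp: es polys_over_def)

text \<open>Since \<open>r\<close> satisfies the same relations as \<open>y\<close>, the image of an
  element does not depend on the polynomial chosen to represent it.\<close>

lemma emb_extend:
  assumes iff: "\<And>p. p \<in> polys_over R \<Longrightarrow> poly p y = 0 \<longleftrightarrow> poly (map_poly \<phi> p) r = 0"
  shows "\<exists>\<psi>. ring_emb (adjoin R y) \<psi> \<and> (\<forall>x\<in>R. \<psi> x = \<phi> x) \<and> \<psi> y = r"
proof -
  define \<psi> where "\<psi> = (\<lambda>x. poly (map_poly \<phi> (SOME p. p \<in> polys_over R \<and> x = poly p y)) r)"
  have \<psi>: "\<psi> (poly p y) = poly (map_poly \<phi> p) r" if p: "p \<in> polys_over R" for p
  proof -
    define q where "q = (SOME q. q \<in> polys_over R \<and> poly p y = poly q y)"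
    have q: "q \<in> polys_over R \<and> poly p y = poly q y" unfolding q_def by (rule someI[of _ p]) (use p in auto)
    then have "poly (p - q) y = 0" by simp
    then have "poly (map_poly \<phi> (p - q)) r = 0" using iff[of "p - q"] polys_over_closed(3)[OF es(1)] p q by blast
    then have "poly (map_poly \<phi> p) r = poly (map_poly \<phi> q) r" using emb_poly_hom(1)[OF p, of q] q by simp
    moreover have "\<psi> (poly p y) = poly (map_poly \<phi> q) r" by (simp only: \<psi>_def q_def)
    ultimately show ?thesis by simp
  qed
  have "ring_emb (adjoin R y) \<psi>" unfolding ring_emb_def
  proof (intro conjI ballI impI)
    show "is_subring (adjoin R y)" by (rule subring_adjoin[OF es(1)])
    show "\<psi> 1 = 1" using \<psi>[of 1] polys_over_closed(2)[OF es(1)] by (simp add: one_pCons map_poly_pCons es)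
    fix u v assume "u \<in> adjoin R y" "v \<in> adjoin R y"
    then obtain p q where pq: "p \<in> polys_over R" "q \<in> polys_over R" "u = poly p y" "v = poly q y" by (auto simp: adjoin_def)
    note pc = polys_over_closed[OF es(1)]
    show "\<psi> (u - v) = \<psi> u - \<psi> v"
      using \<psi>[of "p - q"] \<psi>[of p] \<psi>[of q] pq pc emb_poly_hom[OF pq(1,2)] by simp
    show "\<psi> (u * v) = \<psi> u * \<psi> v"
      using \<psi>[of "p * q"] \<psi>[of p] \<psi>[of q] pq pc emb_poly_hom[OF pq(1,2)] by simp
  next
    fix u assume "u \<in> adjoin R y" "\<psi> u = 0"
    then show "u = 0" using \<psi> iff by (auto simp: adjoin_def)
  qed
  moreover have "\<psi> x = \<phi> x" if "x \<in> R" for x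
    using \<psi>[of "[:x:]"] that polys_over_closed(1)[OF es(1)] by (simp add: map_poly_pCons es)
  moreover have "\<psi> y = r"
    using \<psi>[of "[:0, 1:]"] rc polys_over_closed(1)[OF es(1)] by (simp add: map_poly_pCons es)
  ultimately show ?thesis by blast
qed

text \<open>The coefficients form a ring only, so division is possible up to a nonzero factor from
  \<open>R\<close>.\<close>

lemma poly_pseudo_division:
  assumes g: "g \<in> polys_over R" "g \<noteq> 0"
  shows "f \<in> polys_over R \<Longrightarrow> \<exists>a\<in>R. \<exists>q\<in>polys_over R. \<exists>r\<in>polys_over R.
    a \<noteq> 0 \<and> smult a f = g * q + r \<and> (r = 0 \<or> degree r < degree g)"
proof (induction "degree f" arbitrary: f rule: less_induct)
  case less
  note pc = polys_over_closed[OF es(1)]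
  show ?case
  proof (cases "f = 0 \<or> degree f < degree g")
    case True
    then show ?thesis using less.prems pc rc by (intro bexI[of _ 1] bexI[of _ 0] bexI[of _ f]) auto
  next
    case False
    define c where "c = lead_coeff g"
    define m where "m = monom (lead_coeff f) (degree f - degree g)"
    have cR: "c \<in> R" "lead_coeff f \<in> R" using g less.prems by (auto simp: c_def polys_over_def)
    have mR: "m \<in> polys_over R" using cR pc by (simp add: m_def)
    have c0: "c \<noteq> 0" using g by (simp add: c_def)
    define f' where "f' = smult c f - g * m"
    have f'R: "f' \<in> polys_over R" unfolding f'_def using cR g less.prems mR by (intro pc)
    have "degree m = degree f - degree g" using False by (auto simp: m_def degree_monom_eq)
    then have dgm: "degree (g * m) = degree f" "g * m \<noteq> 0"
      using False g by (auto simp: degree_mult_eq m_def)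
    have lgm: "coeff (g * m) (degree f) = c * lead_coeff f"
      using lead_coeff_mult[of g m] dgm(1) False by (simp add: c_def m_def degree_monom_eq)
    have f'0: "f' = 0 \<or> degree f' < degree f"
    proof (cases "f' = 0")
      case False
      have "degree f' \<le> degree f" unfolding f'_def using dgm by (intro degree_diff_le) auto
      moreover have "coeff f' (degree f) = 0" by (simp add: f'_def lgm)
      then have "degree f' \<noteq> degree f" using False leading_coeff_0_iff by metis
      ultimately show ?thesis by simp
    qed simp
    have "\<exists>a\<in>R. \<exists>q\<in>polys_over R. \<exists>r\<in>polys_over R. a \<noteq> 0 \<and> smult a f' = g * q + r \<and> (r = 0 \<or> degree r < degree g)"
    proof (cases "f' = 0")
      case True
      then show ?thesis using pc rc by (intro bexI[of _ 1] bexI[of _ 0]) auto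
    next
      case False
      then show ?thesis using less.hyps[of f'] f'0 f'R by blast
    qed
    then obtain a q r where *: "a \<in> R" "q \<in> polys_over R" "r \<in> polys_over R" "a \<noteq> 0" "smult a f' = g * q + r"
      "r = 0 \<or> degree r < degree g" by blast
    have "smult (a * c) f = smult a f' + smult a (g * m)" by (simp add: f'_def smult_diff_right)
    also have "\<dots> = g * (q + smult a m) + r" by (simp add: *(5) distrib_left)
    finally have "smult (a * c) f = g * (q + smult a m) + r" .
    moreover have "a * c \<in> R" "q + smult a m \<in> polys_over R" using * cR mR rc pc by auto
    ultimately show ?thesis using * c0 by (intro bexI[of _ "a * c"] bexI[of _ "q + smult a m"] bexI[of _ r]) auto
  qed
qed

text \<open>Any root \<open>r\<close> of the image of \<open>m\<close> can serve as the image of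
  \<open>y\<close>. One direction is pseudo-division by \<open>m\<close>. For the other, a
  polynomial \<open>n\<close> of least degree vanishing at \<open>r\<close> divides \<open>m\<close>
  up to a factor from \<open>R\<close>; if it did not vanish at \<open>y\<close>, the minimality of
  \<open>m\<close> would make it a nonzero constant with image zero.\<close>

lemma algebraic_iff:
  assumes m: "m \<in> polys_over R" "m \<noteq> 0" "poly m y = 0"
    and min: "\<And>p. p \<in> polys_over R \<Longrightarrow> p \<noteq> 0 \<Longrightarrow> poly p y = 0 \<Longrightarrow> degree m \<le> degree p"
    and r: "poly (map_poly \<phi> m) r = 0" and p: "p \<in> polys_over R"
  shows "poly p y = 0 \<longleftrightarrow> poly (map_poly \<phi> p) r = 0"
proof -
  note pc = polys_over_closed[OF es(1)]
  have fwd: "poly (map_poly \<phi> p) r = 0" if p: "p \<in> polys_over R" "poly p y = 0" for p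
  proof -
    obtain a q s where *: "a \<in> R" "q \<in> polys_over R" "s \<in> polys_over R" "a \<noteq> 0" "smult a p = m * q + s"
      "s = 0 \<or> degree s < degree m" using poly_pseudo_division[OF m(1,2) p(1)] by blast
    have "poly s y = 0" using arg_cong[OF *(5), of "\<lambda>f. poly f y"] p(2) m(3) by simp
    then have "s = 0" using min[OF *(3)] *(6) by fastforce
    then have "smult (\<phi> a) (map_poly \<phi> p) = map_poly \<phi> m * map_poly \<phi> q"
      using *(5) emb_poly_hom(4)[OF p(1) p(1) *(1)] emb_poly_hom(2)[OF m(1) *(2)] by simp
    then have "\<phi> a * poly (map_poly \<phi> p) r = 0" using r by (metis poly_mult poly_smult mult_zero_left)
    then show ?thesis using *(1,4) es(8) by simp
  qed
  define K where "K = (\<lambda>n. n \<in> polys_over R \<and> n \<noteq> 0 \<and> poly (map_poly \<phi> n) r = 0)"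
  have "K m" using m r by (simp add: K_def)
  then obtain n where n: "K n" "\<And>k. K k \<Longrightarrow> degree n \<le> degree k"
    using ex_has_least_nat[of K m degree] by blast
  have dv: "\<exists>a q. a \<in> R \<and> a \<noteq> 0 \<and> q \<in> polys_over R \<and> smult a f = n * q"
    if f: "f \<in> polys_over R" "poly (map_poly \<phi> f) r = 0" for f
  proof -
    obtain a q s where *: "a \<in> R" "q \<in> polys_over R" "s \<in> polys_over R" "a \<noteq> 0" "smult a f = n * q + s"
      "s = 0 \<or> degree s < degree n" using poly_pseudo_division[of n f] n(1) f(1) by (auto simp: K_def)
    have "smult (\<phi> a) (map_poly \<phi> f) = map_poly \<phi> n * map_poly \<phi> q + map_poly \<phi> s"
      using *(5) emb_poly_hom(4)[OF f(1) f(1) *(1)] emb_poly_hom(2)[of n q] emb_poly_hom(3)[of "n * q" s] * n(1) pc(5)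
      by (simp add: K_def)
    from arg_cong[OF this, of "\<lambda>f. poly f r"] have "poly (map_poly \<phi> s) r = 0" using f(2) n(1) by (simp add: K_def)
    then have "s = 0" using n(2)[of s] *(3,6) by (force simp: K_def)
    then show ?thesis using * by auto
  qed
  have ny: "poly n y = 0"
  proof (rule ccontr)
    assume ny: "poly n y \<noteq> 0"
    obtain a q where *: "a \<in> R" "a \<noteq> 0" "q \<in> polys_over R" "smult a m = n * q" using dv[OF m(1) r] by blast
    have q0: "q \<noteq> 0" using * m(2) by auto
    have "poly n y * poly q y = 0" using arg_cong[OF *(4), of "\<lambda>f. poly f y"] m(3) by simp
    then have "degree m \<le> degree q" using ny min[OF *(3) q0] by simp
    moreover have "degree m = degree n + degree q"
      using arg_cong[OF *(4), of degree] *(2) q0 n(1) by (simp add: degree_mult_eq K_def)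
    ultimately have "degree n = 0" by simp
    then obtain c where c: "n = [:c:]" by (metis degree_eq_zeroE)
    then have "c \<in> R" "c \<noteq> 0" "\<phi> c = 0" using n(1) by (auto simp: K_def map_poly_pCons es)
    then show False using es(8) by simp
  qed
  show ?thesis
  proof
    assume "poly (map_poly \<phi> p) r = 0"
    then obtain a q where *: "a \<in> R" "a \<noteq> 0" "smult a p = n * q" using dv[OF p] by blast
    have "a * poly p y = poly n y * poly q y" using arg_cong[OF *(3), of "\<lambda>f. poly f y"] by simp
    then show "poly p y = 0" using ny *(2) by simp
  qed (use fwd p in blast)
qed

lemma countable_adjoin: "countable R \<Longrightarrow> countable (polys_over R)" "countable R \<Longrightarrow> countable (adjoin R y)"
proof -
  assume R: "countable R"
  have "polys_over R \<subseteq> Poly ` lists R"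
  proof
    fix p assume "p \<in> polys_over R"
    then have "coeffs p \<in> lists R" by (auto simp: polys_over_def coeffs_def)
    then show "p \<in> Poly ` lists R" by (metis Poly_coeffs imageI)
  qed
  then show "countable (polys_over R)" using countable_lists[OF R] by (metis countable_image countable_subset)
  then show "countable (adjoin R y)" by (simp add: adjoin_def)
qed

text \<open>An algebraic \<open>y\<close> goes to a root of its least polynomial. A transcendental
  \<open>y\<close> needs an image that is transcendental over the image of \<open>R\<close>; one
  exists since the polynomials over a countable \<open>R\<close> have only countably many roots
  together.\<close>

lemma emb_extend_any:
  assumes "countable R"
  shows "\<exists>\<psi>. ring_emb (adjoin R y) \<psi> \<and> (\<forall>x\<in>R. \<psi> x = \<phi> x)"
proof (cases "\<exists>p. p \<in> polys_over R \<and> p \<noteq> 0 \<and> poly p y = 0")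
  case True
  then obtain m where m: "m \<in> polys_over R \<and> m \<noteq> 0 \<and> poly m y = 0"
    "\<And>p. p \<in> polys_over R \<and> p \<noteq> 0 \<and> poly p y = 0 \<Longrightarrow> degree m \<le> degree p"
    using ex_has_least_nat[of "\<lambda>p. p \<in> polys_over R \<and> p \<noteq> 0 \<and> poly p y = 0" _ degree] by blast
  have "degree m > 0"
  proof (rule ccontr)
    assume "\<not> ?thesis"
    then obtain c where "m = [:c:]" using degree_eq_zeroE by blast
    then show False using m(1) by auto
  qed
  then have "degree (map_poly \<phi> m) > 0" using m(1) emb_degree by simp
  then obtain r where r: "poly (map_poly \<phi> m) r = 0" using alg_closed_imp_poly_has_root by blast
  show ?thesis using emb_extend[of y r] algebraic_iff[of m y r] m r by blast
next
  case False
  define bad where "bad = (\<Union>p\<in>polys_over R - {0}. {r. poly (map_poly \<phi> p) r = 0})"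
  have nz: "map_poly \<phi> p \<noteq> 0" if "p \<in> polys_over R" "p \<noteq> 0" for p
  proof -
    have "coeff (map_poly \<phi> p) (degree p) \<noteq> 0" using that es by (simp add: coeff_map_poly polys_over_def)
    then show ?thesis by auto
  qed
  have "countable bad" unfolding bad_def
    using countable_adjoin(1)[OF assms] nz
    by (intro countable_UN) (auto intro!: countable_finite poly_roots_finite)
  moreover have "uncountable (UNIV :: complex set)"
  proof
    assume "countable (UNIV :: complex set)"
    then have "countable (range complex_of_real)" by (rule countable_subset[rotated]) simp
    then have "countable (UNIV :: real set)" using countable_image_inj_on[of complex_of_real UNIV] by (simp add: inj_of_real)
    then show False using uncountable_UNIV_real by simp
  qed
  ultimately obtain r where r: "r \<notin> bad" by (metis UNIV_eq_I)
  have "poly p y = 0 \<longleftrightarrow> poly (map_poly \<phi> p) r = 0" if "p \<in> polys_over R" for p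
  proof (cases "p = 0")
    case False
    then show ?thesis using \<open>\<nexists>p. _ p\<close> r that by (auto simp: bad_def)
  qed simp
  then show ?thesis using emb_extend by blast
qed

end

lemma emb_extend_finite:
  fixes R :: "'a::idom set"
  assumes "finite Y" "ring_emb R \<phi>" "countable R"
  shows "\<exists>R' \<psi>. ring_emb R' \<psi> \<and> countable R' \<and> R \<subseteq> R' \<and> Y \<subseteq> R' \<and> (\<forall>x\<in>R. \<psi> x = \<phi> x)"
  using assms(1)
proof (induction Y)
  case empty
  then show ?case using assms by blast
next
  case (insert y Y)
  then obtain R' \<psi> where *: "ring_emb R' \<psi>" "countable R'" "R \<subseteq> R'" "Y \<subseteq> R'" "\<forall>x\<in>R. \<psi> x = \<phi> x" by blast
  obtain \<theta> where \<theta>: "ring_emb (adjoin R' y) \<theta>" "\<forall>x\<in>R'. \<theta> x = \<psi> x"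
    using emb_extend_any[OF *(1,2), of y] by blast
  have "countable (adjoin R' y)" using countable_adjoin(2)[OF *(1,2)] .
  moreover have "R' \<subseteq> adjoin R' y" "y \<in> adjoin R' y"
    using adjoin_superset[OF ring_emb_simps(1)[OF *(1)]] by auto
  ultimately show ?case using * \<theta>
    by (intro exI[of _ "adjoin R' y"] exI[of _ \<theta>]) auto
qed

section \<open>Kronecker's theorem\<close>

lemma ring_emb_of_int:
  assumes char0: "\<And>n::int. of_int n = (0::'a::comm_ring_1) \<Longrightarrow> n = 0"
  shows "\<exists>\<phi>. ring_emb (range (of_int :: int \<Rightarrow> 'a)) \<phi> \<and> (\<forall>z. \<phi> (of_int z) = of_int z)"
proof -
  have inj: "inj (of_int :: int \<Rightarrow> 'a)"
  proof (rule injI)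
    fix x y :: int assume "of_int x = (of_int y :: 'a)"
    then have "of_int (x - y) = (0::'a)" by simp
    then show "x = y" using char0[of "x - y"] by simp
  qed
  define \<phi> where "\<phi> = (\<lambda>x::'a. complex_of_int (inv_into UNIV of_int x))"
  have \<phi>: "\<phi> (of_int z) = of_int z" for z by (simp add: \<phi>_def inj)
  have "ring_emb (range (of_int :: int \<Rightarrow> 'a)) \<phi>" unfolding ring_emb_def
  proof (intro conjI ballI impI)
    show "is_subring (range (of_int :: int \<Rightarrow> 'a))" by (rule subring_range_of_int)
    show "\<phi> 1 = 1" using \<phi>[of 1] by simp
    fix x y :: 'a assume "x \<in> range of_int" "y \<in> range of_int"
    then obtain a b where ab: "x = of_int a" "y = of_int b" by auto
    show "\<phi> (x - y) = \<phi> x - \<phi> y" using \<phi>[of "a - b"] by (simp add: ab \<phi>)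
    show "\<phi> (x * y) = \<phi> x * \<phi> y" using \<phi>[of "a * b"] by (simp add: ab \<phi>)
  next
    fix x :: 'a assume "x \<in> range of_int" "\<phi> x = 0"
    then show "x = 0" using \<phi> by auto
  qed
  then show ?thesis using \<phi> by blast
qed

text \<open>A linear factor whose root lies in the unit disc at most doubles the bound on the
  coefficients.\<close>

lemma coeff_bound_from_roots:
  fixes p :: "complex poly"
  assumes "norm (lead_coeff p) = 1" "\<And>r. poly p r = 0 \<Longrightarrow> norm r \<le> 1"
  shows "norm (coeff p i) \<le> 2 ^ degree p"
  using assms
proof (induction "degree p" arbitrary: p i)
  case 0
  then obtain c where "p = [:c:]" by (metis degree_eq_zeroE)
  then show ?case using 0 by (cases i) auto
next
  case (Suc n)
  then obtain r where r: "poly p r = 0" using alg_closed_imp_poly_has_root[of p] by auto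
  then obtain q where q: "p = [:- r, 1:] * q" by (metis dvdE poly_eq_0_iff_dvd)
  have q0: "q \<noteq> 0" using Suc.prems(1) q by auto
  have dq: "degree p = Suc (degree q)" unfolding q using q0 by (subst degree_mult_eq) auto
  have nr: "norm r \<le> 1" using Suc.prems(2) r by simp
  have lq: "norm (lead_coeff q) = 1" using Suc.prems(1) unfolding q lead_coeff_mult by simp
  have IH: "norm (coeff q j) \<le> 2 ^ degree q" for j
    using Suc.hyps(1)[of q] Suc.hyps(2) dq lq Suc.prems(2) by (simp add: q)
  have c: "coeff p i = (if i = 0 then 0 else coeff q (i - 1)) - r * coeff q i"
    by (cases i) (simp_all add: q)
  have "norm (coeff p i) \<le> norm (if i = 0 then 0 else coeff q (i - 1)) + norm (r * coeff q i)"
    unfolding c by (rule norm_triangle_ineq4)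
  also have "norm (if i = 0 then 0 else coeff q (i - 1)) \<le> 2 ^ degree q" using IH by auto
  also have "norm (r * coeff q i) \<le> 1 * 2 ^ degree q"
    unfolding norm_mult using IH nr by (intro mult_mono) auto
  finally show ?case by (simp add: dq)
qed

lemma finite_bounded_int_polys: "finite {p :: int poly. degree p \<le> d \<and> (\<forall>i. \<bar>coeff p i\<bar> \<le> B)}"
proof -
  have "{p :: int poly. degree p \<le> d \<and> (\<forall>i. \<bar>coeff p i\<bar> \<le> B)} \<subseteq>
      (\<lambda>f. \<Sum>i\<le>d. monom (f i) i) ` ({..d} \<rightarrow>\<^sub>E {- B..B})"
  proof
    fix p :: "int poly" assume p: "p \<in> {p. degree p \<le> d \<and> (\<forall>i. \<bar>coeff p i\<bar> \<le> B)}"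
    define f where "f = (\<lambda>i\<in>{..d}. coeff p i)"
    have "- B \<le> coeff p i \<and> coeff p i \<le> B" for i using p by (simp add: abs_le_iff) (metis minus_le_iff)
    then have "f \<in> {..d} \<rightarrow>\<^sub>E {- B..B}" by (auto simp: f_def)
    moreover have "p = (\<Sum>i\<le>d. monom (f i) i)"
      using poly_as_sum_of_monoms'[of p d] p by (simp add: f_def)
    ultimately show "p \<in> (\<lambda>f. \<Sum>i\<le>d. monom (f i) i) ` ({..d} \<rightarrow>\<^sub>E {- B..B})" by blast
  qed
  then show ?thesis by (rule finite_subset) (intro finite_imageI finite_PiE, auto)
qed

text \<open>Gauss's lemma through contents: if the primitive \<open>n\<close> divides
  \<open>a\<close> times a monic \<open>h\<close>, the cofactor has content \<open>a\<close> up to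
  sign. So \<open>a\<close> cancels from the leading coefficients, and that of \<open>n\<close>
  divides 1.\<close>

lemma minimal_int_poly_monic:
  fixes x :: "'a::field"
  assumes char0: "\<And>n::int. of_int n = (0::'a) \<Longrightarrow> n = 0" and x: "integral_int x"
  shows "\<exists>n::int poly. n \<noteq> 0 \<and> ipoly n x = 0 \<and> \<bar>lead_coeff n\<bar> = 1 \<and>
    (\<forall>g. g \<noteq> 0 \<longrightarrow> ipoly g x = 0 \<longrightarrow> degree n \<le> degree g)"
proof -
  obtain h where h: "lead_coeff h = 1" "ipoly h x = 0" using x by (auto simp: integral_int_def)
  then have h0: "h \<noteq> 0" by auto
  obtain n0 where n0: "n0 \<noteq> 0 \<and> ipoly n0 x = 0" "\<And>g. g \<noteq> 0 \<and> ipoly g x = 0 \<Longrightarrow> degree n0 \<le> degree g"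
    using ex_has_least_nat[of "\<lambda>g. g \<noteq> 0 \<and> ipoly g x = 0" h degree] h h0 by blast
  define n where "n = primitive_part n0"
  have eq: "n0 = smult (content n0) n" by (simp add: n_def content_times_primitive_part)
  have c0: "content n0 \<noteq> 0" using n0(1) by simp
  have n: "n \<noteq> 0" "content n = 1" "degree n = degree n0" using n0(1) by (auto simp: n_def content_primitive_part)
  have "of_int (content n0) * ipoly n x = 0" using n0(1) eq by (metis ipoly_simps(5))
  then have nx: "ipoly n x = 0" using char0[of "content n0"] c0 by auto
  have min: "degree n \<le> degree g" if "g \<noteq> 0" "ipoly g x = 0" for g using n0(2)[of g] that n(3) by simp
  obtain a q r where *: "a \<noteq> 0" "smult a h = n * q + r" "r = 0 \<or> degree r < degree n"
    using ipoly_pseudo_mod[OF n(1)] by blast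
  have "ipoly r x = 0" using arg_cong[OF *(2), of "\<lambda>p. ipoly p x"] h nx by simp
  then have r: "r = 0" using min[of r] *(3) by fastforce
  have "content h dvd coeff h (degree h)" by (rule content_dvd_coeff)
  then have ch: "content h = 1"
    using h(1) by (metis is_unit_content_iff)
  have "content (smult a h) = content (n * q)" using *(2) r by simp
  then have "normalize a = content q" by (simp add: content_mult n(2) ch)
  then have "a dvd lead_coeff q" using content_dvd_coeff[of q "degree q"] by (metis normalize_dvd_iff)
  then obtain t where t: "lead_coeff q = a * t" by (auto elim!: dvdE)
  have "a * 1 = lead_coeff n * lead_coeff q"
    using arg_cong[OF *(2), of lead_coeff] *(1) r h(1) by (simp add: lead_coeff_mult lead_coeff_smult)
  then have "a * 1 = a * (lead_coeff n * t)" unfolding t by (simp only: mult_ac)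
  then have "lead_coeff n * t = 1" using *(1) mult_left_cancel by metis
  then have "lead_coeff n dvd 1" by (metis dvd_triv_left)
  then have "\<bar>lead_coeff n\<bar> = 1" by simp
  then show ?thesis using n nx min by blast
qed

text \<open>Kronecker's theorem: otherwise the powers of \<open>\<mu>\<close> would have monic integral minimal polynomials
  of bounded degree with all complex roots in the unit disc, and there are only finitely many of these.\<close>

theorem exists_expanding_embedding:
  fixes \<mu> :: "'a::field"
  assumes char0: "\<And>n::int. of_int n = (0::'a) \<Longrightarrow> n = 0"
    and \<mu>: "integral_int \<mu>" "\<mu> \<noteq> 0" "\<not> torsion \<mu>"
  shows "\<exists>R \<phi>. ring_emb R \<phi> \<and> countable R \<and> \<mu> \<in> R \<and> norm (\<phi> \<mu>) > 1"
proof (rule ccontr)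
  assume "\<not> ?thesis"
  then have small: "norm (\<phi> \<mu>) \<le> 1" if "ring_emb R \<phi>" "countable R" "\<mu> \<in> R" for R \<phi>
    using that by force
  obtain h where h: "lead_coeff h = 1" "ipoly h \<mu> = 0" using \<mu> by (auto simp: integral_int_def)
  have dh: "degree h > 0"
  proof (rule ccontr)
    assume "\<not> ?thesis"
    then obtain c where "h = [:c:]" using degree_eq_zeroE by blast
    then show False using h by auto
  qed
  let ?d = "degree h"
  define P where "P = {p :: int poly. degree p \<le> ?d \<and> (\<forall>i. \<bar>coeff p i\<bar> \<le> 2 ^ ?d)}"
  have pow: "\<exists>n\<in>P - {0}. ipoly n (\<mu> ^ N) = 0" for N
  proof -
    let ?x = "\<mu> ^ N"
    obtain n where n: "n \<noteq> 0" "ipoly n ?x = 0" "\<bar>lead_coeff n\<bar> = 1" "\<And>g. g \<noteq> 0 \<Longrightarrow> ipoly g ?x = 0 \<Longrightarrow> degree n \<le> degree g"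
      using minimal_int_poly_monic[OF char0 integral_int_power[OF \<mu>(1,2)], of N] by blast
    obtain g where "g \<noteq> 0" "degree g \<le> ?d" "ipoly g ?x = 0" using power_annihilator[OF h dh, of N] by blast
    then have dn: "degree n \<le> ?d" using n(4) by fastforce
    obtain \<phi> where \<phi>: "ring_emb (range (of_int :: int \<Rightarrow> 'a)) \<phi>" "\<And>z. \<phi> (of_int z) = of_int z"
      using ring_emb_of_int[where 'a = 'a] char0 by blast
    let ?Z = "range (of_int :: int \<Rightarrow> 'a)"
    let ?n = "map_poly of_int n :: 'a poly" and ?nc = "map_poly of_int n :: complex poly"
    have mp: "map_poly \<phi> (map_poly of_int p) = map_poly of_int p" for p
      by (intro poly_eqI) (simp add: coeff_map_poly \<phi>(2) ring_emb_simps(3)[OF \<phi>(1)])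
    have nzp: "map_poly of_int p = (0 :: 'a poly) \<longleftrightarrow> p = 0" for p
      using char0 by (auto simp: poly_eq_iff coeff_map_poly)
    have degp: "degree (map_poly of_int p :: 'a poly) = degree p" for p
      by (cases "p = 0") (auto intro!: map_poly_degree_eq dest: char0)
    \<comment> \<open>A root \<open>r\<close> of the minimal polynomial of \<open>\<mu> ^ N\<close>
      is the image of \<open>\<mu> ^ N\<close> under an embedding. Extending the embedding to
      \<open>\<mu>\<close> shows that \<open>r\<close> is the \<open>N\<close>-th power of a number
      of norm at most 1.\<close>
    have root: "norm r \<le> 1" if r: "poly ?nc r = 0" for r
    proof -
      have iff: "poly p ?x = 0 \<longleftrightarrow> poly (map_poly \<phi> p) r = 0" if p: "p \<in> polys_over ?Z" for p
      proof (rule algebraic_iff[OF \<phi>(1), of ?n])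
        show "?n \<in> polys_over ?Z" by (auto simp: polys_over_range_of_int)
        show "?n \<noteq> 0" using n(1) nzp by simp
        show "poly ?n ?x = 0" using n(2) by (simp add: ipoly_def)
        show "poly (map_poly \<phi> ?n) r = 0" using r by (simp add: mp)
        show "degree ?n \<le> degree q" if q: "q \<in> polys_over ?Z" "q \<noteq> 0" "poly q ?x = 0" for q
        proof -
          obtain g where g: "q = map_poly of_int g" using q(1) by (auto simp: polys_over_range_of_int)
          then have "g \<noteq> 0" "ipoly g ?x = 0" using q by (auto simp: ipoly_def)
          then show ?thesis using n(4) g by (simp add: degp)
        qed
      qed (use p in auto)
      obtain \<psi> where \<psi>: "ring_emb (adjoin ?Z ?x) \<psi>" "\<psi> ?x = r" using emb_extend[OF \<phi>(1), of ?x r] iff by blast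
      have cZ: "countable (adjoin ?Z ?x)" using countable_adjoin(2)[OF \<phi>(1)] by simp
      obtain \<theta> where \<theta>: "ring_emb (adjoin (adjoin ?Z ?x) \<mu>) \<theta>" "\<forall>y\<in>adjoin ?Z ?x. \<theta> y = \<psi> y"
        using emb_extend_any[OF \<psi>(1) cZ, of \<mu>] by blast
      have mem: "?x \<in> adjoin ?Z ?x" "\<mu> \<in> adjoin (adjoin ?Z ?x) \<mu>"
        using adjoin_superset subring_range_of_int ring_emb_simps(1)[OF \<psi>(1)] by blast+
      have "norm (\<theta> \<mu>) \<le> 1"
        using small[OF \<theta>(1)] mem countable_adjoin(2)[OF \<psi>(1) cZ] by blast
      moreover have "r = \<theta> \<mu> ^ N"
        using \<theta>(2) mem \<psi>(2) ring_emb_simps(7)[OF \<theta>(1) mem(2), of N] by simp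
      ultimately show ?thesis by (simp add: norm_power power_le_one)
    qed
    have degc: "degree ?nc = degree n" by (rule map_poly_degree_eq) (use n(1) in auto)
    have "norm (lead_coeff ?nc) = 1" using n(3) by (simp add: degc coeff_map_poly flip: of_int_abs)
    then have bnd: "norm (coeff ?nc i) \<le> 2 ^ degree n" for i
      using coeff_bound_from_roots[of ?nc i] root by (simp add: degc)
    have "\<bar>coeff n i\<bar> \<le> 2 ^ ?d" for i
    proof -
      have "real_of_int \<bar>coeff n i\<bar> \<le> 2 ^ degree n" using bnd[of i] by (simp add: coeff_map_poly)
      also have "\<dots> \<le> 2 ^ ?d" using dn by (intro power_increasing) auto
      also have "(2::real) ^ ?d = real_of_int (2 ^ ?d)" by simp
      finally show ?thesis by (simp only: of_int_le_iff)
    qed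
    then show ?thesis using n(1,2) dn by (auto simp: P_def)
  qed
  have finP: "finite P" unfolding P_def by (rule finite_bounded_int_polys)
  have "finite {y :: 'a. ipoly n y = 0}" if "n \<noteq> 0" for n
  proof -
    have "map_poly of_int n \<noteq> (0 :: 'a poly)" using that char0 by (auto simp: poly_eq_iff coeff_map_poly)
    then show ?thesis unfolding ipoly_def by (rule poly_roots_finite)
  qed
  then have "finite (\<Union>n\<in>P - {0}. {y :: 'a. ipoly n y = 0})" using finP by auto
  moreover have "range (\<lambda>N. \<mu> ^ N) \<subseteq> (\<Union>n\<in>P - {0}. {y :: 'a. ipoly n y = 0})" using pow by blast
  ultimately have "finite (range (\<lambda>N. \<mu> ^ N))" by (rule finite_subset[rotated])
  moreover have "inj (\<lambda>N. \<mu> ^ N)" using nontorsion_power_inj[OF \<mu>(3,2)] by (auto intro: injI)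
  ultimately show False using finite_imageD infinite_UNIV_nat by blast
qed

section \<open>Transport of freeness along an embedding\<close>

lemma mproj_cross:
  assumes "mproj A B"
  shows "m11 A * m12 B = m12 A * m11 B" "m11 A * m21 B = m21 A * m11 B" "m11 A * m22 B = m22 A * m11 B"
    "m12 A * m21 B = m21 A * m12 B" "m12 A * m22 B = m22 A * m12 B" "m21 A * m22 B = m22 A * m21 B"
  using assms by (auto simp: mproj_def)

text \<open>Proportionality expressed through the vanishing of minors, without the scalar, which may
  lie outside the ring on which an embedding is defined.\<close>

lemma mproj_crossI:
  fixes A B :: "'a::field mat2"
  assumes c: "m11 A * m12 B = m12 A * m11 B" "m11 A * m21 B = m21 A * m11 B" "m11 A * m22 B = m22 A * m11 B"
    "m12 A * m21 B = m21 A * m12 B" "m12 A * m22 B = m22 A * m12 B" "m21 A * m22 B = m22 A * m21 B"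
    and d: "mdet A \<noteq> 0" "mdet B \<noteq> 0"
  shows "mproj A B"
proof -
  have ex: "mproj A B" if e: "A = mscale k B" for k
  proof -
    have "k \<noteq> 0" using d(1) unfolding e mdet_def by auto
    then show ?thesis using e by (auto simp: mproj_def)
  qed
  show ?thesis
  proof (cases "m11 B = 0")
    case False
    have "A = mscale (m11 A / m11 B) B" using False c by (simp add: mat2_eq_iff field_simps)
    then show ?thesis by (rule ex)
  next
    case True
    then have b: "m12 B \<noteq> 0" using d(2) by (auto simp: mdet_def)
    have "A = mscale (m12 A / m12 B) B" using b c by (simp add: mat2_eq_iff field_simps)
    then show ?thesis by (rule ex)
  qed
qed

definition mats_over :: "'a set \<Rightarrow> 'a mat2 set" where
  "mats_over R = {A. m11 A \<in> R \<and> m12 A \<in> R \<and> m21 A \<in> R \<and> m22 A \<in> R}"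

lemma mats_over_mult: "is_subring R \<Longrightarrow> A \<in> mats_over R \<Longrightarrow> B \<in> mats_over R \<Longrightarrow> A * B \<in> mats_over R"
  by (auto simp: mats_over_def intro!: subring_closed)

lemma mats_over_one: "is_subring R \<Longrightarrow> 1 \<in> mats_over R"
  by (auto simp: mats_over_def intro: subring_closed)

lemma mats_over_power: "is_subring R \<Longrightarrow> A \<in> mats_over R \<Longrightarrow> A ^ n \<in> mats_over R"
  by (induction n) (auto intro: mats_over_mult mats_over_one)

lemma mats_over_prod_list: "is_subring R \<Longrightarrow> set ws \<subseteq> mats_over R \<Longrightarrow> prod_list ws \<in> mats_over R"
  by (induction ws) (auto intro: mats_over_mult mats_over_one)

text \<open>The equations of \<open>mproj_cross\<close> carry a relation between words over to the
  images, where freeness identifies the words.\<close>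

lemma mfree_of_embedding:
  fixes A B :: "'a::field mat2"
  assumes emb: "ring_emb R \<phi>" and AB: "A \<in> mats_over R" "B \<in> mats_over R" "mdet A \<noteq> 0" "mdet B \<noteq> 0"
    and free: "mfree (map_mat2 \<phi> A) (map_mat2 \<phi> B)"
  shows "mfree A B"
proof -
  note es = ring_emb_simps[OF emb] and rc = subring_closed[OF ring_emb_simps(1)[OF emb]]
  have mult: "map_mat2 \<phi> (M * N) = map_mat2 \<phi> M * map_mat2 \<phi> N" if "M \<in> mats_over R" "N \<in> mats_over R" for M N
    using that by (simp add: mat2_eq_iff mat2.map_sel mats_over_def es rc)
  have one: "map_mat2 \<phi> 1 = 1" by (simp add: mat2_eq_iff mat2.map_sel es)
  have prod: "map_mat2 \<phi> (prod_list ws) = prod_list (map (map_mat2 \<phi>) ws)" if "set ws \<subseteq> mats_over R" for ws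
    using that by (induction ws) (auto simp: one mult mats_over_prod_list[OF es(1)])
  have det: "mdet (map_mat2 \<phi> M) = \<phi> (mdet M) \<and> mdet M \<in> R" if "M \<in> mats_over R" for M
    using that by (simp add: mdet_def mat2.map_sel mats_over_def es rc)
  have neq: "map_mat2 \<phi> A \<noteq> map_mat2 \<phi> B" using free by (simp add: mfree_def)
  have "ws = ws'" if w: "ws \<in> lists {A, B}" "ws' \<in> lists {A, B}" "mproj (prod_list ws) (prod_list ws')" for ws ws'
  proof -
    let ?N = "prod_list ws" and ?N' = "prod_list ws'"
    have sub: "set ws \<subseteq> mats_over R" "set ws' \<subseteq> mats_over R" using w AB by auto
    have N: "?N \<in> mats_over R" "?N' \<in> mats_over R" using mats_over_prod_list[OF es(1)] sub by auto
    have dw: "mdet (prod_list us) \<noteq> 0" if "us \<in> lists {A, B}" for us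
      using that AB by (induction us) (auto simp: mdet_mult)
    have e: "\<phi> a * \<phi> b = \<phi> c * \<phi> d" if "a * b = c * d" "a \<in> R" "b \<in> R" "c \<in> R" "d \<in> R" for a b c d
      using that es(5) by metis
    have c1: "\<phi> (m11 ?N) * \<phi> (m12 ?N') = \<phi> (m12 ?N) * \<phi> (m11 ?N')"
      using e[OF mproj_cross(1)[OF w(3)]] N by (simp only: mats_over_def mem_Collect_eq)
    have c2: "\<phi> (m11 ?N) * \<phi> (m21 ?N') = \<phi> (m21 ?N) * \<phi> (m11 ?N')"
      using e[OF mproj_cross(2)[OF w(3)]] N by (simp only: mats_over_def mem_Collect_eq)
    have c3: "\<phi> (m11 ?N) * \<phi> (m22 ?N') = \<phi> (m22 ?N) * \<phi> (m11 ?N')"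
      using e[OF mproj_cross(3)[OF w(3)]] N by (simp only: mats_over_def mem_Collect_eq)
    have c4: "\<phi> (m12 ?N) * \<phi> (m21 ?N') = \<phi> (m21 ?N) * \<phi> (m12 ?N')"
      using e[OF mproj_cross(4)[OF w(3)]] N by (simp only: mats_over_def mem_Collect_eq)
    have c5: "\<phi> (m12 ?N) * \<phi> (m22 ?N') = \<phi> (m22 ?N) * \<phi> (m12 ?N')"
      using e[OF mproj_cross(5)[OF w(3)]] N by (simp only: mats_over_def mem_Collect_eq)
    have c6: "\<phi> (m21 ?N) * \<phi> (m22 ?N') = \<phi> (m22 ?N) * \<phi> (m21 ?N')"
      using e[OF mproj_cross(6)[OF w(3)]] N by (simp only: mats_over_def mem_Collect_eq)
    have "mproj (map_mat2 \<phi> ?N) (map_mat2 \<phi> ?N')"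
    proof (rule mproj_crossI)
      show "mdet (map_mat2 \<phi> ?N) \<noteq> 0" "mdet (map_mat2 \<phi> ?N') \<noteq> 0"
        using det N dw w(1,2) es(8) by auto
    qed (simp_all only: mat2.map_sel c1 c2 c3 c4 c5 c6)
    then have "mproj (prod_list (map (map_mat2 \<phi>) ws)) (prod_list (map (map_mat2 \<phi>) ws'))"
      using prod sub by simp
    moreover have "map (map_mat2 \<phi>) ws \<in> lists {map_mat2 \<phi> A, map_mat2 \<phi> B}"
      "map (map_mat2 \<phi>) ws' \<in> lists {map_mat2 \<phi> A, map_mat2 \<phi> B}" using w by auto
    ultimately have "map (map_mat2 \<phi>) ws = map (map_mat2 \<phi>) ws'" using free by (simp add: mfree_def)
    moreover have "inj_on (map_mat2 \<phi>) (set ws \<union> set ws')"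
    proof (rule inj_on_subset)
      show "inj_on (map_mat2 \<phi>) {A, B}" using neq by (auto simp: inj_on_def)
      show "set ws \<union> set ws' \<subseteq> {A, B}" using w by auto
    qed
    ultimately show ?thesis by (simp add: inj_on_map_eq_map)
  qed
  then show ?thesis using neq by (auto simp: mfree_def)
qed

text \<open>The expanding embedding is extended to the entries of \<open>g\<close>, so that
  ping-pong takes place over the complex numbers.\<close>

lemma integral_nontorsion_free:
  fixes g :: "'a::field mat2"
  assumes char0: "\<And>n::int. of_int n = (0::'a) \<Longrightarrow> n = 0"
    and \<mu>: "integral_int \<mu>" "\<mu> \<noteq> 0" "\<not> torsion \<mu>" and g: "m11 g \<noteq> 0" "m21 g \<noteq> 0" "mdet g = 1"
  shows "\<exists>n m. mfree (Mat2 \<mu> 0 0 (inverse \<mu>) ^ n * g) (Mat2 \<mu> 0 0 (inverse \<mu>) ^ m * g)"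
proof -
  obtain R0 \<phi>0 where R0: "ring_emb R0 \<phi>0" "countable R0" "\<mu> \<in> R0" "norm (\<phi>0 \<mu>) > 1"
    using exists_expanding_embedding[OF char0 \<mu>] by blast
  obtain R \<phi> where R: "ring_emb R \<phi>" "R0 \<subseteq> R" "{inverse \<mu>, m11 g, m12 g, m21 g, m22 g} \<subseteq> R" "\<forall>x\<in>R0. \<phi> x = \<phi>0 x"
    using emb_extend_finite[OF _ R0(1,2), of "{inverse \<mu>, m11 g, m12 g, m21 g, m22 g}"] by auto
  note es = ring_emb_simps[OF R(1)] and rc = subring_closed[OF ring_emb_simps(1)[OF R(1)]]
  have \<mu>R: "\<mu> \<in> R" "inverse \<mu> \<in> R" using R R0 by auto
  have n1: "norm (\<phi> \<mu>) > 1" using R R0 by auto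
  have "\<phi> \<mu> * \<phi> (inverse \<mu>) = 1" using es(2) es(5)[OF \<mu>R] \<mu>(2) by simp
  then have iv: "\<phi> (inverse \<mu>) = inverse (\<phi> \<mu>)" using n1 by (metis inverse_unique)
  let ?D = "Mat2 \<mu> 0 0 (inverse \<mu>)"
  have DR: "?D \<in> mats_over R" "g \<in> mats_over R" using \<mu>R R(3) rc by (auto simp: mats_over_def)
  have mult: "map_mat2 \<phi> (M * N) = map_mat2 \<phi> M * map_mat2 \<phi> N" if "M \<in> mats_over R" "N \<in> mats_over R" for M N
    using that by (simp add: mat2_eq_iff mat2.map_sel mats_over_def es rc)
  have pow: "map_mat2 \<phi> (?D ^ n) = Mat2 (\<phi> \<mu>) 0 0 (inverse (\<phi> \<mu>)) ^ n" for n
  proof (induction n)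
    case 0
    then show ?case by (simp add: mat2_eq_iff mat2.map_sel es)
  next
    case (Suc n)
    then show ?case using mult[OF DR(1) mats_over_power[OF es(1) DR(1), of n]] by (simp add: es iv)
  qed
  have dg: "mdet (map_mat2 \<phi> g) = 1"
  proof -
    have "mdet (map_mat2 \<phi> g) = \<phi> (mdet g)" using DR(2) by (simp add: mdet_def mat2.map_sel mats_over_def es rc)
    then show ?thesis using g es by simp
  qed
  have "m11 (map_mat2 \<phi> g) \<noteq> 0" "m21 (map_mat2 \<phi> g) \<noteq> 0"
    using g DR(2) es(8) by (auto simp: mat2.map_sel mats_over_def)
  then obtain n m where nm: "mfree (Mat2 (\<phi> \<mu>) 0 0 (inverse (\<phi> \<mu>)) ^ n * map_mat2 \<phi> g)
      (Mat2 (\<phi> \<mu>) 0 0 (inverse (\<phi> \<mu>)) ^ m * map_mat2 \<phi> g)"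
    using archimedean_free[OF n1, of "map_mat2 \<phi> g"] dg by auto
  have DgR: "?D ^ k * g \<in> mats_over R" for k using mats_over_power mats_over_mult DR es(1) by blast
  have detD: "mdet (?D ^ k * g) \<noteq> 0" for k
    using \<mu>(2) g(3) unfolding diag_power mdet_mult by (simp add: mdet_def power_inverse)
  have map: "map_mat2 \<phi> (?D ^ k * g) = Mat2 (\<phi> \<mu>) 0 0 (inverse (\<phi> \<mu>)) ^ k * map_mat2 \<phi> g" for k
    using mult[OF mats_over_power[OF es(1) DR(1)] DR(2)] by (simp add: pow)
  have "mfree (?D ^ n * g) (?D ^ m * g)"
    using mfree_of_embedding[OF R(1) DgR DgR detD detD] nm map by simp
  then show ?thesis by blast
qed

section \<open>Orders of eigenvalues\<close>

definition is_ideal :: "'a::comm_ring_1 set \<Rightarrow> 'a set \<Rightarrow> bool" where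
  "is_ideal m A \<longleftrightarrow> 0 \<in> m \<and> (\<forall>x\<in>m. \<forall>y\<in>m. x - y \<in> m) \<and> (\<forall>x\<in>m. \<forall>y\<in>A. x * y \<in> m)"

lemma ideal_closed:
  assumes "is_ideal m A"
  shows "0 \<in> m" "x \<in> m \<Longrightarrow> y \<in> m \<Longrightarrow> x - y \<in> m" "x \<in> m \<Longrightarrow> y \<in> A \<Longrightarrow> x * y \<in> m"
    "x \<in> m \<Longrightarrow> - x \<in> m" "x \<in> m \<Longrightarrow> y \<in> m \<Longrightarrow> x + y \<in> m"
proof -
  show 0: "0 \<in> m" and d: "\<And>x y. x \<in> m \<Longrightarrow> y \<in> m \<Longrightarrow> x - y \<in> m" and "x \<in> m \<Longrightarrow> y \<in> A \<Longrightarrow> x * y \<in> m"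
    using assms by (auto simp: is_ideal_def)
  show u: "x \<in> m \<Longrightarrow> - x \<in> m" for x using d[OF 0, of x] by simp
  show "x \<in> m \<Longrightarrow> y \<in> m \<Longrightarrow> x + y \<in> m" using d[of x "- y"] u[of y] by simp
qed

lemma ideal_sum: "is_ideal m A \<Longrightarrow> (\<And>i. i \<in> I \<Longrightarrow> f i \<in> m) \<Longrightarrow> sum f I \<in> m"
  by (induction I rule: infinite_finite_induct) (auto intro: ideal_closed)

text \<open>The set \<open>R\<close> meets at most \<open>n\<close> classes modulo \<open>m\<close>;
  no quotient ring has to be formed.\<close>

definition finite_residues :: "'a::comm_ring_1 set \<Rightarrow> 'a set \<Rightarrow> nat \<Rightarrow> bool" where
  "finite_residues m R n \<longleftrightarrow> (\<exists>F. finite F \<and> card F \<le> n \<and> (\<forall>x\<in>R. \<exists>f\<in>F. x - f \<in> m))"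

lemma finite_residues_of_int:
  fixes m :: "'a::comm_ring_1 set"
  assumes "is_ideal m A" "is_subring A" "of_int p \<in> m" "p > 0"
  shows "finite_residues m (range (of_int :: int \<Rightarrow> 'a)) (nat p)"
  unfolding finite_residues_def
proof (intro exI conjI ballI)
  let ?F = "(of_int :: int \<Rightarrow> 'a) ` {0..<p}"
  show "finite ?F" by simp
  have "card ?F \<le> card {0..<p}" by (rule card_image_le) simp
  then show "card ?F \<le> nat p" by simp
  fix x :: 'a assume "x \<in> range of_int"
  then obtain z where z: "x = of_int z" by auto
  have "x - of_int (z mod p) = of_int p * of_int (z div p)"
    unfolding z by (metis minus_mod_eq_mult_div of_int_diff of_int_mult)
  also have "\<dots> \<in> m" using assms of_int_in_subring by (intro ideal_closed(3)[OF assms(1)]) auto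
  finally show "\<exists>f\<in>?F. x - f \<in> m" using assms(4) by (intro bexI[of _ "of_int (z mod p)"]) auto
qed

text \<open>It suffices that the monic \<open>g\<close> vanishes at \<open>y\<close> modulo
  \<open>m\<close>: division by \<open>g\<close> leaves \<open>n\<close> coefficients, each with at
  most \<open>k\<close> residues.\<close>

lemma finite_residues_adjoin:
  fixes m :: "'a::idom set"
  assumes m: "is_ideal m A" "is_subring A" and R: "is_subring R" "R \<subseteq> A" and y: "y \<in> A"
    and fr: "finite_residues m R k"
    and g: "g \<in> polys_over R" "degree g = n" "n > 0" "lead_coeff g = 1" "poly g y \<in> m"
  shows "finite_residues m (adjoin R y) (k ^ n)"
proof -
  note pc = polys_over_closed[OF R(1)] and ic = ideal_closed[OF m(1)] and ac = subring_closed[OF m(2)]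
  \<comment> \<open>Division with remainder modulo \<open>m\<close>: after each multiplication by
    \<open>y\<close>, the coefficient of degree \<open>n\<close> is removed with a multiple of
    \<open>g\<close>.\<close>
  have red: "\<exists>q\<in>polys_over R. (\<forall>i\<ge>n. coeff q i = 0) \<and> poly p y - poly q y \<in> m" if "p \<in> polys_over R" for p
    using that
  proof (induction p)
    case 0
    then show ?case using pc ic by (intro bexI[of _ 0]) auto
  next
    case (pCons a p)
    then obtain q where q: "q \<in> polys_over R" "\<forall>i\<ge>n. coeff q i = 0" "poly p y - poly q y \<in> m" by auto
    define c where "c = coeff (pCons a q) n"
    define q' where "q' = pCons a q - smult c g"
    have q1: "pCons a q \<in> polys_over R" using pCons.prems q by simp
    then have cR: "c \<in> R" unfolding c_def by (auto simp: polys_over_def)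
    have "q' \<in> polys_over R" unfolding q'_def using q1 cR g by (intro pc)
    moreover have "coeff q' i = 0" if "i \<ge> n" for i
    proof (cases "i = n")
      case True
      then show ?thesis using g by (simp add: q'_def c_def)
    next
      case False
      then have "i = Suc (i - 1)" "i - 1 \<ge> n" using \<open>i \<ge> n\<close> by auto
      then obtain j where j: "i = Suc j" "j \<ge> n" by blast
      have "coeff g i = 0" using False that g(2) by (intro coeff_eq_0) simp
      then show ?thesis using q(2) j by (simp add: q'_def)
    qed
    moreover have "poly (pCons a p) y - poly q' y = (poly p y - poly q y) * y + poly g y * c"
      by (simp add: q'_def algebra_simps)
    moreover have "(poly p y - poly q y) * y + poly g y * c \<in> m" using ic(5)[OF ic(3)[OF q(3) y] ic(3)[OF g(5)]] cR R(2) by auto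
    ultimately show ?case by (intro bexI[of _ q']) auto
  qed
  obtain F where F: "finite F" "card F \<le> k" "\<forall>x\<in>R. \<exists>f\<in>F. x - f \<in> m" using fr by (auto simp: finite_residues_def)
  let ?F = "(\<lambda>f. \<Sum>i<n. f i * y ^ i) ` ({..<n} \<rightarrow>\<^sub>E F)"
  have finF: "finite ({..<n} \<rightarrow>\<^sub>E F)" using F by (intro finite_PiE) auto
  have "card ?F \<le> card ({..<n} \<rightarrow>\<^sub>E F)" using finF by (rule card_image_le)
  also have "\<dots> = card F ^ n" by (simp add: card_PiE)
  also have "\<dots> \<le> k ^ n" using F by (intro power_mono) auto
  finally have card: "card ?F \<le> k ^ n" .
  have "\<exists>f\<in>?F. x - f \<in> m" if x: "x \<in> adjoin R y" for x
  proof -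
    obtain p where p: "p \<in> polys_over R" "x = poly p y" using x by (auto simp: adjoin_def)
    obtain q where q: "q \<in> polys_over R" "\<forall>i\<ge>n. coeff q i = 0" "poly p y - poly q y \<in> m" using red[OF p(1)] by blast
    have "\<forall>i. \<exists>f. f \<in> F \<and> coeff q i - f \<in> m" using F(3) q(1) by (auto simp: polys_over_def)
    then obtain f where f: "\<And>i. f i \<in> F" "\<And>i. coeff q i - f i \<in> m" by metis
    define f' where "f' = (\<lambda>i\<in>{..<n}. f i)"
    have "degree q \<le> n" using q(2) by (intro degree_le) auto
    then have "poly q y = (\<Sum>i\<le>n. coeff q i * y ^ i)"
      unfolding poly_altdef by (intro sum.mono_neutral_left) (auto simp: coeff_eq_0)
    also have "\<dots> = (\<Sum>i<n. coeff q i * y ^ i)"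
      using q(2) by (simp flip: lessThan_Suc_atMost)
    finally have "poly q y - (\<Sum>i<n. f' i * y ^ i) = (\<Sum>i<n. (coeff q i - f i) * y ^ i)"
      by (simp add: f'_def sum_subtractf left_diff_distrib)
    also have "\<dots> \<in> m" using f(2) y ac by (intro ideal_sum[OF m(1)] ic(3)) auto
    finally have "(poly p y - poly q y) + (poly q y - (\<Sum>i<n. f' i * y ^ i)) \<in> m" by (rule ic(5)[OF q(3)])
    then have "x - (\<Sum>i<n. f' i * y ^ i) \<in> m" by (simp add: p)
    moreover have "f' \<in> {..<n} \<rightarrow>\<^sub>E F" using f(1) by (auto simp: f'_def)
    ultimately show ?thesis by blast
  qed
  moreover have "finite ?F" using finF by simp
  ultimately show ?thesis using card unfolding finite_residues_def by blast
qed

text \<open>Pigeonhole on the \<open>k + 1\<close> powers with exponents from 0 to \<open>k\<close>;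
  the inverse \<open>z'\<close> cancels the smaller power.\<close>

lemma finite_residues_power:
  fixes m :: "'a::comm_ring_1 set"
  assumes m: "is_ideal m A" "is_subring A" and fr: "finite_residues m R k"
    and z: "\<And>i. z ^ i \<in> R" and z': "z' \<in> A" "z * z' = 1"
  shows "\<exists>j. 0 < j \<and> j \<le> k \<and> z ^ j - 1 \<in> m"
proof -
  obtain F where F: "finite F" "card F \<le> k" "\<forall>x\<in>R. \<exists>f\<in>F. x - f \<in> m" using fr by (auto simp: finite_residues_def)
  have "\<forall>i. \<exists>f. f \<in> F \<and> z ^ i - f \<in> m" using F(3) z by blast
  then obtain f where f: "\<And>i. f i \<in> F" "\<And>i. z ^ i - f i \<in> m" by metis
  have "card (f ` {..k}) \<le> card F" using F f by (intro card_mono) auto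
  then have "\<not> inj_on f {..k}" using F(2) by (intro pigeonhole) simp
  then obtain i j where "i \<le> k" "j \<le> k" "i \<noteq> j" "f i = f j" by (auto simp: inj_on_def)
  then obtain i j where ij: "i < j" "j \<le> k" "f i = f j" by (metis linorder_neqE_nat)
  have "(z ^ j - f j) - (z ^ i - f i) \<in> m" by (rule ideal_closed(2)[OF m(1) f(2) f(2)])
  then have "z ^ j - z ^ i \<in> m" by (simp add: ij)
  then have "(z ^ j - z ^ i) * z' ^ i \<in> m" using z' subring_closed(7)[OF m(2)] by (intro ideal_closed(3)[OF m(1)])
  moreover have "(z ^ j - z ^ i) * z' ^ i = z ^ (j - i) - 1"
  proof -
    have "z ^ j = z ^ (j - i) * z ^ i" using ij by (simp flip: power_add)
    then have "(z ^ j - z ^ i) * z' ^ i = (z ^ (j - i) - 1) * (z * z') ^ i" by (simp add: algebra_simps power_mult_distrib)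
    then show ?thesis by (simp add: z')
  qed
  ultimately show ?thesis using ij by (intro exI[of _ "j - i"]) auto
qed

lemma ideal_power_minus_one:
  fixes x :: "'a::comm_ring_1"
  assumes m: "is_ideal m A" "is_subring A" and x: "x \<in> A" "x - 1 \<in> m"
  shows "x ^ n - 1 \<in> m"
proof -
  have "x ^ n - 1 = (x - 1) * (\<Sum>i<n. x ^ i)" using power_diff_1_eq[of x n] by simp
  also have "\<dots> \<in> m"
    using x subring_closed[OF m(2)] by (intro ideal_closed(3)[OF m(1)] subring_sum[OF m(2)]) auto
  finally show ?thesis .
qed

text \<open>Raising to the power \<open>p ^ a\<close> leaves an exponent \<open>k\<close> prime to
  \<open>p\<close>. If \<open>\<theta> \<noteq> 1\<close>, the geometric sum of its first
  \<open>k\<close> powers is zero and also congruent to \<open>k\<close>, so \<open>m\<close>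
  contains the coprime integers \<open>k\<close> and \<open>p\<close>, hence 1.\<close>

lemma congruent_one_torsion:
  fixes \<eta> :: "'a::idom" and p :: nat
  assumes m: "is_ideal m A" "is_subring A" "1 \<notin> m" and p: "prime p" "of_nat p \<in> m"
    and \<eta>: "torsion \<eta>" "\<eta> \<in> A" "\<eta> - 1 \<in> m"
  shows "\<exists>a. \<eta> ^ (p ^ a) = 1"
proof -
  obtain n where n: "n > 0" "\<eta> ^ n = 1" using \<eta> by (auto simp: torsion_def)
  obtain a k where ak: "n = p ^ a * k" "\<not> p dvd k"
    using n(1) p(1) by (metis prime_power_canonical mult.commute)
  define \<theta> where "\<theta> = \<eta> ^ (p ^ a)"
  have tk: "\<theta> ^ k = 1" using n(2) by (simp add: \<theta>_def ak power_mult)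
  have tA: "\<theta> \<in> A" using \<eta> subring_closed[OF m(2)] by (simp add: \<theta>_def)
  have t1: "\<theta> - 1 \<in> m" unfolding \<theta>_def using ideal_power_minus_one[OF m(1,2) \<eta>(2,3)] .
  have "\<theta> = 1"
  proof (rule ccontr)
    assume ne: "\<theta> \<noteq> 1"
    have "(\<theta> - 1) * (\<Sum>i<k. \<theta> ^ i) = 0" using power_diff_1_eq[of \<theta> k] tk by simp
    then have s: "(\<Sum>i<k. \<theta> ^ i) = 0" using ne by simp
    have "(\<Sum>i<k. \<theta> ^ i - 1) \<in> m" using ideal_power_minus_one[OF m(1,2) tA t1] by (intro ideal_sum[OF m(1)])
    then have "- of_nat k \<in> m" by (simp add: sum_subtractf s)
    then have km: "of_nat k \<in> m" using ideal_closed(4)[OF m(1), of "- of_nat k"] by simp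
    have "coprime k p" using prime_imp_coprime[OF p(1) ak(2)] by (simp add: coprime_commute)
    then have "coprime (int k) (int p)" by simp
    then obtain u v where uv: "u * int k + v * int p = 1"
      using bezout_int[of "int k" "int p"] by (auto simp: coprime_iff_gcd_eq_1)
    have "of_nat k * of_int u + of_nat p * of_int v \<in> m"
      using km p of_int_in_subring[OF m(2)] by (intro ideal_closed[OF m(1)])
    also have "of_nat k * of_int u + of_nat p * of_int v = (of_int (u * int k + v * int p) :: 'a)" by (simp add: mult.commute)
    finally show False using m(3) by (simp add: uv)
  qed
  then show ?thesis by (auto simp: \<theta>_def)
qed

definition ring_gen :: "'a::comm_ring_1 list \<Rightarrow> 'a set" where
  "ring_gen ys = foldr (\<lambda>y A. adjoin A y) ys (range of_int)"

lemma ring_gen_props: "is_subring (ring_gen ys)" "set ys \<subseteq> ring_gen ys"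
proof -
  have "is_subring (ring_gen ys) \<and> set ys \<subseteq> ring_gen ys"
  proof (induction ys)
    case Nil
    then show ?case by (simp add: ring_gen_def subring_range_of_int)
  next
    case (Cons y ys)
    then show ?case using subring_adjoin[of "ring_gen ys" y] adjoin_superset[of "ring_gen ys" y] by (auto simp: ring_gen_def)
  qed
  then show "is_subring (ring_gen ys)" "set ys \<subseteq> ring_gen ys" by auto
qed

text \<open>A leading coefficient prime to \<open>p\<close> is invertible modulo \<open>m\<close>,
  so each generator is integral modulo \<open>m\<close> and \<open>finite_residues_adjoin\<close>
  applies along the list.\<close>

lemma ring_gen_finite_residues:
  fixes ys :: "'a::idom list"
  assumes m: "is_ideal m A" "is_subring A" and p: "of_int p \<in> m" "p > 0"
    and "\<And>y. y \<in> set ys \<Longrightarrow> y \<in> A \<and> (\<exists>h. ipoly h y = 0 \<and> coprime (lead_coeff h) p \<and> degree h > 0)"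
  shows "ring_gen ys \<subseteq> A \<and> (\<exists>k. finite_residues m (ring_gen ys) k)"
  using assms(5)
proof (induction ys)
  case Nil
  then show ?case using finite_residues_of_int[OF m p] of_int_in_subring[OF m(2)] by (auto simp: ring_gen_def)
next
  case (Cons y ys)
  let ?R = "ring_gen ys"
  have R: "is_subring ?R" by (rule ring_gen_props)
  obtain k where k: "?R \<subseteq> A" "finite_residues m ?R k" using Cons by auto
  obtain h where h: "ipoly h y = 0" "coprime (lead_coeff h) p" "degree h > 0" and yA: "y \<in> A" using Cons.prems by force
  let ?n = "degree h"
  obtain u v where uv: "u * lead_coeff h + v * p = 1"
    using bezout_int[of "lead_coeff h" p] h(2) by (auto simp: coprime_iff_gcd_eq_1)
  \<comment> \<open>The Bezout combination makes \<open>h\<close> monic while its value at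
    \<open>y\<close> stays in \<open>m\<close>.\<close>
  define g where "g = (smult (of_int u) (map_poly of_int h) + monom (of_int (v * p)) ?n :: 'a poly)"
  have cg: "coeff g i = of_int (u * coeff h i + (if i = ?n then v * p else 0))" for i
    by (simp add: g_def coeff_map_poly)
  have "g \<in> polys_over ?R" unfolding polys_over_def mem_Collect_eq cg using of_int_in_subring[OF R] by blast
  moreover have cn: "coeff g ?n = 1" unfolding cg using uv by simp
  moreover have dg: "degree g = ?n"
  proof (rule antisym)
    show "degree g \<le> ?n" by (rule degree_le) (simp add: cg coeff_eq_0)
    show "?n \<le> degree g" using cn by (intro le_degree) simp
  qed
  moreover have "poly g y \<in> m"
  proof -
    have "poly g y = of_int p * (of_int v * y ^ ?n)"
      using h(1) by (simp add: g_def poly_monom ipoly_def mult_ac)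
    also have "\<dots> \<in> m" 
      using subring_closed(4)[OF m(2) of_int_in_subring[OF m(2)] subring_closed(7)[OF m(2) yA]]
      by (rule ideal_closed(3)[OF m(1) p(1)])
    finally show ?thesis .
  qed
  ultimately have "finite_residues m (adjoin ?R y) (k ^ ?n)"
    using finite_residues_adjoin[OF m R k(1) yA k(2), of g ?n] h(3) by simp
  moreover have "adjoin ?R y \<subseteq> A" using adjoin_least[OF m(2) k(1) yA] .
  ultimately show ?case by (auto simp: ring_gen_def)
qed

text \<open>Terms of \<open>h\<close> above the degree of its reduction are dropped, so that the
  leading coefficient is nonzero modulo the characteristic.\<close>

lemma int_poly_lead_coprime:
  fixes y :: "'a::field"
  assumes "algebraic_int y" "CHAR('a) > 0"
  shows "\<exists>h. ipoly h y = 0 \<and> coprime (lead_coeff h) (int CHAR('a)) \<and> degree h > 0"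
proof -
  let ?p = "CHAR('a)"
  obtain h where h: "map_poly of_int h \<noteq> (0 :: 'a poly)" "ipoly h y = 0" using assms by (auto simp: algebraic_int_def)
  let ?g = "map_poly of_int h :: 'a poly"
  define n where "n = degree ?g"
  define h' where "h' = (\<Sum>i\<le>n. monom (coeff h i) i)"
  have c: "coeff h' i = (if i \<le> n then coeff h i else 0)" for i by (simp add: h'_def coeff_sum)
  have e: "map_poly of_int h' = ?g"
  proof (rule poly_eqI)
    fix i show "coeff (map_poly of_int h') i = coeff ?g i"
      using coeff_eq_0[of ?g i] by (auto simp: coeff_map_poly c n_def)
  qed
  have nz: "of_int (coeff h n) \<noteq> (0::'a)" using h(1) by (auto simp: n_def simp flip: coeff_map_poly)
  then have dv: "\<not> int ?p dvd coeff h n" by (simp add: of_int_eq_0_iff_char_dvd)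
  have d: "degree h' = n"
  proof (rule antisym)
    show "degree h' \<le> n" by (rule degree_le) (simp add: c)
    show "n \<le> degree h'" using dv by (intro le_degree) (auto simp: c)
  qed
  have "prime ?p" using assms(2) by (rule prime_CHAR_semidom)
  then have "coprime (lead_coeff h') (int ?p)" using dv by (simp add: d c prime_imp_coprime coprime_commute)
  moreover have h'y: "ipoly h' y = 0" using h(2) e by (simp add: ipoly_def)
  moreover have "degree h' > 0"
  proof (rule ccontr)
    assume "\<not> ?thesis"
    then obtain a where a: "h' = [:a:]" using degree_eq_zeroE by blast
    then have "a = coeff h n" using d c[of 0] by simp
    then show False using h'y nz a by simp
  qed
  ultimately show ?thesis by blast
qed

text \<open>In positive characteristic the zero ideal serves as \<open>m\<close>: finitely many
  algebraic elements generate a finite ring.\<close>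

lemma ideal_zero: "is_ideal {0} (UNIV :: 'a::comm_ring_1 set)" "is_subring (UNIV :: 'a set)"
  by (auto simp: is_ideal_def is_subring_def)

text \<open>The ring generated by \<open>x\<close> is finite, so the powers of \<open>x\<close>
  repeat.\<close>

lemma algebraic_torsion_char_p:
  fixes x :: "'a::field"
  assumes "algebraic_int x" "CHAR('a) > 0" "x \<noteq> 0"
  shows "torsion x"
proof -
  obtain k where k: "finite_residues {0} (ring_gen [x]) k"
    using ring_gen_finite_residues[OF ideal_zero, of "int CHAR('a)" "[x]"] assms int_poly_lead_coprime[OF assms(1,2)] by auto
  have "x ^ i \<in> ring_gen [x]" for i
    using ring_gen_props[of "[x]"] subring_closed(7) by (metis list.set_intros(1) subsetD)
  from finite_residues_power[OF ideal_zero k this, of "inverse x"] assms(3)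
  show ?thesis by (auto simp: torsion_def)
qed

lemma char_0_of_int: "CHAR('a::comm_ring_1) = 0 \<Longrightarrow> of_int n = (0::'a) \<Longrightarrow> n = 0"
  by (simp add: of_int_eq_0_iff_char_dvd)

text \<open>The eigenvalue \<open>\<zeta>\<close> of a matrix of determinant one and trace \<open>t\<close> is determined modulo the
  maximal ideal by finitely many residues, so its order is bounded up to powers of the residue characteristic.\<close>

lemma eigenvalue_power_congruent_one:
  fixes m :: "'a::idom set"
  assumes m: "is_ideal m A" "is_subring A" and R: "is_subring R" "R \<subseteq> A" and fr: "finite_residues m R k"
    and z: "t \<in> R" "\<zeta> * \<zeta> - t * \<zeta> + 1 = 0" "\<zeta> \<in> A"
  shows "\<zeta> ^ fact (k ^ 2) - 1 \<in> m"
proof -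
  let ?g = "[:1, - t, 1:]"
  have g: "?g \<in> polys_over R" using z(1) subring_closed[OF R(1)] polys_over_closed(1)[OF R(1)] by auto
  have "poly ?g \<zeta> = 0" using z(2) by (simp add: algebra_simps)
  then have fr2: "finite_residues m (adjoin R \<zeta>) (k ^ 2)"
    using finite_residues_adjoin[OF m R z(3) fr g, of 2] ideal_closed(1)[OF m(1)] by simp
  have tA: "t - \<zeta> \<in> A" using z R subring_closed[OF m(2)] by auto
  have "\<zeta> * (t - \<zeta>) = 1" using z(2) by (simp add: algebra_simps add_eq_0_iff2)
  moreover have "\<zeta> ^ i \<in> adjoin R \<zeta>" for i
    using adjoin_superset(2)[OF R(1)] subring_closed(7)[OF subring_adjoin[OF R(1)]] by blast
  ultimately obtain j where j: "0 < j" "j \<le> k ^ 2" "\<zeta> ^ j - 1 \<in> m"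
    using finite_residues_power[OF m fr2 _ tA] by blast
  \<comment> \<open>The factorial is a multiple of every possible \<open>j\<close>, so the exponent
    is the same for all \<open>\<zeta>\<close>.\<close>
  have "j dvd fact (k ^ 2)" using j by (intro dvd_fact) auto
  then obtain l where l: "fact (k ^ 2) = j * l" by (auto elim: dvdE)
  have "(\<zeta> ^ j) ^ l - 1 \<in> m" by (rule ideal_power_minus_one[OF m subring_closed(7)[OF m(2) z(3)] j(3)])
  then show ?thesis by (simp add: l power_mult)
qed

lemma coprime_powers_one:
  fixes w :: "'a::monoid_mult"
  assumes "w ^ a = 1" "w ^ b = 1" "coprime a b" "a > 0"
  shows "w = 1"
proof -
  obtain u v where "a * u = b * v + gcd a b" using bezout_nat[of a b] assms(4) by auto
  then have uv: "a * u = b * v + 1" using assms(3) by simp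
  have "1 = w ^ (a * u)" using assms(1) by (simp add: power_mult)
  also have "\<dots> = w ^ (b * v) * w" by (simp only: uv power_add power_one_right)
  also have "\<dots> = w" using assms(2) by (simp add: power_mult)
  finally show ?thesis by simp
qed

lemma vmax_ideal: "valuation_ring Ov \<Longrightarrow> is_ideal (valuation_ring.vmax Ov) Ov"
  by (simp add: is_ideal_def valuation_ring.zero_in_vmax valuation_ring.vmax_diff valuation_ring.vmax_mult)

text \<open>A valuation ring with \<open>p\<close> in its maximal ideal contains \<open>ys\<close>,
  since the leading coefficients are units there. Reduction then bounds the order of
  \<open>\<zeta>\<close> up to a power of \<open>p\<close>.\<close>

lemma place_above_prime:
  fixes ys :: "'a::field list" and p :: nat
  assumes char0: "CHAR('a) = 0" and p: "prime p"
    and ys: "\<And>y. y \<in> set ys \<Longrightarrow> (\<exists>h. ipoly h y = 0 \<and> coprime (lead_coeff h) (int p) \<and> degree h > 0)"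
  shows "\<exists>M>0. \<forall>t\<in>ring_gen ys. \<forall>\<zeta>. torsion \<zeta> \<longrightarrow> \<zeta> * \<zeta> - t * \<zeta> + 1 = 0 \<longrightarrow> (\<exists>a. \<zeta> ^ (M * p ^ a) = 1)"
proof -
  let ?Z = "range (of_int :: int \<Rightarrow> 'a)" and ?p = "of_nat p :: 'a"
  have p0: "?p \<noteq> 0" using char_0_of_int[OF char0, of "int p"] prime_gt_0_nat[OF p] by auto
  have "inverse ?p \<notin> ?Z"
  proof
    assume "inverse ?p \<in> ?Z"
    then obtain z :: int where "inverse ?p = of_int z" by auto
    then have "of_int (int p * z - 1) = (0::'a)" using p0 by (simp add: field_simps)
    then have "int p * z = 1" using char_0_of_int[OF char0, of "int p * z - 1"] by simp
    then have "int p dvd 1" by (metis dvd_triv_left)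
    then show False using prime_gt_1_nat[OF p] by simp
  qed
  moreover have "?p \<in> ?Z" by (metis of_int_of_nat_eq rangeI)
  ultimately obtain Ov where O: "valuation_ring Ov" "inverse ?p \<notin> Ov"
    using Chevalley_extension[OF subring_range_of_int _ _ p0] by blast
  interpret valuation_ring Ov by fact
  have i: "of_int z \<in> Ov" for z by (rule of_int_in_subring[OF subring])
  have pm: "?p \<in> vmax" using O(2) i[of "int p"] by (simp add: vmax_def)
  note idl = vmax_ideal[OF O(1)]
  have yO: "y \<in> Ov" if y: "y \<in> set ys" for y
  proof -
    obtain h where h: "ipoly h y = 0" "coprime (lead_coeff h) (int p)" using ys[OF y] by blast
    obtain u v where uv: "u * lead_coeff h + v * int p = 1"
      using bezout_int[of "lead_coeff h" "int p"] h(2) by (auto simp: coprime_iff_gcd_eq_1)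
    let ?z = "of_int (lead_coeff h) :: 'a"
    have "?z \<notin> vmax"
    proof
      assume "?z \<in> vmax"
      then have "?z * of_int u + ?p * of_int v \<in> vmax" using pm i by (intro vmax_add vmax_mult)
      also have "?z * of_int u + ?p * of_int v = of_int (u * lead_coeff h + v * int p)" by (simp add: mult.commute)
      finally show False using one_notin_vmax by (simp add: uv)
    qed
    then have z: "?z \<noteq> 0" "inverse ?z \<in> Ov" using unit_notin_vmax i by auto
    let ?h = "smult (inverse ?z) (map_poly of_int h)"
    have "degree (map_poly of_int h :: 'a poly) = degree h" by (rule map_poly_degree_eq) (use z in simp)
    then have "lead_coeff ?h = 1" using z by (simp add: coeff_map_poly)
    moreover have "?h \<in> polys_over Ov" using z i by (auto simp: polys_over_def coeff_map_poly intro: closed)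
    moreover have "poly ?h y = 0" using h(1) by (simp add: ipoly_def)
    ultimately show ?thesis by (intro integrally_closed)
  qed
  obtain k where k: "ring_gen ys \<subseteq> Ov" "finite_residues vmax (ring_gen ys) k"
    using ring_gen_finite_residues[OF idl subring, of "int p" ys] pm prime_gt_0_nat[OF p] yO ys by auto
  have "\<exists>a. \<zeta> ^ (fact (k ^ 2) * p ^ a) = 1"
    if t: "t \<in> ring_gen ys" "torsion \<zeta>" "\<zeta> * \<zeta> - t * \<zeta> + 1 = 0" for t \<zeta>
  proof -
    have "\<zeta> \<in> Ov"
    proof (rule integrally_closed)
      show "[:1, - t, 1:] \<in> polys_over Ov" using t(1) k(1) closed polys_over_closed(1)[OF subring] by auto
      show "poly [:1, - t, 1:] \<zeta> = 0" using t(3) by (simp add: algebra_simps)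
    qed simp
    then have c: "\<zeta> ^ fact (k ^ 2) - 1 \<in> vmax" "\<zeta> ^ fact (k ^ 2) \<in> Ov"
      using eigenvalue_power_congruent_one[OF idl subring ring_gen_props(1) k(1,2) t(1,3)] closed(7) by auto
    obtain n where "n > 0" "\<zeta> ^ n = 1" using t(2) by (auto simp: torsion_def)
    then have "torsion (\<zeta> ^ fact (k ^ 2))"
      unfolding torsion_def by (metis power_mult mult.commute power_one)
    from congruent_one_torsion[OF idl subring one_notin_vmax p pm this c(2,1)]
    show ?thesis by (simp add: power_mult)
  qed
  then show ?thesis by (intro exI[of _ "fact (k ^ 2)"]) auto
qed

text \<open>In characteristic zero the primes \<open>p\<close> and \<open>q\<close> bound the order
  up to powers of \<open>p\<close> and up to powers of \<open>q\<close>, so the order of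
  \<open>\<zeta> ^ (M * M')\<close> divides a power of each and is 1. In positive characteristic
  reduction modulo the zero ideal loses nothing.\<close>

theorem bounded_eigenvalue_order:
  fixes ys :: "'a::field list"
  assumes alg: "\<And>y. y \<in> set ys \<Longrightarrow> algebraic_int y"
  shows "\<exists>K>0. \<forall>t\<in>ring_gen ys. \<forall>\<zeta>. torsion \<zeta> \<longrightarrow> \<zeta> * \<zeta> - t * \<zeta> + 1 = 0 \<longrightarrow> \<zeta> ^ K = 1"
proof (cases "CHAR('a) = 0")
  case False
  obtain k where k: "finite_residues {0} (ring_gen ys) k"
    using ring_gen_finite_residues[OF ideal_zero, of "int CHAR('a)" ys] False int_poly_lead_coprime alg by auto
  have "\<zeta> ^ fact (k ^ 2) = 1" if "t \<in> ring_gen ys" "\<zeta> * \<zeta> - t * \<zeta> + 1 = 0" for t \<zeta>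
    using eigenvalue_power_congruent_one[OF ideal_zero ring_gen_props(1) _ k that] by simp
  then show ?thesis by (intro exI[of _ "fact (k ^ 2)"]) auto
next
  case True
  have "\<forall>y\<in>set ys. \<exists>h. ipoly h y = 0 \<and> h \<noteq> 0 \<and> degree h > 0"
  proof
    fix y assume "y \<in> set ys"
    then obtain h where h: "map_poly of_int h \<noteq> (0 :: 'a poly)" "ipoly h y = 0" using alg by (auto simp: algebraic_int_def)
    have h0: "h \<noteq> 0" using h(1) by auto
    moreover have "degree h > 0"
    proof (rule ccontr)
      assume "\<not> ?thesis"
      then obtain a where "h = [:a:]" using degree_eq_zeroE by blast
      then show False using h h0 char_0_of_int[OF True, of a] by auto
    qed
    ultimately show "\<exists>h. ipoly h y = 0 \<and> h \<noteq> 0 \<and> degree h > 0" using h by blast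
  qed
  then obtain h where h: "\<And>y. y \<in> set ys \<Longrightarrow> ipoly (h y) y = 0 \<and> h y \<noteq> 0 \<and> degree (h y) > 0" by metis
  \<comment> \<open>Primes above \<open>B\<close> divide none of the leading coefficients.\<close>
  define B where "B = Max (insert 0 ((\<lambda>y. nat \<bar>lead_coeff (h y)\<bar>) ` set ys))"
  have B: "nat \<bar>lead_coeff (h y)\<bar> \<le> B" if "y \<in> set ys" for y unfolding B_def using that by (intro Max_ge) auto
  obtain p where p: "prime p" "p > B" using bigger_prime by blast
  obtain q where q: "prime q" "q > p" using bigger_prime by blast
  have cop: "coprime (lead_coeff (h y)) (int r)" if y: "y \<in> set ys" and r: "prime r" "r > B" for y r
  proof -
    have "\<not> int r dvd lead_coeff (h y)"
    proof
      assume "int r dvd lead_coeff (h y)"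
      then have "\<bar>int r\<bar> \<le> \<bar>lead_coeff (h y)\<bar>" using h[OF y] by (intro dvd_imp_le_int) auto
      then show False using B[OF y] r by linarith
    qed
    then show ?thesis using r(1) by (simp add: prime_imp_coprime coprime_commute)
  qed
  have hy: "\<exists>h. ipoly h y = 0 \<and> coprime (lead_coeff h) (int r) \<and> degree h > 0" if "y \<in> set ys" "prime r" "r > B" for y r
    using h[OF that(1)] cop[OF that] by blast
  obtain M where M: "M > 0" "\<And>t \<zeta>. t \<in> ring_gen ys \<Longrightarrow> torsion \<zeta> \<Longrightarrow> \<zeta> * \<zeta> - t * \<zeta> + 1 = 0 \<Longrightarrow> \<exists>a. \<zeta> ^ (M * p ^ a) = 1"
    using place_above_prime[OF True p(1), of ys] hy p by blast
  have qB: "q > B" using p q by simp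
  obtain M' where M': "M' > 0" "\<And>t \<zeta>. t \<in> ring_gen ys \<Longrightarrow> torsion \<zeta> \<Longrightarrow> \<zeta> * \<zeta> - t * \<zeta> + 1 = 0 \<Longrightarrow> \<exists>a. \<zeta> ^ (M' * q ^ a) = 1"
    using place_above_prime[OF True q(1), of ys] hy q(1) qB by blast
  have "\<zeta> ^ (M * M') = 1" if tz: "t \<in> ring_gen ys" "torsion \<zeta>" "\<zeta> * \<zeta> - t * \<zeta> + 1 = 0" for t \<zeta>
  proof -
    obtain a b where ab: "\<zeta> ^ (M * p ^ a) = 1" "\<zeta> ^ (M' * q ^ b) = 1" using M(2)[OF tz] M'(2)[OF tz] by blast
    have e1: "(\<zeta> ^ (M * M')) ^ (p ^ a) = 1"
    proof -
      have "(\<zeta> ^ (M * M')) ^ (p ^ a) = (\<zeta> ^ (M * p ^ a)) ^ M'" by (simp add: mult_ac flip: power_mult)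
      then show ?thesis using ab by simp
    qed
    have e2: "(\<zeta> ^ (M * M')) ^ (q ^ b) = 1"
    proof -
      have "(\<zeta> ^ (M * M')) ^ (q ^ b) = (\<zeta> ^ (M' * q ^ b)) ^ M" by (simp add: mult_ac flip: power_mult)
      then show ?thesis using ab by simp
    qed
    have "coprime (p ^ a) (q ^ b)" using p(1) q by (simp add: primes_coprime)
    then show ?thesis using coprime_powers_one[OF e1 e2] p(1) prime_gt_0_nat by simp
  qed
  then show ?thesis using M(1) M'(1) by (intro exI[of _ "M * M'"]) auto
qed

section \<open>Free pairs from an eigenvalue of infinite order\<close>

lemma torsion_inverse: "torsion (inverse x) \<Longrightarrow> torsion x" for x :: "'a::field"
  by (auto simp: torsion_def power_inverse)

text \<open>If \<open>1/\<mu>\<close> is transcendental, or algebraic with \<open>\<mu>\<close> not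
  integral, there is a place at which \<open>1/\<mu>\<close> is small; an algebraic integer of
  infinite order has an expanding complex embedding. The algebraic cases live in characteristic
  zero, because in positive characteristic nonzero algebraic elements are torsion.\<close>

theorem nontorsion_diag_free:
  fixes g :: "'a::field mat2"
  assumes \<mu>: "\<mu> \<noteq> 0" "\<not> torsion \<mu>" and g: "m11 g \<noteq> 0" "m21 g \<noteq> 0" "mdet g = 1"
  shows "\<exists>n m. mfree (Mat2 \<mu> 0 0 (inverse \<mu>) ^ n * g) (Mat2 \<mu> 0 0 (inverse \<mu>) ^ m * g)"
proof -
  define \<pi> where "\<pi> = inverse \<mu>"
  have \<pi>: "\<pi> \<noteq> 0" "inverse \<pi> = \<mu>" using \<mu> by (auto simp: \<pi>_def)
  have nonarch: ?thesis if pb: "place_base \<pi>"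
  proof -
    let ?Y = "{m12 g / m11 g, m22 g / m21 g, m21 g / m11 g}"
    obtain Ov E where "valuation_ring Ov" "\<pi> \<in> Ov" "inverse \<pi> \<notin> Ov" "is_subfield E"
      "E \<subseteq> valuation_ring.loc Ov \<pi>" "\<pi> \<in> E" using pb by (auto simp: place_base_def)
    then obtain Ov' where "valuation_ring Ov'" "\<pi> \<in> Ov'" "inverse \<pi> \<notin> Ov'" "?Y \<subseteq> valuation_ring.loc Ov' \<pi>"
      using valuation_ring_absorbs_finite[of ?Y Ov \<pi> E] \<pi>(1) by auto
    from nonarchimedean_free[OF this(1-3) \<pi>(1) g(1,2) _ this(4)] g(3) show ?thesis
      by (simp add: \<pi>(2)) (simp add: \<pi>_def)
  qed
  show ?thesis
  proof (cases "algebraic_int \<pi>")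
    case False
    then show ?thesis using place_base_transcendental nonarch by blast
  next
    case True
    have char0: "CHAR('a) = 0"
    proof (rule ccontr)
      assume "CHAR('a) \<noteq> 0"
      then have "torsion \<pi>" using algebraic_torsion_char_p[OF True] \<pi> by simp
      then show False using torsion_inverse[of \<mu>] \<mu>(2) by (simp add: \<pi>_def)
    qed
    note c0 = char_0_of_int[OF char0]
    show ?thesis
    proof (cases "integral_int \<mu>")
      case True
      then show ?thesis using integral_nontorsion_free[OF c0 _ \<mu> g] by blast
    next
      case False
      then have "inverse \<pi> \<notin> range (\<lambda>h. ipoly h \<pi>)" using integral_intI[OF \<mu>(1)] \<pi>(2) by (auto simp: \<pi>_def)
      then show ?thesis using place_base_algebraic[OF c0 True \<pi>(1)] nonarch by blast
    qed
  qed
qed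

definition mtrans :: "'a mat2 \<Rightarrow> 'a mat2" where
  "mtrans A = Mat2 (m11 A) (m21 A) (m12 A) (m22 A)"

lemma mtrans_simps: "mtrans (A * B) = mtrans B * mtrans A" "mtrans 1 = (1 :: 'a mat2)" "mtrans (mtrans C) = C"
  for A B :: "'a::comm_ring_1 mat2"
  by (simp_all add: mtrans_def mat2_eq_iff mult.commute)

text \<open>Transposition reverses all words, and freeness is invariant under reversal.\<close>

lemma mfree_mtrans:
  fixes A B :: "'a::field mat2"
  assumes "mfree (mtrans A) (mtrans B)" shows "mfree A B"
proof -
  have prod: "prod_list (map mtrans (rev ws)) = mtrans (prod_list ws)" for ws :: "'a mat2 list"
    by (induction ws) (simp_all add: mtrans_simps)
  have pr: "mproj (mtrans M) (mtrans N)" if "mproj M N" for M N :: "'a mat2"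
    using that by (auto simp: mproj_def mtrans_def mat2_eq_iff)
  have inj: "inj mtrans" by (rule injI) (metis mtrans_simps(3))
  have "ws = ws'" if w: "ws \<in> lists {A, B}" "ws' \<in> lists {A, B}" "mproj (prod_list ws) (prod_list ws')" for ws ws'
  proof -
    have "mproj (prod_list (map mtrans (rev ws))) (prod_list (map mtrans (rev ws')))"
      unfolding prod using pr[OF w(3)] .
    moreover have "map mtrans (rev ws) \<in> lists {mtrans A, mtrans B}" "map mtrans (rev ws') \<in> lists {mtrans A, mtrans B}"
      using w by auto
    ultimately have "map mtrans (rev ws) = map mtrans (rev ws')" using assms by (simp add: mfree_def)
    then show ?thesis using inj by (metis inj_map_eq_map rev_is_rev_conv)
  qed
  moreover have "A \<noteq> B" using assms by (auto simp: mfree_def)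
  ultimately show ?thesis by (auto simp: mfree_def)
qed

text \<open>\<open>nontorsion_diag_free\<close> requires \<open>m11\<close> and \<open>m21\<close>
  to be nonzero. If \<open>m21\<close> vanishes, it is applied to the transposed matrix; if
  \<open>m11\<close> vanishes, \<open>g * g\<close> replaces \<open>g\<close>.\<close>

lemma nontorsion_semigroup_free:
  fixes T :: "'a::field mat2 set"
  assumes T: "\<And>A B. A \<in> T \<Longrightarrow> B \<in> T \<Longrightarrow> A * B \<in> T" and det: "\<And>A. A \<in> T \<Longrightarrow> mdet A = 1"
    and D: "Mat2 \<mu> 0 0 (inverse \<mu>) \<in> T" "\<mu> \<noteq> 0" "\<not> torsion \<mu>"
    and g: "g \<in> T" "m11 g \<noteq> 0 \<or> m22 g \<noteq> 0" "m12 g \<noteq> 0 \<or> m21 g \<noteq> 0"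
  shows "\<exists>A\<in>T. \<exists>B\<in>T. mfree A B"
proof -
  let ?D = "Mat2 \<mu> 0 0 (inverse \<mu>)"
  have main: ?thesis if g: "g \<in> T" "m11 g \<noteq> 0" "m12 g \<noteq> 0 \<or> m21 g \<noteq> 0" for g
  proof -
    have Dn: "?D ^ n * g \<in> T" "g * ?D ^ n \<in> T" for n
    proof -
      show "?D ^ n * g \<in> T" by (induction n) (use g D T in \<open>auto simp: mult.assoc\<close>)
      show "g * ?D ^ n \<in> T"
        by (induction n) (use g D T in \<open>auto simp: power_Suc2 mult.assoc[symmetric] simp del: power_Suc\<close>)
    qed
    show ?thesis
    proof (cases "m21 g = 0")
      case False
      then obtain n m where "mfree (?D ^ n * g) (?D ^ m * g)" using nontorsion_diag_free[OF D(2,3) g(2) _ det[OF g(1)]] by blast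
      then show ?thesis using Dn by blast
    next
      case True
      have dt: "mdet (mtrans g) = 1" using det[OF g(1)] by (simp add: mdet_def mtrans_def mult.commute)
      have tD: "mtrans ?D = ?D" by (simp add: mtrans_def)
      have tDn: "mtrans (?D ^ n) = ?D ^ n" for n unfolding diag_power by (simp add: mtrans_def)
      have "m11 (mtrans g) \<noteq> 0" "m21 (mtrans g) \<noteq> 0" using g True by (auto simp: mtrans_def)
      then obtain n m where "mfree (?D ^ n * mtrans g) (?D ^ m * mtrans g)"
        using nontorsion_diag_free[OF D(2,3) _ _ dt] by blast
      then have "mfree (mtrans (g * ?D ^ n)) (mtrans (g * ?D ^ m))" by (simp add: mtrans_simps tDn)
      then show ?thesis using mfree_mtrans Dn by blast
    qed
  qed
  show ?thesis
  proof (cases "m11 g = 0")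
    case False
    then show ?thesis using main g by blast
  next
    case True
    then have d: "m22 g \<noteq> 0" "m12 g * m21 g \<noteq> 0" using g(2) det[OF g(1)] by (auto simp: mdet_def)
    have "m11 (g * g) \<noteq> 0" "m12 (g * g) \<noteq> 0" using d True by auto
    then show ?thesis using main[of "g * g"] T g by blast
  qed
qed

section \<open>Conjugation and normal forms\<close>

definition mconj :: "'a::comm_ring_1 mat2 \<Rightarrow> 'a mat2 \<Rightarrow> 'a mat2" where
  "mconj P A = P * A * madj P"

lemma mconj_mult: "mdet P = 1 \<Longrightarrow> mconj P (A * B) = mconj P A * mconj P B"
proof -
  assume P: "mdet P = 1"
  have "mconj P A * mconj P B = P * A * (madj P * P) * B * madj P" by (simp add: mconj_def mult.assoc)
  then show ?thesis using madj_inverse(1)[OF P] by (simp add: mconj_def mult.assoc)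
qed

lemma mconj_one: "mdet P = 1 \<Longrightarrow> mconj P 1 = 1"
  by (simp add: mconj_def madj_inverse)

lemma mdet_mconj: "mdet P = 1 \<Longrightarrow> mdet (mconj P A) = mdet A"
  by (simp add: mconj_def mdet_mult mdet_madj)

lemma mtr_mult_commute: "mtr (A * B) = mtr (B * A)"
  by (simp add: mtr_def algebra_simps)

lemma mtr_mconj: "mdet P = 1 \<Longrightarrow> mtr (mconj P A) = mtr A"
proof -
  assume P: "mdet P = 1"
  have "mtr (mconj P A) = mtr (madj P * P * A)"
    unfolding mconj_def by (subst mtr_mult_commute) (simp add: mult.assoc)
  then show ?thesis using madj_inverse(1)[OF P] by simp
qed

lemma mconj_mconj: "mconj P (mconj Q A) = mconj (P * Q) A"
proof -
  have "madj (P * Q) = madj Q * madj P" by (simp add: madj_def mat2_eq_iff algebra_simps)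
  then show ?thesis by (simp add: mconj_def mult.assoc)
qed

lemma mconj_inj: "mdet P = 1 \<Longrightarrow> mconj P A = mconj P B \<longleftrightarrow> A = B"
proof -
  assume P: "mdet P = 1"
  have "mconj (madj P) (mconj P C) = C" for C
    unfolding mconj_mconj madj_inverse(1)[OF P] by (simp add: mconj_def madj_def mat2_eq_iff)
  then show ?thesis by metis
qed

lemma mconj_prod_list: "mdet P = 1 \<Longrightarrow> prod_list (map (mconj P) ws) = mconj P (prod_list ws)"
  by (induction ws) (simp_all add: mconj_one mconj_mult)

text \<open>An eigenvector is completed to a basis of determinant one.\<close>

lemma triangularize:
  fixes f :: "'a::field mat2"
  assumes f: "mdet f = 1" and \<mu>: "\<mu> * \<mu> - mtr f * \<mu> + 1 = 0"
  shows "\<exists>P. mdet P = 1 \<and> m11 (mconj P f) = \<mu> \<and> m21 (mconj P f) = 0"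
proof -
  have char: "(m11 f - \<mu>) * (m22 f - \<mu>) = m12 f * m21 f"
    using f \<mu> by (simp add: mdet_def mtr_def algebra_simps)
  \<comment> \<open>The eigenvector is, up to sign, a nonzero column of the adjugate of
    \<open>f - \<mu>\<close>; if there is none, \<open>f\<close> is scalar.\<close>
  have "\<exists>p q. (p \<noteq> 0 \<or> q \<noteq> 0) \<and> m11 f * p + m12 f * q = \<mu> * p \<and> m21 f * p + m22 f * q = \<mu> * q"
  proof (cases "m12 f \<noteq> 0 \<or> \<mu> \<noteq> m11 f")
    case True
    then show ?thesis using char
      by (intro exI[of _ "m12 f"] exI[of _ "\<mu> - m11 f"]) (auto simp: algebra_simps)
  next
    case False
    show ?thesis
    proof (cases "m21 f \<noteq> 0 \<or> \<mu> \<noteq> m22 f")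
      case True
      then show ?thesis using False
        by (intro exI[of _ "\<mu> - m22 f"] exI[of _ "m21 f"]) (auto simp: algebra_simps)
    next
      case F2: False
      then show ?thesis using False by (intro exI[of _ 1] exI[of _ 0]) auto
    qed
  qed
  then obtain p q where pq: "p \<noteq> 0 \<or> q \<noteq> 0" "m11 f * p + m12 f * q = \<mu> * p" "m21 f * p + m22 f * q = \<mu> * q" by blast
  have "\<exists>r t. p * t - r * q = 1"
  proof (cases "p = 0")
    case True
    then show ?thesis using pq by (intro exI[of _ "- inverse q"] exI[of _ 0]) auto
  next
    case False
    then show ?thesis by (intro exI[of _ 0] exI[of _ "inverse p"]) auto
  qed
  then obtain r t where rt: "p * t - r * q = 1" by blast
  \<comment> \<open>The inverse of the matrix with columns \<open>(p, q)\<close> and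
    \<open>(r, t)\<close>.\<close>
  define P where "P = Mat2 t (- r) (- q) p"
  have dP: "mdet P = 1" using rt by (simp add: P_def mdet_def algebra_simps)
  have "m11 (mconj P f) = t * (m11 f * p + m12 f * q) - r * (m21 f * p + m22 f * q)"
    by (simp add: mconj_def madj_def P_def algebra_simps)
  also have "\<dots> = \<mu> * (p * t - r * q)" unfolding pq by (simp add: algebra_simps)
  finally have 1: "m11 (mconj P f) = \<mu>" using rt by simp
  have "m21 (mconj P f) = p * (m21 f * p + m22 f * q) - q * (m11 f * p + m12 f * q)"
    by (simp add: mconj_def madj_def P_def algebra_simps)
  also have "\<dots> = 0" unfolding pq by (simp add: algebra_simps)
  finally show ?thesis using dP 1 by blast
qed

lemma diagonalize:
  fixes f :: "'a::field mat2"
  assumes f: "mdet f = 1" and \<mu>: "\<mu> * \<mu> - mtr f * \<mu> + 1 = 0" "\<mu> * \<mu> \<noteq> 1"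
  shows "\<exists>P. mdet P = 1 \<and> mconj P f = Mat2 \<mu> 0 0 (inverse \<mu>)"
proof -
  obtain P where P: "mdet P = 1" "m11 (mconj P f) = \<mu>" "m21 (mconj P f) = 0" using triangularize[OF f \<mu>(1)] by blast
  have "mdet (mconj P f) = 1" using mdet_mconj[OF P(1)] f by simp
  then have m1: "\<mu> * m22 (mconj P f) = 1" using P by (simp add: mdet_def)
  then have \<mu>0: "\<mu> \<noteq> 0" and m22: "m22 (mconj P f) = inverse \<mu>" by (auto simp: inverse_unique)
  \<comment> \<open>The shear parameter that removes the upper right entry; the division is
    legitimate because the two eigenvalues differ.\<close>
  define s where "s = m12 (mconj P f) / (\<mu> - inverse \<mu>)"
  have ne: "\<mu> - inverse \<mu> \<noteq> 0" using \<mu>(2) \<mu>0 by (auto simp: field_simps)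
  define U where "U = Mat2 1 s 0 1"
  have dU: "mdet U = 1" by (simp add: U_def mdet_def)
  have sx: "s * \<mu> = s * inverse \<mu> + m12 (mconj P f)"
  proof -
    have "s * (\<mu> - inverse \<mu>) = m12 (mconj P f)" using ne by (simp add: s_def)
    then show ?thesis by (simp add: algebra_simps)
  qed
  have "mconj U N = Mat2 (m11 N + s * m21 N) (m12 N + s * m22 N - s * (m11 N + s * m21 N)) (m21 N) (m22 N - s * m21 N)" for N
    by (simp add: mconj_def U_def madj_def mat2_eq_iff algebra_simps)
  then have "mconj U (mconj P f) = Mat2 \<mu> 0 0 (inverse \<mu>)"
    using P(2,3) m22 sx by (simp add: algebra_simps)
  moreover have "mdet (U * P) = 1" using dU P by (simp add: mdet_mult)
  ultimately show ?thesis unfolding mconj_mconj by blast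
qed

section \<open>Semigroups of matrices of determinant one\<close>

lemma algebraic_over_monic:
  assumes E: "is_subfield E" and x: "algebraic_over E x"
  shows "\<exists>g\<in>polys_over E. lead_coeff g = 1 \<and> degree g > 0 \<and> poly g x = 0"
proof -
  have sE: "is_subring E" using E by (simp add: is_subfield_def)
  obtain p where p: "p \<in> polys_over E" "p \<noteq> 0" "poly p x = 0" using x by (auto simp: algebraic_over_def)
  define g where "g = smult (inverse (lead_coeff p)) p"
  have "g \<in> polys_over E" unfolding g_def
    using p E by (intro polys_over_closed(6)[OF sE]) (auto simp: is_subfield_def polys_over_def)
  moreover have "lead_coeff g = 1" "poly g x = 0" using p by (auto simp: g_def)
  moreover from this have "degree g > 0"
    by (metis degree_eq_zeroE gr0I lead_coeff_pCons(2) poly_const_conv zero_neq_one)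
  ultimately show ?thesis by blast
qed

lemma adjoin_coordinates:
  fixes R :: "'a::idom set"
  assumes R: "is_subring R" and g: "g \<in> polys_over R" "lead_coeff g = 1" "degree g > 0" "poly g y = 0"
    and z: "z \<in> adjoin R y"
  shows "\<exists>c. (\<forall>i. c i \<in> R) \<and> z = (\<Sum>i<degree g. c i * y ^ i)"
proof -
  note pc = polys_over_closed[OF R]
  let ?n = "degree g"
  have red: "\<exists>q\<in>polys_over R. (\<forall>i\<ge>?n. coeff q i = 0) \<and> poly p y = poly q y" if "p \<in> polys_over R" for p
    using that
  proof (induction p)
    case 0
    then show ?case using pc by (intro bexI[of _ 0]) auto
  next
    case (pCons a p)
    then obtain q where q: "q \<in> polys_over R" "\<forall>i\<ge>?n. coeff q i = 0" "poly p y = poly q y" by auto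
    define c where "c = coeff (pCons a q) ?n"
    define q' where "q' = pCons a q - smult c g"
    have q1: "pCons a q \<in> polys_over R" using pCons.prems q by simp
    then have cR: "c \<in> R" unfolding c_def by (auto simp: polys_over_def)
    have "q' \<in> polys_over R" unfolding q'_def using q1 cR g by (intro pc)
    moreover have "coeff q' i = 0" if "i \<ge> ?n" for i
    proof (cases "i = ?n")
      case True
      then show ?thesis using g by (simp add: q'_def c_def)
    next
      case False
      then have "i = Suc (i - 1)" "i - 1 \<ge> ?n" using \<open>i \<ge> ?n\<close> by auto
      then obtain j where j: "i = Suc j" "j \<ge> ?n" by blast
      have "coeff g i = 0" using j by (intro coeff_eq_0) simp
      then show ?thesis using q(2) j by (simp add: q'_def)
    qed
    moreover have "poly (pCons a p) y = poly q' y" using g(4) q(3) by (simp add: q'_def)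
    ultimately show ?case by blast
  qed
  obtain p where p: "p \<in> polys_over R" "z = poly p y" using z by (auto simp: adjoin_def)
  obtain q where q: "q \<in> polys_over R" "\<forall>i\<ge>?n. coeff q i = 0" "poly p y = poly q y" using red[OF p(1)] by blast
  have "degree q \<le> ?n" using q(2) by (intro degree_le) auto
  then have "poly q y = (\<Sum>i\<le>?n. coeff q i * y ^ i)"
    unfolding poly_altdef by (intro sum.mono_neutral_left) (auto simp: coeff_eq_0)
  also have "\<dots> = (\<Sum>i<?n. coeff q i * y ^ i)"
    using q(2) by (simp flip: lessThan_Suc_atMost)
  finally show ?thesis using p q by (intro exI[of _ "coeff q"]) (auto simp: polys_over_def)
qed

text \<open>All powers of \<open>z\<close> lie in the finite-dimensional space spanned by products
  of powers of \<open>x\<close> and \<open>y\<close>, so they are linearly dependent over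
  \<open>E\<close>.\<close>

lemma algebraic_over_adjoin:
  fixes E :: "'a::field set"
  assumes E: "is_subfield E" and x: "algebraic_over E x" and y: "algebraic_over E y"
    and z: "z \<in> adjoin (adjoin E x) y"
  shows "algebraic_over E z"
proof -
  have sE: "is_subring E" using E by (simp add: is_subfield_def)
  let ?A = "adjoin E x"
  have sA: "is_subring ?A" by (rule subring_adjoin[OF sE])
  obtain g where g: "g \<in> polys_over E" "lead_coeff g = 1" "degree g > 0" "poly g x = 0"
    using algebraic_over_monic[OF E x] by blast
  obtain h where h: "h \<in> polys_over E" "lead_coeff h = 1" "degree h > 0" "poly h y = 0"
    using algebraic_over_monic[OF E y] by blast
  have hA: "h \<in> polys_over ?A" using h(1) adjoin_superset(1)[OF sE] by (auto simp: polys_over_def)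
  let ?J = "{..<degree h} \<times> {..<degree g}"
  have coord: "\<exists>c. (\<forall>j. c j \<in> E) \<and> w = (\<Sum>(i, j)\<in>?J. c (i, j) * (x ^ j * y ^ i))" if w: "w \<in> adjoin ?A y" for w
  proof -
    obtain c where c: "\<And>i. c i \<in> ?A" "w = (\<Sum>i<degree h. c i * y ^ i)"
      using adjoin_coordinates[OF sA hA h(2-4) w] by blast
    have "\<forall>i. \<exists>d. (\<forall>j. d j \<in> E) \<and> c i = (\<Sum>j<degree g. d j * x ^ j)"
      using adjoin_coordinates[OF sE g c(1)] by blast
    then obtain d where d: "\<And>i j. d i j \<in> E" "\<And>i. c i = (\<Sum>j<degree g. d i j * x ^ j)" by metis
    have "w = (\<Sum>i<degree h. \<Sum>j<degree g. d i j * (x ^ j * y ^ i))"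
      unfolding c(2) d(2) by (simp add: sum_distrib_right mult.assoc)
    also have "\<dots> = (\<Sum>(i, j)\<in>?J. d i j * (x ^ j * y ^ i))" by (simp add: sum.cartesian_product)
    finally show ?thesis using d(1) by (intro exI[of _ "\<lambda>(i, j). d i j"]) auto
  qed
  have "z ^ k \<in> adjoin ?A y" for k using z subring_closed(7)[OF subring_adjoin[OF sA]] by blast
  then have "\<forall>k. \<exists>c. (\<forall>j. c j \<in> E) \<and> z ^ k = (\<Sum>(i, j)\<in>?J. c (i, j) * (x ^ j * y ^ i))" using coord by blast
  from choice[OF this] obtain c where
    c': "\<forall>k. (\<forall>j. c k j \<in> E) \<and> z ^ k = (\<Sum>(i, j)\<in>?J. c k (i, j) * (x ^ j * y ^ i))" by blast
  have c: "c k j \<in> E" "z ^ k = (\<Sum>(i, j)\<in>?J. c k (i, j) * (x ^ j * y ^ i))" for k j using c' by blast+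
  define N where "N = card ?J"
  obtain u where u: "\<forall>k\<in>{..N}. u k \<in> E" "\<exists>k\<in>{..N}. u k \<noteq> 0" "\<forall>j\<in>?J. (\<Sum>k\<in>{..N}. u k * c k j) = 0"
    using homogeneous_system_solution[OF sE, of ?J "{..N}" c] c(1) by (auto simp: N_def)
  define p where "p = (\<Sum>k\<le>N. monom (u k) k)"
  have cp: "coeff p k = (if k \<le> N then u k else 0)" for k by (simp add: p_def coeff_sum)
  have "p \<in> polys_over E" using u(1) subring_closed[OF sE] by (auto simp: polys_over_def cp)
  moreover have "p \<noteq> 0" using u(2) cp by (metis atMost_iff coeff_0)
  moreover have "poly p z = 0"
  proof -
    have "poly p z = (\<Sum>k\<le>N. u k * z ^ k)" by (simp add: p_def poly_sum poly_monom)
    also have "\<dots> = (\<Sum>k\<le>N. \<Sum>j\<in>?J. u k * c k j * (x ^ snd j * y ^ fst j))"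
      unfolding c(2) by (simp add: sum_distrib_left case_prod_unfold mult.assoc)
    also have "\<dots> = (\<Sum>j\<in>?J. \<Sum>k\<le>N. u k * c k j * (x ^ snd j * y ^ fst j))" by (rule sum.swap)
    also have "\<dots> = (\<Sum>j\<in>?J. (\<Sum>k\<le>N. u k * c k j) * (x ^ snd j * y ^ fst j))" by (simp add: sum_distrib_right)
    also have "\<dots> = 0" using u(3) by (intro sum.neutral) auto
    finally show ?thesis .
  qed
  ultimately show ?thesis by (auto simp: algebraic_over_def)
qed

lemma algebraic_over_closed:
  fixes E :: "'a::field set"
  assumes E: "is_subfield E" and x: "algebraic_over E x" and y: "algebraic_over E y"
  shows "algebraic_over E (x + y)" "algebraic_over E (x - y)" "algebraic_over E (x * y)"
    "algebraic_over E (inverse x)" "algebraic_over E (x / y)"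
proof -
  have sE: "is_subring E" using E by (simp add: is_subfield_def)
  have inv1: "algebraic_over E (inverse x)" if x: "algebraic_over E x" for x
  proof (cases "x = 0")
    case True
    then show ?thesis using x by simp
  next
    case False
    obtain p where p: "p \<in> polys_over E" "p \<noteq> 0" "poly p x = 0" using x by (auto simp: algebraic_over_def)
    have "poly (reflect_poly p) (inverse x) = 0" using poly_reflect_poly_nz[of "inverse x" p] False p(3) by simp
    then show ?thesis using p polys_over_closed(8)[OF sE p(1)] unfolding algebraic_over_def by (intro bexI[of _ "reflect_poly p"]) auto
  qed
  have ring: "algebraic_over E (x + y) \<and> algebraic_over E (x - y) \<and> algebraic_over E (x * y)"
    if x: "algebraic_over E x" and y: "algebraic_over E y" for x y
  proof -
    let ?W = "adjoin (adjoin E x) y"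
    have sA: "is_subring (adjoin E x)" by (rule subring_adjoin[OF sE])
    have W: "is_subring ?W" "x \<in> ?W" "y \<in> ?W"
      using subring_adjoin[OF sA] adjoin_superset[OF sA] adjoin_superset[OF sE] by blast+
    show ?thesis
      using algebraic_over_adjoin[OF E x y subring_closed(6)[OF W]] algebraic_over_adjoin[OF E x y subring_closed(3)[OF W]]
        algebraic_over_adjoin[OF E x y subring_closed(4)[OF W]] by blast
  qed
  show "algebraic_over E (x + y)" "algebraic_over E (x - y)" "algebraic_over E (x * y)"
    "algebraic_over E (inverse x)" "algebraic_over E (x / y)"
    using ring[OF x y] inv1[OF x] ring[OF x inv1[OF y]] by (auto simp: divide_inverse)
qed

abbreviation alg_elem :: "'a::field \<Rightarrow> bool" where
  "alg_elem \<equiv> algebraic_over prime_field"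

lemmas alg_closed_ops = algebraic_over_closed[OF subfield_prime_field]

lemma torsion_alg_elem: "torsion x \<Longrightarrow> alg_elem x"
proof -
  assume "torsion x"
  then obtain n where n: "n > 0" "x ^ n = 1" by (auto simp: torsion_def)
  have sE: "is_subring (prime_field :: 'a set)" using subfield_prime_field by (auto simp: is_subfield_def)
  let ?p = "monom 1 n - 1 :: 'a poly"
  have "coeff ?p n = 1" using n(1) by (simp add: one_pCons coeff_pCons split: nat.split)
  then have "?p \<noteq> 0" by (metis coeff_0 zero_neq_one)
  moreover have "?p \<in> polys_over prime_field"
    by (rule polys_over_closed(3)[OF sE polys_over_closed(7)[OF sE subring_closed(1)[OF sE]] polys_over_closed(2)[OF sE]])
  moreover have "poly ?p x = 0" using n by (simp add: poly_monom)
  ultimately show ?thesis unfolding algebraic_over_def by blast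
qed

lemma alg_elem_1: "alg_elem (1 :: 'a::field)" "alg_elem (0 :: 'a::field)"
proof -
  have 1: "alg_elem (1 :: 'a)" by (rule torsion_alg_elem) (auto simp: torsion_def)
  then show "alg_elem (1 :: 'a)" "alg_elem (0 :: 'a)" using alg_closed_ops(2)[OF 1 1] by auto
qed

text \<open>Why traces determine a matrix: given a diagonal matrix with distinct entries and a
  second matrix with \<open>c\<close> nonzero and upper right entry 1, these equations are solved
  for the four entries of \<open>N\<close>.\<close>

lemma trace_coordinates:
  fixes N :: "'a::comm_ring_1 mat2"
  shows "m11 N * (\<alpha> - \<beta>) = mtr (Mat2 \<alpha> 0 0 \<beta> * N) - \<beta> * mtr N"
    "m22 N = mtr N - m11 N"
    "(a * m11 N + m21 N) * (\<alpha> - \<beta>) = mtr (Mat2 \<alpha> 0 0 \<beta> * Mat2 a 1 c d * N) - \<beta> * mtr (Mat2 a 1 c d * N)"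
    "c * m12 N = mtr (Mat2 a 1 c d * N) - (a * m11 N + m21 N) - d * m22 N"
  by (simp_all add: mtr_def algebra_simps)

section \<open>Irreducible semigroups whose eigenvalues are roots of unity\<close>

lemma eigenvalue_exists:
  fixes A :: "'a::alg_closed_field mat2"
  shows "\<exists>\<zeta>. \<zeta> * \<zeta> - mtr A * \<zeta> + 1 = 0"
proof -
  have "degree [:1, - mtr A, 1:] > 0" by simp
  then obtain z where "poly [:1, - mtr A, 1:] z = 0" using alg_closed_imp_poly_has_root by blast
  then show ?thesis by (intro exI[of _ z]) (simp add: algebra_simps)
qed

lemma trace_of_eigenvalue:
  fixes \<zeta> :: "'a::field"
  assumes "\<zeta> * \<zeta> - t * \<zeta> + 1 = 0" shows "\<zeta> \<noteq> 0" "t = \<zeta> + inverse \<zeta>"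
proof -
  show z: "\<zeta> \<noteq> 0" using assms by auto
  have "t * \<zeta> = \<zeta> * \<zeta> + 1" using assms by (simp add: algebra_simps eq_neg_iff_add_eq_0)
  then show "t = \<zeta> + inverse \<zeta>" using z by (simp add: field_simps)
qed

text \<open>Equivalently, the matrices in \<open>I\<close> have a common eigenvector; the negation
  is irreducibility.\<close>

definition triangularizable :: "'a::field mat2 set \<Rightarrow> bool" where
  "triangularizable I \<longleftrightarrow> (\<exists>P. mdet P = 1 \<and> (\<forall>g\<in>I. m21 (mconj P g) = 0))"

definition word_products :: "'a::comm_ring_1 mat2 set \<Rightarrow> 'a mat2 set" where
  "word_products I = prod_list ` {ws \<in> lists I. ws \<noteq> []}"

lemma word_products_mult: "A \<in> word_products I \<Longrightarrow> B \<in> word_products I \<Longrightarrow> A * B \<in> word_products I"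
proof -
  assume "A \<in> word_products I" "B \<in> word_products I"
  then obtain ws ws' where "ws \<in> lists I" "ws \<noteq> []" "A = prod_list ws" "ws' \<in> lists I" "B = prod_list ws'"
    by (auto simp: word_products_def)
  then show ?thesis unfolding word_products_def by (intro image_eqI[of _ _ "ws @ ws'"]) auto
qed

lemma word_products_gen: "g \<in> I \<Longrightarrow> g \<in> word_products I"
  unfolding word_products_def by (intro image_eqI[of _ _ "[g]"]) auto

lemma word_products_det: "\<forall>g\<in>I. mdet g = 1 \<Longrightarrow> A \<in> word_products I \<Longrightarrow> mdet A = 1"
  by (auto simp: word_products_def intro: mdet_prod_list)

text \<open>A progression of three terms inside \<open>{k, - k}\<close>: with a nonzero difference
  the signs alternate, so \<open>u + u = 0\<close>. Then \<open>k = 1 + 1\<close> is zero and the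
  progression is constant after all.\<close>

lemma no_three_signs:
  fixes t u k :: "'a::field"
  assumes "t = k \<or> t = - k" "t + u = k \<or> t + u = - k" "t + u + u = k \<or> t + u + u = - k" "k = 1 + 1"
  shows "u = 0"
proof (rule ccontr)
  assume u: "u \<noteq> 0"
  have h: "x + u = - x" if "x = k \<or> x = - k" "x + u = k \<or> x + u = - k" for x
    using that u by auto
  have "t + u + u = t" using h[OF assms(1,2)] h[OF assms(2,3)] by (metis minus_minus)
  then have "u + u = 0" by (simp only: add.assoc add_cancel_left_right)
  then have "(1 + 1) * u = 0" by (simp only: distrib_right mult_1)
  then have "k = 0" using u assms(4) by simp
  then show False using assms(1,2) u by auto
qed

text \<open>Otherwise a nonscalar generator \<open>A\<close> has a double eigenvalue
  \<open>\<epsilon>\<close>. Let \<open>B\<close> be a generator that moves its eigenvector; then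
  the trace of \<open>B\<close>, \<open>\<epsilon>\<close> times that of \<open>A * B\<close>, and
  the trace of \<open>A * A * B\<close> form a progression with nonzero difference, contrary to
  \<open>no_three_signs\<close>.\<close>

lemma irreducible_trace:
  fixes I :: "'a::alg_closed_field mat2 set"
  assumes det: "\<And>g. g \<in> I \<Longrightarrow> mdet g = 1" and irr: "\<not> triangularizable I"
  shows "\<exists>A\<in>word_products I. mtr A \<noteq> 2 \<and> mtr A \<noteq> - 2"
proof (rule ccontr)
  assume "\<not> ?thesis"
  then have tr: "mtr A = 2 \<or> mtr A = - 2" if "A \<in> word_products I" for A using that by blast
  have "mdet (1 :: 'a mat2) = 1" "mconj 1 g = g" for g :: "'a mat2"
    by (simp_all add: mconj_def madj_def mat2_eq_iff)
  then obtain A where A: "A \<in> I" "m21 A \<noteq> 0" using irr unfolding triangularizable_def by metis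
  obtain \<epsilon> where \<epsilon>: "\<epsilon> * \<epsilon> = (1::'a)" "mtr A = 2 * \<epsilon>"
    using tr[OF word_products_gen[OF A(1)]] by (elim disjE) (force intro: that[of 1], force intro: that[of "- 1"])
  have "\<epsilon> * \<epsilon> - mtr A * \<epsilon> + 1 = 0" using \<epsilon> by (simp add: algebra_simps)
  then obtain P where P: "mdet P = 1" "m11 (mconj P A) = \<epsilon>" "m21 (mconj P A) = 0"
    using triangularize[OF det[OF A(1)]] by blast
  have "mdet (mconj P A) = 1" using mdet_mconj[OF P(1)] det[OF A(1)] by simp
  then have "\<epsilon> * m22 (mconj P A) = \<epsilon> * \<epsilon>" using P \<epsilon> by (simp add: mdet_def)
  moreover have "\<epsilon> \<noteq> 0" using \<epsilon>(1) by auto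
  ultimately have m22: "m22 (mconj P A) = \<epsilon>" by (metis mult_left_cancel)
  define s where "s = m12 (mconj P A)"
  have s0: "s \<noteq> 0"
  proof
    assume "s = 0"
    then have "mconj P A = mscale \<epsilon> 1" using P m22 by (simp add: mat2_eq_iff s_def)
    also have "\<dots> = mconj P (mscale \<epsilon> 1)"
      using madj_inverse(2)[OF P(1)] by (simp add: mconj_def mscale_simps)
    finally have "A = mscale \<epsilon> 1" using mconj_inj[OF P(1)] by blast
    then show False using A(2) by simp
  qed
  obtain B where B: "B \<in> I" "m21 (mconj P B) \<noteq> 0" using irr P(1) by (auto simp: triangularizable_def)
  define c where "c = m21 (mconj P B)"
  define t where "t = mtr B"
  define u where "u = \<epsilon> * s * c"
  have u0: "u \<noteq> 0" using s0 B(2) \<epsilon>(1) by (auto simp: u_def c_def)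
  have A': "mconj P A = Mat2 \<epsilon> s 0 \<epsilon>" using P m22 by (simp add: mat2_eq_iff s_def)
  have tB: "m11 (mconj P B) + m22 (mconj P B) = t" using mtr_mconj[OF P(1), of B] by (simp add: t_def mtr_def)
  have 1: "mtr (A * B) = \<epsilon> * t + s * c"
  proof -
    have "mtr (A * B) = mtr (mconj P A * mconj P B)" using mtr_mconj[OF P(1)] mconj_mult[OF P(1)] by metis
    also have "\<dots> = \<epsilon> * (m11 (mconj P B) + m22 (mconj P B)) + s * c" by (simp add: A' mtr_def c_def algebra_simps)
    finally show ?thesis by (simp add: tB)
  qed
  have 2: "mtr (A * A * B) = t + 2 * u"
  proof -
    have "mtr (A * A * B) = mtr (mconj P A * mconj P A * mconj P B)"
      using mtr_mconj[OF P(1)] mconj_mult[OF P(1)] by metis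
    also have "\<dots> = (\<epsilon> * \<epsilon>) * (m11 (mconj P B) + m22 (mconj P B)) + 2 * \<epsilon> * s * c"
      by (simp add: A' mtr_def c_def algebra_simps)
    finally show ?thesis by (simp add: tB \<epsilon> u_def)
  qed
  have w: "B \<in> word_products I" "A * B \<in> word_products I" "A * A * B \<in> word_products I"
    using word_products_mult[OF word_products_gen[OF A(1)] word_products_gen[OF B(1)]]
      word_products_mult[OF word_products_mult[OF word_products_gen[OF A(1)] word_products_gen[OF A(1)]]
        word_products_gen[OF B(1)]] word_products_gen[OF B(1)] by (simp_all only:)
  have "\<epsilon> = 1 \<or> \<epsilon> = - 1" using \<epsilon>(1) by (simp add: square_eq_1_iff)
  have tu: "t = 2 \<or> t = - 2" "t + u = 2 \<or> t + u = - 2" "t + 2 * u = 2 \<or> t + 2 * u = - 2"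
  proof -
    show "t = 2 \<or> t = - 2" "t + 2 * u = 2 \<or> t + 2 * u = - 2" using tr[OF w(1)] tr[OF w(3)] 2 by (auto simp: t_def)
    have "t + u = \<epsilon> * mtr (A * B)" unfolding 1 by (simp add: u_def distrib_left mult.assoc[symmetric] \<epsilon>)
    then show "t + u = 2 \<or> t + u = - 2" using tr[OF w(2)] \<open>\<epsilon> = 1 \<or> \<epsilon> = - 1\<close> by (elim disjE) simp_all
  qed
  have "t + u + u = 2 \<or> t + u + u = - 2" using tu(3) by (simp only: mult_2 add.assoc)
  from no_three_signs[OF tu(1,2) this one_add_one[symmetric]] show False using u0 by blast
qed

text \<open>The normal form behind \<open>trace_coordinates\<close>: a word with distinct
  eigenvalues is made diagonal, and a second word without zeros off the diagonal gets upper right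
  entry 1.\<close>

lemma irreducible_pair:
  fixes I :: "'a::alg_closed_field mat2 set"
  assumes det: "\<And>g. g \<in> I \<Longrightarrow> mdet g = 1" and irr: "\<not> triangularizable I"
  shows "\<exists>Q A B \<alpha> a c d. mdet Q = 1 \<and> A \<in> word_products I \<and> B \<in> word_products I \<and> \<alpha> \<noteq> 0 \<and> \<alpha> \<noteq> inverse \<alpha> \<and>
    mconj Q A = Mat2 \<alpha> 0 0 (inverse \<alpha>) \<and> mconj Q B = Mat2 a 1 c d \<and> c \<noteq> 0"
proof -
  have wdet: "mdet M = 1" if "M \<in> word_products I" for M using word_products_det that det by blast
  obtain A where A: "A \<in> word_products I" "mtr A \<noteq> 2" "mtr A \<noteq> - 2" using irreducible_trace[OF assms] by blast
  obtain \<alpha> where \<alpha>: "\<alpha> * \<alpha> - mtr A * \<alpha> + 1 = 0" using eigenvalue_exists by blast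
  note tr = trace_of_eigenvalue[OF \<alpha>]
  have a1: "\<alpha> * \<alpha> \<noteq> 1"
  proof
    assume "\<alpha> * \<alpha> = 1"
    then have "\<alpha> = 1 \<or> \<alpha> = - 1" by (simp add: square_eq_1_iff)
    then show False using tr(2) A by auto
  qed
  obtain P where P: "mdet P = 1" "mconj P A = Mat2 \<alpha> 0 0 (inverse \<alpha>)" using diagonalize[OF wdet[OF A(1)] \<alpha> a1] by blast
  obtain C where C: "C \<in> I" "m21 (mconj P C) \<noteq> 0" using irr P(1) by (auto simp: triangularizable_def)
  obtain B0 where B0: "B0 \<in> I" "m12 (mconj P B0) \<noteq> 0"
  proof -
    \<comment> \<open>Conjugation by \<open>J\<close> exchanges the coordinate axes, so
      irreducibility also yields a generator with nonzero upper right entry.\<close>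
    define J where "J = Mat2 0 1 (- 1) (0::'a)"
    have J: "mdet J = 1" "m21 (mconj J N) = - m12 N" for N by (simp_all add: J_def mdet_def mconj_def madj_def)
    have "mdet (J * P) = 1" using J P by (simp add: mdet_mult)
    then obtain g where "g \<in> I" "m21 (mconj (J * P) g) \<noteq> 0" using irr by (auto simp: triangularizable_def)
    then show ?thesis using that[of g] J(2) by (simp flip: mconj_mconj)
  qed
  have "\<exists>B\<in>word_products I. m12 (mconj P B) \<noteq> 0 \<and> m21 (mconj P B) \<noteq> 0"
  proof (cases "m12 (mconj P C) \<noteq> 0 \<or> m21 (mconj P B0) \<noteq> 0")
    case True
    then show ?thesis using C B0 word_products_gen by blast
  next
    case False
    \<comment> \<open>After conjugation \<open>C\<close> is lower and \<open>B0\<close> upper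
      triangular, so \<open>C * B0\<close> has both off-diagonal entries nonzero.\<close>
    have dC: "mdet (mconj P C) = 1" "mdet (mconj P B0) = 1" using mdet_mconj[OF P(1)] det C B0 by auto
    then have "m11 (mconj P C) \<noteq> 0" "m11 (mconj P B0) \<noteq> 0" using False by (auto simp: mdet_def)
    then have "m12 (mconj P (C * B0)) \<noteq> 0" "m21 (mconj P (C * B0)) \<noteq> 0"
      using False C(2) B0(2) by (auto simp: mconj_mult[OF P(1)])
    then show ?thesis using word_products_mult word_products_gen C(1) B0(1) by blast
  qed
  then obtain B where B: "B \<in> word_products I" "m12 (mconj P B) \<noteq> 0" "m21 (mconj P B) \<noteq> 0" by blast
  obtain s where s: "s ^ 2 = inverse (m12 (mconj P B))" using nth_root_exists[of 2 "inverse (m12 (mconj P B))"] by auto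
  have s0: "s \<noteq> 0" using s B(2) by auto
  \<comment> \<open>Conjugation by \<open>S\<close> multiplies the upper right entry by
    \<open>s ^ 2\<close> and thus normalises it to 1.\<close>
  define S where "S = Mat2 s 0 0 (inverse s)"
  have dS: "mdet S = 1" using s0 by (simp add: S_def mdet_def)
  have cS: "mconj S N = Mat2 (m11 N) (s ^ 2 * m12 N) (inverse s ^ 2 * m21 N) (m22 N)" for N
    using s0 by (simp add: S_def mconj_def madj_def mat2_eq_iff power2_eq_square)
  have "mdet (S * P) = 1" using dS P by (simp add: mdet_mult)
  moreover have "mconj (S * P) A = Mat2 \<alpha> 0 0 (inverse \<alpha>)" by (simp add: mconj_mconj[symmetric] P cS)
  moreover have "mconj (S * P) B = Mat2 (m11 (mconj P B)) 1 (inverse s ^ 2 * m21 (mconj P B)) (m22 (mconj P B))"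
    using B(2) by (simp add: mconj_mconj[symmetric] cS s)
  moreover have "inverse s ^ 2 * m21 (mconj P B) \<noteq> 0" using s0 B(3) by simp
  moreover have "\<alpha> \<noteq> inverse \<alpha>" using a1 tr(1) by (metis right_inverse)
  ultimately show ?thesis using A(1) B(1) tr(1) by blast
qed

text \<open>The trace of a word is a root of unity plus its inverse, hence algebraic, and by
  \<open>trace_coordinates\<close> so are all entries after conjugation with \<open>Q\<close>. This
  makes \<open>bounded_eigenvalue_order\<close> applicable to the ring of entries. The four traces
  in \<open>\<tau>\<close> then take finitely many values, and they determine the matrix.\<close>

lemma irreducible_torsion_finite:
  fixes I :: "'a::alg_closed_field mat2 set"
  assumes fin: "finite I" and det: "\<And>g. g \<in> I \<Longrightarrow> mdet g = 1" and irr: "\<not> triangularizable I"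
    and tors: "\<And>A \<zeta>. A \<in> word_products I \<Longrightarrow> \<zeta> * \<zeta> - mtr A * \<zeta> + 1 = 0 \<Longrightarrow> torsion \<zeta>"
  shows "finite (prod_list ` lists I)"
proof -
  obtain Q A B \<alpha> a c d where Q: "mdet Q = 1" and A: "A \<in> word_products I" and B: "B \<in> word_products I"
    and \<alpha>: "\<alpha> \<noteq> 0" "\<alpha> \<noteq> inverse \<alpha>" and cA: "mconj Q A = Mat2 \<alpha> 0 0 (inverse \<alpha>)"
    and cB: "mconj Q B = Mat2 a 1 c d" and c0: "c \<noteq> 0"
    using irreducible_pair[OF det irr] by blast
  let ?W = "word_products I"
  define \<delta> where "\<delta> = \<alpha> - inverse \<alpha>"
  have \<delta>: "\<delta> \<noteq> 0" using \<alpha> by (simp add: \<delta>_def)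
  note cm = mconj_mult[OF Q] and ctr = mtr_mconj[OF Q]
  have t1: "mtr (Mat2 \<alpha> 0 0 (inverse \<alpha>) * mconj Q N) = mtr (A * N)" for N
    unfolding cA[symmetric] cm[symmetric] ctr ..
  have t2: "mtr (Mat2 a 1 c d * mconj Q N) = mtr (B * N)" for N
    unfolding cB[symmetric] cm[symmetric] ctr ..
  have t3: "mtr (Mat2 \<alpha> 0 0 (inverse \<alpha>) * Mat2 a 1 c d * mconj Q N) = mtr (A * B * N)" for N
    unfolding cA[symmetric] cB[symmetric] cm[symmetric] ctr ..
  have co: "m11 (mconj Q N) * \<delta> = mtr (A * N) - inverse \<alpha> * mtr N"
    "m22 (mconj Q N) = mtr N - m11 (mconj Q N)"
    "(a * m11 (mconj Q N) + m21 (mconj Q N)) * \<delta> = mtr (A * B * N) - inverse \<alpha> * mtr (B * N)"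
    "c * m12 (mconj Q N) = mtr (B * N) - (a * m11 (mconj Q N) + m21 (mconj Q N)) - d * m22 (mconj Q N)" for N
  proof -
    show "m11 (mconj Q N) * \<delta> = mtr (A * N) - inverse \<alpha> * mtr N"
      using trace_coordinates(1)[of "mconj Q N" \<alpha> "inverse \<alpha>"] unfolding t1 ctr \<delta>_def .
    show "m22 (mconj Q N) = mtr N - m11 (mconj Q N)"
      using trace_coordinates(2)[of "mconj Q N"] unfolding ctr .
    show "(a * m11 (mconj Q N) + m21 (mconj Q N)) * \<delta> = mtr (A * B * N) - inverse \<alpha> * mtr (B * N)"
      using trace_coordinates(3)[of a "mconj Q N" \<alpha> "inverse \<alpha>" c d] unfolding t2 t3 \<delta>_def .
    show "c * m12 (mconj Q N) = mtr (B * N) - (a * m11 (mconj Q N) + m21 (mconj Q N)) - d * m22 (mconj Q N)"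
      using trace_coordinates(4)[of c "mconj Q N" a d] unfolding t2 .
  qed
  have tralg: "alg_elem (mtr M)" if M: "M \<in> ?W" for M
  proof -
    obtain \<zeta> where z: "\<zeta> * \<zeta> - mtr M * \<zeta> + 1 = 0" using eigenvalue_exists by blast
    have "alg_elem \<zeta>" using tors[OF M z] by (rule torsion_alg_elem)
    then show ?thesis using alg_closed_ops(1)[OF _ alg_closed_ops(4)] trace_of_eigenvalue(2)[OF z] by metis
  qed
  have \<alpha>alg: "alg_elem \<alpha>" "alg_elem (inverse \<alpha>)"
  proof -
    have "mtr A = \<alpha> + inverse \<alpha>" using ctr[of A] by (simp add: cA mtr_def)
    then have "\<alpha> * \<alpha> - mtr A * \<alpha> + 1 = 0" using \<alpha>(1) by (simp add: field_simps)
    then show "alg_elem \<alpha>" using tors[OF A] torsion_alg_elem by blast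
    then show "alg_elem (inverse \<alpha>)" by (rule alg_closed_ops(4)) (rule alg_elem_1)
  qed
  note op = alg_closed_ops
  have \<delta>alg: "alg_elem \<delta>" unfolding \<delta>_def by (intro op \<alpha>alg)
  have diag: "alg_elem (m11 (mconj Q N)) \<and> alg_elem (m22 (mconj Q N))" if N: "N \<in> ?W" for N
  proof -
    have "m11 (mconj Q N) = (mtr (A * N) - inverse \<alpha> * mtr N) / \<delta>" using co(1)[of N] \<delta> by (simp add: field_simps)
    then have 1: "alg_elem (m11 (mconj Q N))"
      using op(5)[OF op(2)[OF tralg op(3)[OF \<alpha>alg(2) tralg]] \<delta>alg] N A word_products_mult by metis
    then show ?thesis using co(2)[of N] op(2)[OF tralg[OF N] 1] by simp
  qed
  have ad: "alg_elem a" "alg_elem d" using diag[OF B] by (simp_all add: cB)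
  have "mdet (mconj Q B) = 1" using mdet_mconj[OF Q] word_products_det[OF _ B] det by simp
  then have "c = a * d - 1" by (simp add: cB mdet_def algebra_simps)
  then have calg: "alg_elem c" using op(2)[OF op(3)[OF ad] alg_elem_1(1)] by simp
  have off: "alg_elem (m21 (mconj Q N)) \<and> alg_elem (m12 (mconj Q N))" if N: "N \<in> ?W" for N
  proof -
    define e where "e = a * m11 (mconj Q N) + m21 (mconj Q N)"
    have "e = (mtr (A * B * N) - inverse \<alpha> * mtr (B * N)) / \<delta>" using co(3)[of N] \<delta> by (simp add: e_def field_simps)
    moreover have w: "A * B * N \<in> ?W" "B * N \<in> ?W" using A B N word_products_mult by blast+
    ultimately have ea: "alg_elem e"
      using op(5)[OF op(2)[OF tralg[OF w(1)] op(3)[OF \<alpha>alg(2) tralg[OF w(2)]]] \<delta>alg] by simp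
    have "m21 (mconj Q N) = e - a * m11 (mconj Q N)" by (simp add: e_def)
    then have 1: "alg_elem (m21 (mconj Q N))" using op(2)[OF ea op(3)[OF ad(1)]] diag[OF N] by simp
    have "m12 (mconj Q N) = (mtr (B * N) - e - d * m22 (mconj Q N)) / c"
      using co(4)[of N] c0 unfolding e_def by (simp add: field_simps)
    then have "alg_elem (m12 (mconj Q N))"
      using op(5)[OF op(2)[OF op(2)[OF tralg[OF w(2)] ea] op(3)[OF ad(2)]] calg] diag[OF N] by simp
    then show ?thesis using 1 by blast
  qed
  obtain gs where gs: "set gs = I" using finite_list[OF fin] by blast
  define ys where "ys = concat (map (\<lambda>g. [m11 (mconj Q g), m12 (mconj Q g), m21 (mconj Q g), m22 (mconj Q g)]) gs)"
  have setys: "set ys = (\<Union>g\<in>I. {m11 (mconj Q g), m12 (mconj Q g), m21 (mconj Q g), m22 (mconj Q g)})"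
    using gs by (auto simp: ys_def)
  have "algebraic_int y" if y: "y \<in> set ys" for y
  proof -
    obtain g where g: "g \<in> I" "y \<in> {m11 (mconj Q g), m12 (mconj Q g), m21 (mconj Q g), m22 (mconj Q g)}"
      using y by (auto simp: setys)
    then have "alg_elem y" using diag[OF word_products_gen[OF g(1)]] off[OF word_products_gen[OF g(1)]] by auto
    then show ?thesis by (rule algebraic_over_prime_field)
  qed
  then obtain K where K: "K > 0" "\<And>t \<zeta>. t \<in> ring_gen ys \<Longrightarrow> torsion \<zeta> \<Longrightarrow> \<zeta> * \<zeta> - t * \<zeta> + 1 = 0 \<Longrightarrow> \<zeta> ^ K = 1"
    using bounded_eigenvalue_order[of ys] by blast
  note sR = ring_gen_props(1)[of ys]
  have genR: "mconj Q g \<in> mats_over (ring_gen ys)" if "g \<in> I" for g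
    using that ring_gen_props(2)[of ys] unfolding setys mats_over_def by blast
  have trR: "mtr M \<in> ring_gen ys" if M: "M \<in> ?W" for M
  proof -
    obtain ws where ws: "ws \<in> lists I" "M = prod_list ws" using M by (auto simp: word_products_def)
    have "prod_list (map (mconj Q) ws) \<in> mats_over (ring_gen ys)"
      using ws(1) genR by (intro mats_over_prod_list[OF sR]) auto
    then have "mconj Q M \<in> mats_over (ring_gen ys)" using mconj_prod_list[OF Q] ws(2) by simp
    then have "mtr (mconj Q M) \<in> ring_gen ys" using subring_closed(6)[OF sR] by (auto simp: mtr_def mats_over_def)
    then show ?thesis by (simp add: ctr)
  qed
  \<comment> \<open>The trace 2 belongs to the identity, which is the empty word.\<close>
  define Tr where "Tr = insert 2 ((\<lambda>\<zeta>. \<zeta> + inverse \<zeta>) ` {\<zeta>::'a. \<zeta> ^ K = 1})"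
  have finTr: "finite Tr" unfolding Tr_def using finite_roots_of_unity[OF K(1), where 'a = 'a] by blast
  have trTr: "mtr M \<in> Tr" if M: "M \<in> ?W" for M
  proof -
    obtain \<zeta> where z: "\<zeta> * \<zeta> - mtr M * \<zeta> + 1 = 0" using eigenvalue_exists by blast
    have "\<zeta> ^ K = 1" using K(2)[OF trR[OF M] tors[OF M z] z] .
    then show ?thesis using trace_of_eigenvalue(2)[OF z] by (auto simp: Tr_def)
  qed
  define \<tau> where "\<tau> = (\<lambda>M. (mtr M, mtr (A * M), mtr (B * M), mtr (A * B * M)))"
  have inW: "prod_list ws = 1 \<or> prod_list ws \<in> ?W" if "ws \<in> lists I" for ws
    using that by (cases "ws = []") (auto simp: word_products_def)
  have "\<tau> ` prod_list ` lists I \<subseteq> Tr \<times> Tr \<times> Tr \<times> Tr"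
  proof (intro image_subsetI)
    fix M assume "M \<in> prod_list ` lists I"
    then consider "M = 1" | "M \<in> ?W" using inW by blast
    then show "\<tau> M \<in> Tr \<times> Tr \<times> Tr \<times> Tr"
    proof cases
      case 1
      have "mtr (1 :: 'a mat2) \<in> Tr" by (simp add: Tr_def mtr_def)
      then show ?thesis
        using trTr[OF A] trTr[OF B] trTr[OF word_products_mult[OF A B]] by (simp add: \<tau>_def 1)
    next
      case 2
      show ?thesis
        using trTr[OF 2] trTr[OF word_products_mult[OF A 2]] trTr[OF word_products_mult[OF B 2]]
          trTr[OF word_products_mult[OF word_products_mult[OF A B] 2]] by (simp add: \<tau>_def)
    qed
  qed
  then have "finite (\<tau> ` prod_list ` lists I)" by (rule finite_subset) (simp add: finTr)
  moreover have "inj \<tau>"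
  proof (rule injI)
    fix M N assume "\<tau> M = \<tau> N"
    then have e: "mtr M = mtr N" "mtr (A * M) = mtr (A * N)" "mtr (B * M) = mtr (B * N)" "mtr (A * B * M) = mtr (A * B * N)"
      by (auto simp: \<tau>_def)
    have 1: "m11 (mconj Q M) = m11 (mconj Q N)" using co(1)[of M] co(1)[of N] e \<delta> by (metis mult_right_cancel)
    have 2: "m22 (mconj Q M) = m22 (mconj Q N)" using co(2)[of M] co(2)[of N] e 1 by metis
    have "a * m11 (mconj Q M) + m21 (mconj Q M) = a * m11 (mconj Q N) + m21 (mconj Q N)"
      using co(3)[of M] co(3)[of N] e \<delta> by (metis mult_right_cancel)
    then have 3: "m21 (mconj Q M) = m21 (mconj Q N)" using 1 by simp
    have 4: "m12 (mconj Q M) = m12 (mconj Q N)" using co(4)[of M] co(4)[of N] e 1 2 3 c0 by (metis mult_left_cancel)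
    have "mconj Q M = mconj Q N" using 1 2 3 4 by (simp add: mat2_eq_iff)
    then show "M = N" using mconj_inj[OF Q] by blast
  qed
  ultimately show ?thesis using finite_imageD inj_on_subset by blast
qed

text \<open>A diagonal letter multiplies the essential entry, an antidiagonal letter inverts it
  before multiplying. So a word is described by its shape, a sign, and the exponents of the entries
  \<open>cc g\<close> and of their inverses, each at most the length of the word.\<close>

lemma monomial_growth:
  fixes I :: "'a::field mat2 set"
  assumes fin: "finite I" and I: "\<And>g. g \<in> I \<Longrightarrow> mdet g = 1 \<and> (m12 g = 0 \<and> m21 g = 0 \<or> m11 g = 0 \<and> m22 g = 0)"
  shows "\<exists>C k. \<forall>n. card (prod_list ` {ws \<in> lists I. length ws \<le> n}) \<le> C * (n + 1) ^ k"
proof -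
  define dg where "dg = (\<lambda>g::'a mat2. m12 g = 0 \<and> m21 g = 0)"
  define cc where "cc = (\<lambda>g::'a mat2. if dg g then m11 g else m12 g)"
  \<comment> \<open>Diagonal for \<open>True\<close>, antidiagonal for \<open>False\<close>, of
    determinant one and given by the nonzero entry of the upper row.\<close>
  define form where "form = (\<lambda>b (x::'a). if b then Mat2 x 0 0 (inverse x) else Mat2 0 x (- inverse x) 0)"
  define val where "val = (\<lambda>e. \<Prod>g\<in>I. cc g ^ e (g, True) * inverse (cc g) ^ e (g, False))"
  have g: "cc g \<noteq> 0 \<and> g = form (dg g) (cc g)" if "g \<in> I" for g
  proof (cases "dg g")
    case True
    then have e: "m11 g * m22 g = 1" using I[OF that] by (simp add: dg_def mdet_def)
    then have "m11 g \<noteq> 0" "m22 g = inverse (m11 g)" by (auto simp: inverse_unique)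
    then show ?thesis using True by (simp add: form_def cc_def mat2_eq_iff) (simp add: dg_def)
  next
    case False
    then have z: "m11 g = 0" "m22 g = 0" using I[OF that] by (auto simp: dg_def)
    then have e: "m12 g * - m21 g = 1" using I[OF that] by (simp add: mdet_def)
    then have "m12 g \<noteq> 0" by auto
    moreover have "- m21 g = inverse (m12 g)" using inverse_unique[OF e] by simp
    ultimately show ?thesis using False z by (simp add: form_def cc_def mat2_eq_iff) (metis minus_minus)
  qed
  have mult: "form b c * form b' x = (if b then form b' (c * x) else if b' then form False (c * inverse x) else form True (- (c * inverse x)))"
    if "c \<noteq> 0" "x \<noteq> 0" for b b' c x
    using that by (simp add: form_def mat2_eq_iff)
  have val0: "val e \<noteq> 0" for e using g fin by (simp add: val_def)
  have bump: "val (\<lambda>i. e i + (if i = (h, True) then 1 else 0)) = cc h * val e" if "h \<in> I" for e h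
  proof -
    have "val (\<lambda>i. e i + (if i = (h, True) then 1 else 0)) =
        (\<Prod>g\<in>I. (if g = h then cc g else 1) * (cc g ^ e (g, True) * inverse (cc g) ^ e (g, False)))"
      unfolding val_def by (intro prod.cong) auto
    also have "\<dots> = cc h * val e" using that fin by (simp add: prod.distrib val_def)
    finally show ?thesis .
  qed
  have flip: "val (\<lambda>(g, b). e (g, \<not> b)) = inverse (val e)" for e
  proof -
    have "val (\<lambda>(g, b). e (g, \<not> b)) * val e = (\<Prod>g\<in>I. 1)"
      unfolding val_def prod.distrib[symmetric] using g by (intro prod.cong) (auto simp: field_simps)
    then have "val e * val (\<lambda>(g, b). e (g, \<not> b)) = 1" by (simp add: mult.commute)
    then show ?thesis by (rule inverse_unique[symmetric])
  qed
  have word: "\<exists>b s e. s \<in> {1, - 1} \<and> (\<forall>i. e i \<le> length ws) \<and> prod_list ws = form b (s * val e)" if "ws \<in> lists I" for ws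
    using that
  proof (induction ws)
    case Nil
    show ?case by (intro exI[of _ True] exI[of _ 1] exI[of _ "\<lambda>_. 0"]) (simp add: form_def val_def mat2_eq_iff)
  next
    case (Cons h ws)
    then obtain b s e where IH: "s \<in> {1, - 1}" "\<forall>i. e i \<le> length ws" "prod_list ws = form b (s * val e)" by auto
    have h: "cc h \<noteq> 0" "h = form (dg h) (cc h)" "h \<in> I" using g Cons by auto
    have s0: "s * val e \<noteq> 0" using IH(1) val0 by auto
    have eq: "prod_list (h # ws) = (if dg h then form b (cc h * (s * val e)) else
        if b then form False (cc h * inverse (s * val e)) else form True (- (cc h * inverse (s * val e))))"
    proof -
      have "prod_list (h # ws) = form (dg h) (cc h) * form b (s * val e)" using h(2) IH(3) by (metis prod_list.Cons)
      then show ?thesis by (simp only: mult[OF h(1) s0])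
    qed
    have inv_s: "inverse s = s" using IH(1) by auto
    show ?case
    proof (cases "dg h")
      case True
      let ?e = "\<lambda>i. e i + (if i = (h, True) then 1 else 0)"
      have "prod_list (h # ws) = form b (s * val ?e)" unfolding eq bump[OF h(3)] using True by (simp add: mult_ac)
      moreover have "\<forall>i. ?e i \<le> length (h # ws)" using IH(2) by (auto intro: le_SucI)
      ultimately show ?thesis using IH(1) by (intro exI[of _ b] exI[of _ s] exI[of _ ?e] conjI)
    next
      case False
      let ?f = "\<lambda>(g, b). e (g, \<not> b)"
      let ?e = "\<lambda>i. ?f i + (if i = (h, True) then 1 else 0)"
      have v: "cc h * inverse (s * val e) = s * val ?e"
        unfolding bump[OF h(3)] flip inverse_mult_distrib inv_s by (simp only: mult_ac)
      have l: "\<forall>i. ?e i \<le> length (h # ws)" using IH(2) by (auto intro: le_SucI)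
      have "prod_list (h # ws) = (if b then form False (s * val ?e) else form True (- s * val ?e))"
        unfolding eq v using False by simp
      then have "prod_list (h # ws) = form (\<not> b) ((if b then s else - s) * val ?e)" by auto
      moreover have "(if b then s else - s) \<in> {1, - 1}" using IH(1) by auto
      ultimately show ?thesis using l
        by (intro exI[of _ "\<not> b"] exI[of _ "if b then s else - s"] exI[of _ ?e] conjI)
    qed
  qed
  have "card (prod_list ` {ws \<in> lists I. length ws \<le> n}) \<le>
      card (UNIV \<times> {1, - 1 :: 'a} :: (bool \<times> 'a) set) * (n + 1) ^ card (I \<times> (UNIV :: bool set))" for n
  proof (rule card_image_exponent_vectors_le)
    show "prod_list ` {ws \<in> lists I. length ws \<le> n} \<subseteq>
      (\<lambda>((b, s), e). form b (s * val e)) ` ((UNIV \<times> {1, - 1}) \<times> ((I \<times> UNIV) \<rightarrow>\<^sub>E {..n}))"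
    proof (intro subsetI, elim imageE)
      fix x ws assume x: "x = prod_list ws" and "ws \<in> {ws \<in> lists I. length ws \<le> n}"
      then have ws: "ws \<in> lists I" "length ws \<le> n" by auto
      obtain b s e where w: "s \<in> {1, - 1}" "\<forall>i. e i \<le> length ws" "prod_list ws = form b (s * val e)" using word[OF ws(1)] by blast
      define e' where "e' = restrict e (I \<times> UNIV)"
      have "val e' = val e" unfolding val_def by (intro prod.cong) (auto simp: e'_def)
      moreover have "e' \<in> (I \<times> UNIV) \<rightarrow>\<^sub>E {..n}" using w(2) by (auto simp: e'_def intro: le_trans[OF _ ws(2)])
      ultimately show "x \<in> (\<lambda>((b, s), e). form b (s * val e)) ` ((UNIV \<times> {1, - 1}) \<times> ((I \<times> UNIV) \<rightarrow>\<^sub>E {..n}))"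
        using w(1,3) x by (intro image_eqI[of _ _ "((b, s), e')"]) auto
    qed
  qed (use fin in auto)
  then show ?thesis by blast
qed

text \<open>The diagonal of a word consists of roots of unity from the finite group
  \<open>U\<close>. The upper right entry is a sum of terms \<open>y * m12 h\<close> with
  \<open>y\<close> in \<open>U\<close>, one for each letter, so it depends only on how often each
  pair \<open>(h, y)\<close> occurs.\<close>

lemma triangular_growth:
  fixes I :: "'a::field mat2 set"
  assumes fin: "finite I" and I: "\<And>g. g \<in> I \<Longrightarrow> mdet g = 1 \<and> m21 g = 0 \<and> torsion (m11 g)"
  shows "\<exists>C k. \<forall>n. card (prod_list ` {ws \<in> lists I. length ws \<le> n}) \<le> C * (n + 1) ^ k"
proof -
  obtain N where N: "N > 0" "\<forall>g\<in>I. m11 g ^ N = 1" using torsion_common_exponent[OF fin, of m11] I by blast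
  define U where "U = {z::'a. z ^ N = 1}"
  have finU: "finite U" unfolding U_def by (rule finite_roots_of_unity[OF N(1)])
  have Umult: "y * z \<in> U" "inverse z \<in> U" if "y \<in> U" "z \<in> U" for y z
    using that by (auto simp: U_def power_mult_distrib power_inverse)
  have U0: "z \<noteq> 0" if "z \<in> U" for z using that N(1) by (auto simp: U_def power_0_left)
  have gU: "m11 g \<in> U" "m22 g = inverse (m11 g)" if "g \<in> I" for g
  proof -
    show "m11 g \<in> U" using N that by (simp add: U_def)
    have "m11 g * m22 g = 1" using I[OF that] by (auto simp: mdet_def)
    then show "m22 g = inverse (m11 g)" by (metis inverse_unique)
  qed
  define val where "val = (\<lambda>e. \<Sum>(h, y)\<in>I \<times> U. of_nat (e (h, y)) * (y * m12 h))"
  have word: "\<exists>z e. z \<in> U \<and> (\<forall>i. e i \<le> length ws) \<and> prod_list ws = Mat2 z (val e) 0 (inverse z)" if "ws \<in> lists I" for ws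
    using that
  proof (induction ws)
    case Nil
    show ?case by (intro exI[of _ 1] exI[of _ "\<lambda>_. 0"]) (simp add: val_def mat2_eq_iff U_def)
  next
    case (Cons g ws)
    then obtain z e where IH: "z \<in> U" "\<forall>i. e i \<le> length ws" "prod_list ws = Mat2 z (val e) 0 (inverse z)" by auto
    have g: "g \<in> I" using Cons by auto
    let ?\<zeta> = "m11 g"
    \<comment> \<open>Multiplication by \<open>g\<close> from the left rotates the old terms by
      \<open>?\<zeta>\<close> and adds the term \<open>inverse z * m12 g\<close>.\<close>
    define e' where "e' = (\<lambda>(h, y). e (h, inverse ?\<zeta> * y) + (if (h, y) = (g, inverse z) then 1 else 0))"
    have \<zeta>0: "?\<zeta> \<noteq> 0" using U0 gU[OF g] by blast
    have "val e' = (\<Sum>(h, y)\<in>I \<times> U. of_nat (e (h, inverse ?\<zeta> * y)) * (y * m12 h)) +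
        (\<Sum>p\<in>I \<times> U. if p = (g, inverse z) then snd p * m12 (fst p) else 0)"
      unfolding val_def e'_def sum.distrib[symmetric] by (intro sum.cong) (auto simp: distrib_right split: if_splits)
    also have "(\<Sum>p\<in>I \<times> U. if p = (g, inverse z) then snd p * m12 (fst p) else 0) = inverse z * m12 g" using g IH(1) Umult fin finU by (subst sum.delta) auto
    also have "(\<Sum>(h, y)\<in>I \<times> U. of_nat (e (h, inverse ?\<zeta> * y)) * (y * m12 h)) =
        (\<Sum>(h, y)\<in>I \<times> U. of_nat (e (h, y)) * (?\<zeta> * y * m12 h))"
      using Umult gU[OF g] \<zeta>0
      by (intro sum.reindex_bij_witness[of _ "\<lambda>(h, y). (h, ?\<zeta> * y)" "\<lambda>(h, y). (h, inverse ?\<zeta> * y)"]) auto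
    also have "\<dots> = ?\<zeta> * val e" by (simp add: val_def sum_distrib_left case_prod_unfold mult_ac)
    finally have ve: "val e' = ?\<zeta> * val e + inverse z * m12 g" .
    have "prod_list (g # ws) = Mat2 (?\<zeta> * z) (val e') 0 (inverse (?\<zeta> * z))"
      using IH(3) I[OF g] gU(2)[OF g] by (simp add: mat2_eq_iff ve mult_ac)
    moreover have "\<forall>i. e' i \<le> length (g # ws)" using IH(2) by (auto simp: e'_def intro: le_SucI)
    moreover have "?\<zeta> * z \<in> U" using Umult gU[OF g] IH(1) by blast
    ultimately show ?case by blast
  qed
  have "card (prod_list ` {ws \<in> lists I. length ws \<le> n}) \<le> card U * (n + 1) ^ card (I \<times> U)" for n
  proof (rule card_image_exponent_vectors_le)
    show "prod_list ` {ws \<in> lists I. length ws \<le> n} \<subseteq>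
      (\<lambda>(z, e). Mat2 z (val e) 0 (inverse z)) ` (U \<times> ((I \<times> U) \<rightarrow>\<^sub>E {..n}))"
    proof (intro subsetI, elim imageE)
      fix x ws assume x: "x = prod_list ws" and "ws \<in> {ws \<in> lists I. length ws \<le> n}"
      then have ws: "ws \<in> lists I" "length ws \<le> n" by auto
      obtain z e where w: "z \<in> U" "\<forall>i. e i \<le> length ws" "prod_list ws = Mat2 z (val e) 0 (inverse z)" using word[OF ws(1)] by blast
      define e' where "e' = restrict e (I \<times> U)"
      have "val e' = val e" unfolding val_def by (intro sum.cong) (auto simp: e'_def)
      moreover have "e' \<in> (I \<times> U) \<rightarrow>\<^sub>E {..n}" using w(2) by (auto simp: e'_def intro: le_trans[OF _ ws(2)])
      ultimately show "x \<in> (\<lambda>(z, e). Mat2 z (val e) 0 (inverse z)) ` (U \<times> ((I \<times> U) \<rightarrow>\<^sub>E {..n}))"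
        using w(1,3) x by (intro image_eqI[of _ _ "(z, e')"]) auto
    qed
  qed (use fin finU in auto)
  then show ?thesis by blast
qed

lemma mfree_mconj:
  fixes A B :: "'a::field mat2"
  assumes P: "mdet P = 1" and "mfree (mconj P A) (mconj P B)"
  shows "mfree A B"
proof -
  have pr: "mproj (mconj P M) (mconj P N)" if "mproj M N" for M N :: "'a mat2"
    using that by (auto simp: mproj_def mconj_def mscale_simps)
  have inj: "inj (mconj P)" using mconj_inj[OF P] by (auto intro: injI)
  have "ws = ws'" if w: "ws \<in> lists {A, B}" "ws' \<in> lists {A, B}" "mproj (prod_list ws) (prod_list ws')" for ws ws'
  proof -
    have "mproj (prod_list (map (mconj P) ws)) (prod_list (map (mconj P) ws'))"
      unfolding mconj_prod_list[OF P] using pr[OF w(3)] .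
    moreover have "map (mconj P) ws \<in> lists {mconj P A, mconj P B}" "map (mconj P) ws' \<in> lists {mconj P A, mconj P B}"
      using w by auto
    ultimately have "map (mconj P) ws = map (mconj P) ws'" using assms(2) by (simp add: mfree_def)
    then show ?thesis using inj by (metis inj_map_eq_map)
  qed
  moreover have "A \<noteq> B" using assms(2) by (auto simp: mfree_def)
  ultimately show ?thesis by (auto simp: mfree_def)
qed

lemma growth_mconj:
  fixes I :: "'a::field mat2 set"
  assumes P: "mdet P = 1"
  shows "card (prod_list ` {ws \<in> lists (mconj P ` I). length ws \<le> n}) = card (prod_list ` {ws \<in> lists I. length ws \<le> n})"
proof -
  have "prod_list ` {ws \<in> lists (mconj P ` I). length ws \<le> n} = mconj P ` prod_list ` {ws \<in> lists I. length ws \<le> n}"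
  proof (intro equalityI subsetI)
    fix M assume "M \<in> prod_list ` {ws \<in> lists (mconj P ` I). length ws \<le> n}"
    then obtain ws where ws: "ws \<in> lists (mconj P ` I)" "length ws \<le> n" "M = prod_list ws" by auto
    then obtain us where us: "us \<in> lists I" "ws = map (mconj P) us" by (auto simp: lists_image)
    then have "M = mconj P (prod_list us)" using ws(3) mconj_prod_list[OF P] by simp
    then show "M \<in> mconj P ` prod_list ` {ws \<in> lists I. length ws \<le> n}" using us ws(2) by auto
  next
    fix M assume "M \<in> mconj P ` prod_list ` {ws \<in> lists I. length ws \<le> n}"
    then obtain us where us: "us \<in> lists I" "length us \<le> n" "M = mconj P (prod_list us)" by auto
    then have "M = prod_list (map (mconj P) us)" "map (mconj P) us \<in> lists (mconj P ` I)"
      using mconj_prod_list[OF P] by auto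
    then show "M \<in> prod_list ` {ws \<in> lists (mconj P ` I). length ws \<le> n}" using us(2) by auto
  qed
  moreover have "inj (mconj P)" using mconj_inj[OF P] by (auto intro: injI)
  ultimately show ?thesis by (simp add: card_image inj_on_subset)
qed

theorem sl2_semigroup_alternative:
  fixes I :: "'a::alg_closed_field mat2 set"
  assumes fin: "finite I" and det: "\<And>g. g \<in> I \<Longrightarrow> mdet g = 1"
  shows "(\<exists>A\<in>word_products I. \<exists>B\<in>word_products I. mfree A B) \<or>
    (\<exists>C k. \<forall>n. card (prod_list ` {ws \<in> lists I. length ws \<le> n}) \<le> C * (n + 1) ^ k)"
proof (cases "\<exists>A\<in>word_products I. \<exists>\<mu>. \<mu> * \<mu> - mtr A * \<mu> + 1 = 0 \<and> \<not> torsion \<mu>")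
  case True
  then obtain A \<mu> where A: "A \<in> word_products I" and \<mu>: "\<mu> * \<mu> - mtr A * \<mu> + 1 = 0" "\<not> torsion \<mu>" by blast
  have wdet: "mdet M = 1" if "M \<in> word_products I" for M using word_products_det that det by blast
  have \<mu>1: "\<mu> * \<mu> \<noteq> 1"
  proof
    assume "\<mu> * \<mu> = 1"
    then have "\<mu> ^ 2 = 1" by (simp add: power2_eq_square)
    then show False using \<mu>(2) by (metis torsion_def zero_less_numeral)
  qed
  obtain P where P: "mdet P = 1" "mconj P A = Mat2 \<mu> 0 0 (inverse \<mu>)" using diagonalize[OF wdet[OF A] \<mu>(1) \<mu>1] by blast
  show ?thesis
  proof (cases "\<forall>g\<in>mconj P ` I. m12 g = 0 \<and> m21 g = 0 \<or> m11 g = 0 \<and> m22 g = 0")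
    case True
    then have "\<exists>C k. \<forall>n. card (prod_list ` {ws \<in> lists (mconj P ` I). length ws \<le> n}) \<le> C * (n + 1) ^ k"
      using fin det mdet_mconj[OF P(1)] by (intro monomial_growth) auto
    then show ?thesis by (simp only: growth_mconj[OF P(1)]) blast
  next
    case False
    then obtain g where g: "g \<in> I" "\<not> (m12 (mconj P g) = 0 \<and> m21 (mconj P g) = 0 \<or> m11 (mconj P g) = 0 \<and> m22 (mconj P g) = 0)"
      by auto
    let ?T = "mconj P ` word_products I"
    have "\<exists>A\<in>?T. \<exists>B\<in>?T. mfree A B"
    proof (rule nontorsion_semigroup_free)
      show "M * N \<in> ?T" if MN: "M \<in> ?T" "N \<in> ?T" for M N
      proof -
        obtain M' N' where "M' \<in> word_products I" "N' \<in> word_products I" "M = mconj P M'" "N = mconj P N'" using MN by auto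
        then show ?thesis using word_products_mult mconj_mult[OF P(1)] by (metis imageI)
      qed
      show "mdet M = 1" if "M \<in> ?T" for M using that wdet mdet_mconj[OF P(1)] by auto
      show "Mat2 \<mu> 0 0 (inverse \<mu>) \<in> ?T" using A P(2) by (metis imageI)
      show "\<mu> \<noteq> 0" using trace_of_eigenvalue(1)[OF \<mu>(1)] .
      show "mconj P g \<in> ?T" using word_products_gen[OF g(1)] by blast
    qed (use g \<mu> in auto)
    then show ?thesis using mfree_mconj[OF P(1)] by auto
  qed
next
  case False
  then have tors: "torsion \<zeta>" if "A \<in> word_products I" "\<zeta> * \<zeta> - mtr A * \<zeta> + 1 = 0" for A \<zeta> using that by blast
  show ?thesis
  proof (cases "triangularizable I")
    case True
    then obtain P where P: "mdet P = 1" "\<And>g. g \<in> I \<Longrightarrow> m21 (mconj P g) = 0" by (auto simp: triangularizable_def)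
    have "torsion (m11 (mconj P g))" if g: "g \<in> I" for g
    proof -
      have d: "m11 (mconj P g) * m22 (mconj P g) = 1"
        using mdet_mconj[OF P(1), of g] det[OF g] P(2)[OF g] by (simp add: mdet_def)
      have "m11 (mconj P g) * m11 (mconj P g) - mtr g * m11 (mconj P g) + 1 = 0"
        using d unfolding mtr_mconj[OF P(1), symmetric, of g] by (simp add: mtr_def algebra_simps)
      then show ?thesis using tors[OF word_products_gen[OF g]] by blast
    qed
    then have "\<exists>C k. \<forall>n. card (prod_list ` {ws \<in> lists (mconj P ` I). length ws \<le> n}) \<le> C * (n + 1) ^ k"
      using fin det P mdet_mconj[OF P(1)] by (intro triangular_growth) auto
    then show ?thesis by (simp only: growth_mconj[OF P(1)]) blast
  next
    case False
    have f: "finite (prod_list ` lists I)" using det False tors by (intro irreducible_torsion_finite[OF fin]) blast+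
    have "card (prod_list ` {ws \<in> lists I. length ws \<le> n}) \<le> card (prod_list ` lists I) * (n + 1) ^ 0" for n
      using card_mono[OF f, of "prod_list ` {ws \<in> lists I. length ws \<le> n}"] by auto
    then show ?thesis by blast
  qed
qed

section \<open>Moebius transformations\<close>

text \<open>The coordinate here is \<open>x/y\<close>, as for rational functions, in contrast to the
  slope in \<open>mact\<close>.\<close>

fun proj_act :: "'f::field mat2 \<Rightarrow> 'f proj_line \<Rightarrow> 'f proj_line" where
  "proj_act A (Aff s) = proj_quot (m11 A * s + m12 A) (m21 A * s + m22 A)"
| "proj_act A Infinity = proj_quot (m11 A) (m21 A)"

lemma proj_quot_scale: "c \<noteq> 0 \<Longrightarrow> proj_quot (c * x) (c * y) = proj_quot x y"
  by (simp add: proj_quot_def)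

text \<open>Homogeneous coordinates remove the case distinction at infinity.\<close>

lemma proj_act_quot:
  assumes "x \<noteq> 0 \<or> y \<noteq> 0"
  shows "proj_act A (proj_quot x y) = proj_quot (m11 A * x + m12 A * y) (m21 A * x + m22 A * y)"
proof (cases "y = 0")
  case True
  then have "proj_quot x y = Infinity" by (simp add: proj_quot_def)
  then show ?thesis using True assms proj_quot_scale[of x "m11 A" "m21 A"] by (simp add: mult.commute)
next
  case False
  have "m11 A * x + m12 A * y = y * (m11 A * (x / y) + m12 A)" "m21 A * x + m22 A * y = y * (m21 A * (x / y) + m22 A)"
    using False by (simp_all add: field_simps)
  then show ?thesis using False proj_quot_scale[OF False] by (simp add: proj_quot_def[of x y])
qed

lemma proj_quot_exists: "\<exists>x y. p = proj_quot x y \<and> (x \<noteq> 0 \<or> y \<noteq> 0)"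
proof (cases p)
  case (Aff s)
  then show ?thesis by (intro exI[of _ s] exI[of _ 1]) (simp add: proj_quot_def)
next
  case Infinity
  then show ?thesis by (intro exI[of _ 1] exI[of _ 0]) (simp add: proj_quot_def)
qed

lemma proj_act_mult:
  fixes A B :: "'f::field mat2"
  assumes "mdet B \<noteq> 0"
  shows "proj_act (A * B) p = proj_act A (proj_act B p)"
proof -
  obtain x y where p: "p = proj_quot x y" "x \<noteq> 0 \<or> y \<noteq> 0" using proj_quot_exists by blast
  let ?u = "m11 B * x + m12 B * y" and ?v = "m21 B * x + m22 B * y"
  have "m22 B * ?u - m12 B * ?v = mdet B * x" "m11 B * ?v - m21 B * ?u = mdet B * y"
    by (simp_all add: mdet_def algebra_simps)
  then have nz: "?u \<noteq> 0 \<or> ?v \<noteq> 0" using assms p(2) by (metis diff_zero mult_eq_0_iff mult_zero_right)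
  show ?thesis unfolding p(1) proj_act_quot[OF p(2)] proj_act_quot[OF nz]
    by (simp add: algebra_simps)
qed

lemma proj_act_mproj: "mproj A B \<Longrightarrow> proj_act A p = proj_act B p"
proof -
  assume "mproj A B"
  then obtain c where c: "c \<noteq> 0" "A = mscale c B" by (auto simp: mproj_def)
  show ?thesis
  proof (cases p)
    case (Aff s)
    have "c * m11 B * s + c * m12 B = c * (m11 B * s + m12 B)" "c * m21 B * s + c * m22 B = c * (m21 B * s + m22 B)"
      by (simp_all add: algebra_simps)
    then show ?thesis using c(1) by (simp add: Aff c(2) proj_quot_scale)
  qed (use c in \<open>simp add: proj_quot_scale\<close>)
qed

lemma map_mat2_hom:
  assumes "field_hom h"
  shows "map_mat2 h (A * B) = map_mat2 h A * map_mat2 h B" "map_mat2 h 1 = 1" "mdet (map_mat2 h A) = h (mdet A)"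
    "mproj A B \<Longrightarrow> mproj (map_mat2 h A) (map_mat2 h B)"
proof -
  note h = field_hom_simps[OF assms]
  have minus: "h (x - y) = h x - h y" for x y
    using h(3)[of "x - y" y] by simp
  show "map_mat2 h (A * B) = map_mat2 h A * map_mat2 h B" "map_mat2 h 1 = 1" "mdet (map_mat2 h A) = h (mdet A)"
    by (simp_all add: mat2_eq_iff mat2.map_sel mdet_def h minus)
  assume "mproj A B"
  then obtain c where "c \<noteq> 0" "A = mscale c B" by (auto simp: mproj_def)
  then have "h c \<noteq> 0" "map_mat2 h A = mscale (h c) (map_mat2 h B)"
    using field_hom_eq_0_iff[OF assms] by (auto simp: mat2_eq_iff mat2.map_sel h)
  then show "mproj (map_mat2 h A) (map_mat2 h B)" by (auto simp: mproj_def)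
qed

text \<open>Expressed by minors, proportionality descends from the algebraic closure to the base
  field.\<close>

lemma mproj_of_hom:
  fixes A B :: "'a::field mat2"
  assumes h: "field_hom h" and p: "mproj (map_mat2 h A) (map_mat2 h B)" and d: "mdet A \<noteq> 0" "mdet B \<noteq> 0"
  shows "mproj A B"
proof -
  have e: "a * b = c * d" if "h a * h b = h c * h d" for a b c d
    using that by (simp add: field_hom_inj[OF h] flip: field_hom_simps(4)[OF h])
  show ?thesis
    by (rule mproj_crossI; (rule e)?) (use mproj_cross[OF p] d in \<open>simp_all add: mat2.map_sel\<close>)
qed

abbreviation rlift :: "'k::field mat2 \<Rightarrow> 'k poly fract mat2" where
  "rlift \<equiv> map_mat2 rat_const"

text \<open>In lowest terms the numerator and the denominator are not proportional, which means that
  the determinant is nonzero. The formula covers all arguments, constants and infinity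
  included.\<close>

lemma rat_comp_moebius:
  fixes f :: "'k::field ratfun"
  assumes "\<not> is_constant f" "rat_degree f = 1"
  shows "\<exists>A. mdet A \<noteq> 0 \<and> (\<forall>x. rat_comp f x = proj_act (rlift A) x)"
proof -
  obtain r where f: "f = Aff r" using assms(1) by (cases f) (auto simp: is_constant_def)
  let ?p = "numer r" and ?q = "denom r"
  have deg: "degree ?p \<le> 1" "degree ?q \<le> 1" "degree ?p = 1 \<or> degree ?q = 1" using assms(2) by (auto simp: f max_def split: if_splits)
  define a where "a = coeff ?p 1"
  define b where "b = coeff ?p 0"
  define c where "c = coeff ?q 1"
  define d where "d = coeff ?q 0"
  have lin: "g = [:coeff g 0, coeff g 1:]" if "degree g \<le> 1" for g :: "'k poly"
  proof (rule poly_eqI)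
    fix n show "coeff g n = coeff [:coeff g 0, coeff g 1:] n"
      using that by (cases n rule: nat.exhaust; cases "n - 1") (auto simp: coeff_pCons coeff_eq_0 split: nat.splits)
  qed
  have p: "?p = [:b, a:]" and q: "?q = [:d, c:]" using lin deg by (auto simp: a_def b_def c_def d_def)
  have cop: "coprime ?p ?q" by (rule lowest_terms(2))
  have "a * d - b * c \<noteq> 0"
  proof
    assume "a * d - b * c = 0"
    then have e: "smult c ?p = smult a ?q" unfolding p q by (simp add: mult.commute)
    show False
    proof (cases "c = 0")
      case False
      have "?p = smult (inverse c) (smult c ?p)" using False by simp
      also have "\<dots> = smult (inverse c) (smult a ?q)" by (simp only: e)
      finally have "?p = smult (inverse c) (smult a ?q)" .
      then have "?q dvd ?p" by (metis dvd_refl dvd_smult)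
      then have "is_unit ?q" using cop by (metis coprime_absorb_right coprime_commute)
      then show False using False q by (simp add: is_unit_pCons_iff)
    next
      case True
      then have "smult a ?q = 0" using e by simp
      then have "a = 0" by simp
      then show False using deg(3) True p q by simp
    qed
  qed
  then have "mdet (Mat2 a b c d) \<noteq> 0" by (simp add: mdet_def)
  moreover have "rat_comp f x = proj_act (rlift (Mat2 a b c d)) x" for x
  proof (cases x)
    case (Aff s)
    then show ?thesis by (simp add: f rat_comp_def p q map_poly_pCons rat_const_simps algebra_simps)
  next
    case Infinity
    have "rat_degree (Aff r) = 1" using assms(2) f by simp
    then show ?thesis by (simp add: f rat_comp_def Infinity a_def c_def del: rat_degree.simps)
  qed
  ultimately show ?thesis by blast
qed

lemma proj_act_rat_id:
  fixes A :: "'k::field mat2"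
  assumes "mdet A \<noteq> 0"
  shows "proj_act (rlift A) rat_id = Aff (to_fract [:m12 A, m11 A:] / to_fract [:m22 A, m21 A:])"
    "to_fract [:m22 A, m21 A:] \<noteq> 0"
proof -
  have e: "rat_const u * to_fract [:0, 1:] + rat_const v = to_fract [:v, u:]" for u v :: 'k
    by (simp add: rat_const_def flip: to_fract_mult to_fract_add)
  show nz: "to_fract [:m22 A, m21 A:] \<noteq> 0" using assms by (auto simp: mdet_def)
  show "proj_act (rlift A) rat_id = Aff (to_fract [:m12 A, m11 A:] / to_fract [:m22 A, m21 A:])"
    using nz by (simp add: rat_id_def mat2.map_sel e proj_quot_def)
qed

lemma to_fract_divide_eqD:
  fixes p q c :: "'k::field poly"
  assumes "to_fract p / to_fract q = to_fract c" "to_fract q \<noteq> 0"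
  shows "p = c * q"
proof -
  have "to_fract p = to_fract c * to_fract q" using assms by (metis nonzero_divide_eq_eq)
  then show ?thesis by (metis to_fract_mult to_fract_eq_iff)
qed

text \<open>A matrix that fixes the generic point \<open>rat_id\<close> is scalar, by comparison of
  polynomials; this is applied to the adjugate of \<open>B\<close> times \<open>A\<close>.\<close>

lemma proj_act_eq_imp_mproj:
  fixes A B :: "'k::field mat2"
  assumes d: "mdet A \<noteq> 0" "mdet B \<noteq> 0" and eq: "proj_act (rlift A) rat_id = proj_act (rlift B) rat_id"
  shows "mproj A B"
proof -
  define N where "N = madj B * A"
  have dr: "mdet (rlift M) \<noteq> 0" if "mdet M \<noteq> 0" for M :: "'k mat2"
    using that by (simp add: map_mat2_hom(3)[OF field_hom_rat_const] field_hom_eq_0_iff[OF field_hom_rat_const])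
  have dN: "mdet N \<noteq> 0" using d by (simp add: N_def mdet_mult mdet_madj)
  have "proj_act (rlift N) rat_id = proj_act (rlift (madj B)) (proj_act (rlift B) rat_id)"
    unfolding N_def map_mat2_hom(1)[OF field_hom_rat_const] proj_act_mult[OF dr[OF d(1)]] eq ..
  also have "\<dots> = proj_act (rlift (madj B * B)) rat_id"
    unfolding map_mat2_hom(1)[OF field_hom_rat_const] proj_act_mult[OF dr[OF d(2)]] ..
  also have "\<dots> = proj_act (rlift 1) rat_id"
  proof (rule proj_act_mproj, rule map_mat2_hom(4)[OF field_hom_rat_const])
    show "mproj (madj B * B) 1" using d(2) by (auto simp: mproj_def madj_mult)
  qed
  also have "\<dots> = rat_id" by (simp add: map_mat2_hom(2)[OF field_hom_rat_const] rat_id_def proj_quot_def)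
  finally have id: "proj_act (rlift N) rat_id = rat_id" .
  then have "to_fract [:m12 N, m11 N:] / to_fract [:m22 N, m21 N:] = to_fract [:0, 1:]"
    using proj_act_rat_id(1)[OF dN] unfolding rat_id_def by (metis proj_line.inject)
  then have "[:m12 N, m11 N:] = [:0, 1:] * [:m22 N, m21 N:]"
    by (rule to_fract_divide_eqD[OF _ proj_act_rat_id(2)[OF dN]])
  then have N: "m12 N = 0" "m11 N = m22 N" "m21 N = 0" by simp_all
  define k where "k = m11 N"
  have "N = mscale k 1" using N by (simp add: mat2_eq_iff k_def)
  then have "B * N = mscale k B" by (simp add: mscale_simps)
  then have "mscale (mdet B) A = mscale k B" by (simp add: N_def mult.assoc[symmetric] madj_mult mscale_simps)
  then have "mscale (inverse (mdet B)) (mscale (mdet B) A) = mscale (inverse (mdet B)) (mscale k B)" by simp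
  then have A: "A = mscale (inverse (mdet B) * k) B" using d(2) by (simp add: mscale_simps)
  moreover have "inverse (mdet B) * k \<noteq> 0"
  proof
    assume "inverse (mdet B) * k = 0"
    then have "A = mscale 0 B" using A by metis
    then have "mdet A = mdet (mscale 0 B)" by (rule arg_cong)
    then show False using d(1) by (simp add: mdet_def)
  qed
  ultimately show ?thesis unfolding mproj_def by blast
qed

lemma proj_act_rat_id_nonconstant:
  fixes A :: "'k::field mat2"
  assumes "mdet A \<noteq> 0" shows "\<not> is_constant (proj_act (rlift A) rat_id)"
proof
  assume "is_constant (proj_act (rlift A) rat_id)"
  then obtain c where "to_fract [:m12 A, m11 A:] / to_fract [:m22 A, m21 A:] = rat_const c"
    unfolding proj_act_rat_id(1)[OF assms] by (auto simp: is_constant_def)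
  then have "[:m12 A, m11 A:] = [:c:] * [:m22 A, m21 A:]"
    unfolding rat_const_def by (rule to_fract_divide_eqD[OF _ proj_act_rat_id(2)[OF assms]])
  then have "m12 A = c * m22 A" "m11 A = c * m21 A" by simp_all
  then show False using assms by (simp add: mdet_def)
qed

lemma card_image_factor_le:
  assumes "finite (g ` S)" "\<And>a b. a \<in> S \<Longrightarrow> b \<in> S \<Longrightarrow> g a = g b \<Longrightarrow> f a = f b"
  shows "finite (f ` S)" "card (f ` S) \<le> card (g ` S)"
proof -
  have "f ` S = (\<lambda>y. f (inv_into S g y)) ` g ` S"
  proof (intro equalityI subsetI)
    fix y assume "y \<in> f ` S"
    then obtain a where a: "a \<in> S" "y = f a" by auto
    have "f (inv_into S g (g a)) = f a"
      using a(1) by (intro assms(2)) (auto intro: inv_into_into f_inv_into_f)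
    then show "y \<in> (\<lambda>y. f (inv_into S g y)) ` g ` S" using a by (auto intro!: image_eqI[of _ _ "g a"])
  next
    fix y assume "y \<in> (\<lambda>y. f (inv_into S g y)) ` g ` S"
    then show "y \<in> f ` S" by (auto intro: inv_into_into)
  qed
  then show "finite (f ` S)" "card (f ` S) \<le> card (g ` S)"
    using assms(1) card_image_le[OF assms(1)] by auto
qed

text \<open>Degree one maps become matrices over the base field, and square roots in the algebraic
  closure normalise their determinants, which changes words by scalars only. Constant letters are
  treated apart: whatever stands to the right of one is irrelevant.\<close>

theorem moebius_alternative:
  fixes G :: "'k::field ratfun set"
  assumes "finite G" and S: "S = semigroup_gen G"
    and deg: "\<And>f. f \<in> S \<Longrightarrow> \<not> is_constant f \<Longrightarrow> rat_degree f = 1"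
  shows "contains_nonabelian_free_semigroup S \<or> poly_bounded_growth G"
proof -
  define G' where "G' = {g \<in> G. \<not> is_constant g}"
  have GS: "G \<subseteq> S" unfolding S by (auto intro: semigroup_gen.gen)
  have "\<forall>g. \<exists>A. g \<in> G' \<longrightarrow> mdet A \<noteq> 0 \<and> (\<forall>x. rat_comp g x = proj_act (rlift A) x)"
    using rat_comp_moebius deg GS unfolding G'_def by blast
  then obtain m where m: "\<And>g. g \<in> G' \<Longrightarrow> mdet (m g) \<noteq> 0"
    "\<And>g x. g \<in> G' \<Longrightarrow> rat_comp g x = proj_act (rlift (m g)) x" by metis
  note rh = map_mat2_hom[OF field_hom_rat_const] and th = map_mat2_hom[OF field_hom_to_ac]
  have dr: "mdet (rlift M) \<noteq> 0" if "mdet M \<noteq> 0" for M :: "'k mat2"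
    using that by (simp add: rh(3) field_hom_eq_0_iff[OF field_hom_rat_const])
  define M where "M = (\<lambda>us. prod_list (map m us))"
  have dM: "mdet (M us) \<noteq> 0" if "us \<in> lists G'" for us
    using that m(1) by (induction us) (auto simp: M_def mdet_mult)
  have fold: "foldr rat_comp us x = proj_act (rlift (M us)) x" if "us \<in> lists G'" for us x
    using that
  proof (induction us)
    case Nil
    show ?case
    proof (cases x)
      case (Aff s)
      then show ?thesis by (simp add: M_def rh(2) proj_quot_def)
    next
      case Infinity
      then show ?thesis by (simp add: M_def rh(2) proj_quot_def)
    qed
  next
    case (Cons g us)
    then have "foldr rat_comp (g # us) x = proj_act (rlift (m g)) (proj_act (rlift (M us)) x)" using m(2) by simp
    also have "\<dots> = proj_act (rlift (m g * M us)) x" unfolding rh(1) using proj_act_mult[OF dr[OF dM]] Cons by simp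
    finally show ?case by (simp add: M_def)
  qed
  have cw: "comp_word us = proj_act (rlift (M us)) rat_id" if "us \<in> lists G'" for us
    using fold[OF that] by (simp add: comp_word_def)
  have "\<forall>g. \<exists>r. r ^ 2 = to_ac (mdet (m g))" using nth_root_exists[OF zero_less_numeral] by blast
  then obtain r where r: "\<And>g. r g ^ 2 = to_ac (mdet (m g))" by metis
  have r0: "r g \<noteq> 0" if "g \<in> G'" for g
  proof
    assume "r g = 0"
    then show False using r[of g] m(1)[OF that] by simp
  qed
  define L where "L = (\<lambda>g. mscale (inverse (r g)) (map_mat2 to_ac (m g)))"
  have mds: "mdet (mscale c A) = c ^ 2 * mdet A" for c and A :: "'k alg_closure mat2"
    by (simp add: mdet_def power2_eq_square algebra_simps)
  have dL: "mdet (L g) = 1" if "g \<in> G'" for g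
  proof -
    have "to_ac (mdet (m g)) \<noteq> 0" using m(1)[OF that] by simp
    then show ?thesis by (simp add: L_def mds th(3) power_inverse r)
  qed
  have LM: "mproj (prod_list (map L us)) (map_mat2 to_ac (M us))" if "us \<in> lists G'" for us
    using that
  proof (induction us)
    case Nil
    then show ?case by (simp add: M_def th(2) mproj_refl)
  next
    case (Cons g us)
    then obtain c where c: "c \<noteq> 0" "prod_list (map L us) = mscale c (map_mat2 to_ac (M us))" by (auto simp: mproj_def)
    have "prod_list (map L (g # us)) = mscale (inverse (r g) * c) (map_mat2 to_ac (M (g # us)))"
    proof -
      have "prod_list (map L (g # us)) = L g * mscale c (map_mat2 to_ac (M us))" by (simp only: list.map prod_list.Cons c(2))
      also have "\<dots> = mscale (inverse (r g) * c) (map_mat2 to_ac (m g) * map_mat2 to_ac (M us))"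
        unfolding L_def by (simp add: mat2_eq_iff algebra_simps)
      also have "map_mat2 to_ac (m g) * map_mat2 to_ac (M us) = map_mat2 to_ac (M (g # us))"
        by (simp only: M_def list.map prod_list.Cons th(1))
      finally show ?thesis .
    qed
    moreover have "inverse (r g) * c \<noteq> 0" using c(1) r0 Cons by simp
    ultimately show ?case unfolding mproj_def by blast
  qed
  have msym: "mproj B A" if AB: "mproj A B" for A B :: "'k alg_closure mat2"
  proof -
    obtain c where c: "c \<noteq> 0" "A = mscale c B" using AB unfolding mproj_def by blast
    have "B = mscale (inverse c) A" unfolding c(2) using c(1) by (simp add: mat2_eq_iff)
    moreover have "inverse c \<noteq> 0" using c(1) by simp
    ultimately show ?thesis unfolding mproj_def by blast
  qed
  have mtrans: "mproj A C" if AB: "mproj A B" and BC: "mproj B C" for A B C :: "'k alg_closure mat2"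
  proof -
    obtain c where c: "c \<noteq> 0" "A = mscale c B" using AB unfolding mproj_def by blast
    obtain d where d: "d \<noteq> 0" "B = mscale d C" using BC unfolding mproj_def by blast
    have "A = mscale (c * d) C" unfolding c(2) d(2) by (simp add: mat2_eq_iff)
    moreover have "c * d \<noteq> 0" using c(1) d(1) by simp
    ultimately show ?thesis unfolding mproj_def by blast
  qed
  let ?I = "L ` G'"
  have finG': "finite G'" using assms(1) by (simp add: G'_def)
  have "(\<exists>A\<in>word_products ?I. \<exists>B\<in>word_products ?I. mfree A B) \<or>
      (\<exists>C k. \<forall>n. card (prod_list ` {ws \<in> lists ?I. length ws \<le> n}) \<le> C * (n + 1) ^ k)"
    using sl2_semigroup_alternative[of ?I] finG' dL by blast
  then show ?thesis
  proof
    assume "\<exists>A\<in>word_products ?I. \<exists>B\<in>word_products ?I. mfree A B"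
    then obtain A B where A: "A \<in> word_products ?I" and B: "B \<in> word_products ?I" and free: "mfree A B" by blast
    have ex: "\<exists>us. us \<in> lists G' \<and> us \<noteq> [] \<and> N = prod_list (map L us)" if "N \<in> word_products ?I" for N
      using that unfolding word_products_def lists_image by auto
    obtain us where us: "us \<in> lists G'" "us \<noteq> []" "A = prod_list (map L us)" using ex[OF A] by blast
    obtain vs where vs: "vs \<in> lists G'" "vs \<noteq> []" "B = prod_list (map L vs)" using ex[OF B] by blast
    define u where "u = comp_word us"
    define v where "v = comp_word vs"
    have S': "comp_word ws \<in> S" if "ws \<in> lists G'" "ws \<noteq> []" for ws
      unfolding S using that by (intro comp_word_in_semigroup_gen) (auto simp: G'_def intro: semigroup_gen.gen)
    have uv: "u \<in> S" "v \<in> S" using S' us vs by (auto simp: u_def v_def)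
    \<comment> \<open>The composite is itself a nonconstant map of degree one and so has a matrix of
      its own; comparison at \<open>rat_id\<close> shows that it is proportional to the product over
      the letters.\<close>
    have act: "rat_comp (comp_word ws) x = proj_act (rlift (M ws)) x" if ws: "ws \<in> lists G'" "ws \<noteq> []" for ws x
    proof -
      let ?f = "comp_word ws"
      have f: "?f = proj_act (rlift (M ws)) rat_id" using cw ws by blast
      then have nc: "\<not> is_constant ?f" using proj_act_rat_id_nonconstant[OF dM[OF ws(1)]] by simp
      obtain N where N: "mdet N \<noteq> 0" "\<And>x. rat_comp ?f x = proj_act (rlift N) x"
        using rat_comp_moebius[OF nc deg[OF S'[OF ws] nc]] by blast
      have "proj_act (rlift N) rat_id = proj_act (rlift (M ws)) rat_id"
        using N(2)[of rat_id] f by (simp add: rat_comp_id_right)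
      then have "mproj N (M ws)" by (rule proj_act_eq_imp_mproj[OF N(1) dM[OF ws(1)]])
      then show ?thesis using N(2) proj_act_mproj[OF rh(4)] by metis
    qed
    have uneq: "u \<noteq> v"
    proof
      assume "u = v"
      then have "mproj (M us) (M vs)"
        using proj_act_eq_imp_mproj[OF dM[OF us(1)] dM[OF vs(1)]] cw us(1) vs(1) by (simp add: u_def v_def)
      then have "mproj A B" using mtrans[OF LM[OF us(1)] mtrans[OF th(4) msym[OF LM[OF vs(1)]]]] us(3) vs(3) by simp
      then have "mproj (prod_list [A]) (prod_list [B])" by simp
      moreover have "[A] \<in> lists {A, B}" "[B] \<in> lists {A, B}" by simp_all
      ultimately have "[A] = [B]" using free unfolding mfree_def by blast
      then show False using free by (simp add: mfree_def)
    qed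
    define wd where "wd = (\<lambda>x. if x = u then us else vs)"
    define h where "h = (\<lambda>x. if x = u then A else B)"
    have wd: "wd x \<in> lists G'" "wd x \<noteq> []" "h x = prod_list (map L (wd x))" "x = comp_word (wd x)" if "x \<in> {u, v}" for x
      using that us vs uneq by (auto simp: wd_def h_def u_def v_def)
    \<comment> \<open>Flattens a word in \<open>u\<close> and \<open>v\<close> to a word in the
      generators, to which \<open>M\<close> and \<open>L\<close> apply.\<close>
    define cat where "cat = (\<lambda>ws. concat (map wd ws))"
    have cat: "cat ws \<in> lists G'" if "ws \<in> lists {u, v}" for ws
      using that wd(1) unfolding cat_def by (induction ws) auto
    have cwcat: "comp_word ws = proj_act (rlift (M (cat ws))) rat_id" if "ws \<in> lists {u, v}" for ws
      using that
    proof (induction ws)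
      case Nil
      then show ?case using cw[of "[]"] by (simp add: cat_def)
    next
      case (Cons x ws)
      have x: "x \<in> {u, v}" and ws: "ws \<in> lists {u, v}" using Cons by auto
      have "comp_word (x # ws) = rat_comp (comp_word (wd x)) (comp_word ws)" using wd(4)[OF x] by simp
      also have "\<dots> = proj_act (rlift (M (wd x))) (proj_act (rlift (M (cat ws))) rat_id)"
        using act[OF wd(1,2)[OF x]] Cons.IH by simp
      also have "\<dots> = proj_act (rlift (M (wd x) * M (cat ws))) rat_id"
        unfolding rh(1) using proj_act_mult[OF dr[OF dM[OF cat[OF ws]]]] by simp
      also have "M (wd x) * M (cat ws) = M (cat (x # ws))" by (simp add: M_def cat_def)
      finally show ?case .
    qed
    have hcat: "prod_list (map h ws) = prod_list (map L (cat ws))" if "ws \<in> lists {u, v}" for ws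
      using that wd(3) by (induction ws) (auto simp: cat_def)
    show ?thesis
    proof (rule disjI1, unfold S, rule contains_nonabelian_free_semigroupI)
      show "u \<in> semigroup_gen G" "v \<in> semigroup_gen G" "u \<noteq> v" using uv uneq S by auto
      fix ws ws' assume w: "ws \<in> lists {u, v}" "ws' \<in> lists {u, v}" and eq: "comp_word ws = comp_word ws'"
      have "mproj (M (cat ws)) (M (cat ws'))"
        using proj_act_eq_imp_mproj[OF dM[OF cat[OF w(1)]] dM[OF cat[OF w(2)]]] eq cwcat[OF w(1)] cwcat[OF w(2)] by simp
      then have "mproj (prod_list (map L (cat ws))) (prod_list (map L (cat ws')))"
        using mtrans[OF LM[OF cat[OF w(1)]] mtrans[OF th(4) msym[OF LM[OF cat[OF w(2)]]]]] by blast
      then have "mproj (prod_list (map h ws)) (prod_list (map h ws'))" using hcat w by simp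
      moreover have "map h ws \<in> lists {A, B}" "map h ws' \<in> lists {A, B}" by (auto simp: h_def)
      ultimately have "map h ws = map h ws'" using free unfolding mfree_def by blast
      moreover have "inj_on h (set ws \<union> set ws')"
      proof (rule inj_on_subset)
        show "inj_on h {u, v}" using free uneq by (auto simp: inj_on_def h_def mfree_def)
        show "set ws \<union> set ws' \<subseteq> {u, v}" using w by auto
      qed
      ultimately show "ws = ws'" by (simp add: inj_on_map_eq_map)
    qed
  next
    assume "\<exists>C k. \<forall>n. card (prod_list ` {ws \<in> lists ?I. length ws \<le> n}) \<le> C * (n + 1) ^ k"
    then obtain C k where Ck: "\<And>n. card (prod_list ` {ws \<in> lists ?I. length ws \<le> n}) \<le> C * (n + 1) ^ k" by blast
    \<comment> \<open>A word is a string of nonconstant letters applied to its first constant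
      letter, or to the identity if there is none.\<close>
    define B where "B = insert rat_id {g \<in> G. is_constant g}"
    have finB: "finite B" using assms(1) by (simp add: B_def)
    have split: "\<exists>us x. us \<in> lists G' \<and> x \<in> B \<and> length us \<le> length ws \<and> comp_word ws = foldr rat_comp us x"
      if "ws \<in> lists G" for ws
      using that
    proof (induction ws)
      case Nil
      then show ?case by (intro exI[of _ "[]"] exI[of _ rat_id]) (simp add: B_def)
    next
      case (Cons w ws)
      show ?case
      proof (cases "is_constant w")
        case True
        then show ?thesis using Cons rat_comp_const_left[OF True]
          by (intro exI[of _ "[]"] exI[of _ w]) (simp add: B_def)
      next
        case False
        obtain us x where "us \<in> lists G'" "x \<in> B" "length us \<le> length ws" "comp_word ws = foldr rat_comp us x" using Cons by auto
        then show ?thesis using Cons False by (intro exI[of _ "w # us"] exI[of _ x]) (auto simp: G'_def)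
      qed
    qed
    have "num_elements G n \<le> (card B * C) * (n + 1) ^ k" for n
    proof -
      let ?U = "{us \<in> lists G'. length us \<le> n}"
      let ?W = "{ws \<in> lists ?I. length ws \<le> n}"
      have finW: "finite (prod_list ` ?W)"
        using finite_lists_length_le[of ?I n] finG' by (auto intro!: finite_imageI simp: lists_eq_set)
      have img: "(\<lambda>us. prod_list (map L us)) ` ?U \<subseteq> prod_list ` ?W"
      proof (intro image_subsetI)
        fix us assume "us \<in> ?U"
        then have "map L us \<in> ?W" by auto
        then show "prod_list (map L us) \<in> prod_list ` ?W" by (rule imageI)
      qed
      have finU: "finite ((\<lambda>us. prod_list (map L us)) ` ?U)" using img finW by (rule finite_subset)
      \<comment> \<open>Equal normalised products come from proportional matrices and hence act
        alike, so the count of matrices bounds the count of maps for each \<open>x\<close>.\<close>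
      have fac: "foldr rat_comp us x = foldr rat_comp us' x"
        if "us \<in> ?U" "us' \<in> ?U" "prod_list (map L us) = prod_list (map L us')" for us us' x
      proof -
        have l: "us \<in> lists G'" "us' \<in> lists G'" using that by auto
        have "mproj (map_mat2 to_ac (M us)) (map_mat2 to_ac (M us'))"
          using mtrans[OF msym[OF LM[OF l(1)]]] LM[OF l(2)] that(3) by simp
        then have "mproj (M us) (M us')" using mproj_of_hom[OF field_hom_to_ac] dM l by blast
        then show ?thesis using fold l proj_act_mproj[OF rh(4)] by metis
      qed
      have cx: "finite ((\<lambda>us. foldr rat_comp us x) ` ?U) \<and> card ((\<lambda>us. foldr rat_comp us x) ` ?U) \<le> C * (n + 1) ^ k" for x
      proof -
        have "card ((\<lambda>us. foldr rat_comp us x) ` ?U) \<le> card ((\<lambda>us. prod_list (map L us)) ` ?U)"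
          by (rule card_image_factor_le(2)[OF finU]) (rule fac)
        also have "\<dots> \<le> card (prod_list ` ?W)" using img finW by (intro card_mono)
        also have "\<dots> \<le> C * (n + 1) ^ k" by (rule Ck)
        finally show ?thesis using card_image_factor_le(1)[OF finU, of "\<lambda>us. foldr rat_comp us x"] fac by blast
      qed
      have sub: "comp_word ` {ws \<in> lists G. ws \<noteq> [] \<and> length ws \<le> n} \<subseteq> (\<Union>x\<in>B. (\<lambda>us. foldr rat_comp us x) ` ?U)"
      proof (intro image_subsetI)
        fix ws assume "ws \<in> {ws \<in> lists G. ws \<noteq> [] \<and> length ws \<le> n}"
        then have ws: "ws \<in> lists G" "length ws \<le> n" by auto
        obtain us x where us: "us \<in> lists G'" "x \<in> B" "length us \<le> length ws" "comp_word ws = foldr rat_comp us x"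
          using split[OF ws(1)] by blast
        have "us \<in> ?U" using us(1,3) ws(2) by simp
        then show "comp_word ws \<in> (\<Union>x\<in>B. (\<lambda>us. foldr rat_comp us x) ` ?U)"
          unfolding us(4) using us(2) by (intro UN_I[of x] imageI)
      qed
      have "num_elements G n \<le> card (\<Union>x\<in>B. (\<lambda>us. foldr rat_comp us x) ` ?U)"
        unfolding num_elements_def using sub finB cx by (intro card_mono) auto
      also have "\<dots> \<le> (\<Sum>x\<in>B. card ((\<lambda>us. foldr rat_comp us x) ` ?U))" using finB by (rule card_UN_le)
      also have "\<dots> \<le> (\<Sum>x\<in>B. C * (n + 1) ^ k)" using cx by (intro sum_mono) blast
      finally show ?thesis by (simp add: mult.assoc)
    qed
    then show ?thesis using poly_bounded_growthI by blast
  qed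
qed

theorem theorem5p1:
  fixes G S :: "'k::field ratfun set"
  assumes "finite G" and "S = semigroup_gen G"
    and "(\<forall>f\<in>S. \<not> is_constant f \<longrightarrow> rat_degree f = 1) \<or>
      (\<exists>\<alpha> :: 'k alg_closure proj_line.
         (\<forall>f\<in>S. rat_eval to_ac f \<alpha> = \<alpha>) \<and>
         (\<exists>f\<in>S. \<not> is_constant f \<and> local_deg f \<alpha> > 1) \<and>
         (\<forall>g\<in>S. \<not> is_constant g \<longrightarrow> \<not> CHAR('k) dvd local_deg g \<alpha>))"
  shows "contains_nonabelian_free_semigroup S \<or> poly_bounded_growth G"
  using assms(3)
proof (elim disjE exE conjE)
  assume "\<forall>f\<in>S. \<not> is_constant f \<longrightarrow> rat_degree f = 1"
  then show ?thesis by (intro moebius_alternative[OF assms(1,2)]) blast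
next
  fix \<alpha> :: "'k alg_closure proj_line"
  assume fixed: "\<forall>f\<in>S. rat_eval to_ac f \<alpha> = \<alpha>"
    and super: "\<exists>f\<in>S. \<not> is_constant f \<and> local_deg f \<alpha> > 1"
    and tame: "\<forall>g\<in>S. \<not> is_constant g \<longrightarrow> \<not> CHAR('k) dvd local_deg g \<alpha>"
  from super obtain f where "f \<in> S" "\<not> is_constant f" "local_deg f \<alpha> > 1" by blast
  then show ?thesis using fixed tame by (intro fixed_point_alternative[OF assms(1,2)]) blast+
qed

end
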